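(* Let $\alpha\in(0,1)$ be fixed, let $T>0$, let $\theta_*\in H^{1}(\mathbb{R}^2)$ and let $\theta$ be a solution to the modified quasi-geostrophic equation $$\partial_t\theta+\Lambda^{\alpha}\theta+u\cdot\nabla\theta=0,\qquad u=\Lambda^{\alpha-1}\mathcal{R}^{\perp}(\theta),\qquad \theta|_{t=0}=\theta_*$$ belonging to the space $$C^{1}\big([0,T],L^{2}(\mathbb{R}^2)\big)\cap C\big([0,T],H^{1}(\mathbb{R}^2)\big)\cap L^{2}\big([0,T],H^{1+\frac{\alpha}{2}}(\mathbb{R}^2)\big).$$ If there exist $t_0\in[0,T)$ and $\sigma\ge1$ such that $\theta(t_0)\in H^{\sigma}(\mathbb{R}^2)$, then $\theta$ belongs to the space $$C\big([t_0,T],H^{\sigma}(\mathbb{R}^2)\big)\cap L^{2}\big([t_0,T],H^{\sigma+\frac{\alpha}{2}}(\mathbb{R}^2)\big).$$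
   Context: All functions are real-valued. $\Lambda^{\gamma}$ is defined by $\widehat{\Lambda^{\gamma}f}(\xi)=|\xi|^{\gamma}\hat f(\xi)$; $\mathcal{R}^{\perp}(\theta)=(-\mathcal{R}_2\theta,\mathcal{R}_1\theta)$ with $\mathcal{R}_j$ the Riesz transforms on $\mathbb{R}^2$ (multipliers $i\xi_j/|\xi|$). $H^s(\mathbb{R}^2)$ is the inhomogeneous Sobolev space. The equation is understood in the sense of distributions. *)

theory Defs
  imports "HOL-Analysis.Analysis"
begin

section \<open>Smooth functions, test functions and Schwartz functions\<close>

fun partials :: "'a::euclidean_space list \<Rightarrow> ('a \<Rightarrow> 'b::real_normed_vector) \<Rightarrow> 'a \<Rightarrow> 'b" where
  "partials [] f = f"
| "partials (v # vs) f = (\<lambda>x. frechet_derivative (partials vs f) (at x) v)"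

definition smooth :: "('a::euclidean_space \<Rightarrow> 'b::real_normed_vector) \<Rightarrow> bool" where
  "smooth f \<longleftrightarrow> (\<forall>vs \<in> lists Basis. \<forall>x. partials vs f differentiable (at x))"

definition test_function :: "'a::euclidean_space set \<Rightarrow> ('a \<Rightarrow> real) \<Rightarrow> bool" where
  "test_function \<Omega> \<phi> \<longleftrightarrow>
     smooth \<phi> \<and> compact (closure {z. \<phi> z \<noteq> 0}) \<and> closure {z. \<phi> z \<noteq> 0} \<subseteq> \<Omega>"

definition schwartz :: "('a::euclidean_space \<Rightarrow> complex) \<Rightarrow> bool" where
  "schwartz \<phi> \<longleftrightarrow>
     smooth \<phi> \<and> (\<forall>k::nat. \<forall>vs \<in> lists Basis. bounded (range (\<lambda>x. norm x ^ k *\<^sub>R partials vs \<phi> x)))"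


section \<open>Fourier transform\<close>

definition fourier_integral :: "(real^2 \<Rightarrow> complex) \<Rightarrow> real^2 \<Rightarrow> complex" where
  "fourier_integral \<phi> \<xi> = (\<integral>x. cis (- (x \<bullet> \<xi>)) * \<phi> x \<partial>lborel)"

text \<open>
  The function \<open>F\<close> is the Fourier transform of the function \<open>f\<close> in the sense of tempered
  distributions. The \<open>L\<^sup>2\<close> (Plancherel) transform alone would not suffice: for \<open>\<theta> \<in> L\<^sup>2\<close> the
  velocity field below lies in \<open>L\<^bsup>2/\<alpha>\<^esup>\<close> but in general not in \<open>L\<^sup>2\<close>, because of the singularity of
  \<open>\<bar>\<xi>\<bar>\<^bsup>\<alpha>-1\<^esup>\<close> at the origin. Integrability of \<open>f \<phi>\<close> for every Schwartz function \<open>\<phi>\<close>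
  makes \<open>\<phi> \<mapsto> \<integral> f \<phi>\<close> a tempered distribution.
\<close>

definition has_fourier :: "(real^2 \<Rightarrow> complex) \<Rightarrow> (real^2 \<Rightarrow> complex) \<Rightarrow> bool" where
  "has_fourier f F \<longleftrightarrow>
     f \<in> borel_measurable lborel \<and> F \<in> borel_measurable lborel \<and>
     (\<forall>\<phi>. schwartz \<phi> \<longrightarrow>
        integrable lborel (\<lambda>x. f x * \<phi> x) \<and>
        integrable lborel (\<lambda>\<xi>. F \<xi> * \<phi> \<xi>) \<and>
        (\<integral>\<xi>. F \<xi> * \<phi> \<xi> \<partial>lborel) = (\<integral>x. f x * fourier_integral \<phi> x \<partial>lborel))"

text \<open>
  Functions stand for their almost-everywhere classes; the choices below (and that of
  the weak derivative) are unique up to null sets.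
\<close>

definition fourier :: "(real^2 \<Rightarrow> real) \<Rightarrow> real^2 \<Rightarrow> complex" where
  "fourier f = (SOME F. has_fourier (\<lambda>x. complex_of_real (f x)) F)"

definition fourier_multiplier ::
  "(real^2 \<Rightarrow> complex) \<Rightarrow> (real^2 \<Rightarrow> real) \<Rightarrow> real^2 \<Rightarrow> real" where
  "fourier_multiplier m f =
     (SOME g. has_fourier (\<lambda>x. complex_of_real (g x)) (\<lambda>\<xi>. m \<xi> * fourier f \<xi>))"

definition Lambda :: "real \<Rightarrow> (real^2 \<Rightarrow> real) \<Rightarrow> real^2 \<Rightarrow> real" where
  "Lambda \<gamma> = fourier_multiplier (\<lambda>\<xi>. complex_of_real (norm \<xi> powr \<gamma>))"

definition riesz :: "2 \<Rightarrow> (real^2 \<Rightarrow> real) \<Rightarrow> real^2 \<Rightarrow> real" where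
  "riesz j = fourier_multiplier (\<lambda>\<xi>. \<i> * complex_of_real (\<xi> $ j / norm \<xi>))"

definition riesz_perp :: "(real^2 \<Rightarrow> real) \<Rightarrow> real^2 \<Rightarrow> real^2" where
  "riesz_perp f x = vector [- riesz 2 f x, riesz 1 f x]"


section \<open>Function spaces\<close>

definition L2 :: "(real^2 \<Rightarrow> real) set" where
  "L2 = {f. f \<in> borel_measurable lborel \<and> integrable lborel (\<lambda>x. (f x)\<^sup>2)}"

definition L2_norm :: "(real^2 \<Rightarrow> real) \<Rightarrow> real" where
  "L2_norm f = sqrt (\<integral>x. (f x)\<^sup>2 \<partial>lborel)"

text \<open>The space \<open>H\<^sup>s\<close> for \<open>s \<ge> 0\<close>, where it consists of functions in \<open>L\<^sup>2\<close>.\<close>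

definition Sobolev :: "real \<Rightarrow> (real^2 \<Rightarrow> real) set" where
  "Sobolev s =
     {f \<in> L2. integrable lborel (\<lambda>\<xi>. (1 + (norm \<xi>)\<^sup>2) powr s * (cmod (fourier f \<xi>))\<^sup>2)}"

definition Sobolev_norm :: "real \<Rightarrow> (real^2 \<Rightarrow> real) \<Rightarrow> real" where
  "Sobolev_norm s f =
     sqrt (\<integral>\<xi>. (1 + (norm \<xi>)\<^sup>2) powr s * (cmod (fourier f \<xi>))\<^sup>2 \<partial>lborel)"

definition C_L2 :: "real \<Rightarrow> real \<Rightarrow> (real \<Rightarrow> real^2 \<Rightarrow> real) set" where
  "C_L2 a b = {\<theta>. (\<forall>t\<in>{a..b}. \<theta> t \<in> L2) \<and>
     (\<forall>t\<in>{a..b}. ((\<lambda>r. L2_norm (\<lambda>x. \<theta> r x - \<theta> t x)) \<longlongrightarrow> 0) (at t within {a..b}))}"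

definition C1_L2 :: "real \<Rightarrow> real \<Rightarrow> (real \<Rightarrow> real^2 \<Rightarrow> real) set" where
  "C1_L2 a b = {\<theta>. (\<forall>t\<in>{a..b}. \<theta> t \<in> L2) \<and>
     (\<exists>\<theta>' \<in> C_L2 a b. \<forall>t\<in>{a..b}.
        ((\<lambda>r. L2_norm (\<lambda>x. (\<theta> r x - \<theta> t x) / (r - t) - \<theta>' t x)) \<longlongrightarrow> 0) (at t within {a..b}))}"

definition C_Sobolev :: "real \<Rightarrow> real \<Rightarrow> real \<Rightarrow> (real \<Rightarrow> real^2 \<Rightarrow> real) set" where
  "C_Sobolev a b s = {\<theta>. (\<forall>t\<in>{a..b}. \<theta> t \<in> Sobolev s) \<and>
     (\<forall>t\<in>{a..b}. ((\<lambda>r. Sobolev_norm s (\<lambda>x. \<theta> r x - \<theta> t x)) \<longlongrightarrow> 0) (at t within {a..b}))}"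

text \<open>
  The Bochner space \<open>L\<^sup>2([a,b], H\<^sup>s)\<close>: strong measurability is expressed by
  approximation with \<open>H\<^sup>s\<close>-valued simple functions.
\<close>

definition L2_Sobolev :: "real \<Rightarrow> real \<Rightarrow> real \<Rightarrow> (real \<Rightarrow> real^2 \<Rightarrow> real) set" where
  "L2_Sobolev a b s = {\<theta>.
     (AE t in lebesgue_on {a..b}. \<theta> t \<in> Sobolev s) \<and>
     (\<exists>S :: nat \<Rightarrow> real \<Rightarrow> real^2 \<Rightarrow> real.
        (\<forall>n. simple_function (lebesgue_on {a..b}) (S n) \<and> (\<forall>t\<in>{a..b}. S n t \<in> Sobolev s)) \<and>
        (AE t in lebesgue_on {a..b}.
           (\<lambda>n. Sobolev_norm s (\<lambda>x. S n t x - \<theta> t x)) \<longlonglongrightarrow> 0)) \<and>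
     integrable (lebesgue_on {a..b}) (\<lambda>t. (Sobolev_norm s (\<theta> t))\<^sup>2)}"


section \<open>The modified quasi-geostrophic equation\<close>

definition weak_derivative :: "2 \<Rightarrow> (real^2 \<Rightarrow> real) \<Rightarrow> real^2 \<Rightarrow> real" where
  "weak_derivative j f = (SOME g. g \<in> borel_measurable lborel \<and>
     (\<forall>\<psi>. test_function UNIV \<psi> \<longrightarrow>
        integrable lborel (\<lambda>x. g x * \<psi> x) \<and>
        (\<integral>x. g x * \<psi> x \<partial>lborel) =
          - (\<integral>x. f x * frechet_derivative \<psi> (at x) (axis j 1) \<partial>lborel)))"

definition weak_gradient :: "(real^2 \<Rightarrow> real) \<Rightarrow> real^2 \<Rightarrow> real^2" where
  "weak_gradient f x = (\<chi> j. weak_derivative j f x)"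

definition velocity :: "real \<Rightarrow> (real^2 \<Rightarrow> real) \<Rightarrow> real^2 \<Rightarrow> real^2" where
  "velocity \<alpha> f x = (\<chi> j. Lambda (\<alpha> - 1) (\<lambda>y. riesz_perp f y $ j) x)"

text \<open>
  The equation holds in the sense of distributions on \<open>(0,T) \<times> \<real>\<^sup>2\<close>. The pairing is an
  iterated integral because \<open>\<theta>\<close> is a curve of almost-everywhere classes and need not be
  jointly measurable in \<open>(t,x)\<close>. The integrability requirements only say that the pairing is
  defined; they hold automatically for \<open>\<theta> \<in> C([0,T], H\<^sup>1)\<close>, where \<open>u\<close> is continuous and bounded.
\<close>

definition mqg_pairing ::
  "real \<Rightarrow> (real \<Rightarrow> real^2 \<Rightarrow> real) \<Rightarrow> (real \<times> (real^2) \<Rightarrow> real) \<Rightarrow> real \<Rightarrow> real^2 \<Rightarrow> real" where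
  "mqg_pairing \<alpha> \<theta> \<phi> t x =
     - \<theta> t x * frechet_derivative \<phi> (at (t, x)) (1, 0)
     + (Lambda \<alpha> (\<theta> t) x + velocity \<alpha> (\<theta> t) x \<bullet> weak_gradient (\<theta> t) x) * \<phi> (t, x)"

definition mqg_solution ::
  "real \<Rightarrow> real \<Rightarrow> (real^2 \<Rightarrow> real) \<Rightarrow> (real \<Rightarrow> real^2 \<Rightarrow> real) \<Rightarrow> bool" where
  "mqg_solution \<alpha> T \<theta>\<^sub>0 \<theta> \<longleftrightarrow>
     (\<forall>\<phi>. test_function ({0<..<T} \<times> UNIV) \<phi> \<longrightarrow>
        (\<forall>t\<in>{0..T}. integrable lborel (mqg_pairing \<alpha> \<theta> \<phi> t)) \<and>
        integrable (lebesgue_on {0..T}) (\<lambda>t. \<integral>x. mqg_pairing \<alpha> \<theta> \<phi> t x \<partial>lborel) \<and>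
        (\<integral>t. (\<integral>x. mqg_pairing \<alpha> \<theta> \<phi> t x \<partial>lborel) \<partial>lebesgue_on {0..T}) = 0) \<and>
     (AE x in lborel. \<theta> 0 x = \<theta>\<^sub>0 x)"

end

theory Submission
  imports Defs "HOL-Probability.Probability"
begin

text \<open>
  Let \<open>X\<close> be the spatial Fourier transform of \<open>\<theta>\<close> and \<open>E\<^sub>N = \<integral> min(\<bar>\<xi>\<bar>, N)\<^bsup>2\<sigma>\<^esup> \<bar>X\<bar>\<^sup>2\<close>,
  \<open>D\<^sub>N = \<integral> \<bar>\<xi>\<bar>\<^bsup>\<alpha>\<^esup> min(\<bar>\<xi>\<bar>, N)\<^bsup>2\<sigma>\<^esup> \<bar>X\<bar>\<^sup>2\<close>. In the energy identity for \<open>E\<^sub>N\<close> the incompressibility of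
  \<open>u\<close> and the Hermitian symmetry of \<open>X\<close> turn the trilinear term into a commutator: it only involves the
  difference of the weights at \<open>\<xi>\<close> and \<open>\<xi> - \<eta>\<close>. Hence it is dominated by the integral of
  \<open>\<bar>p\<bar>\<^bsup>\<alpha>\<^esup> \<bar>X(p)\<bar>\<close> against the weighted values of \<open>X\<close> at the two other frequencies, where \<open>p\<close> is the
  smallest of the three. The part \<open>\<bar>p\<bar> \<le> M\<close> is at most a multiple of \<open>E\<^sub>N\<close>. The part \<open>\<bar>p\<bar> > M\<close> is at most
  \<open>\<epsilon> D\<^sub>N\<close>, with \<open>\<epsilon>\<close> proportional to the \<open>H\<^sup>1\<close> norm of the frequencies above \<open>M\<close>; since \<open>H\<^sup>1\<close> is the critical
  space, no smallness but only the uniformity of this tail in time is needed, which follows from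
  compactness of the orbit. So \<open>\<bar>E\<^sub>N' + 2 D\<^sub>N\<bar> \<le> D\<^sub>N + K E\<^sub>N\<close> with \<open>K\<close> independent of \<open>N\<close>, and Gronwall's
  inequality bounds \<open>E\<^sub>N\<close> and \<open>\<integral> D\<^sub>N\<close> uniformly. The limit \<open>E\<close> is continuous in time, which by Dini's theorem
  makes the \<open>H\<^sup>\<sigma>\<close> tails uniformly small and yields continuity in \<open>H\<^sup>\<sigma>\<close>.
\<close>

section \<open>Square integrable functions\<close>

text \<open>The operators in the statement are choices of almost-everywhere classes and the velocity
  need not lie in L^2, so they can be computed with only once existence and uniqueness of tempered
  transforms are settled. Hence a Fourier theory on the plane, with Gaussians as separating test
  functions, precedes the analysis. The analysis rests on one fact: |\<eta>|^(\<alpha>-1) /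
  sqrt(1+|\<eta>|^2) is in L^2 exactly for 0 < \<alpha> < 1. So for \<theta> in H^1 the transform of
  the velocity is integrable, the nonlinear term lies in L^2, and the equation becomes an identity
  between L^2 functions of the frequency at every interior time. The scaling
  \<theta>(\<lambda>^\<alpha> t, \<lambda> x) preserves both the equation and the homogeneous H^1
  norm. Hence the high-frequency part of the commutator has exactly the strength of the dissipation,
  and a small factor in front of it can only come from a frequency tail. The weight min(|\<xi>|, N)
  is bounded, so the energy is differentiable although \<theta> is C^1 only in L^2, and it keeps the
  doubling and difference bounds of powers of |\<xi>| with constants free of N.\<close>

lemma lborel_distr_affine_unit:
  fixes a :: "'a::euclidean_space" and c :: real
  assumes "\<bar>c\<bar> = 1"
  shows "distr lborel borel (\<lambda>x. a + c *\<^sub>R x) = lborel"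
proof -
  have "c \<noteq> 0" using assms by auto
  from lborel_affine[OF this, of a] show ?thesis using assms by (simp add: density_1)
qed

lemma nn_integral_affine_unit:
  fixes a :: "'a::euclidean_space" and c :: real
  assumes [measurable]: "f \<in> borel_measurable borel" and "\<bar>c\<bar> = 1"
  shows "(\<integral>\<^sup>+x. f (a + c *\<^sub>R x) \<partial>lborel) = (\<integral>\<^sup>+x. f x \<partial>lborel)"
  by (subst (2) lborel_distr_affine_unit[OF assms(2), of a, symmetric]) (simp add: nn_integral_distr)

lemma integrable_affine_unit:
  fixes a :: "'a::euclidean_space" and c :: real
    and f :: "'a \<Rightarrow> 'b::{banach, second_countable_topology}"
  assumes "integrable lborel f" and "\<bar>c\<bar> = 1"
  shows "integrable lborel (\<lambda>x. f (a + c *\<^sub>R x))"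
proof -
  have "integrable (distr lborel borel (\<lambda>x. a + c *\<^sub>R x)) f"
    using assms by (simp add: lborel_distr_affine_unit)
  moreover have "f \<in> borel_measurable borel" using assms(1) by auto
  ultimately show ?thesis by (simp add: integrable_distr_eq)
qed

lemma integral_affine_unit:
  fixes a :: "'a::euclidean_space" and c :: real
    and f :: "'a \<Rightarrow> 'b::{banach, second_countable_topology}"
  assumes [measurable]: "f \<in> borel_measurable borel" and "\<bar>c\<bar> = 1"
  shows "(LBINT x. f (a + c *\<^sub>R x)) = (LBINT x. f x)"
  by (subst (2) lborel_distr_affine_unit[OF assms(2), of a, symmetric]) (simp add: integral_distr)

lemma AE_affine_unit:
  fixes a :: "'a::euclidean_space" and c :: real
  assumes "AE x in lborel. P x" and "\<bar>c\<bar> = 1"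
  shows "AE x in lborel. P (a + c *\<^sub>R x)"
proof -
  have "AE x in distr lborel borel (\<lambda>x. a + c *\<^sub>R x). P x"
    using assms(1) by (subst lborel_distr_affine_unit[OF assms(2)])
  then obtain N where N: "{x. \<not> P x} \<subseteq> N" "N \<in> null_sets (distr lborel borel (\<lambda>x. a + c *\<^sub>R x))"
    by (auto simp: eventually_ae_filter)
  have "(\<lambda>x. a + c *\<^sub>R x) -` N \<inter> space lborel \<in> null_sets lborel"
    using N(2) by (subst (asm) null_sets_distr_iff) auto
  then show ?thesis
    by (rule AE_I'[where N="(\<lambda>x. a + c *\<^sub>R x) -` N \<inter> space lborel"]) (use N(1) in auto)
qed

text \<open>c = 1 is a translation, c = -1 a point reflection. The substitutions \<eta> -> \<xi> -
  \<eta> and \<eta> -> -\<eta> in the convolution integrals are of these two kinds.\<close>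

lemmas nn_integral_shift = nn_integral_affine_unit[where c=1, simplified]
lemmas nn_integral_flip = nn_integral_affine_unit[where c="-1", simplified]
lemmas integrable_shift = integrable_affine_unit[where c=1, simplified]
lemmas integrable_flip = integrable_affine_unit[where c="-1", simplified]
lemmas integral_shift = integral_affine_unit[where c=1, simplified]
lemmas integral_flip = integral_affine_unit[where c="-1", simplified]
lemmas AE_shift = AE_affine_unit[where c=1, simplified]
lemmas AE_flip = AE_affine_unit[where c="-1", simplified]
lemmas AE_uminus = AE_flip[where a=0, simplified]

section \<open>The space L^2: norm, Cauchy-Schwarz inequality, completeness\<close>

definition sq_integrable :: "('a::euclidean_space \<Rightarrow> complex) \<Rightarrow> bool" where
  "sq_integrable f \<longleftrightarrow> f \<in> borel_measurable lborel \<and> integrable lborel (\<lambda>x. (cmod (f x))\<^sup>2)"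

text \<open>Meaningful only next to \<open>sq_integrable\<close>: the Bochner integral of a
  non-integrable function is 0, so membership in L^2 is always carried as a separate
  hypothesis.\<close>

definition l2n :: "('a::euclidean_space \<Rightarrow> complex) \<Rightarrow> real" where
  "l2n f = sqrt (LBINT x. (cmod (f x))\<^sup>2)"

lemma sq_integrable_measurable: "sq_integrable f \<Longrightarrow> f \<in> borel_measurable borel"
  by (simp add: sq_integrable_def)

lemma l2n_nonneg [simp]: "0 \<le> l2n f"
  by (simp add: l2n_def)

lemma l2n_sq: "(l2n f)\<^sup>2 = (LBINT x. (cmod (f x))\<^sup>2)"
  by (simp add: l2n_def)

lemma norm_sum_sq_le: "(norm (a + b))\<^sup>2 \<le> 2 * (norm a)\<^sup>2 + 2 * (norm (b::'a::real_normed_vector))\<^sup>2"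
proof -
  have "(norm (a + b))\<^sup>2 \<le> (norm a + norm b)\<^sup>2"
    by (intro power_mono norm_triangle_ineq) auto
  also have "\<dots> \<le> 2 * (norm a)\<^sup>2 + 2 * (norm b)\<^sup>2"
    using sum_squares_bound[of "norm a" "norm b"] by (simp add: power2_sum)
  finally show ?thesis .
qed

lemma norm_diff_sq_le: "(norm (a - b))\<^sup>2 \<le> 2 * (norm a)\<^sup>2 + 2 * (norm (b::'a::real_normed_vector))\<^sup>2"
  using norm_sum_sq_le[of a "-b"] by simp

lemma sq_integrable_bound:
  assumes "sq_integrable f" "g \<in> borel_measurable borel" "\<And>x. cmod (g x) \<le> C * cmod (f x)"
  shows "sq_integrable g"
proof -
  have "integrable lborel (\<lambda>x. (cmod (g x))\<^sup>2)"
  proof (rule Bochner_Integration.integrable_bound)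
    show "integrable lborel (\<lambda>x. C\<^sup>2 * (cmod (f x))\<^sup>2)"
      using assms(1) by (simp add: sq_integrable_def)
    show "AE x in lborel. norm ((cmod (g x))\<^sup>2) \<le> norm (C\<^sup>2 * (cmod (f x))\<^sup>2)"
      using power_mono[OF assms(3) norm_ge_zero, of _ 2] by (auto simp: power_mult_distrib)
  qed (use assms(2) in measurable)
  then show ?thesis using assms(2) by (simp add: sq_integrable_def)
qed

lemma sq_integrable_AE_cong:
  assumes "sq_integrable f" "g \<in> borel_measurable borel" "AE x in lborel. f x = g x"
  shows "sq_integrable g"
  using assms unfolding sq_integrable_def
  by (auto elim!: integrable_cong_AE_imp)

lemma l2n_AE_cong:
  assumes "f \<in> borel_measurable borel" "g \<in> borel_measurable borel" "AE x in lborel. f x = g x"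
  shows "l2n f = l2n g"
  unfolding l2n_def using assms by (auto intro!: arg_cong[where f=sqrt] integral_cong_AE)

lemma sq_integrable_add:
  assumes "sq_integrable f" "sq_integrable g"
  shows "sq_integrable (\<lambda>x. f x + g x)"
proof -
  have [measurable]: "f \<in> borel_measurable borel" "g \<in> borel_measurable borel"
    using assms by (auto simp: sq_integrable_def)
  have "integrable lborel (\<lambda>x. (cmod (f x + g x))\<^sup>2)"
  proof (rule Bochner_Integration.integrable_bound)
    show "integrable lborel (\<lambda>x. 2 * (cmod (f x))\<^sup>2 + 2 * (cmod (g x))\<^sup>2)"
      using assms by (simp add: sq_integrable_def)
    show "AE x in lborel. norm ((cmod (f x + g x))\<^sup>2) \<le> norm (2 * (cmod (f x))\<^sup>2 + 2 * (cmod (g x))\<^sup>2)"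
      using norm_sum_sq_le[of "f _" "g _"] by auto
  qed measurable
  then show ?thesis by (simp add: sq_integrable_def)
qed

lemma sq_integrable_cmult:
  "sq_integrable f \<Longrightarrow> sq_integrable (\<lambda>x. c * f x)"
  by (rule sq_integrable_bound[where C="cmod c"]) (auto simp: norm_mult dest: sq_integrable_measurable)

lemma sq_integrable_uminus: "sq_integrable f \<Longrightarrow> sq_integrable (\<lambda>x. - f x)"
  using sq_integrable_cmult[of f "-1"] by simp

lemma sq_integrable_diff:
  "sq_integrable f \<Longrightarrow> sq_integrable g \<Longrightarrow> sq_integrable (\<lambda>x. f x - g x)"
  using sq_integrable_add[of f "\<lambda>x. - g x"] sq_integrable_uminus[of g] by simp

lemma borel_measurable_cnj [measurable]: "cnj \<in> borel_measurable borel"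
  by (intro borel_measurable_continuous_onI continuous_intros)

lemma sq_integrable_cnj: "sq_integrable f \<Longrightarrow> sq_integrable (\<lambda>x. cnj (f x))"
  by (rule sq_integrable_bound[where C=1])
    (auto dest: sq_integrable_measurable intro: measurable_compose[OF _ borel_measurable_cnj])

lemma sq_integrable_flip: "sq_integrable f \<Longrightarrow> sq_integrable (\<lambda>x. f (a - x))"
  unfolding sq_integrable_def using integrable_flip[of "\<lambda>x. (cmod (f x))\<^sup>2" a] by auto

lemma sq_integrable_mult_norm:
  assumes "sq_integrable f" "sq_integrable g"
  shows "integrable lborel (\<lambda>x. cmod (f x) * cmod (g x))"
proof (rule Bochner_Integration.integrable_bound)
  have [measurable]: "f \<in> borel_measurable borel" "g \<in> borel_measurable borel"
    using assms by (auto simp: sq_integrable_def)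
  show "integrable lborel (\<lambda>x. (cmod (f x))\<^sup>2 + (cmod (g x))\<^sup>2)"
    using assms by (simp add: sq_integrable_def)
  have "cmod (f x) * cmod (g x) \<le> (cmod (f x))\<^sup>2 + (cmod (g x))\<^sup>2" for x
    using sum_squares_bound[of "cmod (f x)" "cmod (g x)"]
    mult_nonneg_nonneg[OF norm_ge_zero[of "f x"] norm_ge_zero[of "g x"]] by linarith
  then show "AE x in lborel. norm (cmod (f x) * cmod (g x)) \<le> norm ((cmod (f x))\<^sup>2 + (cmod (g x))\<^sup>2)"
    by auto
qed (use assms in \<open>auto simp: sq_integrable_def\<close>)

lemma sq_integrable_mult:
  assumes "sq_integrable f" "sq_integrable g"
  shows "integrable lborel (\<lambda>x. f x * g x)"
  by (rule Bochner_Integration.integrable_bound[OF sq_integrable_mult_norm[OF assms]])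
    (use assms in \<open>auto simp: sq_integrable_def norm_mult\<close>)

lemma l2n_Cauchy_Schwarz_norm:
  assumes "sq_integrable f" "sq_integrable g"
  shows "(LBINT x. cmod (f x) * cmod (g x)) \<le> l2n f * l2n g"
proof -
  have [measurable]: "f \<in> borel_measurable borel" "g \<in> borel_measurable borel"
    using assms by (auto simp: sq_integrable_def)
  let ?I = "(LBINT x. cmod (f x) * cmod (g x))"
  have I: "(\<integral>\<^sup>+x. ennreal (cmod (f x)) * ennreal (cmod (g x)) \<partial>lborel) = ennreal ?I"
    using sq_integrable_mult_norm[OF assms] by (simp add: ennreal_mult[symmetric] nn_integral_eq_integral)
  have F: "(\<integral>\<^sup>+x. (ennreal (cmod (h x)))\<^sup>2 \<partial>lborel) = ennreal ((l2n h)\<^sup>2)"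
    if "sq_integrable h" for h :: "'a \<Rightarrow> complex"
    using that by (simp add: ennreal_power nn_integral_eq_integral sq_integrable_def l2n_sq)
  have "(ennreal ?I)\<^sup>2 \<le> ennreal ((l2n f)\<^sup>2) * ennreal ((l2n g)\<^sup>2)"
    using Cauchy_Schwarz_nn_integral[of "\<lambda>x. ennreal (cmod (f x))" lborel "\<lambda>x. ennreal (cmod (g x))"]
    unfolding I F[OF assms(1)] F[OF assms(2)] by simp
  then have "ennreal (?I\<^sup>2) \<le> ennreal ((l2n f * l2n g)\<^sup>2)"
    by (simp add: ennreal_power ennreal_mult[symmetric] power_mult_distrib)
  then have "?I\<^sup>2 \<le> (l2n f * l2n g)\<^sup>2" by (subst (asm) ennreal_le_iff) auto
  then show ?thesis by (rule power2_le_imp_le) simp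
qed

lemma l2n_Cauchy_Schwarz:
  assumes "sq_integrable f" "sq_integrable g"
  shows "cmod (LBINT x. f x * g x) \<le> l2n f * l2n g"
proof -
  have "cmod (LBINT x. f x * g x) \<le> (LBINT x. cmod (f x * g x))"
    by (rule integral_norm_bound)
  also have "\<dots> \<le> l2n f * l2n g"
    using l2n_Cauchy_Schwarz_norm[OF assms] by (simp add: norm_mult)
  finally show ?thesis .
qed

lemma l2n_triangle:
  assumes "sq_integrable f" "sq_integrable g"
  shows "l2n (\<lambda>x. f x + g x) \<le> l2n f + l2n g"
proof -
  have "(l2n (\<lambda>x. f x + g x))\<^sup>2 \<le> (LBINT x. (cmod (f x))\<^sup>2 + 2 * (cmod (f x) * cmod (g x)) + (cmod (g x))\<^sup>2)"
    unfolding l2n_sq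
  proof (rule integral_mono)
    show "integrable lborel (\<lambda>x. (cmod (f x + g x))\<^sup>2)"
      using sq_integrable_add[OF assms] by (simp add: sq_integrable_def)
    show "integrable lborel (\<lambda>x. (cmod (f x))\<^sup>2 + 2 * (cmod (f x) * cmod (g x)) + (cmod (g x))\<^sup>2)"
      using assms sq_integrable_mult_norm[OF assms] by (simp add: sq_integrable_def)
    fix x
    have "(cmod (f x + g x))\<^sup>2 \<le> (cmod (f x) + cmod (g x))\<^sup>2"
      by (intro power_mono norm_triangle_ineq) auto
    then show "(cmod (f x + g x))\<^sup>2 \<le> (cmod (f x))\<^sup>2 + 2 * (cmod (f x) * cmod (g x)) + (cmod (g x))\<^sup>2"
      by (simp add: power2_sum algebra_simps)
  qed
  also have "\<dots> = (l2n f)\<^sup>2 + 2 * (LBINT x. cmod (f x) * cmod (g x)) + (l2n g)\<^sup>2"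
    using assms sq_integrable_mult_norm[OF assms] by (simp add: sq_integrable_def l2n_sq)
  also have "\<dots> \<le> (l2n f + l2n g)\<^sup>2"
    using l2n_Cauchy_Schwarz_norm[OF assms] by (simp add: power2_sum)
  finally show ?thesis by (rule power2_le_imp_le) simp
qed

lemma l2n_cmult: "l2n (\<lambda>x. c * f x) = cmod c * l2n f"
  by (simp add: l2n_def norm_mult power_mult_distrib real_sqrt_mult)

lemma l2n_uminus [simp]: "l2n (\<lambda>x. - f x) = l2n f"
  by (simp add: l2n_def)

lemma l2n_minus_commute: "l2n (\<lambda>x. f x - g x) = l2n (\<lambda>x. g x - f x)"
  by (simp add: l2n_def norm_minus_commute)

lemma l2n_triangle_diff:
  assumes "sq_integrable f" "sq_integrable g" "sq_integrable h"
  shows "l2n (\<lambda>x. f x - h x) \<le> l2n (\<lambda>x. f x - g x) + l2n (\<lambda>x. g x - h x)"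
  using l2n_triangle[of "\<lambda>x. f x - g x" "\<lambda>x. g x - h x"] assms by (simp add: sq_integrable_diff)

lemma l2n_le_diff:
  assumes "sq_integrable f" "sq_integrable g"
  shows "l2n f \<le> l2n (\<lambda>x. f x - g x) + l2n g"
  using l2n_triangle[of "\<lambda>x. f x - g x" g] assms by (simp add: sq_integrable_diff)

lemma l2n_mono:
  assumes "sq_integrable f" "g \<in> borel_measurable borel" "\<And>x. cmod (g x) \<le> cmod (f x)"
  shows "l2n g \<le> l2n f"
proof -
  have "sq_integrable g" by (rule sq_integrable_bound[OF assms(1,2), of 1]) (use assms(3) in auto)
  then show ?thesis unfolding l2n_def using assms
    by (intro real_sqrt_le_mono integral_mono) (auto simp: sq_integrable_def intro: power_mono)
qed

text \<open>Cauchy-Schwarz with the factors 2^(-n/2) and 2^(n/2) a_n; the geometric series gives the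
  2. It turns a weighted sum of squares, which can be integrated term by term, into a bound for a
  plain sum, which controls telescoping series.\<close>

lemma sum_geometric_Cauchy_Schwarz:
  fixes a :: "nat \<Rightarrow> real"
  assumes "\<And>n. 0 \<le> a n"
  shows "(\<Sum>n<k. a n)\<^sup>2 \<le> 2 * (\<Sum>n<k. 2^n * (a n)\<^sup>2)"
proof -
  have "(\<Sum>n<k. a n)\<^sup>2 = (\<Sum>n<k. sqrt (1/2^n) * (sqrt (2^n) * a n))\<^sup>2"
    by (intro arg_cong[where f="\<lambda>x. x\<^sup>2"] sum.cong) (auto simp: real_sqrt_divide)
  also have "\<dots> \<le> (\<Sum>n<k. (sqrt (1/2^n))\<^sup>2) * (\<Sum>n<k. (sqrt (2^n) * a n)\<^sup>2)"
    by (rule Cauchy_Schwarz_ineq_sum)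
  also have "\<dots> = (\<Sum>n<k. (1/2)^n) * (\<Sum>n<k. 2^n * (a n)\<^sup>2)"
    by (simp add: power_mult_distrib power_one_over)
  also have "\<dots> \<le> 2 * (\<Sum>n<k. 2^n * (a n)\<^sup>2)"
  proof (rule mult_right_mono)
    have "(\<Sum>n<k. (1/2::real)^n) = 2 * (1 - (1/2)^k)" by (simp add: sum_gp_strict)
    also have "\<dots> \<le> 2" by simp
    finally show "(\<Sum>n<k. (1/2::real)^n) \<le> 2" .
  qed (auto intro: sum_nonneg)
  finally show ?thesis .
qed

text \<open>Riesz-Fischer for rapidly Cauchy sequences. The function S = sum of 2^n |f_(n+1) -
  f_n|^2 has finite integral because 2^n 4^(-n) = 2^(-n), and 2 S dominates the square of the
  absolute telescoping sum. So S yields pointwise convergence almost everywhere and is at the same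
  time the majorant for dominated convergence.\<close>

lemma sq_integrable_complete_fast:
  fixes f :: "nat \<Rightarrow> 'a::euclidean_space \<Rightarrow> complex"
  assumes sq: "\<And>n. sq_integrable (f n)"
    and fast: "\<And>n. l2n (\<lambda>x. f (Suc n) x - f n x) \<le> (1/2)^n"
  shows "\<exists>g. sq_integrable g \<and> (\<lambda>n. l2n (\<lambda>x. f n x - g x)) \<longlonglongrightarrow> 0"
proof -
  have [measurable]: "f n \<in> borel_measurable borel" for n
    using sq by (auto simp: sq_integrable_def)
  define d where "d n x = cmod (f (Suc n) x - f n x)" for n x
  have [measurable]: "d n \<in> borel_measurable borel" for n unfolding d_def by measurable
  have dsq: "integrable lborel (\<lambda>x. (d n x)\<^sup>2)" for n
    using sq_integrable_diff[OF sq[of "Suc n"] sq[of n]] by (simp add: sq_integrable_def d_def)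
  have dle: "(LBINT x. (d n x)\<^sup>2) \<le> (1/4)^n" for n
    using power_mono[OF fast[of n] l2n_nonneg, of 2]
    unfolding l2n_sq d_def by (simp add: power_mult[symmetric] mult.commute power2_eq_square power_mult_distrib[symmetric])
  define S where "S x = (\<Sum>n. ennreal (2^n * (d n x)\<^sup>2))" for x
  have [measurable]: "S \<in> borel_measurable borel" unfolding S_def by measurable
  have "(\<integral>\<^sup>+x. S x \<partial>lborel) = (\<Sum>n. \<integral>\<^sup>+x. ennreal (2^n * (d n x)\<^sup>2) \<partial>lborel)"
    unfolding S_def by (rule nn_integral_suminf) simp
  also have "\<dots> = (\<Sum>n. ennreal (2^n * (LBINT x. (d n x)\<^sup>2)))"
    using dsq by (subst nn_integral_eq_integral) auto
  also have "\<dots> \<le> (\<Sum>n. ennreal ((1/2)^n))"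
  proof (rule suminf_le)
    fix n
    have "2^n * (LBINT x. (d n x)\<^sup>2) \<le> 2^n * (1/4)^n" using dle by simp
    also have "\<dots> = (1/2::real)^n" by (simp add: power_mult_distrib[symmetric])
    finally show "ennreal (2^n * (LBINT x. (d n x)\<^sup>2)) \<le> ennreal ((1/2)^n)" by (rule ennreal_leI)
  qed auto
  also have "\<dots> = ennreal (\<Sum>n. (1/2)^n)" by (rule suminf_ennreal2) (auto intro: summable_geometric)
  also have "\<dots> < \<infinity>" by simp
  finally have Sfin: "(\<integral>\<^sup>+x. S x \<partial>lborel) < \<infinity>" .
  then have AES: "AE x in lborel. S x < \<infinity>"
    using nn_integral_PInf_AE[of S lborel] by (simp add: less_top)
  define T where "T x = enn2real (S x)" for x
  have [measurable]: "T \<in> borel_measurable borel" unfolding T_def by measurable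
  have Tint: "integrable lborel T"
  proof (rule integrableI_nonneg)
    have "(\<integral>\<^sup>+x. ennreal (T x) \<partial>lborel) = (\<integral>\<^sup>+x. S x \<partial>lborel)"
      by (rule nn_integral_cong_AE) (use AES in \<open>auto simp: T_def less_top elim!: AE_mp\<close>)
    then show "(\<integral>\<^sup>+x. ennreal (T x) \<partial>lborel) < \<infinity>" using Sfin by simp
  qed (auto simp: T_def)
  have part: "(\<Sum>n<k. d n x)\<^sup>2 \<le> 2 * T x" if "S x < \<infinity>" for k x
  proof -
    have "(\<Sum>n<k. d n x)\<^sup>2 \<le> 2 * (\<Sum>n<k. 2^n * (d n x)\<^sup>2)"
      by (rule sum_geometric_Cauchy_Schwarz) (simp add: d_def)
    also have "(\<Sum>n<k. 2^n * (d n x)\<^sup>2) \<le> T x"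
    proof -
      have "(\<Sum>n<k. ennreal (2^n * (d n x)\<^sup>2)) \<le> S x"
        unfolding S_def by (rule sum_le_suminf) auto
      also have "S x = ennreal (T x)" using that by (simp add: T_def less_top)
      finally show ?thesis by (simp add: sum_ennreal T_def)
    qed
    finally show ?thesis by simp
  qed
  define g where "g x = lim (\<lambda>n. f n x)" for x
  have [measurable]: "g \<in> borel_measurable borel" unfolding g_def by measurable
  have dist_f: "cmod (f m x - f n x) \<le> (\<Sum>i<m. d i x)" if "n \<le> m" for m n x
  proof -
    have "f m x - f n x = (\<Sum>i\<in>{n..<m}. f (Suc i) x - f i x)"
      using sum_Suc_diff'[OF that, of "\<lambda>i. f i x"] by simp
    also have "cmod \<dots> \<le> (\<Sum>i\<in>{n..<m}. d i x)" unfolding d_def by (rule norm_sum)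
    also have "\<dots> \<le> (\<Sum>i<m. d i x)" by (rule sum_mono2) (auto simp: d_def)
    finally show ?thesis .
  qed
  have conv: "(\<lambda>n. f n x) \<longlonglongrightarrow> g x" if "S x < \<infinity>" for x
  proof -
    have "(\<Sum>n<k. d n x) \<le> sqrt (2 * T x)" for k
      by (rule real_le_rsqrt) (rule part[OF that])
    then have "summable (\<lambda>n. d n x)"
      by (intro summableI_nonneg_bounded) (auto simp: d_def)
    then have "summable (\<lambda>n. f (Suc n) x - f n x)"
      unfolding d_def by (rule summable_norm_cancel)
    then have "convergent (\<lambda>n. \<Sum>i<n. f (Suc i) x - f i x)"
      by (simp add: summable_iff_convergent)
    moreover have "(\<Sum>i<n. f (Suc i) x - f i x) = f n x - f 0 x" for n
      by (rule sum_lessThan_telescope)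
    ultimately have "convergent (\<lambda>n. f n x - f 0 x)" by simp
    then have "convergent (\<lambda>n. f n x - f 0 x + f 0 x)" by (intro convergent_add convergent_const)
    then have "convergent (\<lambda>n. f n x)" by simp
    then show ?thesis unfolding g_def by (simp add: convergent_LIMSEQ_iff)
  qed
  have fg: "(cmod (f n x - g x))\<^sup>2 \<le> 2 * T x" if "S x < \<infinity>" for n x
  proof (rule LIMSEQ_le_const2)
    show "(\<lambda>m. (cmod (f n x - f m x))\<^sup>2) \<longlonglongrightarrow> (cmod (f n x - g x))\<^sup>2"
      by (intro tendsto_intros conv that)
    have "(cmod (f n x - f m x))\<^sup>2 \<le> 2 * T x" if "m \<ge> n" for m
      using order_trans[OF power_mono[OF dist_f[OF that, of x] norm_ge_zero, of 2] part[OF \<open>S x < \<infinity>\<close>, of m]]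
      by (simp add: norm_minus_commute)
    then show "\<exists>N. \<forall>m\<ge>N. (cmod (f n x - f m x))\<^sup>2 \<le> 2 * T x" by blast
  qed
  have lim: "(\<lambda>n. (LBINT x. (cmod (f n x - g x))\<^sup>2)) \<longlonglongrightarrow> (\<integral>x. 0 \<partial>(lborel :: 'a measure))"
  proof (rule integral_dominated_convergence[where w="\<lambda>x. 2 * T x"])
    show "AE x in lborel. (\<lambda>n. (cmod (f n x - g x))\<^sup>2) \<longlonglongrightarrow> 0"
      using AES
    proof eventually_elim
      case (elim x)
      from conv[OF this] have "(\<lambda>n. (cmod (f n x - g x))\<^sup>2) \<longlonglongrightarrow> (cmod (g x - g x))\<^sup>2"
        by (intro tendsto_intros)
      then show ?case by simp
    qed
    show "AE x in lborel. norm ((cmod (f n x - g x))\<^sup>2) \<le> 2 * T x" for n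
      using AES by eventually_elim (use fg in auto)
  qed (use Tint in auto)
  have gsq: "sq_integrable g"
  proof -
    have "integrable lborel (\<lambda>x. (cmod (f 0 x - g x))\<^sup>2)"
    proof (rule Bochner_Integration.integrable_bound[where f="\<lambda>x. 2 * T x"])
      show "AE x in lborel. norm ((cmod (f 0 x - g x))\<^sup>2) \<le> norm (2 * T x)"
        using AES by eventually_elim (use fg in \<open>auto simp: T_def\<close>)
    qed (use Tint in auto)
    then have "sq_integrable (\<lambda>x. f 0 x - g x)" by (simp add: sq_integrable_def)
    from sq_integrable_diff[OF sq[of 0] this] show ?thesis by simp
  qed
  have "(\<lambda>n. l2n (\<lambda>x. f n x - g x)) \<longlonglongrightarrow> sqrt 0"
    unfolding l2n_def using lim by (intro tendsto_real_sqrt) simp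
  then show ?thesis using gsq by auto
qed

lemma sq_integrable_complete:
  fixes f :: "nat \<Rightarrow> 'a::euclidean_space \<Rightarrow> complex"
  assumes sq: "\<And>n. sq_integrable (f n)"
    and Cauchy: "\<And>e. 0 < e \<Longrightarrow> \<exists>N. \<forall>m\<ge>N. \<forall>n\<ge>N. l2n (\<lambda>x. f m x - f n x) < e"
  shows "\<exists>g. sq_integrable g \<and> (\<lambda>n. l2n (\<lambda>x. f n x - g x)) \<longlonglongrightarrow> 0"
proof -
  have "\<forall>k. \<exists>N. \<forall>m\<ge>N. \<forall>n\<ge>N. l2n (\<lambda>x. f m x - f n x) < (1/2)^k"
    using Cauchy by simp
  then obtain N where N: "\<And>k m n. m \<ge> N k \<Longrightarrow> n \<ge> N k \<Longrightarrow> l2n (\<lambda>x. f m x - f n x) < (1/2)^k"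
    by metis
  \<comment> \<open>A partial sum is at least each of its terms, so both r k and r (Suc k) lie
    beyond N k, as the rapid subsequence requires.\<close>
  define r where "r k = (\<Sum>i\<le>k. N i)" for k
  have r: "N k \<le> r k" for k unfolding r_def by (rule member_le_sum) auto
  have r': "N k \<le> r (Suc k)" for k unfolding r_def by (rule member_le_sum) auto
  obtain g where g: "sq_integrable g" "(\<lambda>k. l2n (\<lambda>x. f (r k) x - g x)) \<longlonglongrightarrow> 0"
    using sq_integrable_complete_fast[of "\<lambda>k. f (r k)", OF sq less_imp_le[OF N[OF r' r]]] by blast
  have "(\<lambda>n. l2n (\<lambda>x. f n x - g x)) \<longlonglongrightarrow> 0"
  proof (rule LIMSEQ_I)
    fix e :: real assume "e > 0"
    from g(2) have "\<forall>\<^sub>F k in sequentially. l2n (\<lambda>x. f (r k) x - g x) < e/2"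
      by (rule order_tendstoD) (use \<open>e > 0\<close> in simp)
    moreover have "\<forall>\<^sub>F k in sequentially. (1/2::real)^k < e/2"
      by (rule order_tendstoD(2)[OF LIMSEQ_realpow_zero]) (use \<open>e > 0\<close> in auto)
    ultimately have "\<forall>\<^sub>F k in sequentially. l2n (\<lambda>x. f (r k) x - g x) < e/2 \<and> (1/2::real)^k < e/2"
      by (rule eventually_conj)
    then obtain k where k: "l2n (\<lambda>x. f (r k) x - g x) < e/2" "(1/2::real)^k < e/2"
      by (auto simp: eventually_sequentially)
    have "l2n (\<lambda>x. f n x - g x) < e" if "n \<ge> N k" for n
      using l2n_triangle_diff[OF sq[of n] sq[of "r k"] g(1)] N[OF that r, of ] k by linarith
    then show "\<exists>no. \<forall>n\<ge>no. norm (l2n (\<lambda>x. f n x - g x) - 0) < e" by auto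
  qed
  with g(1) show ?thesis by blast
qed

section \<open>Continuity of translation in L^1\<close>

text \<open>For indicators |a - b| = a + b - 2 min(a, b), and the integrals of a and b agree by
  translation invariance. Only the minimum has to converge: on U it does so because U is open, off U
  it vanishes.\<close>

lemma L1_translation_open:
  fixes z :: "nat \<Rightarrow> 'a::euclidean_space"
  assumes "open U" "emeasure lborel U < \<infinity>" "z \<longlonglongrightarrow> 0"
  shows "(\<lambda>n. (LBINT x. \<bar>indicat_real U (z n + x) - indicat_real U x\<bar>)) \<longlonglongrightarrow> 0"
proof -
  have [measurable]: "U \<in> sets borel" using assms by simp
  have iU: "integrable lborel (indicat_real U)" using assms by simp
  have iUz: "integrable lborel (\<lambda>x. indicat_real U (z n + x))" for n
    using integrable_shift[OF iU] .
  have imin: "integrable lborel (\<lambda>x. min (indicat_real U (z n + x)) (indicat_real U x))" for n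
    by (rule integrable_min[OF iUz iU])
  have "(\<lambda>n. (LBINT x. min (indicat_real U (z n + x)) (indicat_real U x))) \<longlonglongrightarrow> (LBINT x. indicat_real U x)"
  proof (rule integral_dominated_convergence[where w="indicat_real U"])
    show "AE x in lborel. (\<lambda>n. min (indicat_real U (z n + x)) (indicat_real U x)) \<longlonglongrightarrow> indicat_real U x"
    proof (intro AE_I2 tendsto_eventually)
      fix x
      have "(\<lambda>n. z n + x) \<longlonglongrightarrow> 0 + x" by (intro tendsto_intros assms)
      then have "x \<in> U \<Longrightarrow> \<forall>\<^sub>F n in sequentially. z n + x \<in> U"
        using assms(1) by (auto dest: topological_tendstoD)
      then show "\<forall>\<^sub>F n in sequentially. min (indicat_real U (z n + x)) (indicat_real U x) = indicat_real U x"
        by (cases "x \<in> U") (auto simp: indicator_def elim: eventually_mono)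
    qed
  qed (use iU in \<open>auto simp: indicator_def\<close>)
  then have "(\<lambda>n. 2 * (LBINT x. indicat_real U x) - 2 * (LBINT x. min (indicat_real U (z n + x)) (indicat_real U x)))
      \<longlonglongrightarrow> 2 * (LBINT x. indicat_real U x) - 2 * (LBINT x. indicat_real U x)"
    by (intro tendsto_intros)
  moreover have "(LBINT x. \<bar>indicat_real U (z n + x) - indicat_real U x\<bar>)
     = 2 * (LBINT x. indicat_real U x) - 2 * (LBINT x. min (indicat_real U (z n + x)) (indicat_real U x))" for n
  proof -
    have "(LBINT x. \<bar>indicat_real U (z n + x) - indicat_real U x\<bar>)
       = (LBINT x. indicat_real U (z n + x) + indicat_real U x - 2 * min (indicat_real U (z n + x)) (indicat_real U x))"
      by (intro Bochner_Integration.integral_cong) (auto simp: indicator_def)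
    also have "\<dots> = (LBINT x. indicat_real U (z n + x)) + (LBINT x. indicat_real U x) - 2 * (LBINT x. min (indicat_real U (z n + x)) (indicat_real U x))"
      using iU iUz[of n] imin[of n] by simp
    also have "(LBINT x. indicat_real U (z n + x)) = (LBINT x. indicat_real U x)"
      by (rule integral_shift) measurable
    finally show ?thesis by simp
  qed
  ultimately show ?thesis by simp
qed

lemma L1_translation_approx:
  fixes f g :: "'a::euclidean_space \<Rightarrow> complex"
  assumes f: "integrable lborel f" and g: "integrable lborel g"
  shows "(LBINT x. cmod (f (a + x) - f x)) \<le> (LBINT x. cmod (g (a + x) - g x)) + 2 * (LBINT x. cmod (f x - g x))"
proof -
  note ints = f g integrable_shift[OF f, of a] integrable_shift[OF g, of a]
  note [measurable] = borel_measurable_integrable[OF f] borel_measurable_integrable[OF g]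
  have "(LBINT x. cmod (f (a + x) - f x))
      \<le> (LBINT x. cmod (g (a + x) - g x) + cmod (f (a + x) - g (a + x)) + cmod (f x - g x))"
  proof (rule integral_mono)
    fix x
    have "f (a + x) - f x = (g (a + x) - g x) + (f (a + x) - g (a + x)) - (f x - g x)" by simp
    then show "cmod (f (a + x) - f x) \<le> cmod (g (a + x) - g x) + cmod (f (a + x) - g (a + x)) + cmod (f x - g x)"
      by (metis norm_triangle_ineq norm_triangle_ineq4 order_trans add_right_mono)
  qed (use ints in auto)
  also have "\<dots> = (LBINT x. cmod (g (a + x) - g x)) + (LBINT x. cmod (f (a + x) - g (a + x))) + (LBINT x. cmod (f x - g x))"
    using ints by simp
  also have "(LBINT x. cmod (f (a + x) - g (a + x))) = (LBINT x. cmod (f x - g x))"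
    by (rule integral_shift[of "\<lambda>x. cmod (f x - g x)"]) measurable
  finally show ?thesis by simp
qed

lemma L1_translation_limit:
  fixes f :: "'a::euclidean_space \<Rightarrow> complex"
  assumes f: "integrable lborel f"
    and approx: "\<And>e. 0 < e \<Longrightarrow> \<exists>g. integrable lborel g \<and> (\<lambda>n. (LBINT x. cmod (g (z n + x) - g x))) \<longlonglongrightarrow> 0
      \<and> (LBINT x. cmod (f x - g x)) < e"
  shows "(\<lambda>n. (LBINT x. cmod (f (z n + x) - f x))) \<longlonglongrightarrow> 0"
proof (rule LIMSEQ_I)
  fix e :: real assume e: "0 < e"
  then obtain g where g: "integrable lborel g" "(\<lambda>n. (LBINT x. cmod (g (z n + x) - g x))) \<longlonglongrightarrow> 0"
      "(LBINT x. cmod (f x - g x)) < e / 4"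
    using approx[of "e / 4"] by auto
  have "\<forall>\<^sub>F n in sequentially. (LBINT x. cmod (g (z n + x) - g x)) < e / 2"
    using g(2) by (rule order_tendstoD) (use e in simp)
  then have "\<forall>\<^sub>F n in sequentially. (LBINT x. cmod (f (z n + x) - f x)) < e"
  proof eventually_elim
    case (elim n)
    then show ?case using L1_translation_approx[OF f g(1), of "z n"] g(3) by linarith
  qed
  then show "\<exists>no. \<forall>n\<ge>no. norm ((LBINT x. cmod (f (z n + x) - f x)) - 0) < e"
    by (auto simp: eventually_sequentially integral_nonneg_AE)
qed

text \<open>Induction over integrable functions. Measurable sets are reduced to open ones by outer
  regularity; sums and dominated limits are passed through with the approximation bound of
  \<open>L1_translation_limit\<close>.\<close>

lemma L1_translation_continuous:
  fixes f :: "'a::euclidean_space \<Rightarrow> complex" and z :: "nat \<Rightarrow> 'a"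
  assumes "integrable lborel f" and z: "z \<longlonglongrightarrow> 0"
  shows "(\<lambda>n. (LBINT x. cmod (f (z n + x) - f x))) \<longlonglongrightarrow> 0"
  using assms(1)
proof (induction rule: integrable_induct)
  case (base A c)
  then have [measurable]: "A \<in> sets borel" by simp
  show ?case
  proof (rule L1_translation_limit)
    show "integrable lborel (\<lambda>x. indicat_real A x *\<^sub>R c)" using base by simp
    fix e :: real assume "e > 0"
    \<comment> \<open>The added 1 covers c = 0.\<close>
    then have e': "0 < e / (cmod c + 1)" by (simp add: add_nonneg_pos)
    then obtain U where U: "open U" "A \<subseteq> U" "emeasure lborel (U - A) < e / (cmod c + 1)"
      using outer_regular_lborel[of A "e / (cmod c + 1)"] by auto
    have [measurable]: "U \<in> sets borel" using U by simp
    have fin: "emeasure lborel U < \<infinity>"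
    proof -
      have "emeasure lborel U \<le> emeasure lborel A + emeasure lborel (U - A)"
        using emeasure_subadditive[of A lborel "U - A"] U(2) by (simp add: Un_absorb1)
      also have "\<dots> < \<infinity>" using base U(3) by (auto simp: less_top[symmetric] top_unique)
      finally show ?thesis .
    qed
    let ?g = "\<lambda>x. indicat_real U x *\<^sub>R c"
    have "integrable lborel ?g" using fin by simp
    moreover have "(\<lambda>n. (LBINT x. \<bar>indicat_real U (z n + x) - indicat_real U x\<bar>) * cmod c) \<longlonglongrightarrow> 0 * cmod c"
      by (intro tendsto_intros L1_translation_open[OF U(1) fin z])
    then have "(\<lambda>n. (LBINT x. cmod (?g (z n + x) - ?g x))) \<longlonglongrightarrow> 0"
      by (simp add: scaleR_diff_left[symmetric])
    moreover have "(LBINT x. cmod (indicat_real A x *\<^sub>R c - ?g x)) < e"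
    proof -
      have "ennreal (measure lborel (U - A)) < ennreal (e / (cmod c + 1))"
        using U(3) order_less_trans[OF U(3) ennreal_less_top]
        by (subst emeasure_eq_ennreal_measure[symmetric]) auto
      then have m: "measure lborel (U - A) < e / (cmod c + 1)" using e' by (simp add: ennreal_less_iff)
      have "cmod (indicat_real A x *\<^sub>R c - ?g x) = indicat_real (U - A) x * cmod c" for x
        using U(2) by (auto simp: indicator_def)
      then have "(LBINT x. cmod (indicat_real A x *\<^sub>R c - ?g x)) = measure lborel (U - A) * cmod c" by simp
      also have "\<dots> \<le> measure lborel (U - A) * (cmod c + 1)" by (intro mult_left_mono) auto
      also have "\<dots> < e" using m by (simp add: pos_less_divide_eq add_nonneg_pos)
      finally show ?thesis .
    qed
    ultimately show "\<exists>g. integrable lborel g \<and> (\<lambda>n. (LBINT x. cmod (g (z n + x) - g x))) \<longlonglongrightarrow> 0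
        \<and> (LBINT x. cmod (indicat_real A x *\<^sub>R c - g x)) < e" by blast
  qed
next
  case (add f g)
  note ints = add.hyps integrable_shift[OF add.hyps(1)] integrable_shift[OF add.hyps(2)]
  have "(\<lambda>n. (LBINT x. cmod (f (z n + x) - f x)) + (LBINT x. cmod (g (z n + x) - g x))) \<longlonglongrightarrow> 0"
    using tendsto_add[OF add.IH] by simp
  then show ?case
  proof (rule Lim_null_comparison[rotated], intro always_eventually allI)
    fix n
    have "(LBINT x. cmod (f (z n + x) + g (z n + x) - (f x + g x)))
       \<le> (LBINT x. cmod (f (z n + x) - f x) + cmod (g (z n + x) - g x))"
      using ints by (intro integral_mono) (auto intro: norm_diff_triangle_ineq)
    then show "norm (LBINT x. cmod (f (z n + x) + g (z n + x) - (f x + g x)))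
       \<le> (LBINT x. cmod (f (z n + x) - f x)) + (LBINT x. cmod (g (z n + x) - g x))"
      using ints by (simp add: integral_nonneg_AE)
  qed
next
  case (lim f s)
  show ?case
  proof (rule L1_translation_limit[OF lim.hyps(4)])
    note [measurable] = borel_measurable_integrable[OF lim.hyps(1)] borel_measurable_integrable[OF lim.hyps(4)]
    fix e :: real assume "e > 0"
    have "(\<lambda>i. (LBINT x. cmod (f x - s i x))) \<longlonglongrightarrow> (\<integral>x. 0 \<partial>(lborel :: 'a measure))"
    proof (rule integral_dominated_convergence[where w="\<lambda>x. 3 * cmod (f x)"])
      show "AE x in lborel. (\<lambda>i. cmod (f x - s i x)) \<longlonglongrightarrow> 0"
        using lim.hyps(2) by (auto intro!: tendsto_norm_zero simp: LIM_zero_iff norm_minus_commute[of "f _"])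
      show "AE x in lborel. norm (cmod (f x - s i x)) \<le> 3 * cmod (f x)" for i
      proof (rule AE_I2)
        fix x :: 'a assume "x \<in> space lborel"
        then show "norm (cmod (f x - s i x)) \<le> 3 * cmod (f x)"
          using lim.hyps(3)[of x i] norm_triangle_ineq4[of "f x" "s i x"] by simp
      qed
    qed (use lim.hyps in auto)
    then have "\<forall>\<^sub>F i in sequentially. (LBINT x. cmod (f x - s i x)) < e"
      by (intro order_tendstoD) (use \<open>e > 0\<close> in auto)
    then obtain i where "(LBINT x. cmod (f x - s i x)) < e" by (auto simp: eventually_sequentially)
    with lim.hyps(1) lim.IH show "\<exists>g. integrable lborel g \<and> (\<lambda>n. (LBINT x. cmod (g (z n + x) - g x))) \<longlonglongrightarrow> 0
        \<and> (LBINT x. cmod (f x - g x)) < e" by blast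
  qed
qed

section \<open>The Fourier transform\<close>

lemma borel_measurable_cis [measurable]: "cis \<in> borel_measurable borel"
  by (intro borel_measurable_continuous_onI continuous_intros)

lemma integrable_pair_mult:
  fixes f :: "'a::euclidean_space \<Rightarrow> complex" and g :: "'b::euclidean_space \<Rightarrow> complex"
  assumes "integrable lborel f" "integrable lborel g"
  shows "integrable (lborel \<Otimes>\<^sub>M lborel) (\<lambda>(x, y). f x * g y)"
proof (rule lborel_pair.Fubini_integrable)
  have [measurable]: "f \<in> borel_measurable borel" "g \<in> borel_measurable borel"
    using assms by (auto dest: borel_measurable_integrable)
  show "(\<lambda>(x, y). f x * g y) \<in> borel_measurable (lborel \<Otimes>\<^sub>M lborel)" by measurable
  show "integrable lborel (\<lambda>x. (LBINT y. norm (case (x, y) of (x, y) \<Rightarrow> f x * g y)))"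
    using assms by (simp add: norm_mult)
  show "AE x in lborel. integrable lborel (\<lambda>y. case (x, y) of (x, y) \<Rightarrow> f x * g y)"
    using assms by simp
qed

lemma integrable_pair_kernel:
  fixes f :: "'a::euclidean_space \<Rightarrow> complex" and g :: "'b::euclidean_space \<Rightarrow> complex"
  assumes f: "integrable lborel f" and g: "integrable lborel g"
    and k [measurable]: "case_prod k \<in> borel_measurable (borel \<Otimes>\<^sub>M borel)"
    and k1: "\<And>x y. cmod (k x y) \<le> C"
  shows "integrable (lborel \<Otimes>\<^sub>M lborel) (\<lambda>(x, y). f x * k x y * g y)"
proof (rule Bochner_Integration.integrable_bound)
  have [measurable]: "f \<in> borel_measurable borel" "g \<in> borel_measurable borel"
    using assms by (auto dest: borel_measurable_integrable)
  show "integrable (lborel \<Otimes>\<^sub>M lborel) (\<lambda>z. C * norm (case z of (x, y) \<Rightarrow> f x * g y))"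
    using integrable_pair_mult[OF f g] by (intro integrable_mult_right integrable_norm)
  show "(\<lambda>(x, y). f x * k x y * g y) \<in> borel_measurable (lborel \<Otimes>\<^sub>M lborel)" by measurable
  have "cmod (f x * k x y * g y) \<le> \<bar>C\<bar> * (cmod (f x) * cmod (g y))" for x y
    using mult_right_mono[OF order_trans[OF k1[of x y] abs_ge_self], of "cmod (f x) * cmod (g y)"]
    by (simp add: norm_mult mult_ac)
  then show "AE z in lborel \<Otimes>\<^sub>M lborel. norm (case z of (x, y) \<Rightarrow> f x * k x y * g y)
      \<le> norm (C * norm (case z of (x, y) \<Rightarrow> f x * g y))"
    by (intro AE_I2) (auto simp: norm_mult abs_mult)
qed

lemma Fubini_kernel:
  fixes f :: "'a::euclidean_space \<Rightarrow> complex" and g :: "'b::euclidean_space \<Rightarrow> complex"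
  assumes f: "integrable lborel f" and g: "integrable lborel g"
    and k: "case_prod k \<in> borel_measurable (borel \<Otimes>\<^sub>M borel)" "\<And>x y. cmod (k x y) \<le> C"
  shows "(LBINT x. f x * (LBINT y. k x y * g y)) = (LBINT y. (LBINT x. k x y * f x) * g y)"
proof -
  have "(LBINT y. (LBINT x. f x * k x y * g y)) = (LBINT x. (LBINT y. f x * k x y * g y))"
    by (rule lborel_pair.Fubini_integral[OF integrable_pair_kernel[OF assms]])
  moreover have "(LBINT y. f x * k x y * g y) = f x * (LBINT y. k x y * g y)" for x
    by (simp add: mult.assoc)
  moreover have "(LBINT x. f x * k x y * g y) = (LBINT x. k x y * f x) * g y" for y
    by (subst integral_mult_left_zero[symmetric]) (simp add: mult_ac)
  ultimately show ?thesis by (simp only:)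
qed

section \<open>Gaussian integrals in the plane\<close>

lemma lborel_integral_prod:
  fixes f :: "'a::euclidean_space \<Rightarrow> real \<Rightarrow> complex"
  assumes "\<And>b. b \<in> Basis \<Longrightarrow> integrable lborel (f b)"
  shows "integrable lborel (\<lambda>x::'a. \<Prod>b\<in>Basis. f b (x \<bullet> b))"
    and "(\<integral>x. (\<Prod>b\<in>Basis. f b (x \<bullet> b)) \<partial>(lborel :: 'a measure)) = (\<Prod>b\<in>Basis. (LBINT t. f b t))"
proof -
  interpret product_sigma_finite "\<lambda>_::'a. lborel :: real measure" ..
  let ?P = "\<Pi>\<^sub>M b\<in>(Basis::'a set). (lborel :: real measure)"
  have [measurable]: "b \<in> Basis \<Longrightarrow> f b \<in> borel_measurable borel" for b
    using borel_measurable_integrable[OF assms] by simp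
  have eq: "(\<Prod>b\<in>Basis. f b ((\<Sum>b\<in>Basis. x b *\<^sub>R b) \<bullet> b)) = (\<Prod>b\<in>Basis. f b (x b))" for x
    by (intro prod.cong) auto
  have m: "(\<lambda>f. \<Sum>b\<in>Basis. f b *\<^sub>R (b::'a)) \<in> ?P \<rightarrow>\<^sub>M borel" by measurable
  show "integrable lborel (\<lambda>x::'a. \<Prod>b\<in>Basis. f b (x \<bullet> b))"
    unfolding lborel_eq[where 'a='a] by (subst integrable_distr_eq[OF m])
      (use product_integrable_prod[of Basis f] assms in \<open>auto simp: eq\<close>)
  show "(\<integral>x. (\<Prod>b\<in>Basis. f b (x \<bullet> b)) \<partial>(lborel :: 'a measure)) = (\<Prod>b\<in>Basis. (LBINT t. f b t))"
    unfolding lborel_eq[where 'a='a] by (subst integral_distr[OF m])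
      (use product_integral_prod[of Basis f] assms in \<open>auto simp: eq\<close>)
qed

text \<open>For s = 1 this is the characteristic function of the standard normal distribution, up to
  its normalising factor. The substitution x -> x / sqrt s gives the general case.\<close>

lemma integral_cis_gauss_real:
  fixes s t :: real
  assumes "s > 0"
  shows "integrable lborel (\<lambda>x. cis (t * x) * complex_of_real (exp (- (s * x\<^sup>2 / 2))))"
    and "(LBINT x. cis (t * x) * of_real (exp (- (s * x\<^sup>2 / 2))))
      = complex_of_real (sqrt (2 * pi / s) * exp (- (t\<^sup>2 / (2 * s))))"
proof -
  have "(\<integral>x. iexp (u * x) \<partial>std_normal_distribution) = complex_of_real (exp (- (u^2) / 2))" for u
    using char_std_normal_distribution by (simp add: char_def fun_eq_iff)
  then have A: "(LBINT x. std_normal_density x *\<^sub>R cis (u * x)) = of_real (exp (- (u^2) / 2))" for u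
    by (simp add: integral_density cis_conv_exp)
  have I: "integrable lborel (\<lambda>x. std_normal_density x *\<^sub>R cis (u * x))" for u
    by (rule Bochner_Integration.integrable_bound[of _ std_normal_density]) (auto simp: integrable_normal_density)
  have B: "(\<lambda>x. cis (u * x) * of_real (exp (- (x\<^sup>2 / 2)))) = (\<lambda>x. of_real (sqrt (2 * pi)) * (std_normal_density x *\<^sub>R cis (u * x)))" for u
    by (auto simp: fun_eq_iff std_normal_density_def scaleR_conv_of_real real_sqrt_mult)
  define c where "c = 1 / sqrt s"
  have c: "c \<noteq> 0" "\<bar>c\<bar> = c" "s * c\<^sup>2 = 1" using assms by (auto simp: c_def power_divide)
  have C: "cis (t * (0 + c * x)) * of_real (exp (- (s * (0 + c * x)\<^sup>2 / 2)))
      = of_real (sqrt (2 * pi)) * (std_normal_density x *\<^sub>R cis (t * c * x))" for x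
    using fun_cong[OF B[of "t * c"], of x] c(3) by (simp add: power_mult_distrib mult.assoc[symmetric])
  show "integrable lborel (\<lambda>x. cis (t * x) * complex_of_real (exp (- (s * x\<^sup>2 / 2))))"
    by (subst lborel_integrable_real_affine_iff[OF c(1), of _ 0, symmetric]) (unfold C, intro integrable_mult_right I)
  have "(LBINT x. cis (t * x) * of_real (exp (- (s * x\<^sup>2 / 2))))
     = \<bar>c\<bar> *\<^sub>R (complex_of_real (sqrt (2 * pi)) * complex_of_real (exp (- ((t * c)^2) / 2)))"
    by (subst lborel_integral_real_affine[OF c(1), of _ 0]) (unfold C integral_mult_right_zero A, rule refl)
  also have "(t * c)\<^sup>2 = t\<^sup>2 / s" using assms by (simp add: c_def power_divide)
  finally show "(LBINT x. cis (t * x) * of_real (exp (- (s * x\<^sup>2 / 2))))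
      = complex_of_real (sqrt (2 * pi / s) * exp (- (t\<^sup>2 / (2 * s))))"
    using assms by (simp add: scaleR_conv_of_real c_def real_sqrt_divide divide_simps)
qed

definition gauss :: "real \<Rightarrow> real^2 \<Rightarrow> complex" where
  "gauss s x = of_real (exp (- (s * (norm x)\<^sup>2 / 2)))"

lemma gauss_measurable [measurable]: "gauss s \<in> borel_measurable borel"
  unfolding gauss_def by measurable

lemma gauss_nonzero [simp]: "gauss s x \<noteq> 0"
  by (simp add: gauss_def)

lemma norm_gauss: "cmod (gauss s x) = exp (- (s * (norm x)\<^sup>2 / 2))"
  by (simp add: gauss_def)

lemma norm_gauss_le: "s \<ge> 0 \<Longrightarrow> cmod (gauss s x) \<le> 1"
  by (simp add: norm_gauss)

lemma cnj_gauss [simp]: "cnj (gauss s x) = gauss s x"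
  by (simp add: gauss_def)

lemma gauss_uminus [simp]: "gauss s (- x) = gauss s x"
  by (simp add: gauss_def)

lemma integral_cis_gauss:
  assumes "s > 0"
  shows "integrable lborel (\<lambda>\<xi>. cis (x \<bullet> \<xi>) * gauss s \<xi>)"
    and "(LBINT \<xi>. cis (x \<bullet> \<xi>) * gauss s \<xi>) = of_real (2 * pi / s) * gauss (1 / s) x"
proof -
  have n: "(norm y)\<^sup>2 = (\<Sum>b\<in>Basis. (y \<bullet> b)\<^sup>2)" for y :: "real^2"
    unfolding power2_norm_eq_inner by (subst euclidean_inner) (simp add: power2_eq_square)
  have cs: "cis (sum f A) = (\<Prod>b\<in>A. cis (f b))" if "finite A" for f and A :: "(real^2) set"
    using that by induction (auto simp: cis_mult[symmetric])
  have P: "cis (x \<bullet> \<xi>) * gauss s \<xi> = (\<Prod>b\<in>Basis. cis ((x \<bullet> b) * (\<xi> \<bullet> b)) * of_real (exp (- (s * (\<xi> \<bullet> b)\<^sup>2 / 2))))" for \<xi>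
    unfolding gauss_def n euclidean_inner[of x \<xi>]
    by (simp add: prod.distrib cs[symmetric] of_real_prod[symmetric] exp_sum[symmetric] sum_negf sum_divide_distrib sum_distrib_left)
  show "integrable lborel (\<lambda>\<xi>. cis (x \<bullet> \<xi>) * gauss s \<xi>)"
    unfolding P by (rule lborel_integral_prod(1)) (rule integral_cis_gauss_real[OF assms])
  have "(LBINT \<xi>. cis (x \<bullet> \<xi>) * gauss s \<xi>) = (\<Prod>b\<in>Basis. of_real (sqrt (2 * pi / s) * exp (- ((x \<bullet> b)\<^sup>2 / (2 * s)))))"
    unfolding P by (subst lborel_integral_prod(2)) (simp_all only: integral_cis_gauss_real[OF assms])
  also have "\<dots> = complex_of_real ((\<Prod>b\<in>(Basis::(real^2) set). sqrt (2 * pi / s)) * (\<Prod>b\<in>Basis. exp (- ((x \<bullet> b)\<^sup>2 / (2 * s)))))"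
    by (simp only: of_real_prod[symmetric] prod.distrib)
  also have "(\<Prod>b\<in>(Basis::(real^2) set). sqrt (2 * pi / s)) = 2 * pi / s"
    using assms by (simp add: power2_eq_square[symmetric])
  also have "(\<Prod>b\<in>Basis. exp (- ((x \<bullet> b)\<^sup>2 / (2 * s)))) = exp (- ((1 / s) * (norm x)\<^sup>2 / 2))"
    unfolding n by (simp add: exp_sum[symmetric] sum_negf sum_divide_distrib sum_distrib_left mult.commute)
  finally show "(LBINT \<xi>. cis (x \<bullet> \<xi>) * gauss s \<xi>) = of_real (2 * pi / s) * gauss (1 / s) x"
    by (simp add: gauss_def)
qed

lemma integrable_gauss: "s > 0 \<Longrightarrow> integrable lborel (gauss s)"
  using integral_cis_gauss(1)[of s 0] by simp

lemma integral_gauss: "(LBINT v. gauss 1 v) = of_real (2 * pi)"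
  using integral_cis_gauss(2)[of 1 0] by (simp add: gauss_def)

lemma integral_scale:
  fixes f :: "real^2 \<Rightarrow> complex"
  assumes [measurable]: "f \<in> borel_measurable borel" and "r > 0"
  shows "(LBINT x. f x) = complex_of_real (r\<^sup>2) * (LBINT x. f (r *\<^sub>R x))"
proof -
  have "(LBINT x. f x) = (\<integral>x. f x \<partial>density (distr lborel borel (\<lambda>x. 0 + r *\<^sub>R x)) (\<lambda>_. \<bar>r\<bar>^DIM(real^2)))"
    using assms(2) by (subst lborel_affine[of r 0]) auto
  also have "\<dots> = (\<integral>x. (r\<^sup>2) *\<^sub>R f x \<partial>(distr lborel borel (\<lambda>x. 0 + r *\<^sub>R x)))"
    by (subst integral_density) (use assms(2) in auto)
  also have "\<dots> = (LBINT x. (r\<^sup>2) *\<^sub>R f (r *\<^sub>R x))"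
    by (subst integral_distr) auto
  finally show ?thesis by (simp add: scaleR_conv_of_real)
qed

section \<open>Inversion by Gaussian regularisation\<close>

lemma fourier_integral_measurable [measurable]:
  assumes [measurable]: "\<phi> \<in> borel_measurable borel"
  shows "fourier_integral \<phi> \<in> borel_measurable borel"
  unfolding fourier_integral_def by measurable

lemma integrable_cis_mult:
  fixes f :: "real^2 \<Rightarrow> complex"
  assumes "integrable lborel f" and [measurable]: "g \<in> borel_measurable borel"
  shows "integrable lborel (\<lambda>x. cis (g x) * f x)"
  by (rule Bochner_Integration.integrable_bound[OF assms(1)])
    (use borel_measurable_integrable[OF assms(1)] in \<open>auto simp: norm_mult\<close>)

lemma norm_fourier_integral_le: "cmod (fourier_integral f \<xi>) \<le> (LBINT x. cmod (f x))"
  unfolding fourier_integral_def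
  using integral_norm_bound[of lborel "\<lambda>x. cis (- (x \<bullet> \<xi>)) * f x"] by (simp add: norm_mult)

text \<open>Gaussian means of \<open>h\<close> at scale \<open>r\<close>, an approximate identity up to the factor \<open>2\<pi>\<close>.\<close>

definition gmean :: "real \<Rightarrow> (real^2 \<Rightarrow> complex) \<Rightarrow> real^2 \<Rightarrow> complex" where
  "gmean r h y = (LBINT v. h (y + r *\<^sub>R v) * gauss 1 v)"

lemma gmean_measurable [measurable]:
  assumes [measurable]: "h \<in> borel_measurable borel"
  shows "gmean r h \<in> borel_measurable borel"
  unfolding gmean_def by measurable

text \<open>The Gaussian factor makes the double integral converge absolutely although the transform
  of h need not be integrable. After Fubini the inner integral is again a Gaussian, and rescaling by
  r produces the mean.\<close>

lemma fourier_inversion_gauss: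
  assumes h: "integrable lborel h" and "r > 0"
  shows "(LBINT \<xi>. fourier_integral h \<xi> * (cis (y \<bullet> \<xi>) * gauss (r\<^sup>2) \<xi>)) = of_real (2 * pi) * gmean r h y"
proof -
  have [measurable]: "h \<in> borel_measurable borel" using h by auto
  have s: "r\<^sup>2 > 0" using assms by simp
  have "(LBINT \<xi>. fourier_integral h \<xi> * (cis (y \<bullet> \<xi>) * gauss (r\<^sup>2) \<xi>))
     = (LBINT x. h x * (LBINT \<xi>. cis (- (x \<bullet> \<xi>)) * (cis (y \<bullet> \<xi>) * gauss (r\<^sup>2) \<xi>)))"
    unfolding fourier_integral_def
    by (rule Fubini_kernel[symmetric, where C=1, OF h integral_cis_gauss(1)[OF s]]) auto
  also have "\<dots> = (LBINT x. h x * (LBINT \<xi>. cis ((y - x) \<bullet> \<xi>) * gauss (r\<^sup>2) \<xi>))"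
    by (simp add: mult.assoc[symmetric] cis_mult inner_diff_left)
  also have "\<dots> = (LBINT x. h x * (of_real (2 * pi / r\<^sup>2) * gauss (1 / r\<^sup>2) (y - x)))"
    by (simp add: integral_cis_gauss(2)[OF s])
  also have "\<dots> = (LBINT x. h (y + x) * (of_real (2 * pi / r\<^sup>2) * gauss (1 / r\<^sup>2) x))"
    by (subst integral_shift[symmetric, where a=y]) auto
  also have "\<dots> = of_real (r\<^sup>2) * (LBINT x. h (y + r *\<^sub>R x) * (of_real (2 * pi / r\<^sup>2) * gauss (1 / r\<^sup>2) (r *\<^sub>R x)))"
    using assms by (subst integral_scale[where r=r]) auto
  also have "\<dots> = of_real (r\<^sup>2) * (LBINT x. of_real (2 * pi / r\<^sup>2) * (h (y + r *\<^sub>R x) * gauss 1 x))"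
  proof -
    have "gauss (1 / r\<^sup>2) (r *\<^sub>R x) = gauss 1 x" for x
      using assms by (simp add: gauss_def power_mult_distrib)
    then show ?thesis by (simp add: mult_ac)
  qed
  also have "\<dots> = complex_of_real (2 * pi) * gmean r h y"
    using assms unfolding gmean_def by simp
  finally show ?thesis .
qed

text \<open>The L^1 distance is at most the Gaussian average of the translation modulus
  \<open>d n v\<close>. This modulus tends to 0 for each v by continuity of translation and never
  exceeds twice the L^1 norm of h, so dominated convergence in v applies.\<close>

lemma gmean_L1:
  assumes h: "integrable lborel h" and r: "r \<longlonglongrightarrow> 0"
  shows "(\<lambda>n. (LBINT y. cmod (gmean (r n) h y - of_real (2 * pi) * h y))) \<longlonglongrightarrow> 0"
    and "\<And>n. integrable lborel (\<lambda>y. gmean (r n) h y - complex_of_real (2 * pi) * h y)"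
proof -
  have [measurable]: "h \<in> borel_measurable borel" using h by auto
  define G where "G v = cmod (gauss 1 v)" for v
  have [measurable]: "G \<in> borel_measurable borel" unfolding G_def by measurable
  have Gi: "integrable lborel G" using integrable_gauss[of 1] unfolding G_def by simp
  define d where "d n v = (LBINT y. cmod (h (y + r n *\<^sub>R v) - h y))" for n v
  have [measurable]: "d n \<in> borel_measurable borel" for n unfolding d_def by measurable
  have hs: "integrable lborel (\<lambda>y. h (y + a))" for a
    using integrable_shift[OF h, of a] by (simp add: add.commute)
  have dle: "d n v \<le> 2 * (LBINT y. cmod (h y))" for n v
  proof -
    have "d n v \<le> (LBINT y. cmod (h (y + r n *\<^sub>R v)) + cmod (h y))"
      unfolding d_def by (intro integral_mono integrable_norm Bochner_Integration.integrable_diff Bochner_Integration.integrable_add hs h norm_triangle_ineq4)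
    also have "\<dots> = (LBINT y. cmod (h (y + r n *\<^sub>R v))) + (LBINT y. cmod (h y))"
      by (intro Bochner_Integration.integral_add integrable_norm hs h)
    also have "(LBINT y. cmod (h (y + r n *\<^sub>R v))) = (LBINT y. cmod (h y))"
      using integral_shift[of "\<lambda>y. cmod (h y)" "r n *\<^sub>R v"] by (simp add: add.commute)
    finally show ?thesis by simp
  qed
  have d0: "0 \<le> d n v" for n v unfolding d_def by simp
  have dG: "integrable lborel (\<lambda>v. d n v * G v)" for n
  proof (rule Bochner_Integration.integrable_bound)
    show "integrable lborel (\<lambda>v. 2 * (LBINT y. cmod (h y)) * G v)"
      using Gi by (rule integrable_mult_right)
    have "\<bar>d n v\<bar> * \<bar>G v\<bar> \<le> \<bar>2 * (LBINT y. cmod (h y))\<bar> * \<bar>G v\<bar>" for v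
      using dle[of n v] d0[of n v] by (intro mult_right_mono) auto
    then show "AE v in lborel. norm (d n v * G v) \<le> norm (2 * (LBINT y. cmod (h y)) * G v)"
      by (intro AE_I2) (simp only: real_norm_def abs_mult[of "d n _"] abs_mult[of "2 * _"])
  qed measurable
  have lim: "(\<lambda>n. (LBINT v. d n v * G v)) \<longlonglongrightarrow> (\<integral>v. 0 \<partial>(lborel :: (real^2) measure))"
  proof (rule integral_dominated_convergence[where w="\<lambda>v. 2 * (LBINT y. cmod (h y)) * G v"])
    show "AE v in lborel. (\<lambda>n. d n v * G v) \<longlonglongrightarrow> 0"
    proof (rule AE_I2)
      fix v :: "real^2"
      have "(\<lambda>n. r n *\<^sub>R v) \<longlonglongrightarrow> 0" using tendsto_scaleR[OF r tendsto_const[of v]] by simp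
      from L1_translation_continuous[OF h this] have "(\<lambda>n. d n v) \<longlonglongrightarrow> 0"
        by (simp add: d_def add.commute)
      from tendsto_mult_left_zero[OF this] show "(\<lambda>n. d n v * G v) \<longlonglongrightarrow> 0" .
    qed
    show "AE v in lborel. norm (d n v * G v) \<le> 2 * (LBINT y. cmod (h y)) * G v" for n
      using dle d0 by (auto simp: G_def abs_mult intro!: mult_right_mono)
  qed (use Gi in auto)
  have P: "integrable (lborel \<Otimes>\<^sub>M lborel) (\<lambda>(v, y). (h (y + r n *\<^sub>R v) - h y) * gauss 1 v)" for n
  proof (rule lborel_pair.Fubini_integrable)
    show "integrable lborel (\<lambda>v. (LBINT y. norm (case (v, y) of (v, y) \<Rightarrow> (h (y + r n *\<^sub>R v) - h y) * gauss 1 v)))"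
      using dG[of n] by (simp add: norm_mult d_def G_def)
    show "AE v in lborel. integrable lborel (\<lambda>y. case (v, y) of (v, y) \<Rightarrow> (h (y + r n *\<^sub>R v) - h y) * gauss 1 v)"
      using hs h by simp
  qed measurable
  \<comment> \<open>Only almost everywhere: splitting the integral needs h(y + r v) times the
    Gaussian to be integrable in v, which Fubini gives for almost every y.\<close>
  have E: "AE y in lborel. gmean (r n) h y - of_real (2 * pi) * h y = (LBINT v. (h (y + r n *\<^sub>R v) - h y) * gauss 1 v)" for n
    using lborel_pair.AE_integrable_snd[OF P[of n]]
  proof eventually_elim
    case (elim y)
    have i: "integrable lborel (\<lambda>v. h y * gauss 1 v)" using integrable_gauss[of 1] by simp
    have "integrable lborel (\<lambda>v. (h (y + r n *\<^sub>R v) - h y) * gauss 1 v + h y * gauss 1 v)"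
      using elim i by (rule Bochner_Integration.integrable_add)
    then have "integrable lborel (\<lambda>v. h (y + r n *\<^sub>R v) * gauss 1 v)" by (simp add: algebra_simps)
    from Bochner_Integration.integral_diff[OF this i] show ?case
      by (simp add: gmean_def integral_gauss algebra_simps)
  qed
  show I: "integrable lborel (\<lambda>y. gmean (r n) h y - complex_of_real (2 * pi) * h y)" for n
    using lborel_pair.integrable_snd[OF P[of n]]
  proof (rule integrable_cong_AE_imp)
    show "AE y in lborel. (LBINT v. (h (y + r n *\<^sub>R v) - h y) * gauss 1 v)
        = gmean (r n) h y - complex_of_real (2 * pi) * h y"
      using E[of n] by eventually_elim simp
  qed measurable
  have "(LBINT y. cmod (gmean (r n) h y - of_real (2 * pi) * h y)) \<le> (LBINT v. d n v * G v)" for n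
  proof -
    have "(LBINT y. cmod (gmean (r n) h y - of_real (2 * pi) * h y))
       = (LBINT y. cmod (LBINT v. (h (y + r n *\<^sub>R v) - h y) * gauss 1 v))"
    proof (rule integral_cong_AE)
      show "AE y in lborel. cmod (gmean (r n) h y - of_real (2 * pi) * h y)
          = cmod (LBINT v. (h (y + r n *\<^sub>R v) - h y) * gauss 1 v)"
        using E[of n] by eventually_elim simp
    qed measurable
    also have "\<dots> \<le> (LBINT y. (LBINT v. norm ((h (y + r n *\<^sub>R v) - h y) * gauss 1 v)))"
    proof (rule integral_mono)
      show "integrable lborel (\<lambda>y. (LBINT v. norm ((h (y + r n *\<^sub>R v) - h y) * gauss 1 v)))"
        using lborel_pair.integrable_snd[of "\<lambda>v y. norm ((h (y + r n *\<^sub>R v) - h y) * gauss 1 v)"]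
          integrable_norm[OF P[of n]] by (simp add: case_prod_beta')
      show "integrable lborel (\<lambda>y. cmod (LBINT v. (h (y + r n *\<^sub>R v) - h y) * gauss 1 v))"
        using lborel_pair.integrable_snd[OF P[of n]] by (rule integrable_norm)
    qed (rule integral_norm_bound)
    also have "\<dots> = (LBINT v. (LBINT y. norm ((h (y + r n *\<^sub>R v) - h y) * gauss 1 v)))"
      using lborel_pair.Fubini_integral[of "\<lambda>v y. norm ((h (y + r n *\<^sub>R v) - h y) * gauss 1 v)"]
        integrable_norm[OF P[of n]] by (simp add: case_prod_beta')
    also have "\<dots> = (LBINT v. d n v * G v)" by (simp add: norm_mult d_def G_def)
    finally show ?thesis .
  qed
  with lim show "(\<lambda>n. (LBINT y. cmod (gmean (r n) h y - of_real (2 * pi) * h y))) \<longlonglongrightarrow> 0"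
    by (intro tendsto_sandwich[OF _ _ tendsto_const lim[simplified]] always_eventually allI) auto
qed

text \<open>All Gaussian means of h vanish by the regularised inversion, yet they converge in L^1 to
  a multiple of h.\<close>

lemma fourier_integral_eq_0:
  assumes h: "integrable lborel h" and "\<And>\<xi>. fourier_integral h \<xi> = 0"
  shows "AE x in lborel. h x = 0"
proof -
  have "gmean (1 / Suc n) h y = 0" for n y
    using fourier_inversion_gauss[OF h, of "1 / Suc n" y] assms(2) by simp
  then have "(\<lambda>n::nat. (LBINT y. cmod (of_real (2 * pi) * h y))) \<longlonglongrightarrow> 0"
    using gmean_L1(1)[OF h LIMSEQ_Suc[OF lim_1_over_n]] by simp
  then have "(LBINT y. cmod (h y)) = 0"
    by (simp add: LIMSEQ_const_iff norm_mult)
  then have "AE y in lborel. cmod (h y) = 0"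
    using h by (subst (asm) integral_nonneg_eq_0_iff_AE) auto
  then show ?thesis by simp
qed

text \<open>The test class of the L^2 theory. It is contained in L^1 and L^2 and dense in L^2,
  contains Schwartz functions and modulated or translated Gaussians, and boundedness allows pairing
  with errors that are small only in L^1.\<close>

definition BI :: "(real^2 \<Rightarrow> complex) \<Rightarrow> bool" where
  "BI f \<longleftrightarrow> integrable lborel f \<and> bounded (range f)"

lemma BI_integrable: "BI f \<Longrightarrow> integrable lborel f"
  and BI_measurable: "BI f \<Longrightarrow> f \<in> borel_measurable borel"
  by (auto simp: BI_def dest: borel_measurable_integrable)

lemma BI_bound: assumes "BI f" obtains C where "\<And>x. cmod (f x) \<le> C" "C > 0"
  using assms by (auto simp: BI_def bounded_pos)

lemma BI_I: "integrable lborel f \<Longrightarrow> (\<And>x. cmod (f x) \<le> C) \<Longrightarrow> BI f"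
  by (auto simp: BI_def bounded_iff)

lemma BI_sq_integrable: assumes "BI f" shows "sq_integrable f"
proof -
  obtain C where C: "\<And>x. cmod (f x) \<le> C" "C > 0" using BI_bound[OF assms] by blast
  have [measurable]: "f \<in> borel_measurable borel" using BI_measurable[OF assms] .
  have "integrable lborel (\<lambda>x. (cmod (f x))\<^sup>2)"
  proof (rule Bochner_Integration.integrable_bound)
    show "integrable lborel (\<lambda>x. C * cmod (f x))" using BI_integrable[OF assms] by simp
    show "AE x in lborel. norm ((cmod (f x))\<^sup>2) \<le> norm (C * cmod (f x))"
      using C by (intro AE_I2) (simp add: power2_eq_square abs_mult mult_right_mono)
  qed measurable
  then show ?thesis by (simp add: sq_integrable_def)
qed

lemma BI_diff: assumes "BI f" "BI g" shows "BI (\<lambda>x. f x - g x)"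
proof -
  obtain C where C: "\<And>x. cmod (f x) \<le> C" using BI_bound[OF assms(1)] by metis
  obtain D where D: "\<And>x. cmod (g x) \<le> D" using BI_bound[OF assms(2)] by metis
  show ?thesis
    by (rule BI_I[where C="C + D"])
      (use assms C D in \<open>auto simp: BI_integrable intro: order_trans[OF norm_triangle_ineq4 add_mono]\<close>)
qed

lemma BI_cnj_flip: assumes "BI f" shows "BI (\<lambda>x. cnj (f (- x)))"
proof -
  obtain C where C: "\<And>x. cmod (f x) \<le> C" using BI_bound[OF assms] by metis
  show ?thesis
    using integrable_flip[OF BI_integrable[OF assms], of 0] C
    by (intro BI_I[where C=C]) (auto simp: Bochner_Integration.integrable_cnj)
qed

lemma BI_shift: assumes "BI f" shows "BI (\<lambda>x. f (a + x))"
proof -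
  obtain C where C: "\<And>x. cmod (f x) \<le> C" using BI_bound[OF assms] by metis
  show ?thesis using integrable_shift[OF BI_integrable[OF assms], of a] C
    by (intro BI_I[where C=C]) auto
qed

lemma BI_cis_gauss: "BI (\<lambda>\<xi>. cis (x \<bullet> \<xi>) * gauss 1 \<xi>)"
  by (rule BI_I[where C=1]) (auto simp: integral_cis_gauss norm_mult norm_gauss_le)

lemma BI_gauss: "BI (gauss 1)"
  using BI_cis_gauss[of 0] by simp

section \<open>Plancherel, Parseval and inversion for bounded integrable functions\<close>

lemma fourier_integral_diff:
  assumes "integrable lborel f" "integrable lborel g"
  shows "fourier_integral (\<lambda>x. f x - g x) \<xi> = fourier_integral f \<xi> - fourier_integral g \<xi>"
  unfolding fourier_integral_def
  using Bochner_Integration.integral_diff[OF integrable_cis_mult[OF assms(1)] integrable_cis_mult[OF assms(2)], of "\<lambda>x. - (x \<bullet> \<xi>)" "\<lambda>x. - (x \<bullet> \<xi>)"]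
  by (simp add: right_diff_distrib)

lemma fourier_multiplication_formula:
  assumes "integrable lborel f" "integrable lborel g"
  shows "(LBINT \<xi>. fourier_integral f \<xi> * g \<xi>) = (LBINT x. f x * fourier_integral g x)"
proof -
  have "fourier_integral g x = (LBINT \<xi>. cis (- (x \<bullet> \<xi>)) * g \<xi>)" for x
    unfolding fourier_integral_def inner_commute[of _ x] ..
  moreover have "(LBINT x. f x * (LBINT \<xi>. cis (- (x \<bullet> \<xi>)) * g \<xi>))
      = (LBINT \<xi>. (LBINT x. cis (- (x \<bullet> \<xi>)) * f x) * g \<xi>)"
    by (rule Fubini_kernel[where C=1 and k="\<lambda>x \<xi>. cis (- (x \<bullet> \<xi>))", OF assms]) simp_all
  ultimately show ?thesis by (simp only: fourier_integral_def[of f])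
qed

text \<open>The multiplication formula moves the transform from f to the conjugated, Gaussian-damped
  transform of g, and that transform is by inversion the conjugate of a Gaussian mean of g. The
  error \<open>D n\<close> of the mean is small only in L^1, which suffices because f is
  bounded.\<close>

lemma Parseval_gauss:
  assumes f: "BI f" and g: "BI g"
  shows "(\<lambda>n. (LBINT \<xi>. fourier_integral f \<xi> * cnj (fourier_integral g \<xi>) * gauss ((1 / Suc n)\<^sup>2) \<xi>))
    \<longlonglongrightarrow> of_real ((2 * pi)\<^sup>2) * (LBINT x. f x * cnj (g x))"
proof -
  have [measurable]: "f \<in> borel_measurable borel" "g \<in> borel_measurable borel"
    using assms by (auto intro: BI_measurable)
  obtain C where C: "\<And>x. cmod (f x) \<le> C" "C > 0" using BI_bound[OF f] by blast
  define r :: "nat \<Rightarrow> real" where "r n = 1 / Suc n" for n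
  have r: "r n > 0" "r \<longlonglongrightarrow> 0" for n
    using LIMSEQ_Suc[OF lim_1_over_n[where 'a=real]] by (auto simp: r_def[abs_def])
  define D where "D n y = gmean (r n) g y - complex_of_real (2 * pi) * g y" for n y
  have Di: "integrable lborel (D n)" for n
    using gmean_L1(2)[OF BI_integrable[OF g] r(2)] by (simp add: D_def[abs_def])
  have [measurable]: "D n \<in> borel_measurable borel" for n using Di by auto
  have fD: "integrable lborel (\<lambda>x. f x * cnj (D n x))" for n
    by (rule Bochner_Integration.integrable_bound[where f="\<lambda>x. C * cmod (D n x)"])
      (use Di C in \<open>auto simp: norm_mult abs_mult intro!: mult_right_mono measurable_compose[OF _ borel_measurable_cnj]\<close>)
  have fg: "integrable lborel (\<lambda>x. f x * cnj (g x))"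
    by (intro sq_integrable_mult sq_integrable_cnj BI_sq_integrable assms)
  have eq: "(LBINT \<xi>. fourier_integral f \<xi> * cnj (fourier_integral g \<xi>) * gauss ((r n)\<^sup>2) \<xi>)
     = of_real (2 * pi) * (LBINT x. f x * cnj (D n x))
        + of_real ((2 * pi)\<^sup>2) * (LBINT x. f x * cnj (g x))" for n
  proof -
    have gi: "integrable lborel (\<lambda>\<xi>. cnj (fourier_integral g \<xi>) * gauss ((r n)\<^sup>2) \<xi>)"
    proof (rule Bochner_Integration.integrable_bound)
      show "integrable lborel (\<lambda>\<xi>. (LBINT x. cmod (g x)) * cmod (gauss ((r n)\<^sup>2) \<xi>))"
        using integrable_gauss[of "(r n)\<^sup>2"] r(1)[of n] by simp
      show "AE \<xi> in lborel. norm (cnj (fourier_integral g \<xi>) * gauss ((r n)\<^sup>2) \<xi>) \<le> norm ((LBINT x. cmod (g x)) * cmod (gauss ((r n)\<^sup>2) \<xi>))"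
        by (auto simp: norm_mult abs_mult intro!: mult_right_mono norm_fourier_integral_le order_trans[OF _ abs_ge_self])
    qed (auto intro!: borel_measurable_times measurable_compose[OF _ borel_measurable_cnj])
    have A: "fourier_integral (\<lambda>\<xi>. cnj (fourier_integral g \<xi>) * gauss ((r n)\<^sup>2) \<xi>) x
      = of_real (2 * pi) * cnj (D n x) + of_real ((2 * pi)\<^sup>2) * cnj (g x)" for x
    proof -
      have "fourier_integral (\<lambda>\<xi>. cnj (fourier_integral g \<xi>) * gauss ((r n)\<^sup>2) \<xi>) x
        = (LBINT \<xi>. cnj (fourier_integral g \<xi> * (cis (x \<bullet> \<xi>) * gauss ((r n)\<^sup>2) \<xi>)))"
        unfolding fourier_integral_def[of "\<lambda>\<xi>. cnj (fourier_integral g \<xi>) * gauss ((r n)\<^sup>2) \<xi>"] inner_commute[of _ x]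
        by (intro Bochner_Integration.integral_cong refl) (simp add: cis_cnj)
      also have "\<dots> = cnj (LBINT \<xi>. fourier_integral g \<xi> * (cis (x \<bullet> \<xi>) * gauss ((r n)\<^sup>2) \<xi>))"
        by (rule Bochner_Integration.integral_cnj)
      also have "\<dots> = cnj (of_real (2 * pi) * gmean (r n) g x)"
        by (simp only: fourier_inversion_gauss[OF BI_integrable[OF g] r(1)])
      also have "\<dots> = of_real (2 * pi) * cnj (D n x) + of_real ((2 * pi)\<^sup>2) * cnj (g x)"
        by (simp add: D_def algebra_simps power2_eq_square)
      finally show ?thesis .
    qed
    have "(LBINT \<xi>. fourier_integral f \<xi> * cnj (fourier_integral g \<xi>) * gauss ((r n)\<^sup>2) \<xi>)
      = (LBINT x. f x * (of_real (2 * pi) * cnj (D n x) + of_real ((2 * pi)\<^sup>2) * cnj (g x)))"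
      using fourier_multiplication_formula[OF BI_integrable[OF f] gi] by (simp only: A mult.assoc)
    also have "(LBINT x. f x * (of_real (2 * pi) * cnj (D n x) + of_real ((2 * pi)\<^sup>2) * cnj (g x)))
       = (LBINT x. of_real (2 * pi) * (f x * cnj (D n x)) + of_real ((2 * pi)\<^sup>2) * (f x * cnj (g x)))"
      by (simp add: algebra_simps)
    also have "\<dots> = of_real (2 * pi) * (LBINT x. f x * cnj (D n x))
        + of_real ((2 * pi)\<^sup>2) * (LBINT x. f x * cnj (g x))"
      using fD[of n] fg by simp
    finally show ?thesis .
  qed
  have "(\<lambda>n. (LBINT x. f x * cnj (D n x))) \<longlonglongrightarrow> 0"
  proof (rule Lim_null_comparison[OF always_eventually], rule allI)
    show "cmod (LBINT x. f x * cnj (D n x)) \<le> C * (LBINT x. cmod (D n x))" for n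
    proof -
      have "cmod (LBINT x. f x * cnj (D n x)) \<le> (LBINT x. cmod (f x * cnj (D n x)))"
        by (rule integral_norm_bound)
      also have "\<dots> \<le> (LBINT x. C * cmod (D n x))"
        using C by (intro integral_mono integrable_norm integrable_mult_right fD Di)
          (simp add: norm_mult mult_right_mono)
      finally show ?thesis by simp
    qed
    show "(\<lambda>n. C * (LBINT x. cmod (D n x))) \<longlonglongrightarrow> 0"
      using gmean_L1(1)[OF BI_integrable[OF g] r(2)] by (intro tendsto_mult_right_zero) (simp add: D_def)
  qed
  then have "(\<lambda>n. of_real (2 * pi) * (LBINT x. f x * cnj (D n x))
        + of_real ((2 * pi)\<^sup>2) * (LBINT x. f x * cnj (g x)))
     \<longlonglongrightarrow> of_real (2 * pi) * 0 + of_real ((2 * pi)\<^sup>2) * (LBINT x. f x * cnj (g x))"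
    by (intro tendsto_intros)
  then show ?thesis by (simp only: eq[unfolded r_def] mult_zero_right add_0_left)
qed

lemma gauss_tendsto: "(\<lambda>n. gauss ((1 / Suc n)\<^sup>2) \<xi>) \<longlonglongrightarrow> 1"
proof -
  have "(\<lambda>n. complex_of_real (exp (- ((1 / Suc n)\<^sup>2 * (norm \<xi>)\<^sup>2 / 2)))) \<longlonglongrightarrow> complex_of_real (exp (- (0\<^sup>2 * (norm \<xi>)\<^sup>2 / 2)))"
    by (intro tendsto_intros LIMSEQ_Suc[OF lim_1_over_n]) simp
  then show ?thesis by (simp add: gauss_def)
qed

text \<open>For g = f the damped integrands are nonnegative and increase as the Gaussians tend to 1.
  Monotone convergence thus yields square integrability of the transform together with its
  norm.\<close>

lemma Plancherel_BI:
  assumes f: "BI f"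
  shows "sq_integrable (fourier_integral f)" and "l2n (fourier_integral f) = 2 * pi * l2n f"
proof -
  have [measurable]: "f \<in> borel_measurable borel" using f by (rule BI_measurable)
  let ?u = "\<lambda>n \<xi>. (cmod (fourier_integral f \<xi>))\<^sup>2 * exp (- ((1 / Suc n)\<^sup>2 * (norm \<xi>)\<^sup>2 / 2))"
  have int: "integrable lborel (?u n)" for n
  proof (rule Bochner_Integration.integrable_bound)
    show "integrable lborel (\<lambda>\<xi>. (LBINT x. cmod (f x))\<^sup>2 * cmod (gauss ((1 / Suc n)\<^sup>2) \<xi>))"
      using integrable_gauss[of "(1 / Suc n)\<^sup>2"] by simp
    show "AE \<xi> in lborel. norm (?u n \<xi>) \<le> norm ((LBINT x. cmod (f x))\<^sup>2 * cmod (gauss ((1 / Suc n)\<^sup>2) \<xi>))"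
      by (auto simp: norm_gauss abs_mult intro!: mult_right_mono power_mono norm_fourier_integral_le)
  qed measurable
  have "(\<lambda>n. complex_of_real (LBINT \<xi>. ?u n \<xi>)) \<longlonglongrightarrow> complex_of_real ((2 * pi)\<^sup>2) * complex_of_real (LBINT x. (cmod (f x))\<^sup>2)"
  proof -
    have "fourier_integral f \<xi> * cnj (fourier_integral f \<xi>) * gauss s \<xi>
        = complex_of_real ((cmod (fourier_integral f \<xi>))\<^sup>2 * exp (- (s * (norm \<xi>)\<^sup>2 / 2)))" for s \<xi>
      by (simp only: gauss_def of_real_mult complex_norm_square)
    moreover have "f x * cnj (f x) = complex_of_real ((cmod (f x))\<^sup>2)" for x
      by (simp only: complex_norm_square)
    ultimately show ?thesis
      using Parseval_gauss[OF f f] by (simp only: integral_complex_of_real)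
  qed
  then have "(\<lambda>n. complex_of_real (LBINT \<xi>. ?u n \<xi>)) \<longlonglongrightarrow> complex_of_real ((2 * pi)\<^sup>2 * (LBINT x. (cmod (f x))\<^sup>2))"
    by simp
  then have lim: "(\<lambda>n. (LBINT \<xi>. ?u n \<xi>)) \<longlonglongrightarrow> (2 * pi)\<^sup>2 * (LBINT x. (cmod (f x))\<^sup>2)"
    by (subst (asm) tendsto_of_real_iff)
  have mono: "mono (\<lambda>n. ?u n \<xi>)" for \<xi>
  proof (rule monoI)
    fix m n :: nat assume "m \<le> n"
    then have "(1 / Suc n)\<^sup>2 \<le> (1 / Suc m)\<^sup>2" by (intro power_mono divide_left_mono) auto
    then show "?u m \<xi> \<le> ?u n \<xi>" by (intro mult_left_mono) (auto intro: mult_right_mono)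
  qed
  have conv: "(\<lambda>n. ?u n \<xi>) \<longlonglongrightarrow> (cmod (fourier_integral f \<xi>))\<^sup>2" for \<xi>
  proof -
    have "(\<lambda>n. ?u n \<xi>) \<longlonglongrightarrow> (cmod (fourier_integral f \<xi>))\<^sup>2 * exp (- (0\<^sup>2 * (norm \<xi>)\<^sup>2 / 2))"
      by (intro tendsto_intros LIMSEQ_Suc[OF lim_1_over_n]) simp
    then show ?thesis by simp
  qed
  have I: "integrable lborel (\<lambda>\<xi>. (cmod (fourier_integral f \<xi>))\<^sup>2)"
    by (rule integrable_monotone_convergence[OF int _ _ lim]) (use mono conv in auto)
  have E: "(LBINT \<xi>. (cmod (fourier_integral f \<xi>))\<^sup>2) = (2 * pi)\<^sup>2 * (LBINT x. (cmod (f x))\<^sup>2)"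
    by (rule integral_monotone_convergence[OF int _ _ lim]) (use mono conv in auto)
  show "sq_integrable (fourier_integral f)" using I by (simp add: sq_integrable_def)
  show "l2n (fourier_integral f) = 2 * pi * l2n f"
    unfolding l2n_def E by (simp add: real_sqrt_mult)
qed

lemma Parseval_BI:
  assumes f: "BI f" and g: "BI g"
  shows "(LBINT \<xi>. fourier_integral f \<xi> * cnj (fourier_integral g \<xi>))
    = of_real ((2 * pi)\<^sup>2) * (LBINT x. f x * cnj (g x))"
proof -
  have i: "integrable lborel (\<lambda>\<xi>. fourier_integral f \<xi> * cnj (fourier_integral g \<xi>))"
    by (intro sq_integrable_mult sq_integrable_cnj Plancherel_BI assms)
  have [measurable]: "(\<lambda>\<xi>. fourier_integral f \<xi> * cnj (fourier_integral g \<xi>)) \<in> borel_measurable borel"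
    using i by auto
  have "(\<lambda>n. (LBINT \<xi>. fourier_integral f \<xi> * cnj (fourier_integral g \<xi>) * gauss ((1 / Suc n)\<^sup>2) \<xi>))
    \<longlonglongrightarrow> (LBINT \<xi>. fourier_integral f \<xi> * cnj (fourier_integral g \<xi>))"
  proof (rule integral_dominated_convergence)
    show "integrable lborel (\<lambda>\<xi>. norm (fourier_integral f \<xi> * cnj (fourier_integral g \<xi>)))"
      using i by (rule integrable_norm)
    show "AE \<xi> in lborel. (\<lambda>n. fourier_integral f \<xi> * cnj (fourier_integral g \<xi>) * gauss ((1 / Suc n)\<^sup>2) \<xi>) \<longlonglongrightarrow> fourier_integral f \<xi> * cnj (fourier_integral g \<xi>)"
    proof (rule AE_I2)
      fix \<xi> show "(\<lambda>n. fourier_integral f \<xi> * cnj (fourier_integral g \<xi>) * gauss ((1 / Suc n)\<^sup>2) \<xi>) \<longlonglongrightarrow> fourier_integral f \<xi> * cnj (fourier_integral g \<xi>)"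
        using tendsto_mult[OF tendsto_const gauss_tendsto, of "fourier_integral f \<xi> * cnj (fourier_integral g \<xi>)" \<xi>] by simp
    qed
    show "AE \<xi> in lborel. norm (fourier_integral f \<xi> * cnj (fourier_integral g \<xi>) * gauss ((1 / Suc n)\<^sup>2) \<xi>)
        \<le> norm (fourier_integral f \<xi> * cnj (fourier_integral g \<xi>))" for n
      using norm_gauss_le[of "(1 / Suc n)\<^sup>2"] by (intro AE_I2) (simp add: norm_mult mult_left_le)
  qed (use i in auto)
  from LIMSEQ_unique[OF this Parseval_gauss[OF assms]] show ?thesis .
qed

text \<open>Continuity identifies the limit of the Gaussian means at every point, not just almost
  everywhere; integrability of the transform removes the damping by dominated convergence.\<close>

lemma fourier_inversion:
  assumes f: "BI f" and c: "continuous_on UNIV f" and F: "integrable lborel (fourier_integral f)"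
  shows "(LBINT \<xi>. fourier_integral f \<xi> * cis (y \<bullet> \<xi>)) = of_real ((2 * pi)\<^sup>2) * f y"
proof -
  obtain C where C: "\<And>x. cmod (f x) \<le> C" "C > 0" using BI_bound[OF f] by blast
  have [measurable]: "f \<in> borel_measurable borel" using f by (rule BI_measurable)
  have Fc: "integrable lborel (\<lambda>\<xi>. fourier_integral f \<xi> * cis (y \<bullet> \<xi>))"
    using integrable_cis_mult[OF F, of "\<lambda>\<xi>. y \<bullet> \<xi>"] by (simp add: mult.commute)
  have "(\<lambda>n. (LBINT \<xi>. fourier_integral f \<xi> * (cis (y \<bullet> \<xi>) * gauss ((1 / Suc n)\<^sup>2) \<xi>)))
      \<longlonglongrightarrow> (LBINT \<xi>. fourier_integral f \<xi> * cis (y \<bullet> \<xi>))"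
  proof (rule integral_dominated_convergence[where w="\<lambda>\<xi>. cmod (fourier_integral f \<xi>)"])
    show "AE \<xi> in lborel. (\<lambda>n. fourier_integral f \<xi> * (cis (y \<bullet> \<xi>) * gauss ((1 / Suc n)\<^sup>2) \<xi>)) \<longlonglongrightarrow> fourier_integral f \<xi> * cis (y \<bullet> \<xi>)"
    proof (rule AE_I2)
      fix \<xi> show "(\<lambda>n. fourier_integral f \<xi> * (cis (y \<bullet> \<xi>) * gauss ((1 / Suc n)\<^sup>2) \<xi>)) \<longlonglongrightarrow> fourier_integral f \<xi> * cis (y \<bullet> \<xi>)"
        using tendsto_mult[OF tendsto_const gauss_tendsto, of "fourier_integral f \<xi> * cis (y \<bullet> \<xi>)" \<xi>] by (simp add: mult.assoc)
    qed
    show "AE \<xi> in lborel. norm (fourier_integral f \<xi> * (cis (y \<bullet> \<xi>) * gauss ((1 / Suc n)\<^sup>2) \<xi>)) \<le> cmod (fourier_integral f \<xi>)" for n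
      using norm_gauss_le[of "(1 / Suc n)\<^sup>2"] by (intro AE_I2) (simp add: norm_mult mult_left_le)
  qed (use F in auto)
  moreover have "(\<lambda>n. (LBINT \<xi>. fourier_integral f \<xi> * (cis (y \<bullet> \<xi>) * gauss ((1 / Suc n)\<^sup>2) \<xi>)))
      \<longlonglongrightarrow> complex_of_real ((2 * pi)\<^sup>2) * f y"
  proof -
    have "(\<lambda>n. gmean (1 / Suc n) f y) \<longlonglongrightarrow> (LBINT v. f y * gauss 1 v)"
      unfolding gmean_def
    proof (rule integral_dominated_convergence[where w="\<lambda>v. C * cmod (gauss 1 v)"])
      show "AE v in lborel. (\<lambda>n. f (y + (1 / Suc n) *\<^sub>R v) * gauss 1 v) \<longlonglongrightarrow> f y * gauss 1 v"
      proof (intro AE_I2 tendsto_mult tendsto_const)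
        fix v
        have "(\<lambda>n. y + (1 / Suc n) *\<^sub>R v) \<longlonglongrightarrow> y + 0 *\<^sub>R v"
          by (intro tendsto_intros LIMSEQ_Suc[OF lim_1_over_n])
        then have "(\<lambda>n. y + (1 / Suc n) *\<^sub>R v) \<longlonglongrightarrow> y" by simp
        moreover have "isCont f y" using c by (simp add: continuous_on_eq_continuous_at)
        ultimately show "(\<lambda>n. f (y + (1 / Suc n) *\<^sub>R v)) \<longlonglongrightarrow> f y" by (rule isCont_tendsto_compose[rotated])
      qed
      show "AE v in lborel. norm (f (y + (1 / Suc n) *\<^sub>R v) * gauss 1 v) \<le> C * cmod (gauss 1 v)" for n
        using C by (auto simp: norm_mult intro: mult_right_mono)
    qed (use integrable_gauss[of 1] in auto)
    then have "(\<lambda>n. complex_of_real (2 * pi) * gmean (1 / Suc n) f y) \<longlonglongrightarrow> complex_of_real (2 * pi) * (f y * complex_of_real (2 * pi))"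
      by (intro tendsto_intros) (simp add: integral_gauss)
    then show ?thesis
      by (subst fourier_inversion_gauss[OF BI_integrable[OF f]]) (auto simp: power2_eq_square mult_ac)
  qed
  ultimately show ?thesis by (rule LIMSEQ_unique)
qed

section \<open>The Fourier-Plancherel transform on L^2\<close>

text \<open>\<open>L2FT f F\<close>: \<open>F\<close> is the Fourier-Plancherel transform of \<open>f\<close>.\<close>

definition L2FT :: "(real^2 \<Rightarrow> complex) \<Rightarrow> (real^2 \<Rightarrow> complex) \<Rightarrow> bool" where
  "L2FT f F \<longleftrightarrow> sq_integrable f \<and> sq_integrable F \<and>
     (\<forall>\<psi>. BI \<psi> \<longrightarrow> (LBINT \<xi>. F \<xi> * \<psi> \<xi>) = (LBINT x. f x * fourier_integral \<psi> x))"

lemma L2FT_sq: "L2FT f F \<Longrightarrow> sq_integrable f" "L2FT f F \<Longrightarrow> sq_integrable F"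
  by (auto simp: L2FT_def)

lemma L2FT_measurable: "L2FT f F \<Longrightarrow> f \<in> borel_measurable borel" "L2FT f F \<Longrightarrow> F \<in> borel_measurable borel"
  by (auto dest: L2FT_sq sq_integrable_measurable)

lemma L2FT_D:
  "L2FT f F \<Longrightarrow> BI \<psi> \<Longrightarrow> (LBINT \<xi>. F \<xi> * \<psi> \<xi>) = (LBINT x. f x * fourier_integral \<psi> x)"
  by (auto simp: L2FT_def)

lemma L2FT_BI:
  assumes "BI f" shows "L2FT f (fourier_integral f)"
  unfolding L2FT_def using assms
  by (auto intro: BI_sq_integrable Plancherel_BI fourier_multiplication_formula BI_integrable)

lemma L2FT_add:
  assumes "L2FT f F" "L2FT g G"
  shows "L2FT (\<lambda>x. f x + c * g x) (\<lambda>\<xi>. F \<xi> + c * G \<xi>)"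
  unfolding L2FT_def
proof (intro conjI allI impI)
  show "sq_integrable (\<lambda>x. f x + c * g x)" "sq_integrable (\<lambda>x. F x + c * G x)"
    using assms by (auto intro!: sq_integrable_add sq_integrable_cmult dest: L2FT_sq)
  fix \<psi> assume \<psi>: "BI \<psi>"
  have "(LBINT \<xi>. (F \<xi> + c * G \<xi>) * \<psi> \<xi>) = (LBINT \<xi>. F \<xi> * \<psi> \<xi> + c * (G \<xi> * \<psi> \<xi>))"
    by (simp add: algebra_simps)
  also have "\<dots> = (LBINT \<xi>. F \<xi> * \<psi> \<xi>) + c * (LBINT \<xi>. G \<xi> * \<psi> \<xi>)"
    using assms \<psi> by (simp add: sq_integrable_mult L2FT_sq BI_sq_integrable)
  also have "\<dots> = (LBINT x. f x * fourier_integral \<psi> x) + c * (LBINT x. g x * fourier_integral \<psi> x)"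
    using assms \<psi> by (simp add: L2FT_D)
  also have "\<dots> = (LBINT x. f x * fourier_integral \<psi> x + c * (g x * fourier_integral \<psi> x))"
    using assms \<psi> by (simp add: sq_integrable_mult L2FT_sq Plancherel_BI)
  finally show "(LBINT \<xi>. (F \<xi> + c * G \<xi>) * \<psi> \<xi>) = (LBINT x. (f x + c * g x) * fourier_integral \<psi> x)"
    by (simp add: algebra_simps)
qed

lemma L2FT_diff: "L2FT f F \<Longrightarrow> L2FT g G \<Longrightarrow> L2FT (\<lambda>x. f x - g x) (\<lambda>\<xi>. F \<xi> - G \<xi>)"
  using L2FT_add[of f F g G "-1"] by simp

lemma L2FT_zero: "L2FT (\<lambda>x. 0) (\<lambda>x. 0)"
  by (auto simp: L2FT_def sq_integrable_def)

lemma L2FT_cmult: "L2FT g G \<Longrightarrow> L2FT (\<lambda>x. c * g x) (\<lambda>\<xi>. c * G \<xi>)"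
  using L2FT_add[OF L2FT_zero, of g G c] by simp

lemma L2FT_AE_cong:
  assumes "L2FT f F" "AE x in lborel. f x = f' x" "AE x in lborel. F x = F' x"
    "f' \<in> borel_measurable borel" "F' \<in> borel_measurable borel"
  shows "L2FT f' F'"
  unfolding L2FT_def
proof (intro conjI allI impI)
  note [measurable] = assms(4,5) L2FT_measurable[OF assms(1)]
  show "sq_integrable f'" "sq_integrable F'"
    using assms by (auto intro: sq_integrable_AE_cong dest: L2FT_sq)
  fix \<psi> assume \<psi>: "BI \<psi>"
  note [measurable] = BI_measurable[OF \<psi>]
  have "(LBINT \<xi>. F' \<xi> * \<psi> \<xi>) = (LBINT \<xi>. F \<xi> * \<psi> \<xi>)"
  proof (rule integral_cong_AE)
    show "AE x in lborel. F' x * \<psi> x = F x * \<psi> x" using assms(3) by eventually_elim simp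
  qed measurable
  also have "\<dots> = (LBINT x. f x * fourier_integral \<psi> x)" by (rule L2FT_D[OF assms(1) \<psi>])
  also have "\<dots> = (LBINT x. f' x * fourier_integral \<psi> x)"
  proof (rule integral_cong_AE)
    show "AE x in lborel. f x * fourier_integral \<psi> x = f' x * fourier_integral \<psi> x" using assms(2) by eventually_elim simp
  qed measurable
  finally show "(LBINT \<xi>. F' \<xi> * \<psi> \<xi>) = (LBINT x. f' x * fourier_integral \<psi> x)" .
qed

lemma inner_tendsto:
  assumes "\<And>n. sq_integrable (a n)" "\<And>n. sq_integrable (b n)" "sq_integrable A" "sq_integrable B"
    and "((\<lambda>n. l2n (\<lambda>x. a n x - A x)) \<longlongrightarrow> 0) S" "((\<lambda>n. l2n (\<lambda>x. b n x - B x)) \<longlongrightarrow> 0) S"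
  shows "((\<lambda>n. (LBINT x. a n x * b n x)) \<longlongrightarrow> (LBINT x. A x * B x)) S"
proof -
  note sq = assms(1-4) sq_integrable_diff
  have le: "cmod ((LBINT x. a n x * b n x) - (LBINT x. A x * B x))
     \<le> l2n (\<lambda>x. a n x - A x) * (l2n (\<lambda>x. b n x - B x) + l2n B) + l2n A * l2n (\<lambda>x. b n x - B x)" for n
  proof -
    have "(LBINT x. a n x * b n x) - (LBINT x. A x * B x) = (LBINT x. a n x * b n x - A x * B x)"
      by (intro Bochner_Integration.integral_diff[symmetric] sq_integrable_mult sq)
    also have "\<dots> = (LBINT x. (a n x - A x) * b n x + A x * (b n x - B x))"
      by (simp add: algebra_simps)
    also have "\<dots> = (LBINT x. (a n x - A x) * b n x) + (LBINT x. A x * (b n x - B x))"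
      by (intro Bochner_Integration.integral_add sq_integrable_mult sq)
    also have "cmod \<dots> \<le> l2n (\<lambda>x. a n x - A x) * l2n (b n) + l2n A * l2n (\<lambda>x. b n x - B x)"
      by (intro norm_triangle_mono l2n_Cauchy_Schwarz sq)
    also have "\<dots> \<le> l2n (\<lambda>x. a n x - A x) * (l2n (\<lambda>x. b n x - B x) + l2n B) + l2n A * l2n (\<lambda>x. b n x - B x)"
      by (intro add_right_mono mult_left_mono l2n_le_diff sq) simp
    finally show ?thesis .
  qed
  have "((\<lambda>n. l2n (\<lambda>x. a n x - A x) * (l2n (\<lambda>x. b n x - B x) + l2n B) + l2n A * l2n (\<lambda>x. b n x - B x))
      \<longlongrightarrow> 0 * (0 + l2n B) + l2n A * 0) S"
    by (intro tendsto_intros assms)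
  then have lim: "((\<lambda>n. l2n (\<lambda>x. a n x - A x) * (l2n (\<lambda>x. b n x - B x) + l2n B) + l2n A * l2n (\<lambda>x. b n x - B x)) \<longlongrightarrow> 0) S"
    by simp
  have "((\<lambda>n. (LBINT x. a n x * b n x) - (LBINT x. A x * B x)) \<longlongrightarrow> 0) S"
    by (rule Lim_null_comparison[OF always_eventually[OF allI[OF le]] lim])
  then show ?thesis by (simp add: LIM_zero_iff)
qed

lemma l2n_tendsto:
  assumes "\<And>n. sq_integrable (a n)" "sq_integrable A" "((\<lambda>n. l2n (\<lambda>x. a n x - A x)) \<longlongrightarrow> 0) S"
  shows "((\<lambda>n. l2n (a n)) \<longlongrightarrow> l2n A) S"
proof -
  have "\<bar>l2n (a n) - l2n A\<bar> \<le> l2n (\<lambda>x. a n x - A x)" for n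
    using l2n_le_diff[OF assms(1) assms(2), of n] l2n_le_diff[OF assms(2) assms(1), of n]
      l2n_minus_commute[of "a n" A] by linarith
  then have "((\<lambda>n. l2n (a n) - l2n A) \<longlongrightarrow> 0) S"
    by (intro Lim_null_comparison[OF always_eventually[OF allI] assms(3)]) simp
  then show ?thesis by (simp add: LIM_zero_iff)
qed

lemma BI_approx:
  assumes f: "sq_integrable f"
  obtains a where "\<And>n::nat. BI (a n)" "(\<lambda>n. l2n (\<lambda>x. a n x - f x)) \<longlonglongrightarrow> 0"
proof
  note [measurable] = sq_integrable_measurable[OF f]
  define a where "a n x = (if norm x \<le> real n \<and> cmod (f x) \<le> real n then f x else 0)" for n x
  have [measurable]: "a n \<in> borel_measurable borel" for n unfolding a_def by measurable
  show "BI (a n)" for n :: nat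
  proof (rule BI_I[where C="real n"])
    show "cmod (a n x) \<le> real n" for x by (simp add: a_def)
    show "integrable lborel (a n)"
    proof (rule Bochner_Integration.integrable_bound)
      show "integrable lborel (\<lambda>x::real^2. real n * indicat_real (cball 0 (real n)) x)"
        using emeasure_bounded_finite[of "cball (0::real^2) (real n)"]
        by (intro integrable_mult_right integrable_real_indicator) (auto simp: less_top)
      show "AE x in lborel. norm (a n x) \<le> norm (real n * indicat_real (cball 0 (real n)) x)"
        by (intro AE_I2) (auto simp: a_def indicator_def)
    qed measurable
  qed
  have "(\<lambda>n. (LBINT x. (cmod (a n x - f x))\<^sup>2)) \<longlonglongrightarrow> (\<integral>x. 0 \<partial>(lborel :: (real^2) measure))"
  proof (rule integral_dominated_convergence[where w="\<lambda>x. (cmod (f x))\<^sup>2"])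
    show "integrable lborel (\<lambda>x. (cmod (f x))\<^sup>2)" using f by (simp add: sq_integrable_def)
    show "AE x in lborel. (\<lambda>n. (cmod (a n x - f x))\<^sup>2) \<longlonglongrightarrow> 0"
    proof (intro AE_I2 tendsto_eventually)
      fix x
      obtain N :: nat where "max (norm x) (cmod (f x)) \<le> N" using real_arch_simple by blast
      then have "\<forall>n\<ge>N. (cmod (a n x - f x))\<^sup>2 = 0" by (auto simp: a_def)
      then show "\<forall>\<^sub>F n in sequentially. (cmod (a n x - f x))\<^sup>2 = 0"
        by (auto simp: eventually_sequentially)
    qed
  qed (auto simp: a_def)
  then show "(\<lambda>n. l2n (\<lambda>x. a n x - f x)) \<longlonglongrightarrow> 0"
    unfolding l2n_def using tendsto_real_sqrt by fastforce
qed

text \<open>Truncations of f converge in L^2, their transforms form a Cauchy sequence by Plancherel,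
  and duality passes to the limit. The approximants are returned with F because Plancherel and
  Parseval are transferred along them.\<close>

lemma L2FT_exists_seq:
  assumes f: "sq_integrable f"
  obtains F a where "L2FT f F" "\<And>n::nat. BI (a n)" "(\<lambda>n. l2n (\<lambda>x. a n x - f x)) \<longlonglongrightarrow> 0"
    "(\<lambda>n. l2n (\<lambda>x. fourier_integral (a n) x - F x)) \<longlonglongrightarrow> 0"
proof -
  obtain a where a: "\<And>n::nat. BI (a n)" "(\<lambda>n. l2n (\<lambda>x. a n x - f x)) \<longlonglongrightarrow> 0"
    using BI_approx[OF f] by blast
  have eq: "l2n (\<lambda>x. fourier_integral (a m) x - fourier_integral (a n) x) = 2 * pi * l2n (\<lambda>x. a m x - a n x)" for m n
  proof -
    have "fourier_integral (\<lambda>x. a m x - a n x) = (\<lambda>x. fourier_integral (a m) x - fourier_integral (a n) x)"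
      by (rule ext) (intro fourier_integral_diff BI_integrable a)
    with Plancherel_BI(2)[OF BI_diff[OF a(1)[of m] a(1)[of n]]] show ?thesis by simp
  qed
  have "\<exists>F. sq_integrable F \<and> (\<lambda>n. l2n (\<lambda>x. fourier_integral (a n) x - F x)) \<longlonglongrightarrow> 0"
  proof (rule sq_integrable_complete)
    fix e :: real assume "e > 0"
    have "\<forall>\<^sub>F n in sequentially. l2n (\<lambda>x. a n x - f x) < e / (4 * pi)"
      using a(2) by (rule order_tendstoD) (use \<open>e > 0\<close> in simp)
    then obtain N where N: "\<And>n. n \<ge> N \<Longrightarrow> l2n (\<lambda>x. a n x - f x) < e / (4 * pi)"
      by (auto simp: eventually_sequentially)
    have "l2n (\<lambda>x. fourier_integral (a m) x - fourier_integral (a n) x) < e" if "m \<ge> N" "n \<ge> N" for m n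
    proof -
      have "l2n (\<lambda>x. a m x - a n x) \<le> l2n (\<lambda>x. a m x - f x) + l2n (\<lambda>x. f x - a n x)"
        by (intro l2n_triangle_diff BI_sq_integrable a f)
      also have "\<dots> < e / (2 * pi)"
        using N[OF that(1)] N[OF that(2)] l2n_minus_commute[of f "a n"] by (simp add: field_simps)
      finally show ?thesis unfolding eq by (simp add: field_simps)
    qed
    then show "\<exists>N. \<forall>m\<ge>N. \<forall>n\<ge>N. l2n (\<lambda>x. fourier_integral (a m) x - fourier_integral (a n) x) < e" by blast
  qed (intro Plancherel_BI a)
  then obtain F where F: "sq_integrable F" "(\<lambda>n. l2n (\<lambda>x. fourier_integral (a n) x - F x)) \<longlonglongrightarrow> 0" by blast
  have "L2FT f F" unfolding L2FT_def
  proof (intro conjI allI impI f F(1))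
    fix \<psi> assume \<psi>: "BI \<psi>"
    have "(\<lambda>n. (LBINT x. fourier_integral (a n) x * \<psi> x)) \<longlonglongrightarrow> (LBINT x. F x * \<psi> x)"
      by (rule inner_tendsto[OF Plancherel_BI(1)[OF a(1)] BI_sq_integrable[OF \<psi>] F(1) BI_sq_integrable[OF \<psi>] F(2)])
        (simp add: l2n_def)
    moreover have "(\<lambda>n. (LBINT x. a n x * fourier_integral \<psi> x)) \<longlonglongrightarrow> (LBINT x. f x * fourier_integral \<psi> x)"
      by (rule inner_tendsto[OF BI_sq_integrable[OF a(1)] Plancherel_BI(1)[OF \<psi>] f Plancherel_BI(1)[OF \<psi>] a(2)])
        (simp add: l2n_def)
    moreover have "(LBINT x. fourier_integral (a n) x * \<psi> x) = (LBINT x. a n x * fourier_integral \<psi> x)" for n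
      by (intro fourier_multiplication_formula BI_integrable a \<psi>)
    ultimately show "(LBINT x. F x * \<psi> x) = (LBINT x. f x * fourier_integral \<psi> x)"
      using LIMSEQ_unique by auto
  qed
  then show ?thesis using that a F(2) by blast
qed

text \<open>The integrals are the values of the Fourier transform of D times a Gaussian, and that
  product is integrable even when D is not. Modulated Gaussians therefore separate all functions
  that may be paired with them, in L^2 as well as among tempered functions.\<close>

lemma gauss_test_eq_0:
  assumes "D \<in> borel_measurable borel" "\<And>x. integrable lborel (\<lambda>\<xi>. D \<xi> * (cis (x \<bullet> \<xi>) * gauss 1 \<xi>))"
    and "\<And>x. (LBINT \<xi>. D \<xi> * (cis (x \<bullet> \<xi>) * gauss 1 \<xi>)) = 0"
  shows "AE \<xi> in lborel. D \<xi> = 0"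
proof -
  have "AE \<xi> in lborel. D \<xi> * gauss 1 \<xi> = 0"
  proof (rule fourier_integral_eq_0)
    show "integrable lborel (\<lambda>\<xi>. D \<xi> * gauss 1 \<xi>)" using assms(2)[of 0] by simp
    fix x
    have "fourier_integral (\<lambda>\<xi>. D \<xi> * gauss 1 \<xi>) x = (LBINT \<xi>. D \<xi> * (cis ((- x) \<bullet> \<xi>) * gauss 1 \<xi>))"
      unfolding fourier_integral_def inner_commute[of _ x]
      by (intro Bochner_Integration.integral_cong) auto
    then show "fourier_integral (\<lambda>\<xi>. D \<xi> * gauss 1 \<xi>) x = 0" by (simp only: assms(3))
  qed
  then show ?thesis by simp
qed

text \<open>Translated Gaussians are test functions whose transforms are modulated Gaussians. This
  makes \<open>gauss_test_eq_0\<close> available on the f side of the duality as well, so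
  injectivity of the transform follows without an inversion formula.\<close>

lemma fourier_integral_shifted_gauss:
  "fourier_integral (\<lambda>\<xi>. gauss 1 (b + \<xi>)) x = of_real (2 * pi) * (cis (b \<bullet> x) * gauss 1 x)"
proof -
  have "fourier_integral (\<lambda>\<xi>. gauss 1 (b + \<xi>)) x = (LBINT \<xi>. cis (- (x \<bullet> \<xi>)) * gauss 1 (b + \<xi>))"
    unfolding fourier_integral_def inner_commute[of _ x] ..
  also have "\<dots> = (LBINT \<xi>. cis (b \<bullet> x) * (cis ((- x) \<bullet> (b + \<xi>)) * gauss 1 (b + \<xi>)))"
    by (intro Bochner_Integration.integral_cong) (auto simp: mult.assoc[symmetric] cis_mult inner_simps inner_commute)
  also have "\<dots> = cis (b \<bullet> x) * (LBINT \<xi>. cis ((- x) \<bullet> (b + \<xi>)) * gauss 1 (b + \<xi>))"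
    by (rule integral_mult_right_zero)
  also have "(LBINT \<xi>. cis ((- x) \<bullet> (b + \<xi>)) * gauss 1 (b + \<xi>)) = (LBINT \<xi>. cis ((- x) \<bullet> \<xi>) * gauss 1 \<xi>)"
    by (rule integral_shift[of "\<lambda>\<xi>. cis ((- x) \<bullet> \<xi>) * gauss 1 \<xi>"]) measurable
  also have "\<dots> = of_real (2 * pi) * gauss 1 x"
    using integral_cis_gauss(2)[of 1 "- x"] by simp
  finally show ?thesis by simp
qed

lemma L2FT_unique:
  assumes "L2FT f F" "L2FT f F'" shows "AE x in lborel. F x = F' x"
proof -
  have "AE x in lborel. F x - F' x = 0"
  proof (rule gauss_test_eq_0)
    note D = L2FT_diff[OF assms]
    show "(\<lambda>x. F x - F' x) \<in> borel_measurable borel" by (rule L2FT_measurable(2)[OF D])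
    fix x
    show "integrable lborel (\<lambda>\<xi>. (F \<xi> - F' \<xi>) * (cis (x \<bullet> \<xi>) * gauss 1 \<xi>))"
      by (intro sq_integrable_mult L2FT_sq(2)[OF D] BI_sq_integrable BI_cis_gauss)
    show "(LBINT \<xi>. (F \<xi> - F' \<xi>) * (cis (x \<bullet> \<xi>) * gauss 1 \<xi>)) = 0"
      using L2FT_D[OF D BI_cis_gauss[of x]] by simp
  qed
  then show ?thesis by simp
qed

lemma L2FT_inj:
  assumes "L2FT f F" "L2FT f' F" shows "AE x in lborel. f x = f' x"
proof -
  have "AE x in lborel. f x - f' x = 0"
  proof (rule gauss_test_eq_0)
    note D = L2FT_diff[OF assms]
    show "(\<lambda>x. f x - f' x) \<in> borel_measurable borel" by (rule L2FT_measurable(1)[OF D])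
    fix x
    show "integrable lborel (\<lambda>\<xi>. (f \<xi> - f' \<xi>) * (cis (x \<bullet> \<xi>) * gauss 1 \<xi>))"
      by (intro sq_integrable_mult L2FT_sq(1)[OF D] BI_sq_integrable BI_cis_gauss)
    have "of_real (2 * pi) * (LBINT \<xi>. (f \<xi> - f' \<xi>) * (cis (x \<bullet> \<xi>) * gauss 1 \<xi>))
        = (LBINT \<xi>. (f \<xi> - f' \<xi>) * fourier_integral (\<lambda>\<xi>. gauss 1 (x + \<xi>)) \<xi>)"
      unfolding integral_mult_right_zero[symmetric] fourier_integral_shifted_gauss
      by (intro Bochner_Integration.integral_cong refl mult.left_commute)
    also have "\<dots> = 0" using L2FT_D[OF D BI_shift[OF BI_gauss, of x]] by simp
    finally show "(LBINT \<xi>. (f \<xi> - f' \<xi>) * (cis (x \<bullet> \<xi>) * gauss 1 \<xi>)) = 0" by simp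
  qed
  then show ?thesis by simp
qed

lemma L2FT_seq:
  assumes "L2FT f F"
  obtains a where "\<And>n::nat. BI (a n)" "(\<lambda>n. l2n (\<lambda>x. a n x - f x)) \<longlonglongrightarrow> 0"
    "(\<lambda>n. l2n (\<lambda>x. fourier_integral (a n) x - F x)) \<longlonglongrightarrow> 0"
proof -
  obtain F' a where a: "L2FT f F'" "\<And>n::nat. BI (a n)" "(\<lambda>n. l2n (\<lambda>x. a n x - f x)) \<longlonglongrightarrow> 0"
    "(\<lambda>n. l2n (\<lambda>x. fourier_integral (a n) x - F' x)) \<longlonglongrightarrow> 0"
    using L2FT_exists_seq[OF L2FT_sq(1)[OF assms]] by blast
  note [measurable] = L2FT_measurable[OF a(1)] L2FT_measurable[OF assms] BI_measurable[OF a(2)]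
  have "l2n (\<lambda>x. fourier_integral (a n) x - F' x) = l2n (\<lambda>x. fourier_integral (a n) x - F x)" for n
  proof (rule l2n_AE_cong)
    show "AE x in lborel. fourier_integral (a n) x - F' x = fourier_integral (a n) x - F x"
      using L2FT_unique[OF a(1) assms] by eventually_elim simp
  qed measurable
  with a(4) have "(\<lambda>n. l2n (\<lambda>x. fourier_integral (a n) x - F x)) \<longlonglongrightarrow> 0" by simp
  from that[OF a(2,3) this] show ?thesis .
qed

lemma Plancherel:
  assumes "L2FT f F" shows "l2n F = 2 * pi * l2n f"
proof -
  obtain a where a: "\<And>n::nat. BI (a n)" "(\<lambda>n. l2n (\<lambda>x. a n x - f x)) \<longlonglongrightarrow> 0"
    "(\<lambda>n. l2n (\<lambda>x. fourier_integral (a n) x - F x)) \<longlonglongrightarrow> 0"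
    using L2FT_seq[OF assms] by blast
  have "(\<lambda>n. l2n (fourier_integral (a n))) \<longlonglongrightarrow> l2n F"
    by (intro l2n_tendsto Plancherel_BI a L2FT_sq(2)[OF assms])
  moreover have "(\<lambda>n. 2 * pi * l2n (a n)) \<longlonglongrightarrow> 2 * pi * l2n f"
    by (intro tendsto_mult tendsto_const l2n_tendsto BI_sq_integrable a L2FT_sq(1)[OF assms])
  ultimately show ?thesis
    unfolding Plancherel_BI(2)[OF a(1)] by (rule LIMSEQ_unique)
qed

lemma Parseval:
  assumes "L2FT f F" "L2FT g G"
  shows "(LBINT \<xi>. F \<xi> * cnj (G \<xi>)) = of_real ((2 * pi)\<^sup>2) * (LBINT x. f x * cnj (g x))"
proof -
  obtain a where a: "\<And>n::nat. BI (a n)" "(\<lambda>n. l2n (\<lambda>x. a n x - f x)) \<longlonglongrightarrow> 0"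
    "(\<lambda>n. l2n (\<lambda>x. fourier_integral (a n) x - F x)) \<longlonglongrightarrow> 0"
    using L2FT_seq[OF assms(1)] by blast
  obtain b where b: "\<And>n::nat. BI (b n)" "(\<lambda>n. l2n (\<lambda>x. b n x - g x)) \<longlonglongrightarrow> 0"
    "(\<lambda>n. l2n (\<lambda>x. fourier_integral (b n) x - G x)) \<longlonglongrightarrow> 0"
    using L2FT_seq[OF assms(2)] by blast
  have c: "l2n (\<lambda>x. cnj (u x) - cnj (v x)) = l2n (\<lambda>x. u x - v x)" for u v :: "real^2 \<Rightarrow> complex"
    by (simp add: l2n_def flip: complex_cnj_diff)
  have "(\<lambda>n. (LBINT \<xi>. fourier_integral (a n) \<xi> * cnj (fourier_integral (b n) \<xi>))) \<longlonglongrightarrow> (LBINT \<xi>. F \<xi> * cnj (G \<xi>))"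
    by (rule inner_tendsto[OF Plancherel_BI(1)[OF a(1)] sq_integrable_cnj[OF Plancherel_BI(1)[OF b(1)]]
        L2FT_sq(2)[OF assms(1)] sq_integrable_cnj[OF L2FT_sq(2)[OF assms(2)]] a(3)]) (use b(3) in \<open>simp add: c\<close>)
  moreover have "(\<lambda>n. of_real ((2 * pi)\<^sup>2) * (LBINT \<xi>. a n \<xi> * cnj (b n \<xi>)))
     \<longlonglongrightarrow> of_real ((2 * pi)\<^sup>2) * (LBINT \<xi>. f \<xi> * cnj (g \<xi>))"
    by (intro tendsto_mult tendsto_const, rule inner_tendsto[OF BI_sq_integrable[OF a(1)] sq_integrable_cnj[OF BI_sq_integrable[OF b(1)]]
        L2FT_sq(1)[OF assms(1)] sq_integrable_cnj[OF L2FT_sq(1)[OF assms(2)]] a(2)]) (use b(2) in \<open>simp add: c\<close>)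
  ultimately show ?thesis
    unfolding Parseval_BI[OF a(1) b(1)] by (rule LIMSEQ_unique)
qed

lemma fourier_integral_cnj: "fourier_integral (\<lambda>x. cnj (f x)) \<xi> = cnj (fourier_integral f (- \<xi>))"
  unfolding fourier_integral_def Bochner_Integration.integral_cnj[symmetric]
  by (intro Bochner_Integration.integral_cong) (auto simp: cis_cnj)

lemma fourier_integral_uminus:
  assumes [measurable]: "f \<in> borel_measurable borel"
  shows "fourier_integral (\<lambda>x. f (- x)) \<xi> = fourier_integral f (- \<xi>)"
  unfolding fourier_integral_def
  using integral_flip[of "\<lambda>x. cis (- (x \<bullet> (- \<xi>))) * f x" 0] by simp

lemma L2FT_pairing:
  assumes "L2FT f F" "BI \<psi>"
  shows "(LBINT \<xi>. F \<xi> * fourier_integral \<psi> (- \<xi>)) = of_real ((2 * pi)\<^sup>2) * (LBINT x. f x * \<psi> x)"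
proof -
  have "BI (\<lambda>x. cnj (\<psi> x))"
    using BI_bound[OF assms(2)] BI_integrable[OF assms(2)] by (metis BI_I complex_mod_cnj Bochner_Integration.integrable_cnj)
  from Parseval[OF assms(1) L2FT_BI[OF this]] show ?thesis by (simp add: fourier_integral_cnj)
qed

lemma L2FT_cnj:
  assumes "L2FT f F" shows "L2FT (\<lambda>x. cnj (f x)) (\<lambda>\<xi>. cnj (F (- \<xi>)))"
  unfolding L2FT_def
proof (intro conjI allI impI)
  show "sq_integrable (\<lambda>x. cnj (f x))" using L2FT_sq(1)[OF assms] by (rule sq_integrable_cnj)
  show "sq_integrable (\<lambda>\<xi>. cnj (F (- \<xi>)))"
    using sq_integrable_flip[OF L2FT_sq(2)[OF assms], of 0] by (intro sq_integrable_cnj) simp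
  fix \<psi> assume \<psi>: "BI \<psi>"
  note [measurable] = L2FT_measurable[OF assms] BI_measurable[OF \<psi>]
  have "(LBINT \<xi>. cnj (F (- \<xi>)) * \<psi> \<xi>) = (LBINT \<xi>. cnj (F (- \<xi>) * cnj (\<psi> (- (- \<xi>)))))"
    by simp
  also have "\<dots> = cnj (LBINT \<xi>. F (- \<xi>) * cnj (\<psi> (- (- \<xi>))))" by (rule Bochner_Integration.integral_cnj)
  also have "(LBINT \<xi>. F (- \<xi>) * cnj (\<psi> (- (- \<xi>)))) = (LBINT \<xi>. F \<xi> * cnj (\<psi> (- \<xi>)))"
    using integral_flip[of "\<lambda>\<xi>. F \<xi> * cnj (\<psi> (- \<xi>))" 0] by (simp add: measurable_compose[OF _ borel_measurable_cnj])
  also have "\<dots> = (LBINT x. f x * fourier_integral (\<lambda>\<xi>. cnj (\<psi> (- \<xi>))) x)"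
    by (rule L2FT_D[OF assms BI_cnj_flip[OF \<psi>]])
  also have "\<dots> = (LBINT x. f x * cnj (fourier_integral \<psi> x))"
    by (simp add: fourier_integral_cnj[of "\<lambda>\<xi>. \<psi> (- \<xi>)"] fourier_integral_uminus)
  also have "cnj \<dots> = (LBINT x. cnj (f x) * fourier_integral \<psi> x)"
    unfolding Bochner_Integration.integral_cnj[symmetric] by simp
  finally show "(LBINT \<xi>. cnj (F (- \<xi>)) * \<psi> \<xi>) = (LBINT x. cnj (f x) * fourier_integral \<psi> x)" .
qed

lemma L2FT_inverse_exists:
  assumes "sq_integrable G" obtains g where "L2FT g G"
proof -
  obtain F where F: "L2FT G F" using L2FT_exists_seq[OF assms] by blast
  \<comment> \<open>Applying the transform twice gives a reflection times (2 pi)^2, so the reflected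
    transform divided by this constant is the inverse.\<close>
  define g where "g x = F (0 - x) / complex_of_real ((2 * pi)\<^sup>2)" for x
  have "L2FT g G" unfolding L2FT_def
  proof (intro conjI allI impI assms)
    show "sq_integrable g"
      using sq_integrable_cmult[OF sq_integrable_flip[OF L2FT_sq(2)[OF F], of 0], of "1 / of_real ((2 * pi)\<^sup>2)"]
      by (simp add: g_def[abs_def])
    fix \<psi> assume \<psi>: "BI \<psi>"
    note [measurable] = L2FT_measurable[OF F] BI_measurable[OF \<psi>]
    have "of_real ((2 * pi)\<^sup>2) * (LBINT x. G x * \<psi> x) = (LBINT \<xi>. F \<xi> * fourier_integral \<psi> (- \<xi>))"
      by (rule L2FT_pairing[OF F \<psi>, symmetric])
    also have "\<dots> = (LBINT \<xi>. F (0 - \<xi>) * fourier_integral \<psi> (- (0 - \<xi>)))"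
      by (rule integral_flip[symmetric]) measurable
    also have "\<dots> = (LBINT \<xi>. of_real ((2 * pi)\<^sup>2) * (g \<xi> * fourier_integral \<psi> \<xi>))"
      by (simp add: g_def)
    finally show "(LBINT x. G x * \<psi> x) = (LBINT x. g x * fourier_integral \<psi> x)" by simp
  qed
  with that show ?thesis .
qed

lemma L2FT_hermitian:
  assumes "L2FT (\<lambda>x. of_real (f x)) F"
  shows "AE \<xi> in lborel. F (- \<xi>) = cnj (F \<xi>)"
proof -
  have "AE \<xi> in lborel. cnj (F (- \<xi>)) = F \<xi>"
    using L2FT_unique[OF L2FT_cnj[OF assms]] assms by simp
  then show ?thesis by eventually_elim (metis complex_cnj_cnj)
qed

text \<open>With G Hermitian, the preimage h and its conjugate have the same transform, so they
  agree by injectivity. Multipliers and weak derivatives are chosen among real functions, hence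
  their witnesses must be real.\<close>

lemma L2FT_inverse_real:
  assumes "sq_integrable G" "AE \<xi> in lborel. G (- \<xi>) = cnj (G \<xi>)"
  obtains g :: "real^2 \<Rightarrow> real" where "L2FT (\<lambda>x. complex_of_real (g x)) G"
proof -
  obtain h where h: "L2FT h G" using L2FT_inverse_exists[OF assms(1)] by blast
  note [measurable] = L2FT_measurable[OF h]
  have "L2FT (\<lambda>x. cnj (h x)) G"
    by (rule L2FT_AE_cong[OF L2FT_cnj[OF h]])
      (use assms(2) in \<open>auto elim!: eventually_mono intro: measurable_compose[OF _ borel_measurable_cnj]\<close>)
  from L2FT_inj[OF h this] have "AE x in lborel. h x = of_real (Re (h x))"
    by eventually_elim (simp add: complex_eq_iff)
  then have "L2FT (\<lambda>x. of_real (Re (h x))) G"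
    by (intro L2FT_AE_cong[OF h]) auto
  with that show ?thesis .
qed

section \<open>Convolution of an L^1 with an L^2 function\<close>

text \<open>Splitting |U| |G| into sqrt |U| times sqrt |U| |G| and applying Cauchy-Schwarz in \<eta>
  bounds the square of the convolution by the L^1 norm of U times the convolution of |U| with |G|^2,
  which Tonelli integrates.\<close>

lemma Young_convolution:
  assumes U: "integrable lborel (U :: real^2 \<Rightarrow> complex)" and G: "sq_integrable G"
  shows "sq_integrable (\<lambda>\<xi>. (LBINT \<eta>. U \<eta> * G (\<xi> - \<eta>)))"
    and "AE \<xi> in lborel. integrable lborel (\<lambda>\<eta>. U \<eta> * G (\<xi> - \<eta>))"
    and "l2n (\<lambda>\<xi>. (LBINT \<eta>. U \<eta> * G (\<xi> - \<eta>))) \<le> (LBINT \<eta>. cmod (U \<eta>)) * l2n G"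
proof -
  have [measurable]: "U \<in> borel_measurable borel" using U by auto
  have [measurable]: "G \<in> borel_measurable borel" using sq_integrable_measurable[OF G] .
  define C where "C = (LBINT \<eta>. cmod (U \<eta>))"
  have C0: "C \<ge> 0" unfolding C_def by simp
  have nnU: "(\<integral>\<^sup>+\<eta>. ennreal (cmod (U \<eta>)) \<partial>lborel) = ennreal C"
    unfolding C_def using U by (intro nn_integral_eq_integral) auto
  define P where "P \<xi> = (\<integral>\<^sup>+\<eta>. ennreal (cmod (U \<eta>)) * ennreal (cmod (G (\<xi> - \<eta>))) \<partial>lborel)" for \<xi>
  have [measurable]: "P \<in> borel_measurable borel" unfolding P_def by measurable
  have Psq: "(P \<xi>)\<^sup>2 \<le> ennreal C * (\<integral>\<^sup>+\<eta>. ennreal (cmod (U \<eta>)) * ennreal ((cmod (G (\<xi> - \<eta>)))\<^sup>2) \<partial>lborel)" for \<xi>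
  proof -
    have "P \<xi> = (\<integral>\<^sup>+\<eta>. ennreal (sqrt (cmod (U \<eta>))) * ennreal (sqrt (cmod (U \<eta>)) * cmod (G (\<xi> - \<eta>))) \<partial>lborel)"
      unfolding P_def by (intro nn_integral_cong) (simp add: ennreal_mult[symmetric] mult.assoc[symmetric])
    also have "\<dots>\<^sup>2 \<le> (\<integral>\<^sup>+\<eta>. (ennreal (sqrt (cmod (U \<eta>))))\<^sup>2 \<partial>lborel) * (\<integral>\<^sup>+\<eta>. (ennreal (sqrt (cmod (U \<eta>)) * cmod (G (\<xi> - \<eta>))))\<^sup>2 \<partial>lborel)"
      by (rule Cauchy_Schwarz_nn_integral) measurable
    finally show ?thesis
      by (simp add: ennreal_power nnU power_mult_distrib ennreal_mult)
  qed
  have "(\<integral>\<^sup>+\<xi>. (P \<xi>)\<^sup>2 \<partial>lborel) \<le> (\<integral>\<^sup>+\<xi>. ennreal C * (\<integral>\<^sup>+\<eta>. ennreal (cmod (U \<eta>)) * ennreal ((cmod (G (\<xi> - \<eta>)))\<^sup>2) \<partial>lborel) \<partial>lborel)"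
    by (intro nn_integral_mono Psq)
  also have "\<dots> = ennreal C * (\<integral>\<^sup>+\<xi>. (\<integral>\<^sup>+\<eta>. ennreal (cmod (U \<eta>)) * ennreal ((cmod (G (\<xi> - \<eta>)))\<^sup>2) \<partial>lborel) \<partial>lborel)"
    by (rule nn_integral_cmult) measurable
  also have "(\<integral>\<^sup>+\<xi>. (\<integral>\<^sup>+\<eta>. ennreal (cmod (U \<eta>)) * ennreal ((cmod (G (\<xi> - \<eta>)))\<^sup>2) \<partial>lborel) \<partial>lborel)
     = (\<integral>\<^sup>+\<eta>. (\<integral>\<^sup>+\<xi>. ennreal (cmod (U \<eta>)) * ennreal ((cmod (G (\<xi> - \<eta>)))\<^sup>2) \<partial>lborel) \<partial>lborel)"
    by (rule lborel_pair.Fubini') measurable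
  also have "\<dots> = (\<integral>\<^sup>+\<eta>. ennreal (cmod (U \<eta>)) * ennreal ((l2n G)\<^sup>2) \<partial>lborel)"
  proof (rule nn_integral_cong)
    fix \<eta>
    have "(\<integral>\<^sup>+\<xi>. ennreal ((cmod (G (\<xi> - \<eta>)))\<^sup>2) \<partial>lborel) = (\<integral>\<^sup>+\<xi>. ennreal ((cmod (G \<xi>))\<^sup>2) \<partial>lborel)"
      using nn_integral_shift[of "\<lambda>\<xi>. ennreal ((cmod (G \<xi>))\<^sup>2)" "- \<eta>"] by simp
    also have "\<dots> = ennreal ((l2n G)\<^sup>2)"
      using G by (simp add: l2n_sq nn_integral_eq_integral sq_integrable_def)
    finally show "(\<integral>\<^sup>+\<xi>. ennreal (cmod (U \<eta>)) * ennreal ((cmod (G (\<xi> - \<eta>)))\<^sup>2) \<partial>lborel) = ennreal (cmod (U \<eta>)) * ennreal ((l2n G)\<^sup>2)"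
      by (simp add: nn_integral_cmult)
  qed
  also have "\<dots> = ennreal C * ennreal ((l2n G)\<^sup>2)"
    by (subst nn_integral_multc) (simp_all add: nnU)
  also have "ennreal C * (ennreal C * ennreal ((l2n G)\<^sup>2)) = ennreal ((C * l2n G)\<^sup>2)"
    using C0 by (simp add: ennreal_mult[symmetric] power2_eq_square mult_ac)
  finally have PP: "(\<integral>\<^sup>+\<xi>. (P \<xi>)\<^sup>2 \<partial>lborel) \<le> ennreal ((C * l2n G)\<^sup>2)" .
  have "AE \<xi> in lborel. (P \<xi>)\<^sup>2 \<noteq> \<infinity>"
    using PP by (intro nn_integral_PInf_AE) (auto simp: top_unique)
  then show "AE \<xi> in lborel. integrable lborel (\<lambda>\<eta>. U \<eta> * G (\<xi> - \<eta>))"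
  proof eventually_elim
    case (elim \<xi>)
    then have "P \<xi> < \<infinity>" by (auto simp: less_top power2_eq_square ennreal_mult_eq_top_iff)
    then show ?case
      by (intro integrableI_bounded) (auto simp: P_def norm_mult ennreal_mult)
  qed
  have le: "cmod (LBINT \<eta>. U \<eta> * G (\<xi> - \<eta>)) \<le> P \<xi>" for \<xi>
  proof (cases "integrable lborel (\<lambda>\<eta>. U \<eta> * G (\<xi> - \<eta>))")
    case True
    from integral_norm_bound_ennreal[OF True] show ?thesis by (simp add: P_def norm_mult ennreal_mult)
  qed (simp add: not_integrable_integral_eq)
  have "(\<integral>\<^sup>+\<xi>. ennreal ((cmod (LBINT \<eta>. U \<eta> * G (\<xi> - \<eta>)))\<^sup>2) \<partial>lborel) \<le> (\<integral>\<^sup>+\<xi>. (P \<xi>)\<^sup>2 \<partial>lborel)"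
    by (intro nn_integral_mono) (simp add: ennreal_power[symmetric] power_mono le)
  also note PP
  finally have fin: "(\<integral>\<^sup>+\<xi>. ennreal ((cmod (LBINT \<eta>. U \<eta> * G (\<xi> - \<eta>)))\<^sup>2) \<partial>lborel) \<le> ennreal ((C * l2n G)\<^sup>2)" .
  then have "integrable lborel (\<lambda>\<xi>. (cmod (LBINT \<eta>. U \<eta> * G (\<xi> - \<eta>)))\<^sup>2)"
    by (intro integrableI_bounded) (auto intro: le_less_trans)
  then show sq: "sq_integrable (\<lambda>\<xi>. (LBINT \<eta>. U \<eta> * G (\<xi> - \<eta>)))"
    by (simp add: sq_integrable_def)
  have "ennreal ((l2n (\<lambda>\<xi>. (LBINT \<eta>. U \<eta> * G (\<xi> - \<eta>))))\<^sup>2) \<le> ennreal ((C * l2n G)\<^sup>2)"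
    using fin sq by (simp add: l2n_sq nn_integral_eq_integral sq_integrable_def)
  then have "(l2n (\<lambda>\<xi>. (LBINT \<eta>. U \<eta> * G (\<xi> - \<eta>))))\<^sup>2 \<le> (C * l2n G)\<^sup>2"
    by (subst (asm) ennreal_le_iff) auto
  then show "l2n (\<lambda>\<xi>. (LBINT \<eta>. U \<eta> * G (\<xi> - \<eta>))) \<le> (LBINT \<eta>. cmod (U \<eta>)) * l2n G"
    unfolding C_def[symmetric] by (rule power2_le_imp_le) (simp add: C0)
qed

lemma fourier_integral_shift_arg:
  assumes [measurable]: "\<psi> \<in> borel_measurable borel"
  shows "fourier_integral (\<lambda>\<xi>. \<psi> (\<eta> + \<xi>)) x = cis (x \<bullet> \<eta>) * fourier_integral \<psi> x"
proof -
  have "fourier_integral (\<lambda>\<xi>. \<psi> (\<eta> + \<xi>)) x = (LBINT \<xi>. cis (x \<bullet> \<eta>) * (cis (- ((\<eta> + \<xi>) \<bullet> x)) * \<psi> (\<eta> + \<xi>)))"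
    unfolding fourier_integral_def
    by (intro Bochner_Integration.integral_cong) (auto simp: mult.assoc[symmetric] cis_mult inner_simps inner_commute)
  also have "\<dots> = cis (x \<bullet> \<eta>) * (LBINT \<xi>. cis (- ((\<eta> + \<xi>) \<bullet> x)) * \<psi> (\<eta> + \<xi>))"
    by (rule integral_mult_right_zero)
  also have "(LBINT \<xi>. cis (- ((\<eta> + \<xi>) \<bullet> x)) * \<psi> (\<eta> + \<xi>)) = fourier_integral \<psi> x"
    unfolding fourier_integral_def
    by (rule integral_shift[of "\<lambda>\<xi>. cis (- (\<xi> \<bullet> x)) * \<psi> \<xi>"]) measurable
  finally show ?thesis .
qed

text \<open>Multiplying by cis(x . \<eta>) shifts the test function by \<eta>; integrating against U
  turns the shifts into a convolution. The factor in front of g is (2 pi)^2 times the function with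
  transform U, so the normalising constant is absent here and enters in \<open>NF\<close>.\<close>

lemma L2FT_mult:
  assumes U: "integrable lborel U" and g: "L2FT g G"
  shows "L2FT (\<lambda>x. (LBINT \<eta>. U \<eta> * cis (x \<bullet> \<eta>)) * g x) (\<lambda>\<xi>. (LBINT \<eta>. U \<eta> * G (\<xi> - \<eta>)))"
  unfolding L2FT_def
proof (intro conjI allI impI)
  note [measurable] = L2FT_measurable[OF g] borel_measurable_integrable[OF U, simplified]
  show "sq_integrable (\<lambda>x. (LBINT \<eta>. U \<eta> * cis (x \<bullet> \<eta>)) * g x)"
  proof (rule sq_integrable_bound[OF L2FT_sq(1)[OF g]])
    fix x
    have "cmod (LBINT \<eta>. U \<eta> * cis (x \<bullet> \<eta>)) \<le> (LBINT \<eta>. cmod (U \<eta>))"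
      using integral_norm_bound[of lborel "\<lambda>\<eta>. U \<eta> * cis (x \<bullet> \<eta>)"] by (simp add: norm_mult)
    then show "cmod ((LBINT \<eta>. U \<eta> * cis (x \<bullet> \<eta>)) * g x) \<le> (LBINT \<eta>. cmod (U \<eta>)) * cmod (g x)"
      by (simp add: norm_mult mult_right_mono)
  qed measurable
  show "sq_integrable (\<lambda>\<xi>. (LBINT \<eta>. U \<eta> * G (\<xi> - \<eta>)))"
    by (rule Young_convolution(1)[OF U L2FT_sq(2)[OF g]])
  fix \<psi> assume \<psi>: "BI \<psi>"
  note [measurable] = BI_measurable[OF \<psi>]
  have gi: "integrable lborel (\<lambda>x. g x * fourier_integral \<psi> x)"
    by (intro sq_integrable_mult L2FT_sq(1)[OF g] Plancherel_BI(1)[OF \<psi>])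
  have "(LBINT x. (LBINT \<eta>. U \<eta> * cis (x \<bullet> \<eta>)) * g x * fourier_integral \<psi> x)
      = (LBINT x. (LBINT \<eta>. cis (x \<bullet> \<eta>) * U \<eta>) * (g x * fourier_integral \<psi> x))"
    by (simp add: mult_ac)
  also have "\<dots> = (LBINT \<eta>. U \<eta> * (LBINT x. cis (x \<bullet> \<eta>) * (g x * fourier_integral \<psi> x)))"
    by (rule Fubini_kernel[where C=1 and k="\<lambda>\<eta> x. cis (x \<bullet> \<eta>)", OF U gi, symmetric]) simp_all
  also have "\<dots> = (LBINT \<eta>. U \<eta> * (LBINT \<xi>. G (\<xi> - \<eta>) * \<psi> \<xi>))"
  proof -
    have "(LBINT x. cis (x \<bullet> \<eta>) * (g x * fourier_integral \<psi> x)) = (LBINT \<xi>. G (\<xi> - \<eta>) * \<psi> \<xi>)" for \<eta>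
    proof -
    have "(LBINT x. cis (x \<bullet> \<eta>) * (g x * fourier_integral \<psi> x)) = (LBINT x. g x * fourier_integral (\<lambda>\<xi>. \<psi> (\<eta> + \<xi>)) x)"
      by (simp add: fourier_integral_shift_arg mult_ac)
    also have "\<dots> = (LBINT \<xi>. G \<xi> * \<psi> (\<eta> + \<xi>))"
      by (rule L2FT_D[OF g BI_shift[OF \<psi>], symmetric])
    also have "\<dots> = (LBINT \<xi>. G (- \<eta> + \<xi>) * \<psi> (\<eta> + (- \<eta> + \<xi>)))"
      by (rule integral_shift[symmetric]) measurable
    finally show ?thesis by simp
    qed
    then show ?thesis by (simp only:)
  qed
  also have "\<dots> = (LBINT \<eta>. (LBINT \<xi>. U \<eta> * G (\<xi> - \<eta>) * \<psi> \<xi>))"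
    by (simp add: mult.assoc)
  \<comment> \<open>The order may be exchanged because \<open>Young_convolution\<close>, applied to
    the absolute values, gives an L^2 function of \<xi> that pairs with \<psi>.\<close>
  also have "\<dots> = (LBINT \<xi>. (LBINT \<eta>. U \<eta> * G (\<xi> - \<eta>) * \<psi> \<xi>))"
  proof -
    let ?k = "\<lambda>(\<xi>, \<eta>). U \<eta> * G (\<xi> - \<eta>) * \<psi> \<xi>"
    have aU: "integrable lborel (\<lambda>\<eta>. complex_of_real (cmod (U \<eta>)))" using U by simp
    have aG: "sq_integrable (\<lambda>\<xi>. complex_of_real (cmod (G \<xi>)))"
      by (rule sq_integrable_bound[OF L2FT_sq(2)[OF g], of _ 1]) auto
    have k: "?k \<in> borel_measurable (lborel \<Otimes>\<^sub>M lborel)" by measurable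
    have "integrable lborel (\<lambda>\<xi>. cmod (LBINT \<eta>. complex_of_real (cmod (U \<eta>)) * complex_of_real (cmod (G (\<xi> - \<eta>)))) * cmod (\<psi> \<xi>))"
      by (rule sq_integrable_mult_norm[OF Young_convolution(1)[OF aU aG] BI_sq_integrable[OF \<psi>]])
    then have i: "integrable lborel (\<lambda>\<xi>. (LBINT \<eta>. norm (?k (\<xi>, \<eta>))))"
      by (simp add: norm_mult integral_complex_of_real flip: of_real_mult)
    have "AE \<xi> in lborel. integrable lborel (\<lambda>\<eta>. ?k (\<xi>, \<eta>))"
      using Young_convolution(2)[OF U L2FT_sq(2)[OF g]] by eventually_elim simp
    from lborel_pair.Fubini_integrable[OF k i this]
    show ?thesis by (rule lborel_pair.Fubini_integral)
  qed
  finally show "(LBINT \<xi>. (LBINT \<eta>. U \<eta> * G (\<xi> - \<eta>)) * \<psi> \<xi>)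
      = (LBINT x. (LBINT \<eta>. U \<eta> * cis (x \<bullet> \<eta>)) * g x * fourier_integral \<psi> x)"
    by simp
qed

section \<open>Smooth functions\<close>

text \<open>\<open>smooth\<close> quantifies over all finite lists of directions. A class of
  differentiable functions closed under partial derivatives takes the place of an induction for each
  function.\<close>

lemma smooth_coinduct [consumes 1, case_names diff deriv]:
  assumes "P f"
    and diff: "\<And>f x. P f \<Longrightarrow> f differentiable (at x)"
    and deriv: "\<And>f v. P f \<Longrightarrow> v \<in> Basis \<Longrightarrow> P (\<lambda>x. frechet_derivative f (at x) v)"
  shows "smooth f"
proof -
  have "P (partials vs f)" if "vs \<in> lists Basis" for vs
    using that by (induction vs) (auto intro: assms)
  then show ?thesis unfolding smooth_def using diff by blast
qed

lemma partials_append: "partials (vs @ ws) f = partials vs (partials ws f)"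
  by (induction vs) auto

lemma smooth_differentiable: "smooth f \<Longrightarrow> f differentiable (at x)"
  unfolding smooth_def by (metis lists.Nil partials.simps(1))

lemma smooth_partials: "smooth f \<Longrightarrow> ws \<in> lists Basis \<Longrightarrow> smooth (partials ws f)"
  unfolding smooth_def partials_append[symmetric] by simp

lemma smooth_frechet: "smooth f \<Longrightarrow> v \<in> Basis \<Longrightarrow> smooth (\<lambda>x. frechet_derivative f (at x) v)"
  using smooth_partials[of f "[v]"] by simp

lemma smooth_continuous: "smooth f \<Longrightarrow> continuous_on UNIV f"
  by (meson continuous_at_imp_continuous_on differentiable_imp_continuous_within smooth_differentiable)

lemma frechet_derivativeI:
  "(f has_derivative f') (at x) \<Longrightarrow> frechet_derivative f (at x) = f'"
  using frechet_derivative_at by metis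

lemma frechet_derivative_worksI:
  "f differentiable (at x) \<Longrightarrow> (f has_derivative frechet_derivative f (at x)) (at x)"
  by (simp add: frechet_derivative_works[symmetric])

text \<open>The algebra generated by S. By the sum and product rules it is closed under partial
  derivatives as soon as those of the generators stay inside it, which is how the bump functions are
  seen to be smooth.\<close>

inductive smooth_alg :: "('a::euclidean_space \<Rightarrow> 'b::real_normed_field) set \<Rightarrow> ('a \<Rightarrow> 'b) \<Rightarrow> bool" for S where
  base: "f \<in> S \<Longrightarrow> smooth_alg S f"
| const: "smooth_alg S (\<lambda>_. c)"
| add: "smooth_alg S f \<Longrightarrow> smooth_alg S g \<Longrightarrow> smooth_alg S (\<lambda>x. f x + g x)"
| mult: "smooth_alg S f \<Longrightarrow> smooth_alg S g \<Longrightarrow> smooth_alg S (\<lambda>x. f x * g x)"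

lemma smooth_alg_differentiable:
  assumes "smooth_alg S f" "\<And>f x. f \<in> S \<Longrightarrow> f differentiable (at x)"
  shows "f differentiable (at x)"
  using assms(1) by induction (auto intro: assms(2))

lemma smooth_alg_frechet:
  assumes "smooth_alg S f" "v \<in> Basis" and diff: "\<And>f x. f \<in> S \<Longrightarrow> f differentiable (at x)"
    and deriv: "\<And>f v. f \<in> S \<Longrightarrow> v \<in> Basis \<Longrightarrow> smooth_alg S (\<lambda>x. frechet_derivative f (at x) v)"
  shows "smooth_alg S (\<lambda>x. frechet_derivative f (at x) v)"
  using assms(1)
proof induction
  case (base f)
  then show ?case by (rule deriv) fact
next
  case (const c)
  have "frechet_derivative (\<lambda>_. c) (at x) = (\<lambda>_. 0)" for x :: 'a
    by (rule frechet_derivativeI) (auto intro: derivative_eq_intros)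
  then show ?case by (simp add: smooth_alg.const)
next
  case (add f g)
  have "f differentiable (at x)" "g differentiable (at x)" for x
    using add.hyps diff by (auto intro: smooth_alg_differentiable)
  then have "frechet_derivative (\<lambda>x. f x + g x) (at x) v = frechet_derivative f (at x) v + frechet_derivative g (at x) v" for x
    by (subst frechet_derivativeI[OF has_derivative_add[OF frechet_derivative_worksI frechet_derivative_worksI]]) auto
  with add show ?case by (simp add: smooth_alg.add)
next
  case (mult f g)
  have d: "f differentiable (at x)" "g differentiable (at x)" for x
    using mult.hyps diff by (auto intro: smooth_alg_differentiable)
  have "frechet_derivative (\<lambda>x. f x * g x) (at x) v = f x * frechet_derivative g (at x) v + frechet_derivative f (at x) v * g x" for x
    by (subst frechet_derivativeI[OF has_derivative_mult[OF frechet_derivative_worksI[OF d(1)] frechet_derivative_worksI[OF d(2)]]]) auto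
  with mult show ?case by (simp add: smooth_alg.add smooth_alg.mult)
qed

lemma smooth_alg_smooth:
  assumes "smooth_alg S f" and "\<And>f x. f \<in> S \<Longrightarrow> f differentiable (at x)"
    and "\<And>f v. f \<in> S \<Longrightarrow> v \<in> Basis \<Longrightarrow> smooth_alg S (\<lambda>x. frechet_derivative f (at x) v)"
  shows "smooth f"
  using assms(1)
  by (rule smooth_coinduct[where P="smooth_alg S"])
    (use assms(2,3) in \<open>auto intro: smooth_alg_differentiable smooth_alg_frechet\<close>)

subsection \<open>Bump functions\<close>

text \<open>The classical flat function exp(-1/t) together with its multiples by powers of 1/t. The
  whole family is needed because differentiation raises the power: the derivative of
  \<open>eflat k\<close> combines \<open>eflat (k + 2)\<close> and
  \<open>eflat (k + 1)\<close>.\<close>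

definition eflat :: "nat \<Rightarrow> real \<Rightarrow> real" where
  "eflat k t = (if t \<le> 0 then 0 else exp (- inverse t) * inverse t ^ k)"

lemma power_le_fact_exp:
  assumes "0 \<le> (x::real)" shows "x ^ k \<le> fact k * exp x"
proof -
  have "(\<Sum>n\<in>{k}. x ^ n /\<^sub>R fact n) \<le> (\<Sum>n. x ^ n /\<^sub>R fact n)"
    using assms by (intro sum_le_suminf summable_exp_generic) auto
  then show ?thesis using assms by (simp add: exp_def field_simps)
qed

text \<open>With u = 1/h this is u^(k+2) <= (k+2)! exp u. The quadratic bound in h makes the
  difference quotient at 0 tend to 0.\<close>

lemma eflat_le:
  assumes "\<bar>h\<bar> < 1" shows "\<bar>eflat k h\<bar> \<le> fact (k + 2) * h\<^sup>2"
proof (cases "h \<le> 0")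
  case False
  define u where "u = inverse h"
  have u: "u > 0" "h = inverse u" using False by (auto simp: u_def)
  have "u ^ (k + 2) * exp (- u) \<le> fact (k + 2)"
    using mult_right_mono[OF power_le_fact_exp[of u "k + 2"], of "exp (- u)"] u by (simp add: mult.assoc exp_minus_inverse)
  then have "exp (- u) * u ^ k \<le> fact (k + 2) * (inverse u)\<^sup>2"
    using u(1) by (simp add: power_add field_simps power2_eq_square)
  with False u show ?thesis by (simp add: eflat_def)
qed (simp add: eflat_def)

lemma eflat_deriv: "(eflat k has_real_derivative (eflat (k + 2) t - k * eflat (k + 1) t)) (at t)"
proof -
  consider "t < 0" | "t = 0" | "t > 0" by linarith
  then show ?thesis
  proof cases
    case 1
    have "((\<lambda>_. 0) has_real_derivative 0) (at t)" by simp
    then have "(eflat k has_real_derivative 0) (at t)"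
      by (rule has_field_derivative_transform_within_open[where S="{..<0}"]) (use 1 in \<open>auto simp: eflat_def\<close>)
    with 1 show ?thesis by (simp add: eflat_def)
  next
    case 2
    have "(\<lambda>h. (eflat k (0 + h) - eflat k 0) / h) \<midarrow>0\<rightarrow> 0"
    proof (rule Lim_null_comparison)
      show "\<forall>\<^sub>F h in at (0::real). norm ((eflat k (0 + h) - eflat k 0) / h) \<le> fact (k + 2) * \<bar>h\<bar>"
        unfolding eventually_at
      proof (intro exI[of _ 1] conjI ballI impI)
        fix h :: real assume h: "h \<noteq> 0 \<and> dist h 0 < 1"
        then have "\<bar>eflat k h\<bar> / \<bar>h\<bar> \<le> (fact (k + 2) * h\<^sup>2) / \<bar>h\<bar>"
          by (intro divide_right_mono eflat_le) auto
        also have "\<dots> = fact (k + 2) * \<bar>h\<bar>"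
          using h by (simp add: power2_eq_square abs_if field_simps)
        finally show "norm ((eflat k (0 + h) - eflat k 0) / h) \<le> fact (k + 2) * \<bar>h\<bar>"
          by (simp add: eflat_def)
      qed simp
      have "((\<lambda>h::real. fact (k + 2) * \<bar>h\<bar>) \<longlongrightarrow> fact (k + 2) * \<bar>0\<bar>) (at 0)"
        by (intro tendsto_intros)
      then show "((\<lambda>h::real. fact (k + 2) * \<bar>h\<bar>) \<longlongrightarrow> 0) (at 0)" by simp
    qed
    with 2 show ?thesis by (simp add: DERIV_def eflat_def)
  next
    case 3
    have "((\<lambda>t. exp (- inverse t) * inverse t ^ k) has_real_derivative
       exp (- inverse t) * inverse t ^ (k + 2) - k * (exp (- inverse t) * inverse t ^ (k + 1))) (at t)"
      using 3 by (auto intro!: derivative_eq_intros simp: field_simps power2_eq_square) (cases k; simp add: field_simps)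
    then have "(eflat k has_real_derivative
       exp (- inverse t) * inverse t ^ (k + 2) - k * (exp (- inverse t) * inverse t ^ (k + 1))) (at t)"
      by (rule has_field_derivative_transform_within_open[where S="{0<..}"]) (use 3 in \<open>auto simp: eflat_def\<close>)
    with 3 show ?thesis by (simp add: eflat_def)
  qed
qed

lemma eflat_affine_has_derivative:
  "((\<lambda>z. eflat k (z \<bullet> v + c)) has_derivative (\<lambda>d. (d \<bullet> v) * (eflat (k + 2) (z \<bullet> v + c) - k * eflat (k + 1) (z \<bullet> v + c)))) (at z)"
  by (rule DERIV_compose_FDERIV[OF eflat_deriv]) (auto intro!: derivative_eq_intros)

lemma smooth_eflat_alg:
  fixes f :: "'a::euclidean_space \<Rightarrow> real"
  assumes "smooth_alg {f. \<exists>k v c. f = (\<lambda>z. eflat k (z \<bullet> v + c))} f"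
  shows "smooth f"
  using assms
proof (rule smooth_alg_smooth)
  fix f :: "'a \<Rightarrow> real" assume "f \<in> {f. \<exists>k v c. f = (\<lambda>z. eflat k (z \<bullet> v + c))}"
  then obtain k v c where f: "f = (\<lambda>z. eflat k (z \<bullet> v + c))" by blast
  show "f differentiable (at x)" for x
    unfolding f using eflat_affine_has_derivative by (rule differentiableI)
  fix w :: 'a
  have "frechet_derivative f (at x) w = (w \<bullet> v) * (eflat (k + 2) (x \<bullet> v + c) + (- real k) * eflat (k + 1) (x \<bullet> v + c))" for x
    unfolding f by (subst frechet_derivativeI[OF eflat_affine_has_derivative]) simp
  then show "smooth_alg {f. \<exists>k v c. f = (\<lambda>z. eflat k (z \<bullet> v + c))} (\<lambda>x. frechet_derivative f (at x) w)"
    by (simp only:) (intro smooth_alg.mult smooth_alg.add smooth_alg.const; rule smooth_alg.base; blast)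
qed

text \<open>\<open>bump n a b\<close> is positive exactly on \<open>box a b\<close> and increases to its indicator function.\<close>

definition bump :: "nat \<Rightarrow> 'a::euclidean_space \<Rightarrow> 'a \<Rightarrow> 'a \<Rightarrow> real" where
  "bump n a b z = (\<Prod>i\<in>Basis. eflat 0 (z \<bullet> (real (Suc n) *\<^sub>R i) + (- (real (Suc n) * (a \<bullet> i))))
      * eflat 0 (z \<bullet> (- (real (Suc n) *\<^sub>R i)) + real (Suc n) * (b \<bullet> i)))"

lemma smooth_alg_prod:
  "finite I \<Longrightarrow> (\<And>i. i \<in> I \<Longrightarrow> smooth_alg S (f i)) \<Longrightarrow> smooth_alg S (\<lambda>x. \<Prod>i\<in>I. f i x)"
  by (induction I rule: finite_induct) (auto intro: smooth_alg.intros)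

lemma smooth_bump: "smooth (bump n a b)"
  unfolding bump_def[abs_def]
  by (rule smooth_eflat_alg, intro smooth_alg_prod smooth_alg.mult finite_Basis; rule smooth_alg.base; blast)

lemma eflat_0: "eflat 0 t \<ge> 0" "eflat 0 t \<le> 1" "eflat 0 t > 0 \<longleftrightarrow> t > 0" "eflat 0 t = 0 \<longleftrightarrow> t \<le> 0"
  by (auto simp: eflat_def)

lemma bump_alt: "bump n a b z = (\<Prod>i\<in>Basis. eflat 0 (real (Suc n) * (z \<bullet> i - a \<bullet> i)) * eflat 0 (real (Suc n) * (b \<bullet> i - z \<bullet> i)))"
  unfolding bump_def by (intro prod.cong) (auto simp: algebra_simps)

lemma bump_nonneg: "bump n a b z \<ge> 0"
  unfolding bump_alt by (intro prod_nonneg) (auto simp: eflat_0)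

lemma bump_le_1: "bump n a b z \<le> 1"
  unfolding bump_alt by (intro prod_le_1) (auto simp: eflat_0 intro: mult_le_one)

lemma bump_eq_0: "z \<notin> box a b \<Longrightarrow> bump n a b z = 0"
  unfolding bump_alt by (auto simp: mem_box not_less eflat_0 mult_le_0_iff)

lemma bump_pos: "z \<in> box a b \<Longrightarrow> bump n a b z > 0"
  unfolding bump_alt by (intro prod_pos) (auto simp: mem_box eflat_0)

lemma bump_tendsto: "(\<lambda>n. bump n a b z) \<longlonglongrightarrow> indicat_real (box a b) z"
proof (cases "z \<in> box a b")
  case True
  have e: "(\<lambda>n. eflat 0 (real (Suc n) * t)) \<longlonglongrightarrow> 1" if "t > 0" for t
  proof -
    have "(\<lambda>n. exp (- (inverse (real (Suc n)) * inverse t))) \<longlonglongrightarrow> exp (- (0 * inverse t))"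
      by (intro tendsto_intros LIMSEQ_inverse_real_of_nat)
    moreover have "eflat 0 (real (Suc n) * t) = exp (- (inverse (real (Suc n)) * inverse t))" for n
      using that by (simp add: eflat_def mult_le_0_iff)
    ultimately show ?thesis by simp
  qed
  have "(\<lambda>n. bump n a b z) \<longlonglongrightarrow> (\<Prod>i\<in>(Basis::'a set). 1 * 1)"
    unfolding bump_alt by (intro tendsto_prod tendsto_mult e) (use True in \<open>auto simp: mem_box\<close>)
  with True show ?thesis by simp
qed (simp add: bump_eq_0)

lemma test_function_bump:
  assumes "cbox a b \<subseteq> \<Omega>" shows "test_function \<Omega> (bump n a b)"
proof -
  have "closure {z. bump n a b z \<noteq> 0} \<subseteq> cbox a b"
    using bump_eq_0 box_subset_cbox by (intro closure_minimal) (auto, blast)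
  moreover from this have "bounded {z. bump n a b z \<noteq> 0}"
    using closure_subset bounded_subset[OF bounded_cbox] by blast
  ultimately show ?thesis unfolding test_function_def using assms smooth_bump[of n a b]
    by (auto simp: compact_closure)
qed

text \<open>Boxes form an intersection-stable generator of the Borel sets, so a Dynkin argument
  carries vanishing integrals from boxes to all Borel sets. Since h is only locally integrable, this
  is done on each large box of half-width N.\<close>

lemma integral_box_zero_AE:
  fixes h :: "'a::euclidean_space \<Rightarrow> real"
  assumes [measurable]: "h \<in> borel_measurable borel"
    and int: "\<And>a b. integrable lborel (\<lambda>x. h x * indicat_real (box a b) x)"
    and zero: "\<And>a b. (LBINT x. h x * indicat_real (box a b) x) = 0"
  shows "AE x in lborel. h x = 0"
proof -
  have "AE x in lborel. h x * indicat_real (box (- (real N *\<^sub>R One)) (real N *\<^sub>R One)) x = 0" for N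
  proof (rule sigma_finite_measure.density_zero[OF sigma_finite_lborel int])
    let ?B = "box (- (real N *\<^sub>R One)) (real N *\<^sub>R (One::'a))"
    let ?h = "\<lambda>x. h x * indicat_real ?B x"
    let ?E = "range (\<lambda>(a, b). box a b :: 'a set)"
    have bb: "box a b \<inter> ?B \<in> ?E" for a b :: 'a unfolding box_Int_box by auto
    have si: "set_integrable lborel A ?h" if "A \<in> sets lborel" for A
      unfolding set_integrable_def using int that by (intro integrable_mult_indicator) auto
    have sall: "set_lebesgue_integral lborel UNIV ?h = 0"
      unfolding set_lebesgue_integral_def using zero by simp
    fix A :: "'a set" assume "A \<in> sets lborel"
    then have mem: "A \<in> sigma_sets UNIV ?E"
      by (simp add: borel_eq_box)
    have stable: "Int_stable ?E" by (auto simp: Int_stable_def box_Int_box)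
    have sub: "?E \<subseteq> Pow UNIV" by simp
    from stable sub mem show "set_lebesgue_integral lborel A ?h = 0"
    proof (induction rule: sigma_sets_induct_disjoint)
      case (basic A)
      then obtain a b where A: "A = box a b" by auto
      obtain c d where cd: "A \<inter> ?B = box c d" using bb[of a b] A by auto
      have "set_lebesgue_integral lborel A ?h = (LBINT x. h x * indicat_real (A \<inter> ?B) x)"
        unfolding set_lebesgue_integral_def by (intro Bochner_Integration.integral_cong) (auto simp: indicator_def)
      then show ?case unfolding cd using zero by simp
    next
      case (compl A)
      then have A: "A \<in> sets lborel" by (simp add: borel_eq_box)
      have "set_lebesgue_integral lborel (A \<union> (UNIV - A)) ?h
          = set_lebesgue_integral lborel A ?h + set_lebesgue_integral lborel (UNIV - A) ?h"
        by (intro set_integral_Un si) (use A in auto)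
      with compl sall show ?case by simp
    next
      case (union A)
      then have A: "A i \<in> sets lborel" for i by (auto simp: borel_eq_box)
      have "set_lebesgue_integral lborel (\<Union>i. A i) ?h = (\<Sum>i. set_lebesgue_integral lborel (A i) ?h)"
        using union(1) A by (intro lebesgue_integral_countable_add si) (auto simp: disjoint_family_on_def)
      with union show ?case by simp
    qed (auto simp: set_lebesgue_integral_def)
  qed
  then have "AE x in lborel. \<forall>N. h x * indicat_real (box (- (real N *\<^sub>R One)) (real N *\<^sub>R One)) x = 0"
    unfolding AE_all_countable by (rule allI)
  then show ?thesis
  proof eventually_elim
    case (elim x)
    obtain N :: nat where N: "norm x < N" using reals_Archimedean2 by blast
    have "x \<in> box (- (real N *\<^sub>R One)) (real N *\<^sub>R One)"
      unfolding mem_box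
    proof (intro ballI conjI)
      fix i :: 'a assume "i \<in> Basis"
      with N Basis_le_norm[of i x] show "- (real N *\<^sub>R One) \<bullet> i < x \<bullet> i" "x \<bullet> i < (real N *\<^sub>R One) \<bullet> i"
        by (auto simp: abs_if split: if_splits)
    qed
    with elim[rule_format, of N] show ?case by simp
  qed
qed

text \<open>The fundamental lemma of the calculus of variations. Bumps converge to indicators of
  boxes and are dominated by them, so vanishing bump integrals give vanishing box integrals.\<close>

lemma bump_integrals_0_AE:
  fixes h :: "'a::euclidean_space \<Rightarrow> real"
  assumes [measurable]: "h \<in> borel_measurable borel"
    and int: "\<And>n a b. integrable lborel (\<lambda>x. h x * bump n a b x)"
    and zero: "\<And>n a b. (LBINT x. h x * bump n a b x) = 0"
  shows "AE x in lborel. h x = 0"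
proof (rule integral_box_zero_AE)
  fix a b :: 'a
  show int_box: "integrable lborel (\<lambda>x. h x * indicat_real (box a b) x)"
  proof (cases "box a b = {}")
    case False
    \<comment> \<open>A bump on the enlarged box is bounded below by a positive constant on the
      compact box. This converts integrability against bumps into integrability over the
      box.\<close>
    let ?\<psi> = "bump 0 (a - One) (b + One)"
    have sub: "cbox a b \<subseteq> box (a - One) (b + One)" by (auto simp: mem_box algebra_simps) (smt (verit))+
    have ne: "cbox a b \<noteq> {}" using False box_subset_cbox by blast
    have "continuous_on (cbox a b) ?\<psi>"
      using smooth_continuous[OF smooth_bump] continuous_on_subset by blast
    then obtain z where z: "z \<in> cbox a b" "\<forall>x\<in>cbox a b. ?\<psi> z \<le> ?\<psi> x"
      using continuous_attains_inf[OF compact_cbox ne] by blast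
    have pz: "?\<psi> z > 0" using z(1) sub by (intro bump_pos) auto
    show ?thesis
    proof (rule Bochner_Integration.integrable_bound)
      show "integrable lborel (\<lambda>x. inverse (?\<psi> z) * (h x * ?\<psi> x))"
        by (intro integrable_mult_right int)
      show "AE x in lborel. norm (h x * indicat_real (box a b) x) \<le> norm (inverse (?\<psi> z) * (h x * ?\<psi> x))"
      proof (rule AE_I2)
        fix x
        show "norm (h x * indicat_real (box a b) x) \<le> norm (inverse (?\<psi> z) * (h x * ?\<psi> x))"
        proof (cases "x \<in> box a b")
          case True
          then have "?\<psi> z \<le> ?\<psi> x" using z box_subset_cbox by blast
          then have "1 \<le> inverse (?\<psi> z) * ?\<psi> x" using pz by (simp add: field_simps)
          then have "\<bar>h x\<bar> * 1 \<le> \<bar>h x\<bar> * (inverse (?\<psi> z) * ?\<psi> x)" by (intro mult_left_mono) auto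
          then show ?thesis using True pz bump_nonneg[of 0 "a - One" "b + One" x] by (simp add: abs_mult mult_ac)
        qed simp
      qed
    qed measurable
  qed simp
  have "(\<lambda>n. (LBINT x. h x * bump n a b x)) \<longlonglongrightarrow> (LBINT x. h x * indicat_real (box a b) x)"
  proof (rule integral_dominated_convergence)
    show "integrable lborel (\<lambda>x. norm (h x * indicat_real (box a b) x))" using int_box by (rule integrable_norm)
    show "AE x in lborel. (\<lambda>n. h x * bump n a b x) \<longlonglongrightarrow> h x * indicat_real (box a b) x"
      by (intro AE_I2 tendsto_mult tendsto_const bump_tendsto)
    show "AE x in lborel. norm (h x * bump n a b x) \<le> norm (h x * indicat_real (box a b) x)" for n
    proof (rule AE_I2)
      fix x show "norm (h x * bump n a b x) \<le> norm (h x * indicat_real (box a b) x)"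
        using bump_eq_0[of x a b n] bump_le_1[of n a b x] bump_nonneg[of n a b x]
        by (cases "x \<in> box a b") (auto simp: abs_mult intro: mult_left_le)
    qed
    show "(\<lambda>x. h x * bump n a b x) \<in> borel_measurable lborel" for n
      using borel_measurable_continuous_onI[OF smooth_continuous[OF smooth_bump[of n a b]]] by measurable
  qed measurable
  moreover have "(LBINT x. h x * bump n a b x) = 0" for n by (rule zero)
  ultimately show "(LBINT x. h x * indicat_real (box a b) x) = 0"
    by (simp add: LIMSEQ_const_iff)
qed fact

subsection \<open>Gaussians are Schwartz functions\<close>

text \<open>Polynomials times one modulated, translated Gaussian. Differentiation only raises the
  degree of the polynomial, so a single inductive class yields both smoothness and decay of all
  derivatives.\<close>

inductive gsch :: "real^2 \<Rightarrow> real^2 \<Rightarrow> (real^2 \<Rightarrow> complex) \<Rightarrow> bool" for a b where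
  base: "gsch a b (\<lambda>\<xi>. cis (b \<bullet> \<xi>) * gauss 1 (a + \<xi>))"
| lin: "gsch a b f \<Longrightarrow> gsch a b (\<lambda>\<xi>. complex_of_real (\<xi> \<bullet> v) * f \<xi>)"
| add: "gsch a b f \<Longrightarrow> gsch a b g \<Longrightarrow> gsch a b (\<lambda>\<xi>. f \<xi> + g \<xi>)"
| cmult: "gsch a b f \<Longrightarrow> gsch a b (\<lambda>\<xi>. c * f \<xi>)"

lemma cis_gauss_has_derivative:
  "((\<lambda>\<xi>. cis (b \<bullet> \<xi>) * gauss 1 (a + \<xi>)) has_derivative
    (\<lambda>d. (\<i> * of_real (b \<bullet> d) - of_real (a \<bullet> d) - of_real (\<xi> \<bullet> d)) * (cis (b \<bullet> \<xi>) * gauss 1 (a + \<xi>)))) (at \<xi>)"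
proof -
  have e: "cis (b \<bullet> \<xi>) * gauss 1 (a + \<xi>) = exp (\<i> * of_real (b \<bullet> \<xi>) - of_real ((a + \<xi>) \<bullet> (a + \<xi>) / 2))" for \<xi>
  proof -
    have "complex_of_real (exp (- (1 * (norm (a + \<xi>))\<^sup>2 / 2))) = exp (- complex_of_real ((a + \<xi>) \<bullet> (a + \<xi>) / 2))"
      by (subst exp_of_real[symmetric]) (simp add: power2_norm_eq_inner)
    then show ?thesis unfolding gauss_def cis_conv_exp diff_conv_add_uminus exp_add by simp
  qed
  have "((\<lambda>\<xi>. \<i> * of_real (b \<bullet> \<xi>) - of_real ((a + \<xi>) \<bullet> (a + \<xi>) / 2)) has_derivative
     (\<lambda>d. \<i> * of_real (b \<bullet> d) - of_real ((a + \<xi>) \<bullet> d))) (at \<xi>)"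
    by (auto intro!: derivative_eq_intros simp: inner_commute)
  moreover have "(exp has_derivative (*) (exp z)) (at z)" for z :: complex
    using DERIV_exp[of z] by (simp add: has_field_derivative_def)
  ultimately have "((\<lambda>\<xi>. exp (\<i> * of_real (b \<bullet> \<xi>) - of_real ((a + \<xi>) \<bullet> (a + \<xi>) / 2))) has_derivative
     (\<lambda>d. exp (\<i> * of_real (b \<bullet> \<xi>) - of_real ((a + \<xi>) \<bullet> (a + \<xi>) / 2)) * (\<i> * of_real (b \<bullet> d) - of_real ((a + \<xi>) \<bullet> d)))) (at \<xi>)"
    by (rule has_derivative_compose)
  then show ?thesis unfolding e by (simp add: inner_add_left mult.commute diff_diff_eq)
qed

lemma gsch_differentiable: "gsch a b f \<Longrightarrow> f differentiable (at x)"
proof (induction rule: gsch.induct)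
  case base
  show ?case using cis_gauss_has_derivative by (rule differentiableI)
next
  case (lin f v)
  have "(\<lambda>\<xi>. complex_of_real (\<xi> \<bullet> v)) differentiable (at x)"
    by (rule differentiableI[where f'="\<lambda>d. complex_of_real (d \<bullet> v)"]) (auto intro!: derivative_eq_intros)
  with lin show ?case by (intro differentiable_mult)
qed auto

lemma gsch_frechet: "gsch a b f \<Longrightarrow> gsch a b (\<lambda>x. frechet_derivative f (at x) v)"
proof (induction rule: gsch.induct)
  case base
  have "frechet_derivative (\<lambda>\<xi>. cis (b \<bullet> \<xi>) * gauss 1 (a + \<xi>)) (at x) v
    = (\<i> * of_real (b \<bullet> v) - of_real (a \<bullet> v)) * (cis (b \<bullet> x) * gauss 1 (a + x))
      + (- 1) * (of_real (x \<bullet> v) * (cis (b \<bullet> x) * gauss 1 (a + x)))" for x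
    by (subst frechet_derivativeI[OF cis_gauss_has_derivative]) (simp add: algebra_simps)
  then show ?case by (simp only:) (intro gsch.add gsch.cmult gsch.lin gsch.base)
next
  case (lin f w)
  have d: "((\<lambda>\<xi>. complex_of_real (\<xi> \<bullet> w)) has_derivative (\<lambda>d. complex_of_real (d \<bullet> w))) (at x)" for x
    by (auto intro!: derivative_eq_intros)
  have "frechet_derivative (\<lambda>\<xi>. complex_of_real (\<xi> \<bullet> w) * f \<xi>) (at x) v
    = complex_of_real (x \<bullet> w) * frechet_derivative f (at x) v + complex_of_real (v \<bullet> w) * f x" for x
    by (subst frechet_derivativeI[OF has_derivative_mult[OF d frechet_derivative_worksI[OF gsch_differentiable[OF lin.hyps]]]]) simp
  then show ?case by (simp only:) (intro gsch.add gsch.cmult gsch.lin lin)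
next
  case (add f g)
  have "frechet_derivative (\<lambda>x. f x + g x) (at x) v = frechet_derivative f (at x) v + frechet_derivative g (at x) v" for x
    by (subst frechet_derivativeI[OF has_derivative_add[OF frechet_derivative_worksI[OF gsch_differentiable[OF add.hyps(1)]]
      frechet_derivative_worksI[OF gsch_differentiable[OF add.hyps(2)]]]]) simp
  then show ?case by (simp only:) (intro gsch.add add)
next
  case (cmult f c)
  have "frechet_derivative (\<lambda>x. c * f x) (at x) v = c * frechet_derivative f (at x) v" for x
    by (subst frechet_derivativeI[OF has_derivative_mult_right[OF frechet_derivative_worksI[OF gsch_differentiable[OF cmult.hyps]]]]) simp
  then show ?case by (simp only:) (intro gsch.cmult cmult)
qed

lemma gsch_decay: "gsch a b f \<Longrightarrow> \<exists>C. \<forall>x. norm x ^ k * cmod (f x) \<le> C"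
proof (induction arbitrary: k rule: gsch.induct)
  case base
  have "norm x ^ k * cmod (cis (b \<bullet> x) * gauss 1 (a + x)) \<le> fact k * exp (norm a + 1 / 2)" for x
  proof -
    define r where "r = norm (a + x)"
    have "norm x \<le> norm a + r" unfolding r_def using norm_triangle_ineq4[of "a + x" a] by simp
    \<comment> \<open>A linear bound in r is traded for r^2/2, exactly the exponent of the Gaussian,
      so the power of |x| is absorbed without loss.\<close>
    also have "r \<le> 1 / 2 + r\<^sup>2 / 2" using sum_squares_bound[of 1 r] by (simp add: power2_eq_square)
    finally have "exp (norm x) \<le> exp (norm a + 1 / 2) * exp (r\<^sup>2 / 2)" by (simp add: exp_add[symmetric])
    then have "norm x ^ k \<le> fact k * (exp (norm a + 1 / 2) * exp (r\<^sup>2 / 2))"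
      using power_le_fact_exp[of "norm x" k] by (meson fact_ge_zero mult_left_mono norm_ge_zero order_trans)
    then have "norm x ^ k * exp (- (r\<^sup>2 / 2)) \<le> fact k * (exp (norm a + 1 / 2) * exp (r\<^sup>2 / 2)) * exp (- (r\<^sup>2 / 2))"
      by (rule mult_right_mono) simp
    also have "\<dots> = fact k * exp (norm a + 1 / 2)" by (simp add: exp_minus_inverse mult.assoc)
    finally show ?thesis by (simp add: norm_mult norm_gauss r_def)
  qed
  then show ?case by blast
next
  case (lin f v)
  obtain C where C: "\<And>x. norm x ^ Suc k * cmod (f x) \<le> C" using lin.IH[of "Suc k"] by blast
  have "norm x ^ k * cmod (of_real (x \<bullet> v) * f x) \<le> norm v * C" for x
  proof -
    have "norm x ^ k * cmod (of_real (x \<bullet> v) * f x) = norm x ^ k * cmod (f x) * \<bar>x \<bullet> v\<bar>"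
      by (simp add: norm_mult)
    also have "\<dots> \<le> norm x ^ k * cmod (f x) * (norm x * norm v)"
      by (intro mult_left_mono Cauchy_Schwarz_ineq2) auto
    also have "\<dots> = norm v * (norm x ^ Suc k * cmod (f x))" by simp
    also have "\<dots> \<le> norm v * C" by (intro mult_left_mono C) simp
    finally show ?thesis .
  qed
  then show ?case by blast
next
  case (add f g)
  obtain C D where C: "\<And>x. norm x ^ k * cmod (f x) \<le> C" and D: "\<And>x. norm x ^ k * cmod (g x) \<le> D"
    using add.IH[of k] by blast
  have "norm x ^ k * cmod (f x + g x) \<le> C + D" for x
  proof -
    have "norm x ^ k * cmod (f x + g x) \<le> norm x ^ k * (cmod (f x) + cmod (g x))"
      by (intro mult_left_mono norm_triangle_ineq) simp
    then show ?thesis using C[of x] D[of x] by (simp add: distrib_left)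
  qed
  then show ?case by blast
next
  case (cmult f c)
  obtain C where C: "\<And>x. norm x ^ k * cmod (f x) \<le> C" using cmult.IH[of k] by blast
  have "norm x ^ k * cmod (c * f x) \<le> cmod c * C" for x
    using mult_left_mono[OF C[of x], of "cmod c"] by (simp add: norm_mult mult_ac)
  then show ?case by blast
qed

lemma schwartz_gsch: assumes "gsch a b f" shows "schwartz f"
  unfolding schwartz_def
proof (intro conjI allI ballI)
  show "smooth f" using assms
    by (rule smooth_coinduct[where P="gsch a b"]) (auto intro: gsch_differentiable gsch_frechet)
  fix k :: nat and vs :: "(real^2) list" assume "vs \<in> lists Basis"
  then have "gsch a b (partials vs f)" using assms by (induction vs) (auto intro: gsch_frechet)
  from gsch_decay[OF this, of k] show "bounded (range (\<lambda>x. norm x ^ k *\<^sub>R partials vs f x))"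
    by (auto simp: bounded_iff)
qed

lemma schwartz_cis_gauss: "schwartz (\<lambda>\<xi>. cis (b \<bullet> \<xi>) * gauss 1 (a + \<xi>))"
  by (rule schwartz_gsch[OF gsch.base])

subsection \<open>Schwartz functions and their Fourier transforms\<close>

text \<open>A majorant in product form: its integral factors over the coordinates, and decay of
  order (1 + |x|^2)^(-2) is below it.\<close>

lemma integrable_lorentz: "integrable lborel (\<lambda>x::real^2. complex_of_real (\<Prod>b\<in>Basis. 1 / (1 + (x \<bullet> b)\<^sup>2)))"
proof -
  have "integrable lborel (\<lambda>t::real. 1 / (1 + t\<^sup>2))"
    using integrable_inverse_1_plus_square by (simp add: set_integrable_def inverse_eq_divide)
  then have "integrable lborel (\<lambda>t::real. complex_of_real (1 / (1 + t\<^sup>2)))"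
    by (rule Bochner_Integration.integrable_of_real)
  from lborel_integral_prod(1)[of "\<lambda>_ t. complex_of_real (1 / (1 + t\<^sup>2))", OF this] show ?thesis
    by simp
qed

lemma BI_lorentz:
  assumes [measurable]: "f \<in> borel_measurable borel"
    and le: "\<And>x. cmod (f x) \<le> C * (\<Prod>b\<in>Basis. 1 / (1 + (x \<bullet> b)\<^sup>2))"
  shows "BI f"
proof (rule BI_I)
  show "integrable lborel f"
  proof (rule Bochner_Integration.integrable_bound)
    show "integrable lborel (\<lambda>x::real^2. complex_of_real C * complex_of_real (\<Prod>b\<in>Basis. 1 / (1 + (x \<bullet> b)\<^sup>2)))"
      by (intro integrable_mult_right integrable_lorentz)
    show "AE x in lborel. cmod (f x) \<le> norm (complex_of_real C * complex_of_real (\<Prod>b\<in>Basis. 1 / (1 + (x \<bullet> b)\<^sup>2)))"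
      unfolding of_real_mult[symmetric] norm_of_real
      by (intro AE_I2 order_trans[OF le abs_ge_self])
  qed measurable
  fix x :: "real^2"
  have p: "0 \<le> (\<Prod>b\<in>Basis. 1 / (1 + (x \<bullet> b)\<^sup>2))" "(\<Prod>b\<in>Basis. 1 / (1 + (x \<bullet> b)\<^sup>2)) \<le> 1"
    by (auto intro!: prod_nonneg prod_le_1 simp: divide_le_eq_1 add_pos_nonneg)
  have "cmod (f x) \<le> C * (\<Prod>b\<in>Basis. 1 / (1 + (x \<bullet> b)\<^sup>2))" by (rule le)
  also have "\<dots> \<le> \<bar>C\<bar> * 1" using p by (intro mult_mono) auto
  finally show "cmod (f x) \<le> \<bar>C\<bar>" by simp
qed

lemma prod_one_plus_le: "(\<Prod>b\<in>Basis. 1 + (x \<bullet> b)\<^sup>2) \<le> (1 + (norm (x::real^2))\<^sup>2)\<^sup>2"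
proof -
  have "(\<Prod>b\<in>Basis. 1 + (x \<bullet> b)\<^sup>2) \<le> (\<Prod>b\<in>(Basis::(real^2) set). 1 + (norm x)\<^sup>2)"
  proof (rule prod_mono)
    fix b :: "real^2" assume "b \<in> Basis"
    then have "\<bar>x \<bullet> b\<bar>\<^sup>2 \<le> (norm x)\<^sup>2" by (intro power_mono Basis_le_norm) auto
    then show "0 \<le> 1 + (x \<bullet> b)\<^sup>2 \<and> 1 + (x \<bullet> b)\<^sup>2 \<le> 1 + (norm x)\<^sup>2" by simp
  qed
  then show ?thesis by simp
qed

lemma schwartz_partials: "schwartz \<phi> \<Longrightarrow> ws \<in> lists Basis \<Longrightarrow> schwartz (partials ws \<phi>)"
  unfolding schwartz_def partials_append[symmetric] by (auto simp: smooth_partials)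

lemma schwartz_frechet: "schwartz \<phi> \<Longrightarrow> v \<in> Basis \<Longrightarrow> schwartz (\<lambda>x. frechet_derivative \<phi> (at x) v)"
  using schwartz_partials[of \<phi> "[v]"] by simp

lemma schwartz_smooth: "schwartz \<phi> \<Longrightarrow> smooth \<phi>"
  by (simp add: schwartz_def)

lemma schwartz_BI: assumes "schwartz \<phi>" shows "BI \<phi>"
proof -
  have "bounded (range (\<lambda>x. norm x ^ k *\<^sub>R \<phi> x))" for k
    using assms unfolding schwartz_def by (metis lists.Nil partials.simps(1))
  then have "\<exists>C. \<forall>x. norm x ^ k * cmod (\<phi> x) \<le> C" for k
    by (auto simp: bounded_iff)
  then obtain C where C: "\<And>k x. norm x ^ k * cmod (\<phi> x) \<le> C k" by metis
  show ?thesis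
  proof (rule BI_lorentz)
    show "\<phi> \<in> borel_measurable borel"
      by (intro borel_measurable_continuous_onI smooth_continuous schwartz_smooth assms)
    fix x
    have "(\<Prod>b\<in>Basis. 1 + (x \<bullet> b)\<^sup>2) * cmod (\<phi> x) \<le> (1 + (norm x)\<^sup>2)\<^sup>2 * cmod (\<phi> x)"
      by (intro mult_right_mono prod_one_plus_le) simp
    also have "\<dots> = norm x ^ 0 * cmod (\<phi> x) + 2 * (norm x ^ 2 * cmod (\<phi> x)) + norm x ^ 4 * cmod (\<phi> x)"
      by (simp add: power2_eq_square algebra_simps power4_eq_xxxx)
    also have "\<dots> \<le> C 0 + 2 * C 2 + C 4" by (intro add_mono mult_left_mono C) simp
    finally have "(\<Prod>b\<in>Basis. 1 + (x \<bullet> b)\<^sup>2) * cmod (\<phi> x) \<le> C 0 + 2 * C 2 + C 4" .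
    moreover have "(\<Prod>b\<in>Basis. 1 + (x \<bullet> b)\<^sup>2) > 0" by (intro prod_pos) (auto intro: add_pos_nonneg)
    ultimately show "cmod (\<phi> x) \<le> (C 0 + 2 * C 2 + C 4) * (\<Prod>b\<in>Basis. 1 / (1 + (x \<bullet> b)\<^sup>2))"
      by (simp add: prod_dividef pos_le_divide_eq mult.commute)
  qed
qed

text \<open>Integration by parts: the integral of \<open>h (x + v) - h x\<close> vanishes by translation invariance.\<close>

lemma integral_directional_derivative_0:
  fixes h :: "real^2 \<Rightarrow> complex"
  assumes h: "integrable lborel h" and d: "\<And>x. (h has_derivative D x) (at x)"
    and Dc: "continuous_on UNIV (\<lambda>x. D x v)" and Di: "integrable lborel (\<lambda>x. D x v)"
  shows "(LBINT x. D x v) = 0"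
proof -
  have [measurable]: "(\<lambda>x. D x v) \<in> borel_measurable borel" using Di by auto
  have [measurable]: "h \<in> borel_measurable borel" using h by auto
  let ?k = "\<lambda>(t::real, x). indicat_real {0..1} t *\<^sub>R D (x + t *\<^sub>R v) v"
  have shift: "(LBINT x. g (x + a)) = (LBINT x. g x)" if "g \<in> borel_measurable borel"
    for g :: "real^2 \<Rightarrow> 'c::{banach,second_countable_topology}" and a
    using integral_shift[OF that, of a] by (simp add: add.commute)
  have shifti: "integrable lborel (\<lambda>x. g (x + a))" if "integrable lborel g" for g :: "real^2 \<Rightarrow> complex" and a
    using integrable_shift[OF that, of a] by (simp add: add.commute)
  have "integrable (lborel \<Otimes>\<^sub>M lborel) ?k"
  proof (rule lborel_pair.Fubini_integrable)
    show "?k \<in> borel_measurable (lborel \<Otimes>\<^sub>M lborel)" by measurable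
    have "(LBINT x. norm (?k (t, x))) = indicat_real {0..1} t * (LBINT x. norm (D x v))" for t
      using shift[of "\<lambda>x. norm (D x v)" "t *\<^sub>R v"] by simp
    then show "integrable lborel (\<lambda>t. (LBINT x. norm (?k (t, x))))" by (simp only:) simp
    show "AE t in lborel. integrable lborel (\<lambda>x. ?k (t, x))"
      using shifti[OF Di] by (intro AE_I2) auto
  qed
  from lborel_pair.Fubini_integral[of "\<lambda>t x. ?k (t, x)"] this
  have F: "(LBINT x. (LBINT t. indicat_real {0..1} t *\<^sub>R D (x + t *\<^sub>R v) v))
      = (LBINT t. (LBINT x. indicat_real {0..1} t *\<^sub>R D (x + t *\<^sub>R v) v))" by simp
  have "(LBINT t. indicat_real {0..1} t *\<^sub>R D (x + t *\<^sub>R v) v) = h (x + 1 *\<^sub>R v) - h (x + 0 *\<^sub>R v)" for x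
  proof (rule integral_FTC_Icc)
    show "((\<lambda>t. h (x + t *\<^sub>R v)) has_vector_derivative D (x + t *\<^sub>R v) v) (at t within {0..1})" for t
    proof -
      have lin: "linear (D (x + t *\<^sub>R v))" using d has_derivative_linear by blast
      have "((\<lambda>t. x + t *\<^sub>R v) has_derivative (\<lambda>s. s *\<^sub>R v)) (at t within {0..1})"
        by (auto intro!: derivative_eq_intros)
      from has_derivative_compose[OF this d] show ?thesis
        by (simp add: has_vector_derivative_def linear_cmul[OF lin])
    qed
    show "continuous_on {0..1} (\<lambda>t. D (x + t *\<^sub>R v) v)"
      by (intro continuous_on_compose2[OF Dc] continuous_intros) auto
  qed simp
  then have "(LBINT x. (LBINT t. indicat_real {0..1} t *\<^sub>R D (x + t *\<^sub>R v) v)) = (LBINT x. h (x + v) - h x)"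
    by simp
  also have "\<dots> = 0" using shift[of h v] shifti[OF h] h by simp
  finally have "(LBINT t. (LBINT x. indicat_real {0..1} t *\<^sub>R D (x + t *\<^sub>R v) v)) = 0" using F by simp
  moreover have "(LBINT x. indicat_real {0..1} t *\<^sub>R D (x + t *\<^sub>R v) v) = indicat_real {0..1} t *\<^sub>R (LBINT x. D x v)" for t
    using shift[of "\<lambda>x. D x v" "t *\<^sub>R v"] by simp
  moreover have "(LBINT t. indicat_real {0..1::real} t *\<^sub>R (LBINT x. D x v)) = (LBINT x. D x v)"
    by (subst integral_scaleR_left) (auto simp: content_real intro!: integrable_real_indicator)
  ultimately show ?thesis by (simp only:)
qed

lemma fourier_integral_derivative:
  assumes f: "BI f" and d: "\<And>x. (f has_derivative D x) (at x)"
    and Dc: "continuous_on UNIV (\<lambda>x. D x v)" and Di: "BI (\<lambda>x. D x v)"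
  shows "fourier_integral (\<lambda>x. D x v) \<xi> = \<i> * of_real (v \<bullet> \<xi>) * fourier_integral f \<xi>"
proof -
  have fc: "continuous_on UNIV f"
    using d by (meson continuous_at_imp_continuous_on has_derivative_continuous)
  define E where "E x = cis (- (x \<bullet> \<xi>))" for x :: "real^2"
  have Ed: "(E has_derivative (\<lambda>y. - (\<i> * of_real (y \<bullet> \<xi>)) * E x)) (at x)" for x
  proof -
    have i: "((\<lambda>x. - (\<i> * of_real (x \<bullet> \<xi>))) has_derivative (\<lambda>y. - (\<i> * of_real (y \<bullet> \<xi>)))) (at x)"
      by (auto intro!: derivative_eq_intros)
    have e: "(exp has_derivative (*) (exp z)) (at z)" for z :: complex
      using DERIV_exp[of z] by (simp add: has_field_derivative_def)
    show ?thesis using has_derivative_compose[OF i e]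
      by (simp add: E_def[abs_def] cis_conv_exp mult.commute)
  qed
  have Ec: "continuous_on UNIV E" unfolding E_def by (intro continuous_intros)
  define H where "H x y = E x * D x y + - (\<i> * complex_of_real (y \<bullet> \<xi>)) * E x * f x" for x y
  have i1: "integrable lborel (\<lambda>x. E x * f x)" and i2: "integrable lborel (\<lambda>x. E x * D x v)"
    unfolding E_def by (rule integrable_cis_mult[OF BI_integrable[OF f]], measurable)
      (rule integrable_cis_mult[OF BI_integrable[OF Di]], measurable)
  have Hv: "(\<lambda>x. H x v) = (\<lambda>x. E x * D x v - \<i> * of_real (v \<bullet> \<xi>) * (E x * f x))"
    by (auto simp: H_def algebra_simps)
  have "(LBINT x. H x v) = 0"
  proof (rule integral_directional_derivative_0[OF i1])
    show "((\<lambda>x. E x * f x) has_derivative H x) (at x)" for x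
      using has_derivative_mult[OF Ed d, of x] unfolding H_def[abs_def] by simp
    show "continuous_on UNIV (\<lambda>x. H x v)" unfolding Hv by (intro continuous_intros Ec Dc fc)
    show "integrable lborel (\<lambda>x. H x v)" unfolding Hv
      by (intro Bochner_Integration.integrable_diff integrable_mult_right i1 i2)
  qed
  then have "(LBINT x. E x * D x v) = \<i> * of_real (v \<bullet> \<xi>) * (LBINT x. E x * f x)"
    unfolding Hv using i1 i2 by simp
  then show ?thesis by (simp add: fourier_integral_def E_def)
qed

lemma fourier_integral_schwartz_derivative:
  assumes "schwartz \<phi>" "v \<in> Basis"
  shows "fourier_integral (\<lambda>x. frechet_derivative \<phi> (at x) v) \<xi> = \<i> * of_real (v \<bullet> \<xi>) * fourier_integral \<phi> \<xi>"
proof (rule fourier_integral_derivative)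
  show "(\<phi> has_derivative frechet_derivative \<phi> (at x)) (at x)" for x
    by (intro frechet_derivative_worksI smooth_differentiable schwartz_smooth assms)
  show "continuous_on UNIV (\<lambda>x. frechet_derivative \<phi> (at x) v)"
    by (intro smooth_continuous schwartz_smooth schwartz_frechet assms)
qed (intro schwartz_BI schwartz_frechet assms)+

text \<open>Applying (1 - d_1^2)(1 - d_2^2) to \<phi> multiplies the transform by (1 + \<xi>_1^2)(1
  + \<xi>_2^2). The four terms of the expansion are \<phi> and, up to sign, \<phi>1, \<phi>2,
  \<phi>3; each has a bounded transform, whence the product decay.\<close>

lemma fourier_integral_schwartz_BI:
  assumes "schwartz \<phi>" shows "BI (fourier_integral \<phi>)"
proof -
  define \<Delta> where "\<Delta> v \<phi> = (\<lambda>x. \<phi> x - frechet_derivative (\<lambda>x. frechet_derivative \<phi> (at x) v) (at x) v)"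
    for v and \<phi> :: "real^2 \<Rightarrow> complex"
  have dd: "schwartz (\<lambda>x. frechet_derivative (\<lambda>x. frechet_derivative \<phi> (at x) v) (at x) v)" if "schwartz \<phi>" "v \<in> Basis" for \<phi> v
    using that by (intro schwartz_frechet)
  have F2: "fourier_integral (\<lambda>x. frechet_derivative (\<lambda>x. frechet_derivative \<phi> (at x) v) (at x) v) \<xi>
      = - of_real ((v \<bullet> \<xi>)\<^sup>2) * fourier_integral \<phi> \<xi>" if "schwartz \<phi>" "v \<in> Basis" for \<phi> v \<xi>
    using that by (simp add: fourier_integral_schwartz_derivative schwartz_frechet power2_eq_square algebra_simps)
  have B: "(Basis :: (real^2) set) = {axis 1 1, axis 2 1}"
    by (auto simp: Basis_vec_def UNIV_2)
  have ne: "axis 1 1 \<noteq> (axis 2 1 :: real^2)" by (simp add: axis_eq_axis)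
  let ?e = "axis 1 1 :: real^2" and ?f = "axis 2 1 :: real^2"
  define \<phi>1 where "\<phi>1 = (\<lambda>x. frechet_derivative (\<lambda>x. frechet_derivative \<phi> (at x) ?e) (at x) ?e)"
  define \<phi>2 where "\<phi>2 = (\<lambda>x. frechet_derivative (\<lambda>x. frechet_derivative \<phi> (at x) ?f) (at x) ?f)"
  define \<phi>3 where "\<phi>3 = (\<lambda>x. frechet_derivative (\<lambda>x. frechet_derivative \<phi>1 (at x) ?f) (at x) ?f)"
  have s1: "schwartz \<phi>1" unfolding \<phi>1_def by (rule dd[OF assms]) (simp add: B)
  have F: "fourier_integral \<phi>1 \<xi> = - of_real ((?e \<bullet> \<xi>)\<^sup>2) * fourier_integral \<phi> \<xi>"
     "fourier_integral \<phi>2 \<xi> = - of_real ((?f \<bullet> \<xi>)\<^sup>2) * fourier_integral \<phi> \<xi>"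
     "fourier_integral \<phi>3 \<xi> = - of_real ((?f \<bullet> \<xi>)\<^sup>2) * fourier_integral \<phi>1 \<xi>" for \<xi>
    unfolding \<phi>1_def \<phi>2_def \<phi>3_def by (intro F2 assms s1[unfolded \<phi>1_def]; simp add: B)+
  define K where "K = (LBINT x. cmod (\<phi> x)) + (LBINT x. cmod (\<phi>1 x)) + (LBINT x. cmod (\<phi>2 x)) + (LBINT x. cmod (\<phi>3 x))"
  show ?thesis
  proof (rule BI_lorentz)
    show "fourier_integral \<phi> \<in> borel_measurable borel"
      by (intro fourier_integral_measurable BI_measurable schwartz_BI assms)
    fix \<xi> :: "real^2"
    have P: "(\<Prod>b\<in>Basis. 1 + (\<xi> \<bullet> b)\<^sup>2) = (1 + (?e \<bullet> \<xi>)\<^sup>2) * (1 + (?f \<bullet> \<xi>)\<^sup>2)"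
      unfolding B using ne by (simp add: inner_commute)
    have eq: "of_real ((1 + (?e \<bullet> \<xi>)\<^sup>2) * (1 + (?f \<bullet> \<xi>)\<^sup>2)) * fourier_integral \<phi> \<xi>
       = fourier_integral \<phi> \<xi> - fourier_integral \<phi>1 \<xi> - fourier_integral \<phi>2 \<xi> + fourier_integral \<phi>3 \<xi>"
      unfolding F by (simp add: algebra_simps)
    have "cmod (of_real ((1 + (?e \<bullet> \<xi>)\<^sup>2) * (1 + (?f \<bullet> \<xi>)\<^sup>2)) * fourier_integral \<phi> \<xi>)
       \<le> cmod (fourier_integral \<phi> \<xi>) + cmod (fourier_integral \<phi>1 \<xi>) + cmod (fourier_integral \<phi>2 \<xi>) + cmod (fourier_integral \<phi>3 \<xi>)"
      unfolding eq using norm_triangle_ineq[of "fourier_integral \<phi> \<xi> - fourier_integral \<phi>1 \<xi> - fourier_integral \<phi>2 \<xi>" "fourier_integral \<phi>3 \<xi>"]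
        norm_triangle_ineq4[of "fourier_integral \<phi> \<xi> - fourier_integral \<phi>1 \<xi>" "fourier_integral \<phi>2 \<xi>"]
        norm_triangle_ineq4[of "fourier_integral \<phi> \<xi>" "fourier_integral \<phi>1 \<xi>"] by linarith
    also have "\<dots> \<le> K" unfolding K_def by (intro add_mono norm_fourier_integral_le)
    finally have "(\<Prod>b\<in>Basis. 1 + (\<xi> \<bullet> b)\<^sup>2) * cmod (fourier_integral \<phi> \<xi>) \<le> K"
      unfolding P by (simp add: norm_mult abs_mult del: of_real_mult of_real_add)
    moreover have "(\<Prod>b\<in>Basis. 1 + (\<xi> \<bullet> b)\<^sup>2) > 0" by (intro prod_pos) (auto intro: add_pos_nonneg)
    ultimately show "cmod (fourier_integral \<phi> \<xi>) \<le> K * (\<Prod>b\<in>Basis. 1 / (1 + (\<xi> \<bullet> b)\<^sup>2))"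
      by (simp add: prod_dividef pos_le_divide_eq mult.commute)
  qed
qed

subsection \<open>Tempered Fourier transforms\<close>

lemma has_fourier_L2FT: assumes "L2FT f F" shows "has_fourier f F"
  unfolding has_fourier_def
proof (intro conjI allI impI)
  show "f \<in> borel_measurable lborel" "F \<in> borel_measurable lborel" using L2FT_measurable[OF assms] by simp_all
  fix \<phi> :: "real^2 \<Rightarrow> complex" assume "schwartz \<phi>"
  then have \<phi>: "BI \<phi>" by (rule schwartz_BI)
  show "integrable lborel (\<lambda>x. f x * \<phi> x)"
    by (rule sq_integrable_mult[OF L2FT_sq(1)[OF assms] BI_sq_integrable[OF \<phi>]])
  show "integrable lborel (\<lambda>x. F x * \<phi> x)"
    by (rule sq_integrable_mult[OF L2FT_sq(2)[OF assms] BI_sq_integrable[OF \<phi>]])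
  show "(LBINT \<xi>. F \<xi> * \<phi> \<xi>) = (LBINT x. f x * fourier_integral \<phi> x)"
    by (rule L2FT_D[OF assms \<phi>])
qed

lemma has_fourierD:
  assumes "has_fourier f F" "schwartz \<phi>"
  shows "integrable lborel (\<lambda>x. f x * \<phi> x)" "integrable lborel (\<lambda>\<xi>. F \<xi> * \<phi> \<xi>)"
    "(LBINT \<xi>. F \<xi> * \<phi> \<xi>) = (LBINT x. f x * fourier_integral \<phi> x)"
proof -
  from assms(1) have "schwartz \<phi> \<longrightarrow> integrable lborel (\<lambda>x. f x * \<phi> x) \<and> integrable lborel (\<lambda>\<xi>. F \<xi> * \<phi> \<xi>) \<and>
      (LBINT \<xi>. F \<xi> * \<phi> \<xi>) = (LBINT x. f x * fourier_integral \<phi> x)"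
    unfolding has_fourier_def by (elim conjE) (rule spec[where x=\<phi>])
  note C = mp[OF this assms(2)]
  show "integrable lborel (\<lambda>x. f x * \<phi> x)" by (rule conjunct1[OF C])
  show "integrable lborel (\<lambda>\<xi>. F \<xi> * \<phi> \<xi>)" by (rule conjunct1[OF conjunct2[OF C]])
  show "(LBINT \<xi>. F \<xi> * \<phi> \<xi>) = (LBINT x. f x * fourier_integral \<phi> x)"
    by (rule conjunct2[OF conjunct2[OF C]])
qed

lemma has_fourier_measurable:
  assumes "has_fourier f F" shows "f \<in> borel_measurable borel" "F \<in> borel_measurable borel"
  using assms unfolding has_fourier_def by simp_all

lemma has_fourier_unique:
  assumes "has_fourier f F" "has_fourier f F'" shows "AE \<xi> in lborel. F \<xi> = F' \<xi>"
proof -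
  have "AE \<xi> in lborel. F \<xi> - F' \<xi> = 0"
  proof (rule gauss_test_eq_0)
    show "(\<lambda>x. F x - F' x) \<in> borel_measurable borel"
      by (intro borel_measurable_diff has_fourier_measurable(2)[OF assms(1)] has_fourier_measurable(2)[OF assms(2)])
    fix x
    have s: "schwartz (\<lambda>\<xi>. cis (x \<bullet> \<xi>) * gauss 1 \<xi>)" using schwartz_cis_gauss[of x 0] by simp
    have i: "integrable lborel (\<lambda>\<xi>. F \<xi> * (cis (x \<bullet> \<xi>) * gauss 1 \<xi>))" "integrable lborel (\<lambda>\<xi>. F' \<xi> * (cis (x \<bullet> \<xi>) * gauss 1 \<xi>))"
      by (rule has_fourierD(2)[OF assms(1) s] has_fourierD(2)[OF assms(2) s])+
    have e: "(LBINT \<xi>. F \<xi> * (cis (x \<bullet> \<xi>) * gauss 1 \<xi>)) = (LBINT \<xi>. F' \<xi> * (cis (x \<bullet> \<xi>) * gauss 1 \<xi>))"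
      by (simp only: has_fourierD(3)[OF assms(1) s] has_fourierD(3)[OF assms(2) s])
    show "integrable lborel (\<lambda>\<xi>. (F \<xi> - F' \<xi>) * (cis (x \<bullet> \<xi>) * gauss 1 \<xi>))"
      using Bochner_Integration.integrable_diff[OF i] by (simp add: left_diff_distrib)
    show "(LBINT \<xi>. (F \<xi> - F' \<xi>) * (cis (x \<bullet> \<xi>) * gauss 1 \<xi>)) = 0"
      using Bochner_Integration.integral_diff[OF i] e by (simp add: left_diff_distrib)
  qed
  then show ?thesis by simp
qed

lemma has_fourier_inj:
  assumes "has_fourier f F" "has_fourier f' F" shows "AE x in lborel. f x = f' x"
proof -
  have "AE \<xi> in lborel. f \<xi> - f' \<xi> = 0"
  proof (rule gauss_test_eq_0)
    show "(\<lambda>x. f x - f' x) \<in> borel_measurable borel"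
      by (intro borel_measurable_diff has_fourier_measurable(1)[OF assms(1)] has_fourier_measurable(1)[OF assms(2)])
    fix x
    have s: "schwartz (\<lambda>\<xi>. cis (x \<bullet> \<xi>) * gauss 1 \<xi>)" using schwartz_cis_gauss[of x 0] by simp
    have s2: "schwartz (\<lambda>\<xi>. gauss 1 (x + \<xi>))" using schwartz_cis_gauss[of 0 x] by simp
    have i: "integrable lborel (\<lambda>\<xi>. f \<xi> * (cis (x \<bullet> \<xi>) * gauss 1 \<xi>))" "integrable lborel (\<lambda>\<xi>. f' \<xi> * (cis (x \<bullet> \<xi>) * gauss 1 \<xi>))"
      by (rule has_fourierD(1)[OF assms(1) s] has_fourierD(1)[OF assms(2) s])+
    have "(LBINT \<xi>. f \<xi> * fourier_integral (\<lambda>\<xi>. gauss 1 (x + \<xi>)) \<xi>) = (LBINT \<xi>. f' \<xi> * fourier_integral (\<lambda>\<xi>. gauss 1 (x + \<xi>)) \<xi>)"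
      by (simp only: has_fourierD(3)[OF assms(1) s2, symmetric] has_fourierD(3)[OF assms(2) s2, symmetric])
    then have e: "of_real (2 * pi) * (LBINT \<xi>. f \<xi> * (cis (x \<bullet> \<xi>) * gauss 1 \<xi>))
        = of_real (2 * pi) * (LBINT \<xi>. f' \<xi> * (cis (x \<bullet> \<xi>) * gauss 1 \<xi>))"
      unfolding fourier_integral_shifted_gauss mult.left_commute[of _ "complex_of_real (2 * pi)"] integral_mult_right_zero .
    show "integrable lborel (\<lambda>\<xi>. (f \<xi> - f' \<xi>) * (cis (x \<bullet> \<xi>) * gauss 1 \<xi>))"
      using Bochner_Integration.integrable_diff[OF i] by (simp add: left_diff_distrib)
    show "(LBINT \<xi>. (f \<xi> - f' \<xi>) * (cis (x \<bullet> \<xi>) * gauss 1 \<xi>)) = 0"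
      using Bochner_Integration.integral_diff[OF i] e by (simp add: left_diff_distrib)
  qed
  then show ?thesis by simp
qed

text \<open>The second source of tempered transforms besides L^2: inverse integrals of integrable
  functions. The velocity requires it, because |\<xi>|^(\<alpha>-1) is singular at the origin. The
  proof is Fubini and inversion for the Schwartz function.\<close>

lemma has_fourier_L1:
  assumes U: "integrable lborel U"
  shows "has_fourier (\<lambda>x. (LBINT \<eta>. U \<eta> * cis (x \<bullet> \<eta>)) / of_real ((2 * pi)\<^sup>2)) U"
  unfolding has_fourier_def
proof (intro conjI allI impI)
  note [measurable] = borel_measurable_integrable[OF U, simplified]
  show "U \<in> borel_measurable lborel" by measurable
  show m: "(\<lambda>x. (LBINT \<eta>. U \<eta> * cis (x \<bullet> \<eta>)) / of_real ((2 * pi)\<^sup>2)) \<in> borel_measurable lborel" by measurable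
  fix \<phi> :: "real^2 \<Rightarrow> complex" assume s: "schwartz \<phi>"
  have \<phi>: "BI \<phi>" by (rule schwartz_BI[OF s])
  note [measurable] = BI_measurable[OF \<phi>]
  have F: "integrable lborel (fourier_integral \<phi>)" by (intro BI_integrable fourier_integral_schwartz_BI s)
  have le: "cmod (LBINT \<eta>. U \<eta> * cis (x \<bullet> \<eta>)) \<le> (LBINT \<eta>. cmod (U \<eta>))" for x
    using integral_norm_bound[of lborel "\<lambda>\<eta>. U \<eta> * cis (x \<bullet> \<eta>)"] by (simp add: norm_mult)
  show "integrable lborel (\<lambda>x. (LBINT \<eta>. U \<eta> * cis (x \<bullet> \<eta>)) / complex_of_real ((2 * pi)\<^sup>2) * \<phi> x)"
  proof (rule Bochner_Integration.integrable_bound)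
    show "integrable lborel (\<lambda>x. (LBINT \<eta>. cmod (U \<eta>)) / (2 * pi)\<^sup>2 * cmod (\<phi> x))"
      using BI_integrable[OF \<phi>] by simp
    show "AE x in lborel. norm ((LBINT \<eta>. U \<eta> * cis (x \<bullet> \<eta>)) / of_real ((2 * pi)\<^sup>2) * \<phi> x)
        \<le> norm ((LBINT \<eta>. cmod (U \<eta>)) / (2 * pi)\<^sup>2 * cmod (\<phi> x))"
    proof (rule AE_I2)
      fix x
      have "norm ((LBINT \<eta>. U \<eta> * cis (x \<bullet> \<eta>)) / of_real ((2 * pi)\<^sup>2) * \<phi> x)
        = cmod (LBINT \<eta>. U \<eta> * cis (x \<bullet> \<eta>)) / (2 * pi)\<^sup>2 * cmod (\<phi> x)"
        by (simp only: norm_mult norm_divide norm_of_real abs_power2)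
      also have "\<dots> \<le> (LBINT \<eta>. cmod (U \<eta>)) / (2 * pi)\<^sup>2 * cmod (\<phi> x)"
        by (intro mult_right_mono divide_right_mono le) auto
      also have "\<dots> \<le> norm ((LBINT \<eta>. cmod (U \<eta>)) / (2 * pi)\<^sup>2 * cmod (\<phi> x))" by simp
      finally show "norm ((LBINT \<eta>. U \<eta> * cis (x \<bullet> \<eta>)) / of_real ((2 * pi)\<^sup>2) * \<phi> x)
        \<le> norm ((LBINT \<eta>. cmod (U \<eta>)) / (2 * pi)\<^sup>2 * cmod (\<phi> x))" .
    qed
  qed measurable
  obtain C where C: "\<And>x. cmod (\<phi> x) \<le> C" "C > 0" using BI_bound[OF \<phi>] by blast
  show "integrable lborel (\<lambda>\<xi>. U \<xi> * \<phi> \<xi>)"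
  proof (rule Bochner_Integration.integrable_bound)
    show "integrable lborel (\<lambda>x. C * cmod (U x))" using U by simp
    have "cmod (U x) * cmod (\<phi> x) \<le> C * cmod (U x)" for x
      using mult_left_mono[OF C(1)[of x], of "cmod (U x)"] by (simp add: mult.commute)
    then show "AE x in lborel. norm (U x * \<phi> x) \<le> norm (C * cmod (U x))"
      using C(2) by (intro AE_I2) (simp add: norm_mult abs_mult)
  qed measurable
  have c: "(LBINT \<eta>. U \<eta> * cis (x \<bullet> \<eta>)) = (LBINT \<eta>. cis (x \<bullet> \<eta>) * U \<eta>)" for x
    by (simp add: mult.commute)
  have A: "(LBINT x. cis (x \<bullet> \<eta>) * fourier_integral \<phi> x) = of_real ((2 * pi)\<^sup>2) * \<phi> \<eta>" for \<eta>
    using fourier_inversion[OF \<phi> smooth_continuous[OF schwartz_smooth[OF s]] F, of \<eta>]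
    unfolding inner_commute[of \<eta>] by (simp only: mult.commute)
  have "(LBINT x. (LBINT \<eta>. U \<eta> * cis (x \<bullet> \<eta>)) * fourier_integral \<phi> x)
      = (LBINT \<eta>. U \<eta> * (LBINT x. cis (x \<bullet> \<eta>) * fourier_integral \<phi> x))"
    unfolding c by (rule Fubini_kernel[where C=1 and k="\<lambda>\<eta> x. cis (x \<bullet> \<eta>)", OF U F, symmetric]) simp_all
  also have "\<dots> = (LBINT \<eta>. U \<eta> * (complex_of_real ((2 * pi)\<^sup>2) * \<phi> \<eta>))" by (simp only: A)
  also have "(LBINT \<eta>. U \<eta> * (complex_of_real ((2 * pi)\<^sup>2) * \<phi> \<eta>)) = complex_of_real ((2 * pi)\<^sup>2) * (LBINT \<eta>. U \<eta> * \<phi> \<eta>)"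
    unfolding mult.left_commute[of _ "complex_of_real ((2 * pi)\<^sup>2)"] by (rule integral_mult_right_zero)
  finally have "(LBINT \<eta>. U \<eta> * \<phi> \<eta>) = (LBINT x. (LBINT \<eta>. U \<eta> * cis (x \<bullet> \<eta>)) * fourier_integral \<phi> x) / of_real ((2 * pi)\<^sup>2)"
    by simp
  then show "(LBINT \<xi>. U \<xi> * \<phi> \<xi>) = (LBINT x. (LBINT \<eta>. U \<eta> * cis (x \<bullet> \<eta>)) / of_real ((2 * pi)\<^sup>2) * fourier_integral \<phi> x)"
    by simp
qed

section \<open>Fourier multipliers\<close>

abbreviation cr :: "(real^2 \<Rightarrow> real) \<Rightarrow> real^2 \<Rightarrow> complex" where
  "cr f \<equiv> \<lambda>x. complex_of_real (f x)"

lemma borel_measurable_cr_iff: "cr f \<in> borel_measurable borel \<longleftrightarrow> f \<in> borel_measurable borel"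
proof
  assume "cr f \<in> borel_measurable borel"
  then have "(\<lambda>x. Re (cr f x)) \<in> borel_measurable borel" by measurable
  then show "f \<in> borel_measurable borel" by simp
qed measurable

lemma L2_iff: "f \<in> L2 \<longleftrightarrow> sq_integrable (cr f)"
  by (auto simp: L2_def sq_integrable_def borel_measurable_cr_iff[simplified])

lemma L2_norm_eq: "L2_norm f = l2n (cr f)"
  by (simp add: L2_norm_def l2n_def)

lemma has_fourier_AE_cong:
  assumes "has_fourier f F" "AE x in lborel. f x = f' x" "AE x in lborel. F x = F' x"
    and m: "f' \<in> borel_measurable borel" "F' \<in> borel_measurable borel"
  shows "has_fourier f' F'"
  unfolding has_fourier_def
proof (intro conjI allI impI)
  note [measurable] = m has_fourier_measurable[OF assms(1)]
  show "f' \<in> borel_measurable lborel" "F' \<in> borel_measurable lborel" by measurable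
  fix \<phi> :: "real^2 \<Rightarrow> complex" assume s: "schwartz \<phi>"
  note [measurable] = BI_measurable[OF schwartz_BI[OF s]]
  have a1: "AE x in lborel. f x * \<phi> x = f' x * \<phi> x" using assms(2) by eventually_elim simp
  have a2: "AE x in lborel. F x * \<phi> x = F' x * \<phi> x" using assms(3) by eventually_elim simp
  have a3: "AE x in lborel. f x * fourier_integral \<phi> x = f' x * fourier_integral \<phi> x"
    using assms(2) by eventually_elim simp
  show "integrable lborel (\<lambda>x. f' x * \<phi> x)"
    by (rule integrable_cong_AE_imp[OF has_fourierD(1)[OF assms(1) s] _ a1]) measurable
  show "integrable lborel (\<lambda>x. F' x * \<phi> x)"
    by (rule integrable_cong_AE_imp[OF has_fourierD(2)[OF assms(1) s] _ a2]) measurable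
  have "(LBINT \<xi>. F' \<xi> * \<phi> \<xi>) = (LBINT \<xi>. F \<xi> * \<phi> \<xi>)"
    by (rule integral_cong_AE[OF _ _ a2, symmetric]) measurable
  also have "\<dots> = (LBINT x. f x * fourier_integral \<phi> x)" by (rule has_fourierD(3)[OF assms(1) s])
  also have "\<dots> = (LBINT x. f' x * fourier_integral \<phi> x)"
    by (rule integral_cong_AE[OF _ _ a3]) measurable
  finally show "(LBINT \<xi>. F' \<xi> * \<phi> \<xi>) = (LBINT x. f' x * fourier_integral \<phi> x)" .
qed

lemma fourier_AE:
  assumes "L2FT (cr f) F" shows "AE \<xi> in lborel. fourier f \<xi> = F \<xi>" "fourier f \<in> borel_measurable borel"
proof -
  have "has_fourier (cr f) (fourier f)"
    unfolding fourier_def by (rule someI[where P="has_fourier (cr f)", OF has_fourier_L2FT[OF assms]])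
  then show "AE \<xi> in lborel. fourier f \<xi> = F \<xi>" "fourier f \<in> borel_measurable borel"
    using has_fourier_unique has_fourier_L2FT[OF assms] by (auto intro: has_fourier_measurable)
qed

lemma fourier_L2FT: assumes "f \<in> L2" shows "L2FT (cr f) (fourier f)"
proof -
  obtain F where F: "L2FT (cr f) F"
    using L2FT_exists_seq assms unfolding L2_iff by metis
  have "AE \<xi> in lborel. F \<xi> = fourier f \<xi>" using fourier_AE(1)[OF F] by (auto elim!: eventually_mono)
  then show ?thesis
    by (intro L2FT_AE_cong[OF F]) (use fourier_AE(2)[OF F] L2FT_measurable(1)[OF F] in auto)
qed

lemma fourier_hermitian: "f \<in> L2 \<Longrightarrow> AE \<xi> in lborel. fourier f (- \<xi>) = cnj (fourier f \<xi>)"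
  by (rule L2FT_hermitian[OF fourier_L2FT])

lemma L2_diff: "f \<in> L2 \<Longrightarrow> g \<in> L2 \<Longrightarrow> (\<lambda>x. f x - g x) \<in> L2"
  unfolding L2_iff using sq_integrable_diff by auto

lemma L2_cmult: "f \<in> L2 \<Longrightarrow> (\<lambda>x. c * f x) \<in> L2"
  unfolding L2_iff using sq_integrable_cmult[of "cr f" "complex_of_real c"] by simp

text \<open>Turns the choice behind \<open>fourier_multiplier\<close> into a computation: any
  witness shows that the choice is well posed, and injectivity of the tempered transform identifies
  the two almost everywhere.\<close>

lemma fourier_multiplier_AE:
  assumes g: "has_fourier (cr g) G" and G: "AE \<xi> in lborel. G \<xi> = m \<xi> * fourier f \<xi>"
    and meas: "(\<lambda>\<xi>. m \<xi> * fourier f \<xi>) \<in> borel_measurable borel"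
  shows "AE x in lborel. fourier_multiplier m f x = g x" "fourier_multiplier m f \<in> borel_measurable borel"
proof -
  have g': "has_fourier (cr g) (\<lambda>\<xi>. m \<xi> * fourier f \<xi>)"
    by (rule has_fourier_AE_cong[OF g _ G has_fourier_measurable(1)[OF g] meas]) simp
  then have s: "has_fourier (cr (fourier_multiplier m f)) (\<lambda>\<xi>. m \<xi> * fourier f \<xi>)"
    unfolding fourier_multiplier_def by (rule someI[where P="\<lambda>g. has_fourier (cr g) (\<lambda>\<xi>. m \<xi> * fourier f \<xi>)"])
  show "AE x in lborel. fourier_multiplier m f x = g x"
    using has_fourier_inj[OF s g'] by simp
  show "fourier_multiplier m f \<in> borel_measurable borel"
    using has_fourier_measurable(1)[OF s] by (simp only: borel_measurable_cr_iff)
qed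

lemma multiplier_L2FT:
  assumes f: "f \<in> L2" and m [measurable]: "m \<in> borel_measurable borel"
    and herm: "\<And>\<xi>. m (- \<xi>) = cnj (m \<xi>)" and sq: "sq_integrable (\<lambda>\<xi>. m \<xi> * fourier f \<xi>)"
  shows "L2FT (cr (fourier_multiplier m f)) (\<lambda>\<xi>. m \<xi> * fourier f \<xi>)"
proof -
  have "AE \<xi> in lborel. m (- \<xi>) * fourier f (- \<xi>) = cnj (m \<xi> * fourier f \<xi>)"
    using fourier_hermitian[OF f] by eventually_elim (simp add: herm)
  then obtain g where g: "L2FT (cr g) (\<lambda>\<xi>. m \<xi> * fourier f \<xi>)"
    using L2FT_inverse_real[OF sq] by blast
  note M = fourier_multiplier_AE[OF has_fourier_L2FT[OF g] _ sq_integrable_measurable[OF sq]]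
  show ?thesis
  proof (rule L2FT_AE_cong[OF g])
    show "AE x in lborel. of_real (g x) = of_real (fourier_multiplier m f x)"
      using M(1) by (auto elim!: eventually_mono)
    show "cr (fourier_multiplier m f) \<in> borel_measurable borel" using M(2) by simp
  qed (use sq_integrable_measurable[OF sq] in auto)
qed

text \<open>G is separate from m times the transform because nested choices determine the latter
  only almost everywhere. Hermitian symmetry makes the inverse integral equal to its conjugate, so
  it is a real witness for the choice.\<close>

lemma multiplier_L1_AE:
  assumes f: "f \<in> L2" and m [measurable]: "m \<in> borel_measurable borel"
    and herm: "\<And>\<xi>. m (- \<xi>) = cnj (m \<xi>)" and G: "integrable lborel G"
    and Gm: "AE \<xi> in lborel. G \<xi> = m \<xi> * fourier f \<xi>"
  shows "AE x in lborel. of_real (fourier_multiplier m f x) = (LBINT \<eta>. G \<eta> * cis (x \<bullet> \<eta>)) / of_real ((2 * pi)\<^sup>2)"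
    and "fourier_multiplier m f \<in> borel_measurable borel"
proof -
  note [measurable] = fourier_AE(2)[OF fourier_L2FT[OF f]] borel_measurable_integrable[OF G, simplified]
  define g where "g x = (LBINT \<eta>. G \<eta> * cis (x \<bullet> \<eta>)) / complex_of_real ((2 * pi)\<^sup>2)" for x
  have hG: "AE \<xi> in lborel. cnj (G \<xi>) = G (0 - \<xi>)"
    using AE_uminus[OF Gm] Gm fourier_hermitian[OF f] by eventually_elim (simp add: herm)
  have real: "g x = complex_of_real (Re (g x))" for x
  proof -
    have "cnj (LBINT \<eta>. G \<eta> * cis (x \<bullet> \<eta>)) = (LBINT \<eta>. cnj (G \<eta>) * cis (- (x \<bullet> \<eta>)))"
      by (subst Bochner_Integration.integral_cnj[symmetric]) (simp add: cis_cnj del: Bochner_Integration.integral_cnj)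
    also have "\<dots> = (LBINT \<eta>. G (0 - \<eta>) * cis (x \<bullet> (0 - \<eta>)))"
      by (rule integral_cong_AE)
        (use hG in \<open>auto elim!: eventually_mono intro!: borel_measurable_times measurable_compose[OF _ borel_measurable_cnj]\<close>)
    also have "\<dots> = (LBINT \<eta>. G \<eta> * cis (x \<bullet> \<eta>))"
      by (rule integral_flip[of "\<lambda>\<eta>. G \<eta> * cis (x \<bullet> \<eta>)"]) measurable
    finally have "cnj (g x) = g x" by (simp add: g_def)
    then show ?thesis by (simp add: complex_eq_iff)
  qed
  have hf: "has_fourier (cr (\<lambda>x. Re (g x))) G"
    using has_fourier_L1[OF G] unfolding g_def[symmetric] real[symmetric] by simp
  have "(\<lambda>\<xi>. m \<xi> * fourier f \<xi>) \<in> borel_measurable borel" by measurable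
  note M = fourier_multiplier_AE[OF hf Gm this]
  show "AE x in lborel. of_real (fourier_multiplier m f x) = (LBINT \<eta>. G \<eta> * cis (x \<bullet> \<eta>)) / of_real ((2 * pi)\<^sup>2)"
    using M(1) unfolding g_def[symmetric] by eventually_elim (simp add: real[symmetric])
  show "fourier_multiplier m f \<in> borel_measurable borel" by (rule M(2))
qed

text \<open>The \<open>H\<^sup>s\<close> norm is the \<open>L\<^sup>2\<close> norm of \<open>sobw s F\<close> for the transform \<open>F\<close>.\<close>

definition sobw :: "real \<Rightarrow> (real^2 \<Rightarrow> complex) \<Rightarrow> real^2 \<Rightarrow> complex" where
  "sobw s F \<xi> = complex_of_real ((1 + (norm \<xi>)\<^sup>2) powr (s / 2)) * F \<xi>"

lemma sobw_measurable [measurable]: "F \<in> borel_measurable borel \<Longrightarrow> sobw s F \<in> borel_measurable borel"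
  unfolding sobw_def[abs_def] by measurable

lemma powr_half_sq: "0 < x \<Longrightarrow> (x powr (s / 2))\<^sup>2 = x powr (s::real)"
  by (simp add: power2_eq_square powr_add[symmetric])

lemma norm_sobw_sq: "(cmod (sobw s F \<xi>))\<^sup>2 = (1 + (norm \<xi>)\<^sup>2) powr s * (cmod (F \<xi>))\<^sup>2"
  by (simp add: sobw_def norm_mult power_mult_distrib powr_half_sq add_pos_nonneg)

lemma Sobolev_iff: "f \<in> Sobolev s \<longleftrightarrow> f \<in> L2 \<and> sq_integrable (sobw s (fourier f))"
proof (cases "f \<in> L2")
  case True
  note [measurable] = fourier_AE(2)[OF fourier_L2FT[OF True]]
  have "sobw s (fourier f) \<in> borel_measurable borel" by measurable
  with True show ?thesis by (simp add: Sobolev_def sq_integrable_def norm_sobw_sq)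
qed (simp add: Sobolev_def)

lemma Sobolev_norm_eq: "Sobolev_norm s f = l2n (sobw s (fourier f))"
  by (simp add: Sobolev_norm_def l2n_def norm_sobw_sq)

lemma sobw_diff: "sobw s (\<lambda>\<xi>. F \<xi> - G \<xi>) \<xi> = sobw s F \<xi> - sobw s G \<xi>"
  by (simp add: sobw_def algebra_simps)

lemma one_le_powr: "1 \<le> (1 + (norm \<xi>)\<^sup>2) powr s" if "0 \<le> s"
  using that ge_one_powr_ge_zero[of "1 + (norm \<xi>)\<^sup>2" s] by simp

lemma norm_le_sobw: "0 \<le> s \<Longrightarrow> cmod (F \<xi>) \<le> cmod (sobw s F \<xi>)"
  using mult_right_mono[OF one_le_powr[of "s / 2" \<xi>], of "cmod (F \<xi>)"] by (simp add: sobw_def norm_mult)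

lemma norm_powr_le:
  assumes "0 \<le> a" "a \<le> s" shows "norm \<xi> powr a \<le> (1 + (norm (\<xi>::real^2))\<^sup>2) powr (s / 2)"
proof -
  have "norm \<xi> \<le> sqrt (1 + (norm \<xi>)\<^sup>2)" by (rule real_le_rsqrt) simp
  then have "norm \<xi> powr a \<le> sqrt (1 + (norm \<xi>)\<^sup>2) powr a"
    using assms by (intro powr_mono2) auto
  also have "\<dots> \<le> sqrt (1 + (norm \<xi>)\<^sup>2) powr s"
    using assms by (intro powr_mono) auto
  also have "\<dots> = (1 + (norm \<xi>)\<^sup>2) powr (s / 2)"
    by (simp add: powr_half_sqrt[symmetric] powr_powr add_nonneg_nonneg)
  finally show ?thesis .
qed

lemma sobw_1: "cmod (sobw 1 F \<xi>) = sqrt (1 + (norm \<xi>)\<^sup>2) * cmod (F \<xi>)"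
  by (simp add: sobw_def norm_mult powr_half_sqrt add_nonneg_nonneg)

lemma norm_mult_le_sobw_1: "norm \<xi> * cmod (F \<xi>) \<le> cmod (sobw 1 F \<xi>)"
  unfolding sobw_1 by (intro mult_right_mono real_le_rsqrt) auto

subsection \<open>Integrals of power kernels\<close>

lemma nn_integral_even_le:
  fixes g :: "real \<Rightarrow> real"
  assumes [measurable]: "g \<in> borel_measurable borel" and nn: "\<And>t. 0 \<le> g t"
  shows "(\<integral>\<^sup>+t. ennreal (g \<bar>t\<bar>) \<partial>lborel) \<le> 2 * (\<integral>\<^sup>+t. ennreal (indicat_real {0..} t * g t) \<partial>lborel)"
proof -
  let ?h = "\<lambda>t. ennreal (indicat_real {0..} t * g t)"
  have "(\<integral>\<^sup>+t. ennreal (g \<bar>t\<bar>) \<partial>lborel) \<le> (\<integral>\<^sup>+t. ?h t + ?h (0 - t) \<partial>lborel)"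
  proof (rule nn_integral_mono)
    fix t :: real
    show "ennreal (g \<bar>t\<bar>) \<le> ?h t + ?h (0 - t)"
    proof (cases "0 \<le> t")
      case True
      then have "?h t = ennreal (g \<bar>t\<bar>)" by simp
      then show ?thesis by simp
    next
      case False
      then have "?h (0 - t) = ennreal (g \<bar>t\<bar>)" by simp
      then show ?thesis by simp
    qed
  qed
  also have "\<dots> = (\<integral>\<^sup>+t. ?h t \<partial>lborel) + (\<integral>\<^sup>+t. ?h (0 - t) \<partial>lborel)"
    by (rule nn_integral_add) measurable
  also have "(\<integral>\<^sup>+t. ?h (0 - t) \<partial>lborel) = (\<integral>\<^sup>+t. ?h t \<partial>lborel)"
    by (rule nn_integral_flip) measurable
  finally show ?thesis by (simp add: mult_2)
qed

lemma nn_integral_powr_ball_real: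
  assumes "0 < a" "0 \<le> R"
  shows "(\<integral>\<^sup>+t. ennreal (if \<bar>t\<bar> \<le> R then \<bar>t\<bar> powr (a - 1) else 0) \<partial>lborel) \<le> ennreal (2 * R powr a / a)"
proof -
  let ?g = "\<lambda>t::real. if t \<le> R then t powr (a - 1) else 0"
  have "(\<integral>\<^sup>+t. ennreal (?g \<bar>t\<bar>) \<partial>lborel) \<le> 2 * (\<integral>\<^sup>+t. ennreal (indicat_real {0..} t * ?g t) \<partial>lborel)"
    by (rule nn_integral_even_le) auto
  also have "(\<integral>\<^sup>+t. ennreal (indicat_real {0..} t * ?g t) \<partial>lborel) = (\<integral>\<^sup>+t. indicator {0..R} t * ennreal (t powr (a - 1)) \<partial>lborel)"
    by (intro nn_integral_cong) (auto simp: indicator_def)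
  also have "\<dots> = ennreal (R powr (a - 1 + 1) / (a - 1 + 1))"
    using nn_integral_has_integral_lebesgue[OF _ has_integral_powr_from_0[of "a - 1" R]] assms by (simp add: ennreal_mult ennreal_indicator)
  finally show ?thesis using assms by (simp add: ennreal_mult''[symmetric] flip: ennreal_numeral)
qed

text \<open>A one-variable majorant of |t|^(a-1) / sqrt(1 + t^2), integrable at the origin because a
  > 0 and at infinity because a < 1.\<close>

definition kq :: "real \<Rightarrow> real \<Rightarrow> real" where
  "kq a t = (if \<bar>t\<bar> \<le> 1 then \<bar>t\<bar> powr (a - 1) else \<bar>t\<bar> powr (a - 2))"

lemma nn_integral_kq:
  assumes "0 < a" "a < 1" shows "(\<integral>\<^sup>+t. ennreal (kq a t) \<partial>lborel) < \<infinity>"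
proof -
  let ?g = "\<lambda>t::real. if t \<le> 1 then t powr (a - 1) else t powr (a - 2)"
  have A: "(\<integral>\<^sup>+t. ennreal (?g \<bar>t\<bar>) \<partial>lborel) \<le> 2 * (\<integral>\<^sup>+t. ennreal (indicat_real {0..} t * ?g t) \<partial>lborel)"
    by (rule nn_integral_even_le) auto
  have "(\<integral>\<^sup>+t. ennreal (indicat_real {0..} t * ?g t) \<partial>lborel)
      \<le> (\<integral>\<^sup>+t. indicator {0..1} t * ennreal (t powr (a - 1)) + indicator {1..} t * ennreal (t powr (a - 2)) \<partial>lborel)"
    by (intro nn_integral_mono) (auto simp: indicator_def)
  also have "\<dots> = (\<integral>\<^sup>+t. indicator {0..1} t * ennreal (t powr (a - 1)) \<partial>lborel) + (\<integral>\<^sup>+t. indicator {1..} t * ennreal (t powr (a - 2)) \<partial>lborel)"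
    by (rule nn_integral_add) measurable
  also have "(\<integral>\<^sup>+t. indicator {0..1} t * ennreal (t powr (a - 1)) \<partial>lborel) = ennreal (1 powr (a - 1 + 1) / (a - 1 + 1))"
    using nn_integral_has_integral_lebesgue[OF _ has_integral_powr_from_0[of "a - 1" 1]] assms by (simp add: ennreal_mult ennreal_indicator)
  also have "(\<integral>\<^sup>+t. indicator {1..} t * ennreal (t powr (a - 2)) \<partial>lborel) = ennreal (- (1 powr (a - 2 + 1)) / (a - 2 + 1))"
    using nn_integral_has_integral_lebesgue[OF _ has_integral_powr_to_inf[of "a - 2" 1]] assms by (simp add: ennreal_mult ennreal_indicator)
  finally have "(\<integral>\<^sup>+t. ennreal (indicat_real {0..} t * ?g t) \<partial>lborel) < \<infinity>" by (rule le_less_trans) simp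
  then have "2 * (\<integral>\<^sup>+t. ennreal (indicat_real {0..} t * ?g t) \<partial>lborel) < \<infinity>" by (simp add: ennreal_mult_less_top)
  with A show ?thesis unfolding kq_def by (rule le_less_trans)
qed

lemma prod_Basis_const: "(\<Prod>b\<in>(Basis::(real^2) set). c) = c\<^sup>2" for c :: "'a::comm_monoid_mult"
  by simp

lemma AE_inner_Basis_nz: "AE x in lborel. \<forall>b\<in>(Basis::(real^2) set). x \<bullet> b \<noteq> 0"
  by (rule AE_finite_allI) (auto intro: AE_lborel_inner_neq)

text \<open>In two dimensions |x|^(2a-2) is the product over the axes of |x|^(a-1), and |x|^(a-1) <=
  |x_b|^(a-1) since a < 1. Integrating over the enclosing square gives a constant that is not sharp
  but scales like R^(2a), and only the scaling matters later.\<close>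

lemma nn_integral_powr_ball:
  assumes "0 < a" "a < 1" "0 \<le> R"
  shows "(\<integral>\<^sup>+x. ennreal (if norm (x::real^2) \<le> R then norm x powr (2 * a - 2) else 0) \<partial>lborel) \<le> ennreal ((2 * R powr a / a)\<^sup>2)"
proof -
  let ?f = "\<lambda>t::real. if \<bar>t\<bar> \<le> R then \<bar>t\<bar> powr (a - 1) else 0"
  have "(\<integral>\<^sup>+x. ennreal (if norm (x::real^2) \<le> R then norm x powr (2 * a - 2) else 0) \<partial>lborel)
      \<le> (\<integral>\<^sup>+x. ennreal (\<Prod>b\<in>Basis. ?f ((x::real^2) \<bullet> b)) \<partial>lborel)"
  proof (rule nn_integral_mono_AE, use AE_inner_Basis_nz in eventually_elim, rule ennreal_leI)
    fix x :: "real^2" assume nz: "\<forall>b\<in>Basis. x \<bullet> b \<noteq> 0"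
    show "(if norm x \<le> R then norm x powr (2 * a - 2) else 0) \<le> (\<Prod>b\<in>Basis. ?f (x \<bullet> b))"
    proof (cases "norm x \<le> R")
      case True
      have "norm x powr (2 * a - 2) = (\<Prod>b\<in>(Basis::(real^2) set). norm x powr (a - 1))"
        unfolding prod_Basis_const by (simp add: power2_eq_square powr_add[symmetric])
      also have "\<dots> \<le> (\<Prod>b\<in>Basis. ?f (x \<bullet> b))"
      proof (rule prod_mono)
        fix b :: "real^2" assume b: "b \<in> Basis"
        with nz have "0 < \<bar>x \<bullet> b\<bar>" "\<bar>x \<bullet> b\<bar> \<le> norm x" by (auto simp: Basis_le_norm)
        then show "0 \<le> norm x powr (a - 1) \<and> norm x powr (a - 1) \<le> ?f (x \<bullet> b)"
          using True assms by (auto intro: powr_mono2')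
      qed
      finally show ?thesis using True by simp
    qed (auto intro!: prod_nonneg)
  qed
  also have "\<dots> = (\<Prod>b\<in>(Basis::(real^2) set). (\<integral>\<^sup>+t. ennreal (?f t) \<partial>lborel))"
    by (subst nn_integral_lborel_prod[symmetric]) (auto simp: prod_ennreal intro!: nn_integral_cong)
  also have "\<dots> = (\<integral>\<^sup>+t. ennreal (?f t) \<partial>lborel)\<^sup>2" by (rule prod_Basis_const)
  also have "\<dots> \<le> (ennreal (2 * R powr a / a))\<^sup>2"
    using nn_integral_powr_ball_real[OF assms(1,3)] by (rule power_mono) simp
  finally show ?thesis using assms by (simp add: ennreal_power)
qed

text \<open>The velocity multiplier divided by the H^1 weight. Its square behaves like |x|^(2a-2) at
  the origin and like |x|^(2a-4) at infinity, hence is integrable in the plane for 0 < a <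
  1.\<close>

definition vker :: "real \<Rightarrow> real^2 \<Rightarrow> complex" where
  "vker a x = complex_of_real (norm x powr (a - 1) / sqrt (1 + (norm x)\<^sup>2))"

lemma vker_sq_integrable:
  assumes "0 < a" "a < 1" shows "sq_integrable (vker a)"
proof -
  have [measurable]: "vker a \<in> borel_measurable borel" unfolding vker_def[abs_def] by measurable
  have "(\<integral>\<^sup>+x. ennreal ((cmod (vker a x))\<^sup>2) \<partial>lborel) \<le> (\<integral>\<^sup>+x. ennreal (\<Prod>b\<in>Basis. kq a ((x::real^2) \<bullet> b)) \<partial>lborel)"
  proof (rule nn_integral_mono_AE, use AE_inner_Basis_nz in eventually_elim, rule ennreal_leI)
    fix x :: "real^2" assume nz: "\<forall>b\<in>Basis. x \<bullet> b \<noteq> 0"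
    have "(cmod (vker a x))\<^sup>2 = (\<Prod>b\<in>(Basis::(real^2) set). norm x powr (a - 1) / sqrt (1 + (norm x)\<^sup>2))"
      unfolding prod_Basis_const by (simp only: vker_def norm_of_real power2_abs)
    also have "\<dots> \<le> (\<Prod>b\<in>Basis. kq a (x \<bullet> b))"
    proof (rule prod_mono)
      fix b :: "real^2" assume b: "b \<in> Basis"
      define t where "t = \<bar>x \<bullet> b\<bar>"
      have p: "0 < 1 + t\<^sup>2" by (rule add_pos_nonneg) auto
      have t: "0 < t" "t \<le> norm x" using nz b unfolding t_def by (auto simp: Basis_le_norm)
      have "norm x powr (a - 1) / sqrt (1 + (norm x)\<^sup>2) \<le> t powr (a - 1) / sqrt (1 + t\<^sup>2)"
      proof -
        have "0 < 1 + t\<^sup>2" by (rule add_pos_nonneg) auto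
        then show ?thesis using t assms by (intro frac_le powr_mono2') (auto intro: power_mono)
      qed
      also have "\<dots> \<le> kq a t"
      proof (cases "t \<le> 1")
        case True
        have "t powr (a - 1) / sqrt (1 + t\<^sup>2) \<le> t powr (a - 1) / 1" using p by (intro divide_left_mono) auto
        then show ?thesis using True t by (simp add: kq_def)
      next
        case False
        have "t \<le> sqrt (1 + t\<^sup>2)" by (rule real_le_rsqrt) simp
        then have "t powr (a - 1) / sqrt (1 + t\<^sup>2) \<le> t powr (a - 1) / t"
          using t p by (intro divide_left_mono) auto
        also have "\<dots> = t powr (a - 2)" using t powr_diff[of t "a - 1" 1] by simp
        finally show ?thesis using False t by (simp add: kq_def)
      qed
      finally show "0 \<le> norm x powr (a - 1) / sqrt (1 + (norm x)\<^sup>2) \<and> norm x powr (a - 1) / sqrt (1 + (norm x)\<^sup>2) \<le> kq a (x \<bullet> b)"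
        by (auto simp: kq_def t_def)
    qed
    finally show "(cmod (vker a x))\<^sup>2 \<le> (\<Prod>b\<in>Basis. kq a (x \<bullet> b))" .
  qed
  also have "\<dots> = (\<Prod>b\<in>(Basis::(real^2) set). (\<integral>\<^sup>+t. ennreal (kq a t) \<partial>lborel))"
    by (subst nn_integral_lborel_prod[symmetric]) (auto simp: prod_ennreal kq_def intro!: nn_integral_cong)
  also have "\<dots> = (\<integral>\<^sup>+t. ennreal (kq a t) \<partial>lborel)\<^sup>2" by (rule prod_Basis_const)
  also have "\<dots> < \<infinity>" using nn_integral_kq[OF assms] by (simp add: power2_eq_square ennreal_mult_less_top)
  finally have "integrable lborel (\<lambda>x. (cmod (vker a x))\<^sup>2)"
    by (intro integrableI_bounded) (auto simp: power2_eq_square)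
  then show ?thesis by (simp add: sq_integrable_def)
qed

subsection \<open>The velocity field\<close>

definition perp :: "2 \<Rightarrow> real^2 \<Rightarrow> real" where
  "perp j \<eta> = (if j = 1 then - (\<eta> $ 2) else \<eta> $ 1)"

lemma perp_le: "\<bar>perp j \<eta>\<bar> \<le> norm \<eta>"
  by (simp add: perp_def component_le_norm_cart)

lemma perp_measurable [measurable]: "perp j \<in> borel_measurable borel"
  unfolding perp_def[abs_def] by (cases "j = 1") (auto intro!: borel_measurable_continuous_onI continuous_intros)

text \<open>The transform of the j-th velocity component, with the two multipliers kept in the order
  in which the Riesz transform and then \<open>Lambda\<close> are applied.\<close>

definition vel :: "real \<Rightarrow> 2 \<Rightarrow> (real^2 \<Rightarrow> complex) \<Rightarrow> real^2 \<Rightarrow> complex" where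
  "vel \<alpha> j F \<eta> = of_real (norm \<eta> powr (\<alpha> - 1)) * (\<i> * of_real (perp j \<eta> / norm \<eta>)) * F \<eta>"

lemma vel_measurable [measurable]: "F \<in> borel_measurable borel \<Longrightarrow> vel \<alpha> j F \<in> borel_measurable borel"
  unfolding vel_def[abs_def] by measurable

lemma perp_divide_norm_le: "\<bar>perp j \<eta> / norm \<eta>\<bar> \<le> 1"
  using perp_le[of j \<eta>] by (cases "\<eta> = 0") (auto simp: divide_le_eq_1)

lemma norm_vel_le: "cmod (vel \<alpha> j F \<eta>) \<le> norm \<eta> powr (\<alpha> - 1) * cmod (F \<eta>)"
proof -
  have "cmod (vel \<alpha> j F \<eta>) = norm \<eta> powr (\<alpha> - 1) * cmod (F \<eta>) * \<bar>perp j \<eta> / norm \<eta>\<bar>"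
    by (simp add: vel_def norm_mult norm_divide)
  also have "\<dots> \<le> norm \<eta> powr (\<alpha> - 1) * cmod (F \<eta>) * 1"
    by (intro mult_left_mono perp_divide_norm_le) auto
  finally show ?thesis by simp
qed

lemma norm_vel_le_vker: "cmod (vel \<alpha> j F \<eta>) \<le> cmod (vker \<alpha> \<eta>) * cmod (sobw 1 F \<eta>)"
proof -
  have "sqrt (1 + (norm \<eta>)\<^sup>2) \<noteq> 0" by (simp add: add_nonneg_eq_0_iff)
  then have "cmod (vker \<alpha> \<eta>) * cmod (sobw 1 F \<eta>) = norm \<eta> powr (\<alpha> - 1) * cmod (F \<eta>)"
    unfolding sobw_1 vker_def by (simp add: norm_divide)
  with norm_vel_le[of \<alpha> j F \<eta>] show ?thesis by simp
qed

lemma vel_integrable: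
  assumes "0 < \<alpha>" "\<alpha> < 1" "sq_integrable (sobw 1 F)" "F \<in> borel_measurable borel"
  shows "integrable lborel (vel \<alpha> j F)"
    and "(LBINT \<eta>. cmod (vel \<alpha> j F \<eta>)) \<le> l2n (vker \<alpha>) * l2n (sobw 1 F)"
proof -
  note [measurable] = assms(4)
  note k = sq_integrable_mult_norm[OF vker_sq_integrable[OF assms(1,2)] assms(3)]
  show i: "integrable lborel (vel \<alpha> j F)"
    by (rule Bochner_Integration.integrable_bound[OF k])
      (measurable, auto intro: order_trans[OF norm_vel_le_vker])
  have "(LBINT \<eta>. cmod (vel \<alpha> j F \<eta>)) \<le> (LBINT \<eta>. cmod (vker \<alpha> \<eta>) * cmod (sobw 1 F \<eta>))"
    by (intro integral_mono integrable_norm i k norm_vel_le_vker)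
  also have "\<dots> \<le> l2n (vker \<alpha>) * l2n (sobw 1 F)"
    by (rule l2n_Cauchy_Schwarz_norm[OF vker_sq_integrable[OF assms(1,2)] assms(3)])
  finally show "(LBINT \<eta>. cmod (vel \<alpha> j F \<eta>)) \<le> l2n (vker \<alpha>) * l2n (sobw 1 F)" .
qed

lemma riesz_L2FT:
  assumes "f \<in> L2"
  shows "L2FT (cr (riesz j f)) (\<lambda>\<xi>. \<i> * of_real (\<xi> $ j / norm \<xi>) * fourier f \<xi>)"
proof -
  have [measurable]: "(\<lambda>\<xi>::real^2. \<xi> $ j) \<in> borel_measurable borel"
    by (auto intro!: borel_measurable_continuous_onI continuous_intros)
  note [measurable] = fourier_AE(2)[OF fourier_L2FT[OF assms]]
  show ?thesis unfolding riesz_def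
  proof (rule multiplier_L2FT[OF assms])
    show "(\<lambda>\<xi>. \<i> * of_real (\<xi> $ j / norm \<xi>)) \<in> borel_measurable borel" by measurable
    show "sq_integrable (\<lambda>\<xi>. \<i> * complex_of_real (\<xi> $ j / norm \<xi>) * fourier f \<xi>)"
    proof (rule sq_integrable_bound[OF L2FT_sq(2)[OF fourier_L2FT[OF assms]], of _ 1])
      fix \<xi> :: "real^2"
      have "\<bar>\<xi> $ j / norm \<xi>\<bar> \<le> 1"
        using component_le_norm_cart[of \<xi> j] by (cases "\<xi> = 0") (auto simp: divide_le_eq_1)
      then have "\<bar>\<xi> $ j / norm \<xi>\<bar> * cmod (fourier f \<xi>) \<le> 1 * cmod (fourier f \<xi>)" by (rule mult_right_mono) simp
      then show "cmod (\<i> * of_real (\<xi> $ j / norm \<xi>) * fourier f \<xi>) \<le> 1 * cmod (fourier f \<xi>)"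
        by (simp add: norm_mult norm_divide)
    qed measurable
  qed simp
qed

lemma velocity_AE:
  assumes \<alpha>: "0 < \<alpha>" "\<alpha> < 1" and f: "f \<in> Sobolev 1"
  shows "AE x in lborel. of_real (velocity \<alpha> f x $ j) = (LBINT \<eta>. vel \<alpha> j (fourier f) \<eta> * cis (x \<bullet> \<eta>)) / of_real ((2 * pi)\<^sup>2)"
    and "(\<lambda>x. velocity \<alpha> f x $ j) \<in> borel_measurable borel"
proof -
  have fL: "f \<in> L2" and fs: "sq_integrable (sobw 1 (fourier f))" using f by (auto simp: Sobolev_iff)
  note [measurable] = fourier_AE(2)[OF fourier_L2FT[OF fL]]
  let ?r = "\<lambda>y. riesz_perp f y $ j"
  have r: "L2FT (cr ?r) (\<lambda>\<xi>. (\<i> * of_real (perp j \<xi> / norm \<xi>)) * fourier f \<xi>)"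
  proof (cases "j = 1")
    case True
    have "L2FT (\<lambda>x. - 1 * cr (riesz 2 f) x) (\<lambda>\<xi>. - 1 * (\<i> * of_real (\<xi> $ 2 / norm \<xi>) * fourier f \<xi>))"
      by (rule L2FT_cmult[OF riesz_L2FT[OF fL]])
    with True show ?thesis by (simp add: riesz_perp_def perp_def vector_def)
  next
    case False
    then have j: "j = 2" using exhaust_2 by blast
    with False riesz_L2FT[OF fL, of 1] show ?thesis by (simp add: riesz_perp_def perp_def vector_def)
  qed
  have rL: "?r \<in> L2" using L2FT_sq(1)[OF r] by (simp add: L2_iff)
  have G: "AE \<xi> in lborel. vel \<alpha> j (fourier f) \<xi> = of_real (norm \<xi> powr (\<alpha> - 1)) * fourier ?r \<xi>"
    using fourier_AE(1)[OF r] by eventually_elim (simp add: vel_def mult.assoc)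
  have v: "velocity \<alpha> f x $ j = fourier_multiplier (\<lambda>\<xi>. of_real (norm \<xi> powr (\<alpha> - 1))) ?r x" for x
    by (simp add: velocity_def Lambda_def)
  have m: "(\<lambda>\<xi>::real^2. complex_of_real (norm \<xi> powr (\<alpha> - 1))) \<in> borel_measurable borel" by measurable
  note M = multiplier_L1_AE[OF rL m _ vel_integrable(1)[OF \<alpha> fs fourier_AE(2)[OF fourier_L2FT[OF fL]]] G]
  show "AE x in lborel. of_real (velocity \<alpha> f x $ j) = (LBINT \<eta>. vel \<alpha> j (fourier f) \<eta> * cis (x \<bullet> \<eta>)) / of_real ((2 * pi)\<^sup>2)"
    unfolding v by (rule M(1)) simp
  show "(\<lambda>x. velocity \<alpha> f x $ j) \<in> borel_measurable borel"
    unfolding v by (rule M(2)) simp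
qed

subsection \<open>The weak gradient\<close>

definition grad :: "2 \<Rightarrow> (real^2 \<Rightarrow> complex) \<Rightarrow> real^2 \<Rightarrow> complex" where
  "grad j F \<xi> = \<i> * of_real (\<xi> $ j) * F \<xi>"

lemma grad_measurable [measurable]: "F \<in> borel_measurable borel \<Longrightarrow> grad j F \<in> borel_measurable borel"
proof -
  have [measurable]: "(\<lambda>\<xi>::real^2. \<xi> $ j) \<in> borel_measurable borel"
    by (auto intro!: borel_measurable_continuous_onI continuous_intros)
  show "F \<in> borel_measurable borel \<Longrightarrow> grad j F \<in> borel_measurable borel"
    unfolding grad_def[abs_def] by measurable
qed

lemma norm_grad_le: "cmod (grad j F \<xi>) \<le> norm \<xi> * cmod (F \<xi>)"
  by (simp add: grad_def norm_mult component_le_norm_cart mult_right_mono)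

lemma grad_sq_integrable:
  assumes "sq_integrable (sobw 1 F)" and [measurable]: "F \<in> borel_measurable borel"
  shows "sq_integrable (grad j F)" "l2n (grad j F) \<le> l2n (sobw 1 F)"
proof -
  have le: "cmod (grad j F \<xi>) \<le> cmod (sobw 1 F \<xi>)" for \<xi>
    using norm_grad_le norm_mult_le_sobw_1 by (rule order_trans)
  show "sq_integrable (grad j F)"
    by (rule sq_integrable_bound[OF assms(1), of _ 1]) (use le in \<open>auto intro: grad_measurable assms(2)\<close>)
  show "l2n (grad j F) \<le> l2n (sobw 1 F)"
    by (rule l2n_mono[OF assms(1) _ le]) (auto intro: grad_measurable assms(2))
qed

lemma test_function_BI:
  assumes "test_function UNIV \<psi>" shows "BI (cr \<psi>)"
proof -
  have s: "smooth \<psi>" and c: "compact (closure {z. \<psi> z \<noteq> 0})" using assms by (auto simp: test_function_def)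
  let ?K = "closure {z. \<psi> z \<noteq> 0}"
  have cont: "continuous_on UNIV (cr \<psi>)"
    using smooth_continuous[OF s] by (intro continuous_intros)
  have z: "\<psi> x = 0" if "x \<notin> ?K" for x using that closure_subset[of "{z. \<psi> z \<noteq> 0}"] by blast
  have eq: "(\<lambda>x. indicat_real ?K x *\<^sub>R cr \<psi> x) = cr \<psi>"
  proof (rule ext)
    fix x show "indicat_real ?K x *\<^sub>R cr \<psi> x = cr \<psi> x" using z[of x] by (cases "x \<in> ?K") auto
  qed
  have "integrable lborel (cr \<psi>)"
    using borel_integrable_compact[OF c continuous_on_subset[OF cont]] unfolding eq by simp
  moreover have "bounded (cr \<psi> ` ?K)"
    by (intro compact_imp_bounded compact_continuous_image continuous_on_subset[OF cont] c) auto
  then obtain C where "\<And>x. x \<in> ?K \<Longrightarrow> cmod (cr \<psi> x) \<le> C" by (auto simp: bounded_iff)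
  then have "cmod (cr \<psi> x) \<le> max C 0" for x using z[of x] by (cases "x \<in> ?K") (auto simp: le_max_iff_disj)
  ultimately show ?thesis by (intro BI_I[where C="max C 0"])
qed

lemma test_function_frechet:
  assumes "test_function \<Omega> \<psi>" "v \<in> Basis" shows "test_function \<Omega> (\<lambda>x. frechet_derivative \<psi> (at x) v)"
proof -
  have s: "smooth \<psi>" and c: "compact (closure {z. \<psi> z \<noteq> 0})" "closure {z. \<psi> z \<noteq> 0} \<subseteq> \<Omega>"
    using assms by (auto simp: test_function_def)
  let ?K = "closure {z. \<psi> z \<noteq> 0}"
  have z: "0 = \<psi> x" if "x \<notin> ?K" for x using that closure_subset[of "{z. \<psi> z \<noteq> 0}"] by auto
  have "frechet_derivative \<psi> (at x) v = 0" if "x \<notin> ?K" for x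
  proof -
    have "(\<psi> has_derivative (\<lambda>_. 0)) (at x)"
    proof (rule has_derivative_transform_within_open)
      show "((\<lambda>_. 0) has_derivative (\<lambda>_. 0)) (at x)" by simp
      show "open (- ?K)" "x \<in> - ?K" using that by auto
      show "\<And>y. y \<in> - ?K \<Longrightarrow> 0 = \<psi> y" by (rule z) simp
    qed
    from frechet_derivativeI[OF this] show ?thesis by simp
  qed
  then have "closure {x. frechet_derivative \<psi> (at x) v \<noteq> 0} \<subseteq> ?K" by (intro closure_minimal) auto
  moreover from this have "compact (closure {x. frechet_derivative \<psi> (at x) v \<noteq> 0})"
    using compact_Int_closed[OF c(1) closed_closure, of "{x. frechet_derivative \<psi> (at x) v \<noteq> 0}"]
    by (simp only: inf.absorb2)
  ultimately show ?thesis unfolding test_function_def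
    using smooth_frechet[OF s assms(2)] c(2) by (intro conjI) (assumption, assumption, rule order_trans)
qed

lemma axis_Basis [simp]: "axis j (1::real) \<in> (Basis :: (real^2) set)"
  by (auto simp: Basis_vec_def)

lemma fourier_integral_test_derivative:
  assumes "test_function UNIV \<psi>"
  shows "fourier_integral (cr (\<lambda>x. frechet_derivative \<psi> (at x) (axis j 1))) \<xi> = \<i> * of_real (\<xi> $ j) * fourier_integral (cr \<psi>) \<xi>"
proof -
  have s: "smooth \<psi>" using assms by (auto simp: test_function_def)
  have "fourier_integral (\<lambda>x. of_real (frechet_derivative \<psi> (at x) (axis j 1))) \<xi>
      = \<i> * of_real (axis j 1 \<bullet> \<xi>) * fourier_integral (cr \<psi>) \<xi>"
  proof (rule fourier_integral_derivative[where D="\<lambda>x y. complex_of_real (frechet_derivative \<psi> (at x) y)"])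
    show "BI (cr \<psi>)" by (rule test_function_BI[OF assms])
    show "BI (\<lambda>x. complex_of_real (frechet_derivative \<psi> (at x) (axis j 1)))"
      by (rule test_function_BI[OF test_function_frechet[OF assms axis_Basis]])
    show "(cr \<psi> has_derivative (\<lambda>y. complex_of_real (frechet_derivative \<psi> (at x) y))) (at x)" for x
      by (intro has_derivative_of_real frechet_derivative_worksI smooth_differentiable s)
    show "continuous_on UNIV (\<lambda>x. complex_of_real (frechet_derivative \<psi> (at x) (axis j 1)))"
      by (intro continuous_intros smooth_continuous smooth_frechet s axis_Basis)
  qed
  then show ?thesis by (simp add: inner_axis')
qed

text \<open>The inverse transform of i \<xi>_j times the transform of f satisfies the defining
  identity of a weak derivative by Parseval. So the choice is well posed, and testing with bumps
  shows that it agrees almost everywhere with this function.\<close>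

lemma weak_derivative_L2FT:
  assumes f: "f \<in> Sobolev 1"
  shows "L2FT (cr (weak_derivative j f)) (grad j (fourier f))"
proof -
  have fL: "f \<in> L2" and fs: "sq_integrable (sobw 1 (fourier f))" using f by (auto simp: Sobolev_iff)
  note F = fourier_L2FT[OF fL]
  note [measurable] = L2FT_measurable[OF F]
  have sq: "sq_integrable (grad j (fourier f))" by (rule grad_sq_integrable(1)[OF fs]) measurable
  have "AE \<xi> in lborel. grad j (fourier f) (- \<xi>) = cnj (grad j (fourier f) \<xi>)"
    using fourier_hermitian[OF fL] by eventually_elim (simp add: grad_def)
  then obtain g where g: "L2FT (cr g) (grad j (fourier f))" using L2FT_inverse_real[OF sq] by blast
  define P where "P h \<longleftrightarrow> h \<in> borel_measurable lborel \<and> (\<forall>\<psi>. test_function UNIV \<psi> \<longrightarrow>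
        integrable lborel (\<lambda>x. h x * \<psi> x) \<and>
        (LBINT x. h x * \<psi> x) = - (LBINT x. f x * frechet_derivative \<psi> (at x) (axis j 1)))" for h
  have "P g" unfolding P_def
  proof (intro conjI allI impI)
    show gm: "g \<in> borel_measurable lborel" using L2FT_measurable(1)[OF g] by (simp add: borel_measurable_cr_iff[simplified])
    fix \<psi> :: "real^2 \<Rightarrow> real" assume t: "test_function UNIV \<psi>"
    note B = test_function_BI[OF t] test_function_BI[OF test_function_frechet[OF t axis_Basis[of j]]]
    have gi: "integrable lborel (\<lambda>x. cr g x * cr \<psi> x)"
      by (intro sq_integrable_mult L2FT_sq(1)[OF g] BI_sq_integrable B)
    then show "integrable lborel (\<lambda>x. g x * \<psi> x)"
      unfolding of_real_mult[symmetric] complex_of_real_integrable_eq .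
    have "of_real ((2 * pi)\<^sup>2) * (LBINT x. cr g x * cr \<psi> x) = (LBINT \<xi>. grad j (fourier f) \<xi> * fourier_integral (cr \<psi>) (- \<xi>))"
      by (rule L2FT_pairing[OF g B(1), symmetric])
    also have "\<dots> = (LBINT \<xi>. - (fourier f \<xi> * fourier_integral (cr (\<lambda>x. frechet_derivative \<psi> (at x) (axis j 1))) (- \<xi>)))"
      by (simp add: fourier_integral_test_derivative[OF t] grad_def mult_ac)
    also have "\<dots> = - (LBINT \<xi>. fourier f \<xi> * fourier_integral (cr (\<lambda>x. frechet_derivative \<psi> (at x) (axis j 1))) (- \<xi>))"
      by (rule Bochner_Integration.integral_minus)
    also have "\<dots> = - (complex_of_real ((2 * pi)\<^sup>2) * (LBINT x. cr f x * cr (\<lambda>x. frechet_derivative \<psi> (at x) (axis j 1)) x))"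
      by (simp only: L2FT_pairing[OF F B(2)])
    finally have "(LBINT x. cr g x * cr \<psi> x) = - (LBINT x. cr f x * cr (\<lambda>x. frechet_derivative \<psi> (at x) (axis j 1)) x)"
      unfolding mult_minus_right[symmetric] by (subst (asm) mult_left_cancel) simp
    then have "complex_of_real (LBINT x. g x * \<psi> x) = complex_of_real (- (LBINT x. f x * frechet_derivative \<psi> (at x) (axis j 1)))"
      unfolding of_real_minus of_real_mult[symmetric] integral_complex_of_real .
    then show "(LBINT x. g x * \<psi> x) = - (LBINT x. f x * frechet_derivative \<psi> (at x) (axis j 1))"
      by (simp only: of_real_eq_iff)
  qed
  then have Pw: "P (weak_derivative j f)"
    unfolding weak_derivative_def P_def[symmetric] by (rule someI[of P])
  have Pm: "g \<in> borel_measurable borel" "weak_derivative j f \<in> borel_measurable borel"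
    using \<open>P g\<close> Pw by (auto simp: P_def)
  have "AE x in lborel. g x - weak_derivative j f x = 0"
  proof (rule bump_integrals_0_AE)
    show "(\<lambda>x. g x - weak_derivative j f x) \<in> borel_measurable borel" using Pm by measurable
    fix n and a b :: "real^2"
    let ?\<psi> = "bump n a b"
    have t: "test_function UNIV ?\<psi>" by (rule test_function_bump) simp
    have i: "integrable lborel (\<lambda>x. g x * ?\<psi> x)" "integrable lborel (\<lambda>x. weak_derivative j f x * ?\<psi> x)"
      and e: "(LBINT x. g x * ?\<psi> x) = (LBINT x. weak_derivative j f x * ?\<psi> x)"
      using \<open>P g\<close> Pw t unfolding P_def by auto
    show "integrable lborel (\<lambda>x. (g x - weak_derivative j f x) * ?\<psi> x)"
      using Bochner_Integration.integrable_diff[OF i] by (simp add: left_diff_distrib)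
    show "(LBINT x. (g x - weak_derivative j f x) * ?\<psi> x) = 0"
      using Bochner_Integration.integral_diff[OF i] e by (simp add: left_diff_distrib)
  qed
  then have "AE x in lborel. cr g x = cr (weak_derivative j f) x" by (auto elim!: eventually_mono)
  then show ?thesis by (rule L2FT_AE_cong[OF g]) (use Pm sq_integrable_measurable[OF sq] in auto)
qed

subsection \<open>The nonlinear operator\<close>

definition NF :: "real \<Rightarrow> (real^2 \<Rightarrow> complex) \<Rightarrow> real^2 \<Rightarrow> complex" where
  "NF \<alpha> F \<xi> = of_real (norm \<xi> powr \<alpha>) * F \<xi>
     + (\<Sum>j\<in>UNIV. (LBINT \<eta>. vel \<alpha> j F \<eta> * grad j F (\<xi> - \<eta>))) / of_real ((2 * pi)\<^sup>2)"

definition mqgN :: "real \<Rightarrow> (real^2 \<Rightarrow> real) \<Rightarrow> real^2 \<Rightarrow> real" where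
  "mqgN \<alpha> f x = Lambda \<alpha> f x + velocity \<alpha> f x \<bullet> weak_gradient f x"

lemma Lambda_L2FT:
  assumes "f \<in> Sobolev 1" "0 \<le> \<alpha>" "\<alpha> \<le> 1"
  shows "L2FT (cr (Lambda \<alpha> f)) (\<lambda>\<xi>. of_real (norm \<xi> powr \<alpha>) * fourier f \<xi>)"
proof -
  have fL: "f \<in> L2" and fs: "sq_integrable (sobw 1 (fourier f))" using assms by (auto simp: Sobolev_iff)
  note [measurable] = fourier_AE(2)[OF fourier_L2FT[OF fL]]
  show ?thesis unfolding Lambda_def
  proof (rule multiplier_L2FT[OF fL])
    show "(\<lambda>\<xi>::real^2. complex_of_real (norm \<xi> powr \<alpha>)) \<in> borel_measurable borel" by measurable
    show "sq_integrable (\<lambda>\<xi>. complex_of_real (norm \<xi> powr \<alpha>) * fourier f \<xi>)"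
    proof (rule sq_integrable_bound[OF fs, of _ 1])
      fix \<xi> show "cmod (of_real (norm \<xi> powr \<alpha>) * fourier f \<xi>) \<le> 1 * cmod (sobw 1 (fourier f) \<xi>)"
        using mult_right_mono[OF norm_powr_le[OF assms(2,3), of \<xi>], of "cmod (fourier f \<xi>)"]
        by (simp add: sobw_def norm_mult)
    qed measurable
  qed simp
qed

lemma mqgN_L2FT:
  assumes \<alpha>: "0 < \<alpha>" "\<alpha> < 1" and f: "f \<in> Sobolev 1"
  shows "L2FT (cr (mqgN \<alpha> f)) (NF \<alpha> (fourier f))"
proof -
  have fL: "f \<in> L2" and fs: "sq_integrable (sobw 1 (fourier f))" using f by (auto simp: Sobolev_iff)
  note [measurable] = fourier_AE(2)[OF fourier_L2FT[OF fL]]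
  let ?c = "1 / complex_of_real ((2 * pi)\<^sup>2)"
  let ?u = "\<lambda>j x. (LBINT \<eta>. vel \<alpha> j (fourier f) \<eta> * cis (x \<bullet> \<eta>)) * cr (weak_derivative j f) x"
  let ?C = "\<lambda>j \<xi>. (LBINT \<eta>. vel \<alpha> j (fourier f) \<eta> * grad j (fourier f) (\<xi> - \<eta>))"
  have u: "L2FT (?u j) (?C j)" for j
    by (rule L2FT_mult[OF vel_integrable(1)[OF \<alpha> fs] weak_derivative_L2FT[OF f]]) measurable
  note S = L2FT_add[OF L2FT_add[OF Lambda_L2FT[OF f] u[of 1], of \<alpha> ?c] u[of 2], of ?c]
  have v: "AE x in lborel. \<forall>j. of_real (velocity \<alpha> f x $ j) = (LBINT \<eta>. vel \<alpha> j (fourier f) \<eta> * cis (x \<bullet> \<eta>)) / of_real ((2 * pi)\<^sup>2)"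
    using AE_finite_allI[of "UNIV :: 2 set", OF finite velocity_AE(1)[OF \<alpha> f]] by simp
  show ?thesis
  proof (rule L2FT_AE_cong[OF S])
    show "AE x in lborel. cr (Lambda \<alpha> f) x + ?c * ?u 1 x + ?c * ?u 2 x = complex_of_real (mqgN \<alpha> f x)"
      using v by eventually_elim (simp add: mqgN_def inner_vec_def UNIV_2 weak_gradient_def)
    show "AE \<xi> in lborel. of_real (norm \<xi> powr \<alpha>) * fourier f \<xi> + ?c * ?C 1 \<xi> + ?c * ?C 2 \<xi> = NF \<alpha> (fourier f) \<xi>"
      by (simp add: NF_def UNIV_2 add_divide_distrib)
    have [measurable]: "Lambda \<alpha> f \<in> borel_measurable borel" "weak_derivative j f \<in> borel_measurable borel" for j
      using L2FT_measurable(1)[OF Lambda_L2FT[OF f, of \<alpha>]] L2FT_measurable(1)[OF weak_derivative_L2FT[OF f, of j]] \<alpha>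
      by (auto simp: borel_measurable_cr_iff[simplified])
    note [measurable] = velocity_AE(2)[OF \<alpha> f]
    show "cr (mqgN \<alpha> f) \<in> borel_measurable borel"
      unfolding mqgN_def inner_vec_def UNIV_2 weak_gradient_def by simp
    show "NF \<alpha> (fourier f) \<in> borel_measurable borel" unfolding NF_def[abs_def] by measurable
  qed (use \<alpha> in auto)
qed

section \<open>The equation on the Fourier side\<close>

text \<open>Bumps over a product of boxes separate into a time factor and a space factor, so the
  distributional equation can be tested with products.\<close>

lemma bump_Pair:
  fixes a b t :: "'a::euclidean_space" and c d x :: "'b::euclidean_space"
  shows "bump n (a, c) (b, d) (t, x) = bump n a b t * bump n c d x"
proof -
  have "bump n (a, c) (b, d) (t, x) =
     (\<Prod>i\<in>(\<lambda>u. (u, 0)) ` (Basis :: 'a set). eflat 0 (real (Suc n) * ((t, x) \<bullet> i - (a, c) \<bullet> i)) * eflat 0 (real (Suc n) * ((b, d) \<bullet> i - (t, x) \<bullet> i)))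
   * (\<Prod>i\<in>(\<lambda>v. (0, v)) ` (Basis :: 'b set). eflat 0 (real (Suc n) * ((t, x) \<bullet> i - (a, c) \<bullet> i)) * eflat 0 (real (Suc n) * ((b, d) \<bullet> i - (t, x) \<bullet> i)))"
    unfolding bump_alt[of n "(a, c)"] Basis_prod_def by (rule prod.union_disjoint) auto
  then show ?thesis
    by (simp add: prod.reindex inj_on_def bump_alt)
qed

lemma NF_cong_AE:
  assumes "AE \<xi> in lborel. F \<xi> = G \<xi>" and [measurable]: "F \<in> borel_measurable borel" "G \<in> borel_measurable borel"
  shows "AE \<xi> in lborel. NF \<alpha> F \<xi> = NF \<alpha> G \<xi>"
proof -
  have J: "(LBINT \<eta>. vel \<alpha> j F \<eta> * grad j F (\<xi> - \<eta>)) = (LBINT \<eta>. vel \<alpha> j G \<eta> * grad j G (\<xi> - \<eta>))" for j \<xi>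
  proof (rule integral_cong_AE)
    show "AE \<eta> in lborel. vel \<alpha> j F \<eta> * grad j F (\<xi> - \<eta>) = vel \<alpha> j G \<eta> * grad j G (\<xi> - \<eta>)"
      using assms(1) AE_flip[OF assms(1), of \<xi>] by eventually_elim (simp add: vel_def grad_def)
  qed measurable
  show ?thesis
    using assms(1) by eventually_elim (simp add: NF_def J)
qed

lemma norm_powr_sq_integrable:
  assumes "0 \<le> \<alpha>" "\<alpha> \<le> 1" "sq_integrable (sobw 1 F)" and [measurable]: "F \<in> borel_measurable borel"
  shows "sq_integrable (\<lambda>\<xi>. complex_of_real (norm \<xi> powr \<alpha>) * F \<xi>)"
    "l2n (\<lambda>\<xi>. of_real (norm \<xi> powr \<alpha>) * F \<xi>) \<le> l2n (sobw 1 F)"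
proof -
  have le: "cmod (of_real (norm \<xi> powr \<alpha>) * F \<xi>) \<le> cmod (sobw 1 F \<xi>)" for \<xi>
    using mult_right_mono[OF norm_powr_le[OF assms(1,2), of \<xi>], of "cmod (F \<xi>)"]
    by (simp add: sobw_def norm_mult)
  show "sq_integrable (\<lambda>\<xi>. complex_of_real (norm \<xi> powr \<alpha>) * F \<xi>)"
    by (rule sq_integrable_bound[OF assms(3), of _ 1]) (measurable, simp add: le)
  show "l2n (\<lambda>\<xi>. of_real (norm \<xi> powr \<alpha>) * F \<xi>) \<le> l2n (sobw 1 F)"
    by (rule l2n_mono[OF assms(3) _ le]) measurable
qed

lemma sobw_sq_integrable_diff:
  "sq_integrable (sobw s F) \<Longrightarrow> sq_integrable (sobw s G) \<Longrightarrow> sq_integrable (sobw s (\<lambda>\<xi>. F \<xi> - G \<xi>))"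
  using sq_integrable_diff[of "sobw s F" "sobw s G"] by (simp add: sobw_diff[abs_def])

lemma sobw_sq_integrable_mono:
  assumes "sq_integrable (sobw s F)" "0 \<le> s" and [measurable]: "F \<in> borel_measurable borel"
  shows "sq_integrable F" "l2n F \<le> l2n (sobw s F)"
  using sq_integrable_bound[OF assms(1,3), of 1] l2n_mono[OF assms(1,3)] norm_le_sobw[OF assms(2)] by auto

text \<open>The 2 counts the velocity components, \<open>l2n (vker \<alpha>)\<close> bounds the L^1
  norm of their transforms in terms of H^1, and (2 pi)^2 is the normalisation of the
  convolution.\<close>

definition NFc :: "real \<Rightarrow> real" where
  "NFc \<alpha> = 2 * l2n (vker \<alpha>) / (2 * pi)\<^sup>2"

text \<open>The nonlinear part is quadratic: B(F,F) - B(G,G) = B(H,F) + B(G,H) with H = F - G, and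
  each term is an L^1-L^2 convolution. The result is local Lipschitz continuity from H^1 to L^2,
  which makes the nonlinear term continuous in time.\<close>

lemma NF_diff:
  assumes \<alpha>: "0 < \<alpha>" "\<alpha> < 1" and F: "sq_integrable (sobw 1 F)" and G: "sq_integrable (sobw 1 G)"
    and [measurable]: "F \<in> borel_measurable borel" "G \<in> borel_measurable borel"
  shows "l2n (\<lambda>\<xi>. NF \<alpha> F \<xi> - NF \<alpha> G \<xi>)
    \<le> (1 + NFc \<alpha> * (l2n (sobw 1 F) + l2n (sobw 1 G))) * l2n (sobw 1 (\<lambda>\<xi>. F \<xi> - G \<xi>))"
proof -
  define H where "H \<xi> = F \<xi> - G \<xi>" for \<xi>
  have [measurable]: "H \<in> borel_measurable borel" unfolding H_def[abs_def] by measurable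
  have Hs: "sq_integrable (sobw 1 H)" unfolding H_def[abs_def] by (rule sobw_sq_integrable_diff[OF F G])
  let ?A = "\<lambda>j \<xi>. (LBINT \<eta>. vel \<alpha> j H \<eta> * grad j F (\<xi> - \<eta>))"
  let ?B = "\<lambda>j \<xi>. (LBINT \<eta>. vel \<alpha> j G \<eta> * grad j H (\<xi> - \<eta>))"
  let ?c = "1 / complex_of_real ((2 * pi)\<^sup>2)"
  let ?L = "\<lambda>\<xi>. complex_of_real (norm \<xi> powr \<alpha>) * H \<xi>"
  note vi = vel_integrable[OF \<alpha>]
  have sq: "sq_integrable (?A j)" "sq_integrable (?B j)" "sq_integrable ?L" for j
    using \<alpha> by (auto intro!: Young_convolution(1) vi grad_sq_integrable(1) norm_powr_sq_integrable(1) F G Hs)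
  have AB: "l2n (?A j) \<le> l2n (vker \<alpha>) * l2n (sobw 1 H) * l2n (sobw 1 F)"
    "l2n (?B j) \<le> l2n (vker \<alpha>) * l2n (sobw 1 G) * l2n (sobw 1 H)" for j
  proof -
    have "l2n (?A j) \<le> (LBINT \<eta>. cmod (vel \<alpha> j H \<eta>)) * l2n (grad j F)"
      by (rule Young_convolution(3)) (auto intro!: vi grad_sq_integrable(1) F Hs)
    also have "\<dots> \<le> (l2n (vker \<alpha>) * l2n (sobw 1 H)) * l2n (sobw 1 F)"
      by (intro mult_mono vi grad_sq_integrable(2) F Hs) auto
    finally show "l2n (?A j) \<le> l2n (vker \<alpha>) * l2n (sobw 1 H) * l2n (sobw 1 F)" .
    have "l2n (?B j) \<le> (LBINT \<eta>. cmod (vel \<alpha> j G \<eta>)) * l2n (grad j H)"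
      by (rule Young_convolution(3)) (auto intro!: vi grad_sq_integrable(1) G Hs)
    also have "\<dots> \<le> (l2n (vker \<alpha>) * l2n (sobw 1 G)) * l2n (sobw 1 H)"
      by (intro mult_mono vi grad_sq_integrable(2) G Hs) auto
    finally show "l2n (?B j) \<le> l2n (vker \<alpha>) * l2n (sobw 1 G) * l2n (sobw 1 H)" .
  qed
  have I: "AE \<xi> in lborel. integrable lborel (\<lambda>\<eta>. vel \<alpha> j H \<eta> * grad j F (\<xi> - \<eta>)) \<and>
      integrable lborel (\<lambda>\<eta>. vel \<alpha> j G \<eta> * grad j H (\<xi> - \<eta>)) \<and>
      integrable lborel (\<lambda>\<eta>. vel \<alpha> j G \<eta> * grad j G (\<xi> - \<eta>))" for j
    by (intro AE_conjI Young_convolution(2) vi grad_sq_integrable(1) F G Hs) measurable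
  have J: "AE \<xi> in lborel. (LBINT \<eta>. vel \<alpha> j F \<eta> * grad j F (\<xi> - \<eta>)) - (LBINT \<eta>. vel \<alpha> j G \<eta> * grad j G (\<xi> - \<eta>)) = ?A j \<xi> + ?B j \<xi>" for j
    using I[of j]
  proof eventually_elim
    case (elim \<xi>)
    have v: "vel \<alpha> j H \<eta> = vel \<alpha> j F \<eta> - vel \<alpha> j G \<eta>" "grad j H \<zeta> = grad j F \<zeta> - grad j G \<zeta>" for \<eta> \<zeta>
      unfolding vel_def grad_def H_def by (rule right_diff_distrib)+
    have "(LBINT \<eta>. vel \<alpha> j F \<eta> * grad j F (\<xi> - \<eta>))
      = (LBINT \<eta>. vel \<alpha> j H \<eta> * grad j F (\<xi> - \<eta>) + vel \<alpha> j G \<eta> * grad j H (\<xi> - \<eta>) + vel \<alpha> j G \<eta> * grad j G (\<xi> - \<eta>))"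
      unfolding v by (intro arg_cong[where f="integral\<^sup>L lborel"] ext) (simp add: algebra_simps)
    also have "\<dots> = ?A j \<xi> + ?B j \<xi> + (LBINT \<eta>. vel \<alpha> j G \<eta> * grad j G (\<xi> - \<eta>))"
      using elim by (simp add: Bochner_Integration.integral_add)
    finally show ?case by simp
  qed
  let ?R = "\<lambda>\<xi>. ?L \<xi> + ?c * (?A 1 \<xi> + ?B 1 \<xi> + (?A 2 \<xi> + ?B 2 \<xi>))"
  have "AE \<xi> in lborel. NF \<alpha> F \<xi> - NF \<alpha> G \<xi> = ?R \<xi>"
    using J[of 1] J[of 2]
  proof eventually_elim
    case (elim \<xi>)
    have "NF \<alpha> F \<xi> - NF \<alpha> G \<xi> = ?L \<xi> + ?c * (((LBINT \<eta>. vel \<alpha> 1 F \<eta> * grad 1 F (\<xi> - \<eta>)) - (LBINT \<eta>. vel \<alpha> 1 G \<eta> * grad 1 G (\<xi> - \<eta>)))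
       + ((LBINT \<eta>. vel \<alpha> 2 F \<eta> * grad 2 F (\<xi> - \<eta>)) - (LBINT \<eta>. vel \<alpha> 2 G \<eta> * grad 2 G (\<xi> - \<eta>))))"
      by (simp add: NF_def UNIV_2 H_def algebra_simps add_divide_distrib diff_divide_distrib)
    then show ?case unfolding elim .
  qed
  then have "l2n (\<lambda>\<xi>. NF \<alpha> F \<xi> - NF \<alpha> G \<xi>) = l2n ?R"
    by (rule l2n_AE_cong[rotated 2]) (unfold NF_def[abs_def], measurable)
  also have "\<dots> \<le> l2n ?L + l2n (\<lambda>\<xi>. ?c * (?A 1 \<xi> + ?B 1 \<xi> + (?A 2 \<xi> + ?B 2 \<xi>)))"
    by (intro l2n_triangle sq sq_integrable_add sq_integrable_cmult)
  also have "l2n (\<lambda>\<xi>. ?c * (?A 1 \<xi> + ?B 1 \<xi> + (?A 2 \<xi> + ?B 2 \<xi>))) = 1 / (2 * pi)\<^sup>2 * l2n (\<lambda>\<xi>. ?A 1 \<xi> + ?B 1 \<xi> + (?A 2 \<xi> + ?B 2 \<xi>))"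
    unfolding l2n_cmult by (simp add: norm_divide norm_power norm_mult)
  also have "l2n (\<lambda>\<xi>. ?A 1 \<xi> + ?B 1 \<xi> + (?A 2 \<xi> + ?B 2 \<xi>)) \<le> (l2n (?A 1) + l2n (?B 1)) + (l2n (?A 2) + l2n (?B 2))"
    by (intro order_trans[OF l2n_triangle] add_mono l2n_triangle sq sq_integrable_add)
  also have "\<dots> \<le> 2 * (l2n (vker \<alpha>) * l2n (sobw 1 H) * l2n (sobw 1 F)) + 2 * (l2n (vker \<alpha>) * l2n (sobw 1 G) * l2n (sobw 1 H))"
    using AB[of 1] AB[of 2] by simp
  also have "l2n ?L \<le> l2n (sobw 1 H)"
    using \<alpha> by (intro norm_powr_sq_integrable(2) Hs) auto
  finally have "l2n (\<lambda>\<xi>. NF \<alpha> F \<xi> - NF \<alpha> G \<xi>) \<le> l2n (sobw 1 H)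
     + 1 / (2 * pi)\<^sup>2 * (2 * (l2n (vker \<alpha>) * l2n (sobw 1 H) * l2n (sobw 1 F)) + 2 * (l2n (vker \<alpha>) * l2n (sobw 1 G) * l2n (sobw 1 H)))"
    by (simp add: divide_right_mono)
  also have "\<dots> = (1 + NFc \<alpha> * (l2n (sobw 1 F) + l2n (sobw 1 G))) * l2n (sobw 1 H)"
    unfolding NFc_def by (simp only: divide_inverse) (simp add: algebra_simps)
  finally show ?thesis unfolding H_def[abs_def] .
qed

text \<open>The curve is controlled only for times in the interval, so off the good set the family
  is replaced by its limit; this does not change the limit along the filter.\<close>

lemma inner_tendsto_within:
  assumes ev: "\<forall>\<^sub>F r in S. sq_integrable (a r) \<and> sq_integrable (b r)" and AB: "sq_integrable A" "sq_integrable B"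
    and lim: "((\<lambda>r. l2n (\<lambda>x. a r x - A x)) \<longlongrightarrow> 0) S" "((\<lambda>r. l2n (\<lambda>x. b r x - B x)) \<longlongrightarrow> 0) S"
  shows "((\<lambda>r. (LBINT x. a r x * b r x)) \<longlongrightarrow> (LBINT x. A x * B x)) S"
proof -
  define P where "P r \<longleftrightarrow> sq_integrable (a r) \<and> sq_integrable (b r)" for r
  have ev: "\<forall>\<^sub>F r in S. P r" using ev by (simp add: P_def)
  have "((\<lambda>r. (LBINT x. (if P r then a r else A) x * (if P r then b r else B) x)) \<longlongrightarrow> (LBINT x. A x * B x)) S"
  proof (rule inner_tendsto)
    show "sq_integrable (if P r then a r else A)" "sq_integrable (if P r then b r else B)" for r
      using AB by (auto simp: P_def)
    show "((\<lambda>r. l2n (\<lambda>x. (if P r then a r else A) x - A x)) \<longlongrightarrow> 0) S"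
      by (rule Lim_transform_eventually[OF lim(1)]) (use ev in eventually_elim, simp)
    show "((\<lambda>r. l2n (\<lambda>x. (if P r then b r else B) x - B x)) \<longlongrightarrow> 0) S"
      by (rule Lim_transform_eventually[OF lim(2)]) (use ev in eventually_elim, simp)
  qed (use AB in auto)
  then show ?thesis
    by (rule Lim_transform_eventually) (use ev in eventually_elim, simp)
qed

text \<open>A representative of the transform of a real function with exact Hermitian symmetry.\<close>

definition hft :: "(real^2 \<Rightarrow> real) \<Rightarrow> real^2 \<Rightarrow> complex" where
  "hft f \<xi> = (fourier f \<xi> + cnj (fourier f (- \<xi>))) / 2"

lemma hft_hermitian: "hft f (- \<xi>) = cnj (hft f \<xi>)"
  by (simp add: hft_def add.commute)

lemma hft_AE: assumes "f \<in> L2" shows "AE \<xi> in lborel. fourier f \<xi> = hft f \<xi>"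
  using fourier_hermitian[OF assms] by eventually_elim (simp add: hft_def)

lemma hft_measurable: assumes "f \<in> L2" shows "hft f \<in> borel_measurable borel"
proof -
  note [measurable] = fourier_AE(2)[OF fourier_L2FT[OF assms]]
  show ?thesis unfolding hft_def[abs_def]
    by (intro borel_measurable_divide borel_measurable_add measurable_compose[OF _ borel_measurable_cnj]) measurable
qed

lemma hft_L2FT: assumes "f \<in> L2" shows "L2FT (cr f) (hft f)"
  by (rule L2FT_AE_cong[OF fourier_L2FT[OF assms] _ hft_AE[OF assms] _ hft_measurable[OF assms]])
    (use L2FT_measurable(1)[OF fourier_L2FT[OF assms]] in auto)

lemma Sobolev_L2FT:
  assumes "L2FT (cr f) F" shows "f \<in> Sobolev s \<longleftrightarrow> sq_integrable (sobw s F)"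
proof -
  note [measurable] = L2FT_measurable(2)[OF assms] fourier_AE(2)[OF assms]
  have a: "AE \<xi> in lborel. sobw s (fourier f) \<xi> = sobw s F \<xi>"
    using fourier_AE(1)[OF assms] by eventually_elim (simp add: sobw_def)
  then have b: "AE \<xi> in lborel. sobw s F \<xi> = sobw s (fourier f) \<xi>" by eventually_elim simp
  show ?thesis unfolding Sobolev_iff L2_iff
    using L2FT_sq(1)[OF assms] sq_integrable_AE_cong[OF _ _ a] sq_integrable_AE_cong[OF _ _ b] by auto
qed

lemma Sobolev_norm_cong:
  assumes "L2FT (cr f) F" shows "Sobolev_norm s f = l2n (sobw s F)"
proof -
  note [measurable] = L2FT_measurable(2)[OF assms] fourier_AE(2)[OF assms]
  have "AE \<xi> in lborel. sobw s (fourier f) \<xi> = sobw s F \<xi>"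
    using fourier_AE(1)[OF assms] by eventually_elim (simp add: sobw_def)
  then show ?thesis unfolding Sobolev_norm_eq by (intro l2n_AE_cong) auto
qed

lemma Sobolev_norm_diff:
  assumes "f \<in> L2" "g \<in> L2"
  shows "Sobolev_norm s (\<lambda>x. f x - g x) = l2n (sobw s (\<lambda>\<xi>. hft f \<xi> - hft g \<xi>))"
  by (rule Sobolev_norm_cong) (use L2FT_diff[OF hft_L2FT[OF assms(1)] hft_L2FT[OF assms(2)]] in simp)

lemma eventually_within_mem: "\<forall>\<^sub>F r in at t within A. r \<in> A"
  by (simp add: eventually_at_filter)

text \<open>If m t were positive, a bump supported where m is positive would make the product
  nonnegative with zero integral, hence zero at t. The one-sided form is applied to m and to -m; a
  single n is enough because each bump is positive on the whole box.\<close>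

lemma nonpos_if_bump_integrals_0:
  fixes m :: "real \<Rightarrow> real"
  assumes m: "continuous_on {0..T} m"
    and zero: "\<And>a b. {a..b} \<subseteq> {0<..<T} \<Longrightarrow> ((\<lambda>t. bump n a b t * m t) has_integral 0) {0..T}"
    and t: "0 < t" "t < T"
  shows "m t \<le> 0"
proof (rule ccontr)
  assume "\<not> m t \<le> 0"
  then have "0 < m t" by simp
  have mo: "continuous_on {0<..<T} m" using m by (rule continuous_on_subset) auto
  have "open ({0<..<T} \<inter> m -` {0<..})"
    using mo by (intro continuous_open_preimage) auto
  moreover have "t \<in> {0<..<T} \<inter> m -` {0<..}" using t \<open>0 < m t\<close> by simp
  ultimately obtain e where e: "e > 0" "ball t e \<subseteq> {0<..<T} \<inter> m -` {0<..}"
    unfolding open_contains_ball by blast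
  define a b where "a = t - e / 2" and "b = t + e / 2"
  have ab: "{a..b} \<subseteq> ball t e" using e(1) by (auto simp: a_def b_def dist_real_def)
  have tab: "t \<in> box a b" using e(1) by (auto simp: a_def b_def)
  have "(bump n a b t * m t) = 0"
  proof (rule has_integral_0_cbox_imp_0[of 0 T "\<lambda>t. bump n a b t * m t"])
    show "continuous_on (cbox 0 T) (\<lambda>t. bump n a b t * m t)"
      using m continuous_on_subset[OF smooth_continuous[OF smooth_bump[of n a b]], of "{0..T}"] by (auto intro: continuous_on_mult)
    show "0 \<le> bump n a b s * m s" if "s \<in> box 0 T" for s
    proof (cases "s \<in> box a b")
      case True
      then have "s \<in> {a..b}" by auto
      then have "s \<in> m -` {0<..}" using ab e(2) by blast
      then have "m s > 0" by simp
      then show ?thesis using bump_nonneg[of n a b s] by simp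
    qed (simp add: bump_eq_0)
    show "((\<lambda>t. bump n a b t * m t) has_integral 0) (cbox 0 T)" using zero[of a b] ab e(2) by auto
  qed (use t in auto)
  with bump_pos[OF tab, of n] \<open>0 < m t\<close> show False by simp
qed

lemma weighted_cnj:
  assumes [measurable]: "w \<in> borel_measurable borel" and B: "\<And>\<xi>. \<bar>w \<xi>\<bar> \<le> B" and F: "sq_integrable F"
  shows "sq_integrable (\<lambda>\<xi>. complex_of_real (w \<xi>) * cnj (F \<xi>))"
    and "l2n (\<lambda>\<xi>. of_real (w \<xi>) * cnj (F \<xi>)) \<le> B * l2n F"
proof -
  have B0: "0 \<le> B" using B[of undefined] by linarith
  show sq: "sq_integrable (\<lambda>\<xi>. complex_of_real (w \<xi>) * cnj (F \<xi>))"
  proof (rule sq_integrable_bound[OF F, of _ B])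
    show "(\<lambda>\<xi>. of_real (w \<xi>) * cnj (F \<xi>)) \<in> borel_measurable borel"
      using sq_integrable_measurable[OF sq_integrable_cnj[OF F]] by measurable
  qed (use B in \<open>auto simp: norm_mult intro: mult_right_mono\<close>)
  have "l2n (\<lambda>\<xi>. of_real (w \<xi>) * cnj (F \<xi>)) \<le> l2n (\<lambda>\<xi>. of_real B * F \<xi>)"
    by (rule l2n_mono[OF sq_integrable_cmult[OF F] sq_integrable_measurable[OF sq]])
      (use B B0 in \<open>auto simp: norm_mult intro: mult_right_mono\<close>)
  then show "l2n (\<lambda>\<xi>. of_real (w \<xi>) * cnj (F \<xi>)) \<le> B * l2n F"
    unfolding l2n_cmult using B0 by simp
qed

section \<open>The solution curve in Fourier variables\<close>

locale mqg_flow =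
  fixes \<alpha> T :: real and \<theta>0 :: "real^2 \<Rightarrow> real" and \<theta> \<theta>' :: "real \<Rightarrow> real^2 \<Rightarrow> real"
  assumes \<alpha>: "0 < \<alpha>" "\<alpha> < 1" and T: "0 < T"
    and sol: "mqg_solution \<alpha> T \<theta>0 \<theta>"
    and \<theta>': "\<theta>' \<in> C_L2 0 T"
    and C1: "\<And>t. t \<in> {0..T} \<Longrightarrow>
        ((\<lambda>r. L2_norm (\<lambda>x. (\<theta> r x - \<theta> t x) / (r - t) - \<theta>' t x)) \<longlongrightarrow> 0) (at t within {0..T})"
    and CH: "\<theta> \<in> C_Sobolev 0 T 1"
begin

definition X :: "real \<Rightarrow> real^2 \<Rightarrow> complex" where "X t = hft (\<theta> t)"
definition Y :: "real \<Rightarrow> real^2 \<Rightarrow> complex" where "Y t = hft (\<theta>' t)"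

lemma H1: "t \<in> {0..T} \<Longrightarrow> \<theta> t \<in> Sobolev 1"
  using CH by (simp add: C_Sobolev_def)

lemma inL2: "t \<in> {0..T} \<Longrightarrow> \<theta> t \<in> L2"
  using H1 by (simp add: Sobolev_iff)

lemma inL2': "t \<in> {0..T} \<Longrightarrow> \<theta>' t \<in> L2"
  using \<theta>' by (simp add: C_L2_def)

lemma X_L2FT: "t \<in> {0..T} \<Longrightarrow> L2FT (cr (\<theta> t)) (X t)"
  unfolding X_def by (intro hft_L2FT inL2)

lemma Y_L2FT: "t \<in> {0..T} \<Longrightarrow> L2FT (cr (\<theta>' t)) (Y t)"
  unfolding Y_def by (intro hft_L2FT inL2')

lemma X_measurable: "t \<in> {0..T} \<Longrightarrow> X t \<in> borel_measurable borel"
  by (rule L2FT_measurable(2)[OF X_L2FT])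

lemma X_herm: "X t (- \<xi>) = cnj (X t \<xi>)"
  by (simp add: X_def hft_hermitian)

lemma X_H1: "t \<in> {0..T} \<Longrightarrow> sq_integrable (sobw 1 (X t))"
  using H1 Sobolev_L2FT[OF X_L2FT] by blast

lemma X_sq: "t \<in> {0..T} \<Longrightarrow> sq_integrable (X t)"
  by (rule L2FT_sq(2)[OF X_L2FT])

lemma Y_sq: "t \<in> {0..T} \<Longrightarrow> sq_integrable (Y t)"
  by (rule L2FT_sq(2)[OF Y_L2FT])

lemma X_cont_H1:
  assumes t: "t \<in> {0..T}"
  shows "((\<lambda>r. l2n (sobw 1 (\<lambda>\<xi>. X r \<xi> - X t \<xi>))) \<longlongrightarrow> 0) (at t within {0..T})"
proof (rule Lim_transform_eventually)
  show "((\<lambda>r. Sobolev_norm 1 (\<lambda>x. \<theta> r x - \<theta> t x)) \<longlongrightarrow> 0) (at t within {0..T})"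
    using CH t by (simp add: C_Sobolev_def)
  show "\<forall>\<^sub>F r in at t within {0..T}. Sobolev_norm 1 (\<lambda>x. \<theta> r x - \<theta> t x) = l2n (sobw 1 (\<lambda>\<xi>. X r \<xi> - X t \<xi>))"
    using eventually_within_mem[of "{0..T}" t]
    by eventually_elim (use t in \<open>simp add: X_def Sobolev_norm_diff inL2\<close>)
qed

lemma X_cont_L2:
  assumes t: "t \<in> {0..T}"
  shows "((\<lambda>r. l2n (\<lambda>\<xi>. X r \<xi> - X t \<xi>)) \<longlongrightarrow> 0) (at t within {0..T})"
proof (rule tendsto_0_le[OF X_cont_H1[OF t], of _ 1])
  show "\<forall>\<^sub>F r in at t within {0..T}. norm (l2n (\<lambda>\<xi>. X r \<xi> - X t \<xi>)) \<le> norm (l2n (sobw 1 (\<lambda>\<xi>. X r \<xi> - X t \<xi>))) * 1"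
    using eventually_within_mem[of "{0..T}" t]
  proof eventually_elim
    case (elim r)
    have "l2n (\<lambda>\<xi>. X r \<xi> - X t \<xi>) \<le> l2n (sobw 1 (\<lambda>\<xi>. X r \<xi> - X t \<xi>))"
      using elim t X_measurable[of r] X_measurable[of t]
      by (intro sobw_sq_integrable_mono(2) sobw_sq_integrable_diff X_H1) auto
    then show ?case by simp
  qed
qed

lemma X_deriv:
  assumes t: "t \<in> {0..T}"
  shows "((\<lambda>r. l2n (\<lambda>\<xi>. of_real (1 / (r - t)) * (X r \<xi> - X t \<xi>) - Y t \<xi>)) \<longlongrightarrow> 0) (at t within {0..T})"
proof (rule Lim_transform_eventually)
  show "((\<lambda>r. 2 * pi * L2_norm (\<lambda>x. (\<theta> r x - \<theta> t x) / (r - t) - \<theta>' t x)) \<longlongrightarrow> 0) (at t within {0..T})"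
    using C1[OF t] by (rule tendsto_mult_right_zero)
  show "\<forall>\<^sub>F r in at t within {0..T}. 2 * pi * L2_norm (\<lambda>x. (\<theta> r x - \<theta> t x) / (r - t) - \<theta>' t x)
      = l2n (\<lambda>\<xi>. of_real (1 / (r - t)) * (X r \<xi> - X t \<xi>) - Y t \<xi>)"
    using eventually_within_mem[of "{0..T}" t]
  proof eventually_elim
    case (elim r)
    have "cr (\<lambda>x. (\<theta> r x - \<theta> t x) / (r - t) - \<theta>' t x) = (\<lambda>x. complex_of_real (1 / (r - t)) * (cr (\<theta> r) x - cr (\<theta> t) x) - cr (\<theta>' t) x)"
      by (rule ext) simp
    with Plancherel[OF L2FT_diff[OF L2FT_cmult[OF L2FT_diff[OF X_L2FT[OF elim] X_L2FT[OF t]], of "of_real (1 / (r - t))"] Y_L2FT[OF t]]]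
    show ?case unfolding L2_norm_eq by simp
  qed
qed

lemma pairing_deriv:
  assumes t: "t \<in> {0..T}" and \<psi>: "\<psi> \<in> L2"
  shows "((\<lambda>t. (LBINT x. \<theta> t x * \<psi> x)) has_real_derivative (LBINT x. \<theta>' t x * \<psi> x)) (at t within {0..T})"
  unfolding has_field_derivative_iff
proof -
  have i: "integrable lborel (\<lambda>x. f x * \<psi> x)" if "f \<in> L2" for f
    using sq_integrable_mult[of "cr f" "cr \<psi>"] that \<psi>
    unfolding L2_iff of_real_mult[symmetric] complex_of_real_integrable_eq by simp
  have "((\<lambda>r. ((LBINT x. \<theta> r x * \<psi> x) - (LBINT x. \<theta> t x * \<psi> x)) / (r - t) - (LBINT x. \<theta>' t x * \<psi> x)) \<longlongrightarrow> 0) (at t within {0..T})"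
  proof (rule tendsto_0_le[OF C1[OF t], of _ "L2_norm \<psi>"])
    show "\<forall>\<^sub>F r in at t within {0..T}. norm (((LBINT x. \<theta> r x * \<psi> x) - (LBINT x. \<theta> t x * \<psi> x)) / (r - t) - (LBINT x. \<theta>' t x * \<psi> x))
       \<le> norm (L2_norm (\<lambda>x. (\<theta> r x - \<theta> t x) / (r - t) - \<theta>' t x)) * L2_norm \<psi>"
      using eventually_within_mem[of "{0..T}" t]
    proof eventually_elim
      case (elim r)
      let ?d = "\<lambda>x. (\<theta> r x - \<theta> t x) / (r - t) - \<theta>' t x"
      have dL: "?d \<in> L2"
        using L2_diff[OF L2_cmult[OF L2_diff[OF inL2[OF elim] inL2[OF t]], of "1 / (r - t)"] inL2'[OF t]] by simp
      have "((LBINT x. \<theta> r x * \<psi> x) - (LBINT x. \<theta> t x * \<psi> x)) / (r - t) - (LBINT x. \<theta>' t x * \<psi> x)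
         = (LBINT x. ?d x * \<psi> x)"
        using i[OF inL2[OF elim]] i[OF inL2[OF t]] i[OF inL2'[OF t]]
        by (simp add: left_diff_distrib diff_divide_distrib)
      moreover have "\<bar>(LBINT x. ?d x * \<psi> x)\<bar> \<le> L2_norm ?d * L2_norm \<psi>"
        using l2n_Cauchy_Schwarz[of "cr ?d" "cr \<psi>"] dL \<psi>
        unfolding L2_iff L2_norm_eq of_real_mult[symmetric] integral_complex_of_real norm_of_real by simp
      ultimately show ?case by (simp add: L2_norm_eq)
    qed
  qed
  then show "((\<lambda>r. ((LBINT x. \<theta> r x * \<psi> x) - (LBINT x. \<theta> t x * \<psi> x)) / (r - t)) \<longlongrightarrow> (LBINT x. \<theta>' t x * \<psi> x)) (at t within {0..T})"
    by (simp add: LIM_zero_iff)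
qed

lemma pairing_continuous:
  assumes u: "\<And>t. t \<in> {0..T} \<Longrightarrow> u t \<in> L2" and \<psi>: "\<psi> \<in> L2"
    and c: "\<And>t. t \<in> {0..T} \<Longrightarrow> ((\<lambda>r. L2_norm (\<lambda>x. u r x - u t x)) \<longlongrightarrow> 0) (at t within {0..T})"
  shows "continuous_on {0..T} (\<lambda>t. (LBINT x. u t x * \<psi> x))"
  unfolding continuous_on_def
proof
  fix t assume t: "t \<in> {0..T}"
  have i: "integrable lborel (\<lambda>x. f x * \<psi> x)" if "f \<in> L2" for f
    using sq_integrable_mult[of "cr f" "cr \<psi>"] that \<psi>
    unfolding L2_iff of_real_mult[symmetric] complex_of_real_integrable_eq by simp
  have "((\<lambda>r. (LBINT x. u r x * \<psi> x) - (LBINT x. u t x * \<psi> x)) \<longlongrightarrow> 0) (at t within {0..T})"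
  proof (rule tendsto_0_le[OF c[OF t], of _ "L2_norm \<psi>"])
    show "\<forall>\<^sub>F r in at t within {0..T}. norm ((LBINT x. u r x * \<psi> x) - (LBINT x. u t x * \<psi> x)) \<le> norm (L2_norm (\<lambda>x. u r x - u t x)) * L2_norm \<psi>"
      using eventually_within_mem[of "{0..T}" t]
    proof eventually_elim
      case (elim r)
      have dL: "(\<lambda>x. u r x - u t x) \<in> L2" by (rule L2_diff[OF u[OF elim] u[OF t]])
      have "(LBINT x. u r x * \<psi> x) - (LBINT x. u t x * \<psi> x) = (LBINT x. (u r x - u t x) * \<psi> x)"
        using i[OF u[OF elim]] i[OF u[OF t]] by (simp add: left_diff_distrib)
      moreover have "\<bar>(LBINT x. (u r x - u t x) * \<psi> x)\<bar> \<le> L2_norm (\<lambda>x. u r x - u t x) * L2_norm \<psi>"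
        using l2n_Cauchy_Schwarz[of "cr (\<lambda>x. u r x - u t x)" "cr \<psi>"] dL \<psi>
        unfolding L2_iff L2_norm_eq of_real_mult[symmetric] integral_complex_of_real norm_of_real by simp
      ultimately show ?case by (simp add: L2_norm_eq)
    qed
  qed
  then show "((\<lambda>t. (LBINT x. u t x * \<psi> x)) \<longlongrightarrow> (LBINT x. u t x * \<psi> x)) (at t within {0..T})"
    by (simp add: LIM_zero_iff)
qed

lemma mqgN_L2FT_X:
  assumes t: "t \<in> {0..T}" shows "L2FT (cr (mqgN \<alpha> (\<theta> t))) (NF \<alpha> (X t))"
proof -
  note N = mqgN_L2FT[OF \<alpha> H1[OF t]]
  note [measurable] = X_measurable[OF t] fourier_AE(2)[OF fourier_L2FT[OF inL2[OF t]]]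
  have "AE \<xi> in lborel. NF \<alpha> (fourier (\<theta> t)) \<xi> = NF \<alpha> (X t) \<xi>"
    by (rule NF_cong_AE) (use hft_AE[OF inL2[OF t]] in \<open>auto simp: X_def[symmetric]\<close>)
  then show ?thesis
    by (rule L2FT_AE_cong[OF N, rotated])
      (use L2FT_measurable(1)[OF N] in \<open>auto simp: NF_def[abs_def]\<close>)
qed

lemma mqgN_L2: "t \<in> {0..T} \<Longrightarrow> mqgN \<alpha> (\<theta> t) \<in> L2"
  unfolding L2_iff by (rule L2FT_sq(1)[OF mqgN_L2FT_X])

lemma mqgN_continuous:
  assumes t: "t \<in> {0..T}"
  shows "((\<lambda>r. L2_norm (\<lambda>x. mqgN \<alpha> (\<theta> r) x - mqgN \<alpha> (\<theta> t) x)) \<longlongrightarrow> 0) (at t within {0..T})"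
proof -
  let ?d = "\<lambda>r. l2n (sobw 1 (\<lambda>\<xi>. X r \<xi> - X t \<xi>))"
  let ?n = "l2n (sobw 1 (X t))"
  have NFc: "NFc \<alpha> \<ge> 0" by (simp add: NFc_def)
  have "((\<lambda>r. (1 + NFc \<alpha> * (?d r + 2 * ?n)) * ?d r) \<longlongrightarrow> (1 + NFc \<alpha> * (0 + 2 * ?n)) * 0) (at t within {0..T})"
    by (intro tendsto_intros X_cont_H1 t)
  then have lim: "((\<lambda>r. (1 + NFc \<alpha> * (?d r + 2 * ?n)) * ?d r) \<longlongrightarrow> 0) (at t within {0..T})" by simp
  show ?thesis
  proof (rule tendsto_0_le[OF lim, of _ "1"])
    show "\<forall>\<^sub>F r in at t within {0..T}. norm (L2_norm (\<lambda>x. mqgN \<alpha> (\<theta> r) x - mqgN \<alpha> (\<theta> t) x)) \<le> norm ((1 + NFc \<alpha> * (?d r + 2 * ?n)) * ?d r) * 1"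
      using eventually_within_mem[of "{0..T}" t]
    proof eventually_elim
      case (elim r)
      note [measurable] = X_measurable[OF t] X_measurable[OF elim]
      have "2 * pi * L2_norm (\<lambda>x. mqgN \<alpha> (\<theta> r) x - mqgN \<alpha> (\<theta> t) x) = l2n (\<lambda>\<xi>. NF \<alpha> (X r) \<xi> - NF \<alpha> (X t) \<xi>)"
        unfolding L2_norm_eq of_real_diff by (rule Plancherel[OF L2FT_diff[OF mqgN_L2FT_X[OF elim] mqgN_L2FT_X[OF t]], symmetric])
      also have "\<dots> \<le> (1 + NFc \<alpha> * (l2n (sobw 1 (X r)) + ?n)) * ?d r"
        by (rule NF_diff[OF \<alpha> X_H1[OF elim] X_H1[OF t]]) measurable
      also have "l2n (sobw 1 (X r)) \<le> ?d r + ?n"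
        using l2n_le_diff[OF X_H1[OF elim] X_H1[OF t]] by (simp add: sobw_diff[abs_def])
      finally have a: "2 * pi * L2_norm (\<lambda>x. mqgN \<alpha> (\<theta> r) x - mqgN \<alpha> (\<theta> t) x) \<le> (1 + NFc \<alpha> * (?d r + 2 * ?n)) * ?d r"
        using NFc by (simp add: mult_left_mono mult_right_mono add.commute)
      have "L2_norm (\<lambda>x. mqgN \<alpha> (\<theta> r) x - mqgN \<alpha> (\<theta> t) x) \<ge> 0" by (simp add: L2_norm_eq)
      then have "1 * L2_norm (\<lambda>x. mqgN \<alpha> (\<theta> r) x - mqgN \<alpha> (\<theta> t) x) \<le> 2 * pi * L2_norm (\<lambda>x. mqgN \<alpha> (\<theta> r) x - mqgN \<alpha> (\<theta> t) x)"
        using pi_ge_two by (intro mult_right_mono) auto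
      with a \<open>L2_norm _ \<ge> 0\<close> show ?case by simp
    qed
  qed
qed

lemma bump_L2: "bump n c d \<in> L2"
  unfolding L2_iff by (rule BI_sq_integrable[OF test_function_BI[OF test_function_bump]]) simp

text \<open>The distributional equation is tested with a product of a time bump and a space bump.
  The time derivative is then moved from the bump to \<theta> by the product rule, since \<theta> is
  differentiable in L^2.\<close>

lemma weak_form:
  assumes ab: "{a..b} \<subseteq> {0<..<T}"
  shows "((\<lambda>t. bump n a b t * ((LBINT x. \<theta>' t x * bump n c d x) + (LBINT x. mqgN \<alpha> (\<theta> t) x * bump n c d x))) has_integral 0) {0..T}"
proof -
  define \<psi> where "\<psi> = (bump n c d :: real^2 \<Rightarrow> real)"
  define \<rho> where "\<rho> = (bump n a b :: real \<Rightarrow> real)"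
  define \<rho>' where "\<rho>' t = frechet_derivative \<rho> (at t) 1" for t
  define \<phi> where "\<phi> = bump n (a, c) (b, d)"
  have \<phi>: "\<phi> (t, x) = \<rho> t * \<psi> x" for t x unfolding \<phi>_def \<rho>_def \<psi>_def by (rule bump_Pair)
  have \<psi>L: "\<psi> \<in> L2" unfolding \<psi>_def by (rule bump_L2)
  have test: "test_function ({0<..<T} \<times> UNIV) \<phi>"
    unfolding \<phi>_def by (rule test_function_bump) (use ab in \<open>auto simp: cbox_Pair_eq\<close>)
  have i: "integrable lborel (\<lambda>x. f x * \<psi> x)" if "f \<in> L2" for f
    using sq_integrable_mult[of "cr f" "cr \<psi>"] that \<psi>L
    unfolding L2_iff of_real_mult[symmetric] complex_of_real_integrable_eq by simp
  have d\<rho>: "(\<rho> has_derivative frechet_derivative \<rho> (at t)) (at t)" and d\<psi>: "(\<psi> has_derivative frechet_derivative \<psi> (at x)) (at x)" for t x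
    unfolding \<rho>_def \<psi>_def by (intro frechet_derivative_worksI smooth_differentiable smooth_bump)+
  have d\<phi>: "frechet_derivative \<phi> (at (t, x)) (1, 0) = \<rho>' t * \<psi> x" for t x
  proof -
    have eq: "\<phi> = (\<lambda>z. \<rho> (fst z) * \<psi> (snd z))" using \<phi> by auto
    have f: "((\<lambda>z. \<rho> (fst z)) has_derivative (\<lambda>z. frechet_derivative \<rho> (at t) (fst z))) (at (t, x))"
      using has_derivative_compose[OF has_derivative_fst[OF has_derivative_ident] , of \<rho> _ "(t, x)"] d\<rho>[of t] by simp
    have s: "((\<lambda>z. \<psi> (snd z)) has_derivative (\<lambda>z. frechet_derivative \<psi> (at x) (snd z))) (at (t, x))"
      using has_derivative_compose[OF has_derivative_snd[OF has_derivative_ident] , of \<psi> _ "(t, x)"] d\<psi>[of x] by simp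
    have "frechet_derivative \<psi> (at x) 0 = 0"
      using d\<psi>[of x] has_derivative_linear linear_0 by blast
    then show ?thesis
      unfolding eq frechet_derivativeI[OF has_derivative_mult[OF f s]] by (simp add: \<rho>'_def)
  qed
  define p where "p t = (LBINT x. \<theta> t x * \<psi> x)" for t
  define p' where "p' t = (LBINT x. \<theta>' t x * \<psi> x)" for t
  define q where "q t = (LBINT x. mqgN \<alpha> (\<theta> t) x * \<psi> x)" for t
  have pair: "(LBINT x. mqg_pairing \<alpha> \<theta> \<phi> t x) = - \<rho>' t * p t + \<rho> t * q t" if t: "t \<in> {0..T}" for t
  proof -
    have "(LBINT x. mqg_pairing \<alpha> \<theta> \<phi> t x) = (LBINT x. (- \<rho>' t) * (\<theta> t x * \<psi> x) + \<rho> t * (mqgN \<alpha> (\<theta> t) x * \<psi> x))"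
      unfolding mqg_pairing_def d\<phi> \<phi> mqgN_def[symmetric] by (simp add: mult_ac)
    also have "\<dots> = - \<rho>' t * p t + \<rho> t * q t"
      unfolding p_def q_def using i[OF inL2[OF t]] i[OF mqgN_L2[OF t]]
      by (subst Bochner_Integration.integral_add) auto
    finally show ?thesis .
  qed
  have int: "integrable (lebesgue_on {0..T}) (\<lambda>t. (LBINT x. mqg_pairing \<alpha> \<theta> \<phi> t x))"
    and zero: "(\<integral>t. (LBINT x. mqg_pairing \<alpha> \<theta> \<phi> t x) \<partial>lebesgue_on {0..T}) = 0"
    using sol test unfolding mqg_solution_def by blast+
  have "((\<lambda>t. (LBINT x. mqg_pairing \<alpha> \<theta> \<phi> t x)) has_integral 0) {0..T}"
    using has_integral_integral_lebesgue_on[OF int] zero by simp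
  then have A: "((\<lambda>t. - \<rho>' t * p t + \<rho> t * q t) has_integral 0) {0..T}"
    by (rule has_integral_eq[rotated]) (rule pair)
  \<comment> \<open>The time bump lives inside the open interval, so integration by parts leaves no
    boundary terms.\<close>
  have \<rho>0: "\<rho> 0 = 0" "\<rho> T = 0" unfolding \<rho>_def using ab by (auto intro!: bump_eq_0 simp: subset_iff dest: spec[of _ T])
  have "((\<lambda>t. \<rho> t * p' t + \<rho>' t * p t) has_integral (\<rho> T * p T - \<rho> 0 * p 0)) {0..T}"
  proof (rule fundamental_theorem_of_calculus)
    fix t assume t: "t \<in> {0..T}"
    have lin: "frechet_derivative \<rho> (at t) = (*) (\<rho>' t)"
    proof
      fix s
      have "frechet_derivative \<rho> (at t) (s *\<^sub>R 1) = s *\<^sub>R frechet_derivative \<rho> (at t) 1"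
        using d\<rho>[of t] has_derivative_linear linear_cmul by blast
      then show "frechet_derivative \<rho> (at t) s = \<rho>' t * s" by (simp add: \<rho>'_def)
    qed
    have "(\<rho> has_real_derivative \<rho>' t) (at t within {0..T})"
      using has_derivative_at_withinI[OF d\<rho>[of t]] unfolding lin has_field_derivative_def .
    moreover have "(p has_real_derivative p' t) (at t within {0..T})"
      unfolding p_def[abs_def] p'_def by (rule pairing_deriv[OF t \<psi>L])
    ultimately have "((\<lambda>t. \<rho> t * p t) has_real_derivative \<rho>' t * p t + p' t * \<rho> t) (at t within {0..T})"
      by (rule DERIV_mult)
    then show "((\<lambda>t. \<rho> t * p t) has_vector_derivative \<rho> t * p' t + \<rho>' t * p t) (at t within {0..T})"
      by (simp add: has_real_derivative_iff_has_vector_derivative algebra_simps)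
  qed (use T in simp)
  from has_integral_add[OF this A] have "((\<lambda>t. \<rho> t * (p' t + q t)) has_integral 0) {0..T}"
    unfolding \<rho>0 by (simp add: algebra_simps)
  then show ?thesis unfolding \<rho>_def p'_def q_def \<psi>_def .
qed

text \<open>For each space bump the tested equation is a continuous function of time, because
  \<theta>' and the nonlinear term are continuous in L^2. Time bumps force it to vanish at every
  interior time, not only almost every one; space bumps then give the identity almost everywhere in
  x.\<close>

lemma equation_L2:
  assumes t: "0 < t" "t < T"
  shows "AE x in lborel. \<theta>' t x + mqgN \<alpha> (\<theta> t) x = 0"
proof (rule bump_integrals_0_AE)
  have t': "t \<in> {0..T}" using t by simp
  show "(\<lambda>x. \<theta>' t x + mqgN \<alpha> (\<theta> t) x) \<in> borel_measurable borel"
    using inL2'[OF t'] mqgN_L2[OF t'] unfolding L2_def by (intro borel_measurable_add) auto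
  fix n and c d :: "real^2"
  have i: "integrable lborel (\<lambda>x. f x * bump n c d x)" if "f \<in> L2" for f
    using sq_integrable_mult[of "cr f" "cr (bump n c d)"] that bump_L2[of n c d]
    unfolding L2_iff of_real_mult[symmetric] complex_of_real_integrable_eq by simp
  note ii = i[OF inL2'[OF t']] i[OF mqgN_L2[OF t']]
  show "integrable lborel (\<lambda>x. (\<theta>' t x + mqgN \<alpha> (\<theta> t) x) * bump n c d x)"
    using Bochner_Integration.integrable_add[OF ii] by (simp add: distrib_right)
  define m where "m t = (LBINT x. \<theta>' t x * bump n c d x) + (LBINT x. mqgN \<alpha> (\<theta> t) x * bump n c d x)" for t
  have mc: "continuous_on {0..T} m"
    unfolding m_def
  proof (intro continuous_on_add pairing_continuous inL2' mqgN_L2 bump_L2 mqgN_continuous)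
    fix t assume "t \<in> {0..T}"
    then show "((\<lambda>r. L2_norm (\<lambda>x. \<theta>' r x - \<theta>' t x)) \<longlongrightarrow> 0) (at t within {0..T})"
      using \<theta>' by (simp add: C_L2_def)
  qed
  have w: "((\<lambda>t. bump n a b t * m t) has_integral 0) {0..T}" if "{a..b} \<subseteq> {0<..<T}" for a b
    unfolding m_def by (rule weak_form[OF that])
  have "m t \<le> 0" by (rule nonpos_if_bump_integrals_0[OF mc w t])
  moreover have "- m t \<le> 0"
  proof (rule nonpos_if_bump_integrals_0[where m="\<lambda>t. - m t" and n=n, OF _ _ t])
    show "continuous_on {0..T} (\<lambda>t. - m t)" using mc by (rule continuous_on_minus)
    show "((\<lambda>t. bump n a b t * - m t) has_integral 0) {0..T}" if "{a..b} \<subseteq> {0<..<T}" for a b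
      using has_integral_neg[OF w[OF that]] by simp
  qed
  ultimately have "m t = 0" by simp
  then show "(LBINT x. (\<theta>' t x + mqgN \<alpha> (\<theta> t) x) * bump n c d x) = 0"
    using Bochner_Integration.integral_add[OF ii] by (simp add: m_def distrib_right)
qed

lemma equation_fourier:
  assumes t: "0 < t" "t < T"
  shows "AE \<xi> in lborel. Y t \<xi> = - NF \<alpha> (X t) \<xi>"
proof -
  have t': "t \<in> {0..T}" using t by simp
  note S = L2FT_add[OF Y_L2FT[OF t'] mqgN_L2FT_X[OF t'], of 1]
  have "L2FT (\<lambda>x. 0) (\<lambda>\<xi>. Y t \<xi> + 1 * NF \<alpha> (X t) \<xi>)"
  proof (rule L2FT_AE_cong[OF S])
    show "AE x in lborel. cr (\<theta>' t) x + 1 * cr (mqgN \<alpha> (\<theta> t)) x = 0"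
      using equation_L2[OF t] by eventually_elim (simp flip: of_real_add)
  qed (use L2FT_measurable(2)[OF S] in auto)
  from L2FT_unique[OF this L2FT_zero] show ?thesis
    by eventually_elim (simp add: add_eq_0_iff)
qed

text \<open>Since |z|^2 - |y|^2 = Re((z - y) conj(z + y)), the difference quotient is an inner
  product of an L^2-convergent quotient with an L^2-convergent sum. Boundedness of w is what allows
  L^2 convergence to suffice.\<close>

lemma energy_deriv:
  fixes w :: "real^2 \<Rightarrow> real"
  assumes [measurable]: "w \<in> borel_measurable borel" and B: "\<And>\<xi>. \<bar>w \<xi>\<bar> \<le> B" and t: "t \<in> {0..T}"
  shows "((\<lambda>t. (LBINT \<xi>. w \<xi> * (cmod (X t \<xi>))\<^sup>2)) has_real_derivative
     2 * Re (LBINT \<xi>. Y t \<xi> * (of_real (w \<xi>) * cnj (X t \<xi>)))) (at t within {0..T})"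
  unfolding has_field_derivative_iff
proof -
  let ?a = "\<lambda>r \<xi>. of_real (1 / (r - t)) * (X r \<xi> - X t \<xi>)"
  let ?b = "\<lambda>r \<xi>. of_real (w \<xi>) * cnj (X r \<xi> + X t \<xi>)"
  note wsq = weighted_cnj(1)[OF assms(1) B] and wl = weighted_cnj(2)[OF assms(1) B]
  have "((\<lambda>r. (LBINT \<xi>. ?a r \<xi> * ?b r \<xi>)) \<longlongrightarrow> (LBINT \<xi>. Y t \<xi> * (of_real (w \<xi>) * cnj (2 * X t \<xi>)))) (at t within {0..T})"
  proof (rule inner_tendsto_within)
    show "\<forall>\<^sub>F r in at t within {0..T}. sq_integrable (?a r) \<and> sq_integrable (?b r)"
      using eventually_within_mem[of "{0..T}" t]
      by eventually_elim (intro conjI sq_integrable_cmult sq_integrable_diff wsq sq_integrable_add X_sq t)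
    show "sq_integrable (Y t)" by (rule Y_sq[OF t])
    show "sq_integrable (\<lambda>\<xi>. complex_of_real (w \<xi>) * cnj (2 * X t \<xi>))"
      by (intro wsq sq_integrable_cmult X_sq t)
    show "((\<lambda>r. l2n (\<lambda>\<xi>. ?a r \<xi> - Y t \<xi>)) \<longlongrightarrow> 0) (at t within {0..T})" by (rule X_deriv[OF t])
    show "((\<lambda>r. l2n (\<lambda>\<xi>. ?b r \<xi> - of_real (w \<xi>) * cnj (2 * X t \<xi>))) \<longlongrightarrow> 0) (at t within {0..T})"
    proof (rule tendsto_0_le[OF X_cont_L2[OF t], of _ B])
      show "\<forall>\<^sub>F r in at t within {0..T}. norm (l2n (\<lambda>\<xi>. ?b r \<xi> - of_real (w \<xi>) * cnj (2 * X t \<xi>))) \<le> norm (l2n (\<lambda>\<xi>. X r \<xi> - X t \<xi>)) * B"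
        using eventually_within_mem[of "{0..T}" t]
      proof eventually_elim
        case (elim r)
        have "(\<lambda>\<xi>. ?b r \<xi> - of_real (w \<xi>) * cnj (2 * X t \<xi>)) = (\<lambda>\<xi>. of_real (w \<xi>) * cnj (X r \<xi> - X t \<xi>))"
          by (rule ext) (simp add: algebra_simps)
        with wl[OF sq_integrable_diff[OF X_sq[OF elim] X_sq[OF t]]] show ?case by (simp add: mult.commute)
      qed
    qed
  qed
  then have "((\<lambda>r. Re (LBINT \<xi>. ?a r \<xi> * ?b r \<xi>)) \<longlongrightarrow> Re (LBINT \<xi>. Y t \<xi> * (of_real (w \<xi>) * cnj (2 * X t \<xi>)))) (at t within {0..T})"
    by (rule tendsto_Re)
  moreover have "(LBINT \<xi>. Y t \<xi> * (of_real (w \<xi>) * cnj (2 * X t \<xi>))) = 2 * (LBINT \<xi>. Y t \<xi> * (of_real (w \<xi>) * cnj (X t \<xi>)))"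
    by (subst integral_mult_right_zero[symmetric]) (simp add: mult_ac)
  ultimately have lim: "((\<lambda>r. Re (LBINT \<xi>. ?a r \<xi> * ?b r \<xi>)) \<longlongrightarrow> 2 * Re (LBINT \<xi>. Y t \<xi> * (of_real (w \<xi>) * cnj (X t \<xi>)))) (at t within {0..T})"
    by simp
  show "((\<lambda>r. ((LBINT \<xi>. w \<xi> * (cmod (X r \<xi>))\<^sup>2) - (LBINT \<xi>. w \<xi> * (cmod (X t \<xi>))\<^sup>2)) / (r - t))
     \<longlongrightarrow> 2 * Re (LBINT \<xi>. Y t \<xi> * (of_real (w \<xi>) * cnj (X t \<xi>)))) (at t within {0..T})"
  proof (rule Lim_transform_eventually[OF lim])
    show "\<forall>\<^sub>F r in at t within {0..T}. Re (LBINT \<xi>. ?a r \<xi> * ?b r \<xi>)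
      = ((LBINT \<xi>. w \<xi> * (cmod (X r \<xi>))\<^sup>2) - (LBINT \<xi>. w \<xi> * (cmod (X t \<xi>))\<^sup>2)) / (r - t)"
      using eventually_within_mem[of "{0..T}" t]
    proof eventually_elim
      case (elim r)
      have i: "integrable lborel (\<lambda>\<xi>. w \<xi> * (cmod (F \<xi>))\<^sup>2)" if "sq_integrable F" for F
      proof (rule Bochner_Integration.integrable_bound)
        show "integrable lborel (\<lambda>\<xi>. B * (cmod (F \<xi>))\<^sup>2)" using that by (simp add: sq_integrable_def)
        show "(\<lambda>\<xi>. w \<xi> * (cmod (F \<xi>))\<^sup>2) \<in> borel_measurable lborel" using sq_integrable_measurable[OF that] by measurable
        show "AE \<xi> in lborel. norm (w \<xi> * (cmod (F \<xi>))\<^sup>2) \<le> norm (B * (cmod (F \<xi>))\<^sup>2)"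
          using B by (intro AE_I2) (auto simp: abs_mult intro!: mult_right_mono intro: order_trans[OF _ abs_ge_self])
      qed
      have ab: "integrable lborel (\<lambda>\<xi>. ?a r \<xi> * ?b r \<xi>)"
        using elim t by (intro sq_integrable_mult sq_integrable_cmult sq_integrable_diff wsq sq_integrable_add X_sq) auto
      have "Re (LBINT \<xi>. ?a r \<xi> * ?b r \<xi>) = (LBINT \<xi>. Re (?a r \<xi> * ?b r \<xi>))"
        by (rule integral_Re[OF ab, symmetric])
      also have "\<dots> = (LBINT \<xi>. (w \<xi> * (cmod (X r \<xi>))\<^sup>2 - w \<xi> * (cmod (X t \<xi>))\<^sup>2) / (r - t))"
      proof (intro Bochner_Integration.integral_cong refl)
        fix \<xi>
        have "Re ((z - y) * cnj (z + y)) = (cmod z)\<^sup>2 - (cmod y)\<^sup>2" for z y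
          unfolding cmod_power2 by (simp add: algebra_simps power2_eq_square)
        moreover have "?a r \<xi> * ?b r \<xi> = of_real (w \<xi> / (r - t)) * ((X r \<xi> - X t \<xi>) * cnj (X r \<xi> + X t \<xi>))"
          by (simp add: mult_ac)
        ultimately have "Re (?a r \<xi> * ?b r \<xi>) = w \<xi> / (r - t) * ((cmod (X r \<xi>))\<^sup>2 - (cmod (X t \<xi>))\<^sup>2)"
          by (simp only: scaleR_conv_of_real[symmetric] scaleR_complex.sel)
        then show "Re (?a r \<xi> * ?b r \<xi>) = (w \<xi> * (cmod (X r \<xi>))\<^sup>2 - w \<xi> * (cmod (X t \<xi>))\<^sup>2) / (r - t)"
          by (simp only:) (simp add: right_diff_distrib diff_divide_distrib)
      qed
      also have "\<dots> = ((LBINT \<xi>. w \<xi> * (cmod (X r \<xi>))\<^sup>2) - (LBINT \<xi>. w \<xi> * (cmod (X t \<xi>))\<^sup>2)) / (r - t)"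
        using i[OF X_sq[OF elim]] i[OF X_sq[OF t]] by simp
      finally show ?case .
    qed
  qed
qed

end

section \<open>The trilinear estimate\<close>

text \<open>Truncating the weight at \<open>N\<close> keeps all energies finite; the estimates below are uniform in \<open>N\<close>.\<close>

definition trunc :: "real \<Rightarrow> real \<Rightarrow> real \<Rightarrow> real" where
  "trunc s N r = (min r N) powr s"

lemma trunc_nonneg [simp]: "0 \<le> trunc s N r"
  by (simp add: trunc_def)

lemma trunc_measurable [measurable]: "trunc s N \<in> borel_measurable borel"
  unfolding trunc_def[abs_def] by measurable

lemma trunc_sq: "trunc (2 * s) N r = trunc s N r * trunc s N r"
  by (simp add: trunc_def powr_add[symmetric])

lemma trunc_le:
  assumes "0 \<le> s" "0 \<le> r" "0 < N" shows "trunc s N r \<le> N powr s"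
  unfolding trunc_def using assms by (intro powr_mono2) auto

lemma trunc_double:
  assumes "0 \<le> s" "0 \<le> r" "0 < N" "x \<le> 2 * r" "0 \<le> x"
  shows "trunc s N x \<le> 2 powr s * trunc s N r"
proof -
  have "min x N powr s \<le> (2 * min r N) powr s" using assms by (intro powr_mono2) auto
  also have "\<dots> = 2 powr s * min r N powr s" by (rule powr_mult)
  finally show ?thesis by (simp add: trunc_def)
qed

text \<open>Rounding p up to an integer n decreases u^p for u <= 1 and reduces the claim to
  Bernoulli's inequality.\<close>

lemma powr_Bernoulli:
  assumes "0 \<le> u" "u \<le> 1" "1 \<le> p" shows "1 - u powr p \<le> real (nat \<lceil>p\<rceil>) * (1 - (u::real))"
proof (cases "u = 0")
  case True
  have "1 \<le> real (nat \<lceil>p\<rceil>)" using assms(3) by linarith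
  with True show ?thesis by simp
next
  case False
  define n where "n = nat \<lceil>p\<rceil>"
  have "p \<le> real n" unfolding n_def using assms(3) by linarith
  then have "u powr real n \<le> u powr p" using False assms by (intro powr_mono') auto
  moreover have "u powr real n = u ^ n" using False assms by (intro powr_realpow) auto
  moreover have "1 + real n * (u - 1) \<le> (1 + (u - 1)) ^ n" using assms by (intro Bernoulli_inequality) auto
  ultimately show ?thesis unfolding n_def[symmetric] by (simp add: algebra_simps)
qed

text \<open>A mean-value bound without derivatives. Truncation moves ratios towards 1, so u =
  min(m,N)/min(x,N) is at least m/x and the relative difference is controlled by (x - m)/x with a
  constant free of N.\<close>

lemma trunc_diff:
  assumes "0 \<le> m" "m \<le> x" "0 < x" "0 < N" "1 \<le> s"
  shows "\<bar>trunc s N x - trunc s N m\<bar> \<le> real (nat \<lceil>s\<rceil>) * trunc s N x * ((x - m) / x)"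
proof -
  define u where "u = min m N / min x N"
  have xN: "min x N > 0" using assms by simp
  have u: "0 \<le> u" "u \<le> 1" "m / x \<le> u"
  proof -
    show "0 \<le> u" "u \<le> 1" using assms xN by (auto simp: u_def)
    have "m * min x N \<le> min m N * x"
    proof (cases "m \<le> N")
      case True
      then show ?thesis using assms by (simp add: mult_left_mono)
    next
      case False
      then have "min x N = N" "min m N = N" using assms by auto
      then show ?thesis using assms by (simp add: mult.commute mult_left_mono)
    qed
    then show "m / x \<le> u"
      unfolding u_def pos_divide_le_eq[OF assms(3)] times_divide_eq_left pos_le_divide_eq[OF xN] .
  qed
  have "trunc s N m = trunc s N x * u powr s"
    using xN u(1) assms by (simp add: trunc_def u_def flip: powr_mult)
  moreover have "u powr s \<le> 1" using u assms by (intro powr_le1) auto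
  ultimately have "\<bar>trunc s N x - trunc s N m\<bar> = trunc s N x * (1 - u powr s)"
    by (simp add: abs_of_nonneg right_diff_distrib mult_left_le)
  also have "\<dots> \<le> trunc s N x * (real (nat \<lceil>s\<rceil>) * (1 - u))"
    using powr_Bernoulli[OF u(1,2) assms(5)] by (intro mult_left_mono) auto
  also have "\<dots> \<le> trunc s N x * (real (nat \<lceil>s\<rceil>) * ((x - m) / x))"
    using u(3) assms by (intro mult_left_mono) (auto simp: diff_divide_distrib)
  finally show ?thesis by (simp add: mult_ac)
qed

text \<open>|\<eta>|^(\<alpha>-2) times the cross product of \<eta> and \<zeta>. The cross product
  encodes incompressibility: adding a multiple of \<eta> to \<zeta> does not change it, so the
  kernel at (\<eta>, \<xi> - \<eta>) is bounded through the smaller of |\<xi>| and |\<xi> -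
  \<eta>|.\<close>

definition ker :: "real \<Rightarrow> real^2 \<Rightarrow> real^2 \<Rightarrow> real" where
  "ker \<alpha> \<eta> \<zeta> = norm \<eta> powr (\<alpha> - 1) / norm \<eta> * (\<eta> $ 1 * \<zeta> $ 2 - \<eta> $ 2 * \<zeta> $ 1)"

lemma cross_le: "\<bar>\<eta> $ 1 * \<zeta> $ 2 - \<eta> $ 2 * \<zeta> $ 1\<bar> \<le> norm \<eta> * norm \<zeta>" for \<eta> \<zeta> :: "real^2"
proof -
  have "(norm \<eta> * norm \<zeta>)\<^sup>2 = ((\<eta> $ 1)\<^sup>2 + (\<eta> $ 2)\<^sup>2) * ((\<zeta> $ 1)\<^sup>2 + (\<zeta> $ 2)\<^sup>2)"
    unfolding power_mult_distrib power2_norm_eq_inner by (simp add: inner_vec_def UNIV_2 power2_eq_square)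
  also have "\<dots> = (\<eta> $ 1 * \<zeta> $ 2 - \<eta> $ 2 * \<zeta> $ 1)\<^sup>2 + (\<eta> $ 1 * \<zeta> $ 1 + \<eta> $ 2 * \<zeta> $ 2)\<^sup>2"
    by (simp add: power2_eq_square algebra_simps)
  finally have "(\<eta> $ 1 * \<zeta> $ 2 - \<eta> $ 2 * \<zeta> $ 1)\<^sup>2 \<le> (norm \<eta> * norm \<zeta>)\<^sup>2" by simp
  from abs_le_square_iff[THEN iffD2, OF this] show ?thesis by simp
qed

lemma ker_le: "\<bar>ker \<alpha> \<eta> \<zeta>\<bar> \<le> norm \<eta> powr (\<alpha> - 1) * norm \<zeta>"
proof (cases "\<eta> = 0")
  case False
  have "\<bar>ker \<alpha> \<eta> \<zeta>\<bar> = norm \<eta> powr (\<alpha> - 1) / norm \<eta> * \<bar>\<eta> $ 1 * \<zeta> $ 2 - \<eta> $ 2 * \<zeta> $ 1\<bar>"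
    by (simp add: ker_def abs_mult)
  also have "\<dots> \<le> norm \<eta> powr (\<alpha> - 1) / norm \<eta> * (norm \<eta> * norm \<zeta>)"
    by (intro mult_left_mono cross_le) auto
  finally show ?thesis using False by simp
qed (simp add: ker_def)

lemma ker_diff: "ker \<alpha> \<eta> (\<xi> - \<eta>) = ker \<alpha> \<eta> \<xi>"
  by (simp add: ker_def algebra_simps)

lemma ker_uminus: "ker \<alpha> (- \<eta>) \<xi> = - ker \<alpha> \<eta> \<xi>"
  by (simp add: ker_def algebra_simps)

lemma vec_nth_measurable [measurable]: "(\<lambda>x. f x $ j) \<in> borel_measurable M"
  if "f \<in> borel_measurable M" for f :: "'a \<Rightarrow> real^2"
  by (rule measurable_compose[OF that]) (auto intro!: borel_measurable_continuous_onI continuous_intros)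

lemma ker_measurable [measurable]:
  assumes [measurable]: "f \<in> borel_measurable M" "g \<in> borel_measurable M"
  shows "(\<lambda>x. ker \<alpha> (f x) (g x)) \<in> borel_measurable M"
  unfolding ker_def by measurable

lemma ker_min_le: "\<bar>ker \<alpha> \<eta> (\<xi> - \<eta>)\<bar> \<le> norm \<eta> powr (\<alpha> - 1) * min (norm \<xi>) (norm (\<xi> - \<eta>))"
  using ker_le[of \<alpha> \<eta> "\<xi> - \<eta>"] ker_le[of \<alpha> \<eta> \<xi>] unfolding ker_diff by (simp add: min_def)

text \<open>\<open>J3\<close> is the model trilinear kernel: its first argument carries the smallest frequency.\<close>

definition J3 :: "real \<Rightarrow> real \<Rightarrow> real \<Rightarrow> (real^2 \<Rightarrow> real) \<Rightarrow> real^2 \<Rightarrow> real^2 \<Rightarrow> real^2 \<Rightarrow> real" where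
  "J3 \<alpha> s N f p q r = (if norm p \<le> norm q \<and> norm p \<le> norm r
     then norm p powr \<alpha> * f p * (trunc s N (norm q) * f q) * (trunc s N (norm r) * f r) else 0)"

lemma J3_nonneg: "(\<And>x. 0 \<le> f x) \<Longrightarrow> 0 \<le> J3 \<alpha> s N f p q r"
  by (simp add: J3_def)

lemma J3_swap: "J3 \<alpha> s N f p q r = J3 \<alpha> s N f p r q"
  by (simp add: J3_def mult_ac conj_commute)

lemma J3_even: "(\<And>x. f (- x) = f x) \<Longrightarrow> J3 \<alpha> s N f p q (- r) = J3 \<alpha> s N f p q r"
  by (simp add: J3_def)

lemma J3_measurable [measurable]:
  assumes [measurable]: "f \<in> borel_measurable borel" "p \<in> borel_measurable M" "q \<in> borel_measurable M" "r \<in> borel_measurable M"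
  shows "(\<lambda>x. J3 \<alpha> s N f (p x) (q x) (r x)) \<in> borel_measurable M"
  unfolding J3_def by measurable

text \<open>The rounded exponent comes from \<open>trunc_diff\<close> for the weight of order 2s;
  2^s is the price of moving one factor of order s to a comparable frequency by
  \<open>trunc_double\<close>.\<close>

definition C0 :: "real \<Rightarrow> real" where
  "C0 s = real (nat \<lceil>2 * s\<rceil>) * 2 powr s"

lemma C0_nonneg: "0 \<le> C0 s"
  by (simp add: C0_def)

text \<open>Here p is the velocity frequency, r the larger and q the smaller of the other two. If p
  is smallest, the weight difference gains |p|/|r|, which turns |p|^(\<alpha>-1) |q| into
  |p|^\<alpha>. If q is smallest, \<alpha> < 1 already gives |p|^(\<alpha>-1) |q| <= |q|^\<alpha>.
  In both cases |r| is at most twice the other large frequency, so half of the weight at r moves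
  there.\<close>

lemma commutator_pointwise_aux:
  assumes s: "1 \<le> s" and N: "0 < N" and \<alpha>: "0 < \<alpha>" "\<alpha> < 1" and f: "\<And>x. 0 \<le> f x"
    and le: "norm q \<le> norm r" and qr: "norm r \<le> norm q + norm p" and pq: "norm r - norm q \<le> norm p"
    and k: "0 \<le> k" "k \<le> norm p powr (\<alpha> - 1) * norm q"
  shows "\<bar>trunc (2 * s) N (norm r) - trunc (2 * s) N (norm q)\<bar> * k * (f p * f q * f r)
    \<le> C0 s * (J3 \<alpha> s N f p q r + J3 \<alpha> s N f q p r)"
proof (cases "norm r = 0")
  case True
  then have "norm q = 0" using le by simp
  then have "k = 0" using k by simp
  then show ?thesis using J3_nonneg[of f] f C0_nonneg[of s] by simp
next
  case False
  let ?n = "real (nat \<lceil>2 * s\<rceil>)" and ?S = "\<lambda>x. trunc s N (norm x)"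
  have r0: "0 < norm r" using False by simp
  have d: "\<bar>trunc (2 * s) N (norm r) - trunc (2 * s) N (norm q)\<bar> \<le> ?n * (?S r * ?S r) * ((norm r - norm q) / norm r)"
    using trunc_diff[of "norm q" "norm r" N "2 * s"] le r0 N s by (simp add: trunc_sq)
  have F: "0 \<le> f p * f q * f r" using f by simp
  consider "norm p \<le> norm q" | "norm q < norm p" by linarith
  then show ?thesis
  proof cases
    case 1
    have J: "J3 \<alpha> s N f p q r = norm p powr \<alpha> * (?S q * ?S r) * (f p * f q * f r)"
      using 1 le by (simp add: J3_def mult_ac)
    have "(norm r - norm q) / norm r * k \<le> norm p / norm r * (norm p powr (\<alpha> - 1) * norm q)"
      using pq k le by (intro mult_mono divide_right_mono) auto
    also have "\<dots> = (norm p * norm p powr (\<alpha> - 1)) * (norm q / norm r)" by simp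
    also have "\<dots> \<le> (norm p * norm p powr (\<alpha> - 1)) * 1"
      using le r0 by (intro mult_left_mono) (auto simp: divide_le_eq_1)
    also have "\<dots> = norm p powr \<alpha>" by (simp add: powr_mult_base)
    finally have a: "(norm r - norm q) / norm r * k \<le> norm p powr \<alpha>" .
    have b: "?S r \<le> 2 powr s * ?S q"
      using qr 1 s N by (intro trunc_double) auto
    have "\<bar>trunc (2 * s) N (norm r) - trunc (2 * s) N (norm q)\<bar> * k
        \<le> ?n * (?S r * ?S r) * ((norm r - norm q) / norm r) * k"
      using d k(1) by (rule mult_right_mono)
    also have "\<dots> = ?n * (?S r * ?S r) * ((norm r - norm q) / norm r * k)" by (simp add: mult_ac)
    also have "\<dots> \<le> ?n * (?S r * (2 powr s * ?S q)) * norm p powr \<alpha>"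
      using a b le k by (intro mult_mono mult_left_mono) auto
    also have "\<dots> = C0 s * (norm p powr \<alpha> * (?S q * ?S r))" by (simp add: C0_def mult_ac)
    finally have "\<bar>trunc (2 * s) N (norm r) - trunc (2 * s) N (norm q)\<bar> * k * (f p * f q * f r)
        \<le> C0 s * (norm p powr \<alpha> * (?S q * ?S r)) * (f p * f q * f r)" using F by (rule mult_right_mono)
    also have "\<dots> = C0 s * J3 \<alpha> s N f p q r" unfolding J by (simp add: mult_ac)
    also have "\<dots> \<le> C0 s * (J3 \<alpha> s N f p q r + J3 \<alpha> s N f q p r)"
      using J3_nonneg[of f, OF f] C0_nonneg by (intro mult_left_mono) auto
    finally show ?thesis .
  next
    case 2
    have J: "J3 \<alpha> s N f q p r = norm q powr \<alpha> * (?S p * ?S r) * (f p * f q * f r)"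
      using 2 le by (simp add: J3_def mult_ac)
    \<comment> \<open>Here q is the small frequency, the difference of weights gains nothing, and
      the trivial bound is used.\<close>
    have "(norm r - norm q) / norm r \<le> 1" using r0 by (simp add: divide_le_eq_1)
    then have "(norm r - norm q) / norm r * k \<le> 1 * k" using k(1) by (rule mult_right_mono)
    also have "\<dots> \<le> norm p powr (\<alpha> - 1) * norm q" using k by simp
    also have "\<dots> \<le> norm q powr \<alpha>"
    proof (cases "norm q = 0")
      case False
      then have "norm p powr (\<alpha> - 1) \<le> norm q powr (\<alpha> - 1)"
        using 2 \<alpha> by (intro powr_mono2') auto
      then have "norm p powr (\<alpha> - 1) * norm q \<le> norm q powr (\<alpha> - 1) * norm q" by (rule mult_right_mono) simp
      also have "\<dots> = norm q powr \<alpha>" by (simp add: powr_mult_base mult.commute)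
      finally show ?thesis .
    qed simp
    finally have a: "(norm r - norm q) / norm r * k \<le> norm q powr \<alpha>" .
    have b: "?S r \<le> 2 powr s * ?S p"
      using qr 2 s N by (intro trunc_double) auto
    have "\<bar>trunc (2 * s) N (norm r) - trunc (2 * s) N (norm q)\<bar> * k
        \<le> ?n * (?S r * ?S r) * ((norm r - norm q) / norm r) * k"
      using d k(1) by (rule mult_right_mono)
    also have "\<dots> = ?n * (?S r * ?S r) * ((norm r - norm q) / norm r * k)" by (simp add: mult_ac)
    also have "\<dots> \<le> ?n * (?S r * (2 powr s * ?S p)) * norm q powr \<alpha>"
      using a b le k by (intro mult_mono mult_left_mono) auto
    also have "\<dots> = C0 s * (norm q powr \<alpha> * (?S p * ?S r))" by (simp add: C0_def mult_ac)
    finally have "\<bar>trunc (2 * s) N (norm r) - trunc (2 * s) N (norm q)\<bar> * k * (f p * f q * f r)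
        \<le> C0 s * (norm q powr \<alpha> * (?S p * ?S r)) * (f p * f q * f r)" using F by (rule mult_right_mono)
    also have "\<dots> = C0 s * J3 \<alpha> s N f q p r" unfolding J by (simp add: mult_ac)
    also have "\<dots> \<le> C0 s * (J3 \<alpha> s N f p q r + J3 \<alpha> s N f q p r)"
      using J3_nonneg[of f, OF f] C0_nonneg by (intro mult_left_mono) auto
    finally show ?thesis .
  qed
qed

lemma commutator_pointwise:
  assumes s: "1 \<le> s" and N: "0 < N" and \<alpha>: "0 < \<alpha>" "\<alpha> < 1" and f: "\<And>x. 0 \<le> f x"
  shows "\<bar>trunc (2 * s) N (norm \<xi>) - trunc (2 * s) N (norm (\<xi> - \<eta>))\<bar> * \<bar>ker \<alpha> \<eta> (\<xi> - \<eta>)\<bar> * (f \<eta> * f (\<xi> - \<eta>) * f \<xi>)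
    \<le> C0 s * (J3 \<alpha> s N f \<eta> \<xi> (\<xi> - \<eta>) + J3 \<alpha> s N f \<xi> \<eta> (\<xi> - \<eta>) + J3 \<alpha> s N f (\<xi> - \<eta>) \<eta> \<xi>)"
proof -
  have t: "norm \<xi> \<le> norm (\<xi> - \<eta>) + norm \<eta>" "norm (\<xi> - \<eta>) \<le> norm \<xi> + norm \<eta>"
    using norm_triangle_ineq[of "\<xi> - \<eta>" \<eta>] norm_triangle_ineq4[of \<xi> \<eta>] by auto
  note k = ker_min_le[of \<alpha> \<eta> \<xi>]
  note nn = J3_nonneg[of f, OF f] C0_nonneg[of s]
  show ?thesis
  proof (cases "norm (\<xi> - \<eta>) \<le> norm \<xi>")
    case True
    have "\<bar>trunc (2 * s) N (norm \<xi>) - trunc (2 * s) N (norm (\<xi> - \<eta>))\<bar> * \<bar>ker \<alpha> \<eta> (\<xi> - \<eta>)\<bar> * (f \<eta> * f (\<xi> - \<eta>) * f \<xi>)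
      \<le> C0 s * (J3 \<alpha> s N f \<eta> (\<xi> - \<eta>) \<xi> + J3 \<alpha> s N f (\<xi> - \<eta>) \<eta> \<xi>)"
      using True t k by (intro commutator_pointwise_aux[OF s N \<alpha> f]) auto
    also have "\<dots> \<le> C0 s * (J3 \<alpha> s N f \<eta> \<xi> (\<xi> - \<eta>) + J3 \<alpha> s N f \<xi> \<eta> (\<xi> - \<eta>) + J3 \<alpha> s N f (\<xi> - \<eta>) \<eta> \<xi>)"
      using nn J3_swap[of \<alpha> s N f \<eta> "\<xi> - \<eta>" \<xi>] by (intro mult_left_mono) auto
    finally show ?thesis .
  next
    case False
    have "\<bar>trunc (2 * s) N (norm (\<xi> - \<eta>)) - trunc (2 * s) N (norm \<xi>)\<bar> * \<bar>ker \<alpha> \<eta> (\<xi> - \<eta>)\<bar> * (f \<eta> * f \<xi> * f (\<xi> - \<eta>))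
      \<le> C0 s * (J3 \<alpha> s N f \<eta> \<xi> (\<xi> - \<eta>) + J3 \<alpha> s N f \<xi> \<eta> (\<xi> - \<eta>))"
      using False t k by (intro commutator_pointwise_aux[OF s N \<alpha> f]) auto
    also have "\<dots> \<le> C0 s * (J3 \<alpha> s N f \<eta> \<xi> (\<xi> - \<eta>) + J3 \<alpha> s N f \<xi> \<eta> (\<xi> - \<eta>) + J3 \<alpha> s N f (\<xi> - \<eta>) \<eta> \<xi>)"
      using nn by (intro mult_left_mono) auto
    finally show ?thesis by (simp add: abs_minus_commute mult_ac)
  qed
qed

abbreviation (input) nn_integral2 :: "(real^2 \<Rightarrow> real^2 \<Rightarrow> ennreal) \<Rightarrow> ennreal" where
  "nn_integral2 g \<equiv> \<integral>\<^sup>+\<xi>. (\<integral>\<^sup>+\<eta>. g \<xi> \<eta> \<partial>lborel) \<partial>lborel"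

text \<open>Exchanging \<xi> with \<eta>, or replacing \<eta> by \<xi> - \<eta>, permutes the three
  frequencies up to sign, and f is even. One of the three model integrals is therefore
  enough.\<close>

lemma J3_permute:
  assumes [measurable]: "f \<in> borel_measurable borel" and even: "\<And>x. f (- x) = f x"
  shows "nn_integral2 (\<lambda>\<xi> \<eta>. ennreal (J3 \<alpha> s N f \<xi> \<eta> (\<xi> - \<eta>))) = nn_integral2 (\<lambda>\<xi> \<eta>. ennreal (J3 \<alpha> s N f \<eta> \<xi> (\<xi> - \<eta>)))"
    and "nn_integral2 (\<lambda>\<xi> \<eta>. ennreal (J3 \<alpha> s N f (\<xi> - \<eta>) \<eta> \<xi>)) = nn_integral2 (\<lambda>\<xi> \<eta>. ennreal (J3 \<alpha> s N f \<eta> \<xi> (\<xi> - \<eta>)))"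
proof -
  have "nn_integral2 (\<lambda>\<xi> \<eta>. ennreal (J3 \<alpha> s N f \<xi> \<eta> (\<xi> - \<eta>))) = (\<integral>\<^sup>+\<eta>. (\<integral>\<^sup>+\<xi>. ennreal (J3 \<alpha> s N f \<xi> \<eta> (\<xi> - \<eta>)) \<partial>lborel) \<partial>lborel)"
    by (rule lborel_pair.Fubini') measurable
  moreover have "J3 \<alpha> s N f \<xi> \<eta> (\<xi> - \<eta>) = J3 \<alpha> s N f \<xi> \<eta> (\<eta> - \<xi>)" for \<xi> \<eta>
    using J3_even[of f \<alpha> s N \<xi> \<eta> "\<eta> - \<xi>", OF even] by simp
  ultimately show "nn_integral2 (\<lambda>\<xi> \<eta>. ennreal (J3 \<alpha> s N f \<xi> \<eta> (\<xi> - \<eta>))) = nn_integral2 (\<lambda>\<xi> \<eta>. ennreal (J3 \<alpha> s N f \<eta> \<xi> (\<xi> - \<eta>)))"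
    by simp
  have "(\<integral>\<^sup>+\<eta>. ennreal (J3 \<alpha> s N f (\<xi> - \<eta>) \<eta> \<xi>) \<partial>lborel) = (\<integral>\<^sup>+\<eta>. ennreal (J3 \<alpha> s N f \<eta> \<xi> (\<xi> - \<eta>)) \<partial>lborel)" for \<xi>
  proof -
    have "(\<integral>\<^sup>+\<eta>. ennreal (J3 \<alpha> s N f (\<xi> - \<eta>) \<eta> \<xi>) \<partial>lborel) = (\<integral>\<^sup>+\<eta>. ennreal (J3 \<alpha> s N f (\<xi> - (\<xi> - \<eta>)) (\<xi> - \<eta>) \<xi>) \<partial>lborel)"
      by (rule nn_integral_flip[symmetric]) measurable
    then show ?thesis by (simp add: J3_swap[of \<alpha> s N f _ "\<xi> - _" \<xi>])
  qed
  then show "nn_integral2 (\<lambda>\<xi> \<eta>. ennreal (J3 \<alpha> s N f (\<xi> - \<eta>) \<eta> \<xi>)) = nn_integral2 (\<lambda>\<xi> \<eta>. ennreal (J3 \<alpha> s N f \<eta> \<xi> (\<xi> - \<eta>)))"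
    by simp
qed

section \<open>Integrating the model kernel\<close>

lemma nn_integral_split_mult:
  fixes u v :: "real^2 \<Rightarrow> ennreal"
  assumes [measurable]: "u \<in> borel_measurable borel" "v \<in> borel_measurable borel"
  shows "nn_integral2 (\<lambda>\<xi> \<eta>. u \<eta> * v \<xi>) = (\<integral>\<^sup>+\<eta>. u \<eta> \<partial>lborel) * (\<integral>\<^sup>+\<xi>. v \<xi> \<partial>lborel)"
  by (simp add: nn_integral_multc nn_integral_cmult)

lemma nn_integral_split_conv:
  fixes g :: "real^2 \<Rightarrow> real^2 \<Rightarrow> ennreal"
  assumes [measurable]: "case_prod g \<in> borel_measurable (borel \<Otimes>\<^sub>M borel)"
  shows "nn_integral2 (\<lambda>\<xi> \<eta>. g \<eta> (\<xi> - \<eta>)) = (\<integral>\<^sup>+\<zeta>. (\<integral>\<^sup>+\<eta>. g \<eta> \<zeta> \<partial>lborel) \<partial>lborel)"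
proof -
  have "nn_integral2 (\<lambda>\<xi> \<eta>. g \<eta> (\<xi> - \<eta>)) = (\<integral>\<^sup>+\<eta>. (\<integral>\<^sup>+\<xi>. g \<eta> (\<xi> - \<eta>) \<partial>lborel) \<partial>lborel)"
    by (rule lborel_pair.Fubini') measurable
  also have "\<dots> = (\<integral>\<^sup>+\<eta>. (\<integral>\<^sup>+\<zeta>. g \<eta> \<zeta> \<partial>lborel) \<partial>lborel)"
  proof (rule nn_integral_cong)
    fix \<eta>
    have "(\<integral>\<^sup>+\<xi>. g \<eta> (- \<eta> + \<xi>) \<partial>lborel) = (\<integral>\<^sup>+\<zeta>. g \<eta> \<zeta> \<partial>lborel)"
      by (rule nn_integral_shift) measurable
    then show "(\<integral>\<^sup>+\<xi>. g \<eta> (\<xi> - \<eta>) \<partial>lborel) = (\<integral>\<^sup>+\<zeta>. g \<eta> \<zeta> \<partial>lborel)" by simp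
  qed
  also have "\<dots> = (\<integral>\<^sup>+\<zeta>. (\<integral>\<^sup>+\<eta>. g \<eta> \<zeta> \<partial>lborel) \<partial>lborel)"
    by (rule lborel_pair.Fubini') measurable
  finally show ?thesis .
qed

text \<open>Low frequencies \<open>\<bar>p\<bar> \<le> M\<close> are estimated crudely; for the high ones the weights are
  redistributed so that each of the two terms is integrable by itself.\<close>

lemma J3_pointwise:
  assumes s: "0 \<le> s" and \<alpha>: "0 < \<alpha>" "\<alpha> < 1" and f: "\<And>x. 0 \<le> f x" and \<epsilon>: "0 < \<epsilon>" and M: "0 \<le> M"
    and q: "norm r \<le> norm q + norm p"
  shows "J3 \<alpha> s N f p q r
    \<le> (if norm p \<le> M then M powr \<alpha> * f p else 0) * ((trunc s N (norm q) * f q)\<^sup>2 / 2)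
    + (if norm p \<le> M then M powr \<alpha> * f p else 0) * ((trunc s N (norm r) * f r)\<^sup>2 / 2)
    + (if M < norm p then (norm p * f p)\<^sup>2 else 0) * (norm q powr \<alpha> * (trunc s N (norm q) * f q)\<^sup>2 / (2 * \<epsilon>))
    + (if norm p \<le> norm r then norm p powr (2 * \<alpha> - 2) else 0) * (norm r powr (- 2 * \<alpha>) * (\<epsilon> * 2 powr \<alpha> / 2) * (norm r powr \<alpha> * (trunc s N (norm r) * f r)\<^sup>2))"
    (is "_ \<le> ?A1 + ?A2 + ?B1 + ?B2")
proof -
  let ?G = "\<lambda>x. trunc s N (norm x) * f x"
  have G: "0 \<le> ?G x" for x using f by simp
  have nn: "0 \<le> ?A1" "0 \<le> ?A2" "0 \<le> ?B1" "0 \<le> ?B2" using f \<epsilon> by auto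
  show ?thesis
  proof (cases "norm p \<le> norm q \<and> norm p \<le> norm r")
    case False
    then have "J3 \<alpha> s N f p q r = 0" by (auto simp: J3_def)
    with nn show ?thesis by linarith
  next
    case True
    then have J: "J3 \<alpha> s N f p q r = norm p powr \<alpha> * f p * (?G q * ?G r)" by (simp add: J3_def mult_ac)
    show ?thesis
    proof (cases "norm p \<le> M")
      case pM: True
      have "norm p powr \<alpha> * f p * (?G q * ?G r) \<le> (M powr \<alpha> * f p) * ((?G q)\<^sup>2 / 2 + (?G r)\<^sup>2 / 2)"
      proof (intro mult_mono)
        show "norm p powr \<alpha> \<le> M powr \<alpha>" using pM \<alpha> by (intro powr_mono2) auto
        show "?G q * ?G r \<le> (?G q)\<^sup>2 / 2 + (?G r)\<^sup>2 / 2" using sum_squares_bound[of "?G q" "?G r"] by simp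
      qed (use f G in auto)
      then have "J3 \<alpha> s N f p q r \<le> ?A1 + ?A2" unfolding J using pM by (simp add: distrib_left)
      with nn show ?thesis by linarith
    next
      case pM: False
      then have p0: "0 < norm p" using pM M by linarith
      then have q0: "0 < norm q" and r0: "0 < norm r" using True by auto
      \<comment> \<open>The square of h is the dissipation density; both large frequencies are
        expressed through it.\<close>
      define h where "h x = norm x powr (\<alpha> / 2) * ?G x" for x :: "real^2"
      have h2: "(h x)\<^sup>2 = norm x powr \<alpha> * (?G x)\<^sup>2" for x
      proof -
        have "(norm x powr (\<alpha> / 2))\<^sup>2 = norm x powr \<alpha>" by (simp add: power2_eq_square powr_add[symmetric])
        then show ?thesis by (simp add: h_def power_mult_distrib)
      qed
      have Gh: "?G x = norm x powr (- \<alpha> / 2) * h x" if "0 < norm x" for x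
        using that by (simp add: h_def mult.assoc[symmetric] powr_add[symmetric])
      have h0: "0 \<le> h x" for x using G by (simp add: h_def)
      \<comment> \<open>Since p is smallest, |r| <= |q| + |p| <= 2 |q|. All negative powers can thus
        be collected at r, at the cost of 2^(\<alpha>/2).\<close>
      have rq: "norm q powr (- \<alpha> / 2) \<le> 2 powr (\<alpha> / 2) * norm r powr (- \<alpha> / 2)"
      proof -
        have "norm r / 2 \<le> norm q" using q True by simp
        then have "norm q powr (- \<alpha> / 2) \<le> (norm r / 2) powr (- \<alpha> / 2)"
          using r0 \<alpha> by (intro powr_mono2') auto
        also have "\<dots> = 2 powr (\<alpha> / 2) * norm r powr (- \<alpha> / 2)"
          by (simp add: powr_divide powr_minus field_simps)
        finally show ?thesis .
      qed
      \<comment> \<open>The factor |p|^\<alpha> is split as |p| times |p|^(\<alpha>-1). In u the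
        first part makes |p| f(p), square integrable with small tail. In v the second part has
        square |p|^(2\<alpha>-2), whose integral over |p| <= |r| is of order |r|^(2\<alpha>) and
        cancels the collected |r|^(-2\<alpha>).\<close>
      define u where "u = norm p * f p * h q"
      define v where "v = 2 powr (\<alpha> / 2) * norm p powr (\<alpha> - 1) * norm r powr (- \<alpha>) * h r"
      have uv0: "0 \<le> u" "0 \<le> v" using f h0 by (auto simp: u_def v_def)
      have "J3 \<alpha> s N f p q r = (norm p * norm p powr (\<alpha> - 1)) * f p * (norm q powr (- \<alpha> / 2) * h q * (norm r powr (- \<alpha> / 2) * h r))"
        unfolding J Gh[OF q0, symmetric] Gh[OF r0, symmetric] by (simp add: powr_mult_base)
      also have "\<dots> \<le> (norm p * norm p powr (\<alpha> - 1)) * f p * ((2 powr (\<alpha> / 2) * norm r powr (- \<alpha> / 2)) * h q * (norm r powr (- \<alpha> / 2) * h r))"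
        using rq f h0 by (intro mult_left_mono mult_right_mono) auto
      also have "\<dots> = u * v"
      proof -
        have e: "norm r powr (- \<alpha>) = norm r powr (- \<alpha> / 2) * norm r powr (- \<alpha> / 2)" by (simp add: powr_add[symmetric])
        show ?thesis unfolding u_def v_def e by (simp only: mult_ac)
      qed
      also have "u * v \<le> u\<^sup>2 / (2 * \<epsilon>) + \<epsilon> * v\<^sup>2 / 2"
      proof -
        have "2 * u * (\<epsilon> * v) \<le> u\<^sup>2 + (\<epsilon> * v)\<^sup>2" by (rule sum_squares_bound)
        then show ?thesis using \<epsilon> by (simp add: field_simps power2_eq_square)
      qed
      also have "u\<^sup>2 / (2 * \<epsilon>) = ?B1" using pM by (simp add: u_def power_mult_distrib h2)
      also have "\<epsilon> * v\<^sup>2 / 2 = ?B2"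
      proof -
        have e: "(2 powr (\<alpha> / 2))\<^sup>2 = 2 powr \<alpha>" "(norm p powr (\<alpha> - 1))\<^sup>2 = norm p powr (2 * \<alpha> - 2)"
          "(norm r powr (- \<alpha>))\<^sup>2 = norm r powr (- 2 * \<alpha>)"
          by (simp_all add: power2_eq_square powr_add[symmetric])
        have "v\<^sup>2 = 2 powr \<alpha> * norm p powr (2 * \<alpha> - 2) * norm r powr (- 2 * \<alpha>) * (norm r powr \<alpha> * (?G r)\<^sup>2)"
          unfolding v_def power_mult_distrib e h2 ..
        then show ?thesis using True by simp
      qed
      finally show ?thesis using nn by linarith
    qed
  qed
qed

text \<open>Each summand of \<open>J3_pointwise\<close> factors after translating variables. The two
  low parts give M^\<alpha> L E/2 each, the tail gives \<epsilon>^2 D/(2\<epsilon>), and the last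
  gives the ball integral 4|r|^(2\<alpha>)/\<alpha>^2 times \<epsilon> 2^\<alpha>/2 against the
  dissipation density.\<close>

lemma J3_integral_le:
  assumes s: "0 \<le> s" and \<alpha>: "0 < \<alpha>" "\<alpha> < 1" and f: "\<And>x. 0 \<le> f x" and [measurable]: "f \<in> borel_measurable borel"
    and \<epsilon>: "0 < \<epsilon>" and M: "0 \<le> M" and L: "0 \<le> L" and E: "0 \<le> E" and D: "0 \<le> D"
    and low: "(\<integral>\<^sup>+p. ennreal (if norm p \<le> M then f p else 0) \<partial>lborel) \<le> ennreal L"
    and tail: "(\<integral>\<^sup>+p. ennreal (if M < norm p then (norm p * f p)\<^sup>2 else 0) \<partial>lborel) \<le> ennreal (\<epsilon>\<^sup>2)"
    and En: "(\<integral>\<^sup>+q. ennreal ((trunc s N (norm q) * f q)\<^sup>2) \<partial>lborel) \<le> ennreal E"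
    and Dn: "(\<integral>\<^sup>+q. ennreal (norm q powr \<alpha> * (trunc s N (norm q) * f q)\<^sup>2) \<partial>lborel) \<le> ennreal D"
  shows "nn_integral2 (\<lambda>\<xi> \<eta>. ennreal (J3 \<alpha> s N f \<eta> \<xi> (\<xi> - \<eta>)))
    \<le> ennreal (M powr \<alpha> * L * E + \<epsilon> * (1 / 2 + 2 * 2 powr \<alpha> / \<alpha>\<^sup>2) * D)"
proof -
  let ?g = "\<lambda>x. trunc s N (norm x) * f x"
  let ?l = "\<lambda>p. ennreal (if norm p \<le> M then M powr \<alpha> * f p else 0)"
  let ?t = "\<lambda>p. ennreal (if M < norm p then (norm p * f p)\<^sup>2 else 0)"
  let ?e = "\<lambda>q. ennreal ((?g q)\<^sup>2 / 2)"
  let ?d = "\<lambda>q. ennreal (norm q powr \<alpha> * (?g q)\<^sup>2 / (2 * \<epsilon>))"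
  let ?h = "\<lambda>(p :: real^2) r. ennreal ((if norm p \<le> norm r then norm p powr (2 * \<alpha> - 2) else 0)) * ennreal (norm r powr (- 2 * \<alpha>) * (\<epsilon> * 2 powr \<alpha> / 2) * (norm r powr \<alpha> * (?g r)\<^sup>2))"
  have pt: "ennreal (J3 \<alpha> s N f \<eta> \<xi> (\<xi> - \<eta>)) \<le> ?l \<eta> * ?e \<xi> + (?l \<eta> * ?e (\<xi> - \<eta>) + (?t \<eta> * ?d \<xi> + ?h \<eta> (\<xi> - \<eta>)))" for \<xi> \<eta> :: "real^2"
  proof -
    have "norm (\<xi> - \<eta>) \<le> norm \<xi> + norm \<eta>" by (rule norm_triangle_ineq4)
    from J3_pointwise[where f=f, OF s \<alpha> f \<epsilon> M this, of N] show ?thesis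
      using f \<epsilon> by (simp add: ennreal_mult[symmetric] ennreal_plus[symmetric] ennreal_leI add.assoc del: ennreal_plus)
  qed
  have E': "(\<integral>\<^sup>+q. ?e q \<partial>lborel) \<le> ennreal (E / 2)"
  proof -
    have "(\<integral>\<^sup>+q. ?e q \<partial>lborel) = (\<integral>\<^sup>+q. ennreal ((?g q)\<^sup>2) * ennreal (1 / 2) \<partial>lborel)"
      by (intro nn_integral_cong, subst ennreal_mult[symmetric]) auto
    also have "\<dots> = (\<integral>\<^sup>+q. ennreal ((?g q)\<^sup>2) \<partial>lborel) * ennreal (1 / 2)" by (rule nn_integral_multc) measurable
    also have "\<dots> \<le> ennreal E * ennreal (1 / 2)" using En by (rule mult_right_mono) simp
    also have "\<dots> = ennreal (E / 2)" using E by (subst ennreal_mult[symmetric]) auto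
    finally show ?thesis .
  qed
  have l: "(\<integral>\<^sup>+p. ?l p \<partial>lborel) \<le> ennreal (M powr \<alpha> * L)"
  proof -
    have "(\<integral>\<^sup>+p. ?l p \<partial>lborel) = (\<integral>\<^sup>+p. ennreal (M powr \<alpha>) * ennreal (if norm p \<le> M then f p else 0) \<partial>lborel)"
      by (intro nn_integral_cong) (auto simp: ennreal_mult[symmetric] f)
    also have "\<dots> = ennreal (M powr \<alpha>) * (\<integral>\<^sup>+p. ennreal (if norm p \<le> M then f p else 0) \<partial>lborel)"
      by (rule nn_integral_cmult) measurable
    also have "\<dots> \<le> ennreal (M powr \<alpha>) * ennreal L" using low by (rule mult_left_mono) simp
    finally show ?thesis using L by (simp add: ennreal_mult[symmetric])
  qed
  have d: "(\<integral>\<^sup>+q. ?d q \<partial>lborel) \<le> ennreal (D / (2 * \<epsilon>))"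
  proof -
    have "(\<integral>\<^sup>+q. ?d q \<partial>lborel) = (\<integral>\<^sup>+q. ennreal (norm q powr \<alpha> * (?g q)\<^sup>2) * ennreal (1 / (2 * \<epsilon>)) \<partial>lborel)"
      using \<epsilon> by (intro nn_integral_cong) (simp add: ennreal_mult[symmetric])
    also have "\<dots> = (\<integral>\<^sup>+q. ennreal (norm q powr \<alpha> * (?g q)\<^sup>2) \<partial>lborel) * ennreal (1 / (2 * \<epsilon>))" by (rule nn_integral_multc) measurable
    also have "\<dots> \<le> ennreal D * ennreal (1 / (2 * \<epsilon>))" using Dn by (rule mult_right_mono) simp
    also have "\<dots> = ennreal (D / (2 * \<epsilon>))" using D \<epsilon> by (simp add: ennreal_mult[symmetric])
    finally show ?thesis .
  qed
  have h: "nn_integral2 (\<lambda>\<xi> \<eta>. ?h \<eta> (\<xi> - \<eta>)) \<le> ennreal (\<epsilon> * (2 * 2 powr \<alpha> / \<alpha>\<^sup>2) * D)"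
  proof -
    have "nn_integral2 (\<lambda>\<xi> \<eta>. ?h \<eta> (\<xi> - \<eta>)) = (\<integral>\<^sup>+\<zeta>. (\<integral>\<^sup>+\<eta>. ?h \<eta> \<zeta> \<partial>lborel) \<partial>lborel)"
      by (rule nn_integral_split_conv[where g="?h"]) measurable
    also have "\<dots> \<le> (\<integral>\<^sup>+\<zeta>. ennreal (\<epsilon> * (2 * 2 powr \<alpha> / \<alpha>\<^sup>2)) * ennreal (norm \<zeta> powr \<alpha> * (?g \<zeta>)\<^sup>2) \<partial>lborel)"
    proof (rule nn_integral_mono)
      fix \<zeta> :: "real^2"
      let ?c = "norm \<zeta> powr (- 2 * \<alpha>) * (\<epsilon> * 2 powr \<alpha> / 2) * (norm \<zeta> powr \<alpha> * (?g \<zeta>)\<^sup>2)"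
      have c0: "0 \<le> ?c" using \<epsilon> by simp
      have "(\<integral>\<^sup>+\<eta>. ?h \<eta> \<zeta> \<partial>lborel) = (\<integral>\<^sup>+(\<eta> :: real^2). ennreal (if norm \<eta> \<le> norm \<zeta> then norm \<eta> powr (2 * \<alpha> - 2) else 0) \<partial>lborel) * ennreal ?c"
        by (rule nn_integral_multc) measurable
      also have "\<dots> \<le> ennreal ((2 * norm \<zeta> powr \<alpha> / \<alpha>)\<^sup>2) * ennreal ?c"
        using nn_integral_powr_ball[OF \<alpha>, of "norm \<zeta>"] by (intro mult_right_mono) auto
      also have "\<dots> = ennreal ((2 * norm \<zeta> powr \<alpha> / \<alpha>)\<^sup>2 * ?c)" using c0 by (simp only: ennreal_mult zero_le_power2)
      also have "(2 * norm \<zeta> powr \<alpha> / \<alpha>)\<^sup>2 * ?c = \<epsilon> * (2 * 2 powr \<alpha> / \<alpha>\<^sup>2) * (norm \<zeta> powr \<alpha> * (?g \<zeta>)\<^sup>2)"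
      proof (cases "\<zeta> = 0")
        case False
        have "(norm \<zeta> powr \<alpha>)\<^sup>2 * norm \<zeta> powr (- 2 * \<alpha>) = 1"
          using False by (simp add: power2_eq_square powr_add[symmetric])
        moreover have "(2 * norm \<zeta> powr \<alpha> / \<alpha>)\<^sup>2 * ?c = ((norm \<zeta> powr \<alpha>)\<^sup>2 * norm \<zeta> powr (- 2 * \<alpha>)) * (\<epsilon> * (2 * 2 powr \<alpha> / \<alpha>\<^sup>2) * (norm \<zeta> powr \<alpha> * (?g \<zeta>)\<^sup>2))"
          by (simp add: power_mult_distrib power_divide)
        ultimately show ?thesis by simp
      qed simp
      finally show "(\<integral>\<^sup>+\<eta>. ?h \<eta> \<zeta> \<partial>lborel) \<le> ennreal (\<epsilon> * (2 * 2 powr \<alpha> / \<alpha>\<^sup>2)) * ennreal (norm \<zeta> powr \<alpha> * (?g \<zeta>)\<^sup>2)"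
        using \<epsilon> by (subst ennreal_mult[symmetric]) auto
    qed
    also have "\<dots> = ennreal (\<epsilon> * (2 * 2 powr \<alpha> / \<alpha>\<^sup>2)) * (\<integral>\<^sup>+\<zeta>. ennreal (norm \<zeta> powr \<alpha> * (?g \<zeta>)\<^sup>2) \<partial>lborel)"
      by (rule nn_integral_cmult) measurable
    also have "\<dots> \<le> ennreal (\<epsilon> * (2 * 2 powr \<alpha> / \<alpha>\<^sup>2)) * ennreal D" using Dn by (rule mult_left_mono) simp
    also have "\<dots> = ennreal (\<epsilon> * (2 * 2 powr \<alpha> / \<alpha>\<^sup>2) * D)" using \<epsilon> D by (simp add: ennreal_mult[symmetric])
    finally show ?thesis .
  qed
  have "nn_integral2 (\<lambda>\<xi> \<eta>. ennreal (J3 \<alpha> s N f \<eta> \<xi> (\<xi> - \<eta>)))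
    \<le> nn_integral2 (\<lambda>\<xi> \<eta>. ?l \<eta> * ?e \<xi> + (?l \<eta> * ?e (\<xi> - \<eta>) + (?t \<eta> * ?d \<xi> + ?h \<eta> (\<xi> - \<eta>))))"
    by (intro nn_integral_mono pt)
  also have "\<dots> = nn_integral2 (\<lambda>\<xi> \<eta>. ?l \<eta> * ?e \<xi>) + (nn_integral2 (\<lambda>\<xi> \<eta>. ?l \<eta> * ?e (\<xi> - \<eta>))
      + (nn_integral2 (\<lambda>\<xi> \<eta>. ?t \<eta> * ?d \<xi>) + nn_integral2 (\<lambda>\<xi> \<eta>. ?h \<eta> (\<xi> - \<eta>))))"
    by (simp add: nn_integral_add)
  also have "nn_integral2 (\<lambda>\<xi> \<eta>. ?l \<eta> * ?e (\<xi> - \<eta>)) = nn_integral2 (\<lambda>\<xi> \<eta>. ?l \<eta> * ?e \<xi>)"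
    by (rule nn_integral_split_conv[where g="\<lambda>\<eta> \<zeta>. ?l \<eta> * ?e \<zeta>"]) measurable
  also have "nn_integral2 (\<lambda>\<xi> \<eta>. ?l \<eta> * ?e \<xi>) = (\<integral>\<^sup>+p. ?l p \<partial>lborel) * (\<integral>\<^sup>+q. ?e q \<partial>lborel)"
    by (rule nn_integral_split_mult) measurable
  also have "nn_integral2 (\<lambda>\<xi> \<eta>. ?t \<eta> * ?d \<xi>) = (\<integral>\<^sup>+p. ?t p \<partial>lborel) * (\<integral>\<^sup>+q. ?d q \<partial>lborel)"
    by (rule nn_integral_split_mult) measurable
  also have "(\<integral>\<^sup>+p. ?l p \<partial>lborel) * (\<integral>\<^sup>+q. ?e q \<partial>lborel) + ((\<integral>\<^sup>+p. ?l p \<partial>lborel) * (\<integral>\<^sup>+q. ?e q \<partial>lborel)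
      + ((\<integral>\<^sup>+p. ?t p \<partial>lborel) * (\<integral>\<^sup>+q. ?d q \<partial>lborel) + nn_integral2 (\<lambda>\<xi> \<eta>. ?h \<eta> (\<xi> - \<eta>))))
    \<le> ennreal (M powr \<alpha> * L) * ennreal (E / 2) + (ennreal (M powr \<alpha> * L) * ennreal (E / 2)
      + (ennreal (\<epsilon>\<^sup>2) * ennreal (D / (2 * \<epsilon>)) + ennreal (\<epsilon> * (2 * 2 powr \<alpha> / \<alpha>\<^sup>2) * D)))"
    by (intro add_mono mult_mono l E' tail d h) auto
  also have "\<dots> = ennreal (M powr \<alpha> * L * (E / 2) + (M powr \<alpha> * L * (E / 2) + (\<epsilon>\<^sup>2 * (D / (2 * \<epsilon>)) + \<epsilon> * (2 * 2 powr \<alpha> / \<alpha>\<^sup>2) * D)))"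
    using L E D \<epsilon> by (simp add: ennreal_mult[symmetric] ennreal_plus[symmetric] del: ennreal_plus)
  also have "M powr \<alpha> * L * (E / 2) + (M powr \<alpha> * L * (E / 2) + (\<epsilon>\<^sup>2 * (D / (2 * \<epsilon>)) + \<epsilon> * (2 * 2 powr \<alpha> / \<alpha>\<^sup>2) * D))
     = M powr \<alpha> * L * E + \<epsilon> * (1 / 2 + 2 * 2 powr \<alpha> / \<alpha>\<^sup>2) * D"
    using \<epsilon> by (simp add: power2_eq_square distrib_left distrib_right)
  finally show ?thesis .
qed

section \<open>From the trilinear form to the energy estimate\<close>

lemma conv_pair_integrable:
  assumes U: "integrable lborel U" and G: "sq_integrable G" and \<psi>: "sq_integrable \<psi>"
  shows "integrable (lborel \<Otimes>\<^sub>M lborel) (\<lambda>(\<xi>, \<eta>). (U \<eta> :: complex) * G (\<xi> - \<eta> :: real^2) * \<psi> \<xi>)"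
proof -
  note [measurable] = borel_measurable_integrable[OF U, simplified] sq_integrable_measurable[OF G] sq_integrable_measurable[OF \<psi>]
  let ?k = "\<lambda>(\<xi>, \<eta>). U \<eta> * G (\<xi> - \<eta>) * \<psi> \<xi>"
  have aU: "integrable lborel (\<lambda>\<eta>. complex_of_real (cmod (U \<eta>)))" using U by simp
  have aG: "sq_integrable (\<lambda>\<xi>. complex_of_real (cmod (G \<xi>)))"
    by (rule sq_integrable_bound[OF G, of _ 1]) auto
  have k: "?k \<in> borel_measurable (lborel \<Otimes>\<^sub>M lborel)" by measurable
  have "integrable lborel (\<lambda>\<xi>. cmod (LBINT \<eta>. complex_of_real (cmod (U \<eta>)) * complex_of_real (cmod (G (\<xi> - \<eta>)))) * cmod (\<psi> \<xi>))"
    by (rule sq_integrable_mult_norm[OF Young_convolution(1)[OF aU aG] \<psi>])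
  then have i: "integrable lborel (\<lambda>\<xi>. (LBINT \<eta>. norm (?k (\<xi>, \<eta>))))"
    by (simp add: norm_mult integral_complex_of_real flip: of_real_mult)
  have "AE \<xi> in lborel. integrable lborel (\<lambda>\<eta>. ?k (\<xi>, \<eta>))"
    using Young_convolution(2)[OF U G] by eventually_elim simp
  from lborel_pair.Fubini_integrable[OF k i this] show ?thesis .
qed

lemma vel_grad_sum:
  "vel \<alpha> 1 F \<eta> * grad 1 F \<zeta> + vel \<alpha> 2 F \<eta> * grad 2 F \<zeta> = - (of_real (ker \<alpha> \<eta> \<zeta>) * (F \<eta> * F \<zeta>))"
proof -
  define c where "c = norm \<eta> powr (\<alpha> - 1) / norm \<eta>"
  have v: "vel \<alpha> j F \<eta> = of_real c * \<i> * of_real (perp j \<eta>) * F \<eta>" for j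
    by (simp add: vel_def c_def)
  have "vel \<alpha> 1 F \<eta> * grad 1 F \<zeta> + vel \<alpha> 2 F \<eta> * grad 2 F \<zeta>
     = (\<i> * \<i>) * (of_real (c * (perp 1 \<eta> * \<zeta> $ 1 + perp 2 \<eta> * \<zeta> $ 2)) * (F \<eta> * F \<zeta>))"
    unfolding v grad_def by (simp add: algebra_simps)
  also have "c * (perp 1 \<eta> * \<zeta> $ 1 + perp 2 \<eta> * \<zeta> $ 2) = ker \<alpha> \<eta> \<zeta>"
    by (simp add: c_def ker_def perp_def)
  finally show ?thesis by simp
qed

text \<open>The substitution (\<xi>, \<eta>) -> (\<xi> - \<eta>, -\<eta>) exchanges the two
  non-velocity frequencies and flips the sign of the kernel. So the conjugate of the integral is
  minus the same integral with w evaluated at \<xi> - \<eta>, and twice the real part sees only the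
  difference of the weights.\<close>

lemma trilinear_commutator:
  assumes \<alpha>: "0 < \<alpha>" "\<alpha> < 1" and F1: "sq_integrable (sobw 1 F)" and [measurable]: "F \<in> borel_measurable borel"
    and herm: "\<And>\<xi>. F (- \<xi>) = cnj (F \<xi>)"
    and [measurable]: "w \<in> borel_measurable borel" and w: "\<And>\<xi>. \<bar>w \<xi>\<bar> \<le> B" "\<And>\<xi>. w (- \<xi>) = w \<xi>"
  defines "TF \<equiv> \<lambda>\<xi>. (LBINT \<eta>. complex_of_real (ker \<alpha> \<eta> (\<xi> - \<eta>)) * (F \<eta> * F (\<xi> - \<eta>)))"
  shows "AE \<xi> in lborel. NF \<alpha> F \<xi> = of_real (norm \<xi> powr \<alpha>) * F \<xi> - TF \<xi> / of_real ((2 * pi)\<^sup>2)"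
    and "integrable lborel (\<lambda>\<xi>. TF \<xi> * (complex_of_real (w \<xi>) * cnj (F \<xi>)))"
    and "ennreal \<bar>2 * Re (LBINT \<xi>. TF \<xi> * (of_real (w \<xi>) * cnj (F \<xi>)))\<bar>
      \<le> nn_integral2 (\<lambda>\<xi> \<eta>. ennreal (\<bar>w \<xi> - w (\<xi> - \<eta>)\<bar> * \<bar>ker \<alpha> \<eta> (\<xi> - \<eta>)\<bar> * (cmod (F \<eta>) * cmod (F (\<xi> - \<eta>)) * cmod (F \<xi>))))"
proof -
  have Fs: "sq_integrable F" by (rule sobw_sq_integrable_mono(1)[OF F1]) auto
  have [measurable]: "(\<lambda>x. cnj (f x)) \<in> borel_measurable M" if "f \<in> borel_measurable M" for f and M :: "'z measure"
    using measurable_compose[OF that borel_measurable_cnj] .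
  define aU where "aU \<eta> = complex_of_real (norm \<eta> powr (\<alpha> - 1) * cmod (F \<eta>))" for \<eta>
  define aG where "aG \<zeta> = complex_of_real (norm \<zeta> * cmod (F \<zeta>))" for \<zeta>
  have [measurable]: "aU \<in> borel_measurable borel" "aG \<in> borel_measurable borel"
    unfolding aU_def[abs_def] aG_def[abs_def] by measurable
  have aU: "integrable lborel aU"
  proof (rule Bochner_Integration.integrable_bound[OF sq_integrable_mult_norm[OF vker_sq_integrable[OF \<alpha>] F1]])
    show "AE \<eta> in lborel. norm (aU \<eta>) \<le> norm (cmod (vker \<alpha> \<eta>) * cmod (sobw 1 F \<eta>))"
    proof (rule AE_I2)
      fix \<eta> :: "real^2"
      have "sqrt (1 + (norm \<eta>)\<^sup>2) \<noteq> 0" by (simp add: add_nonneg_eq_0_iff)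
      then show "norm (aU \<eta>) \<le> norm (cmod (vker \<alpha> \<eta>) * cmod (sobw 1 F \<eta>))"
        unfolding sobw_1 vker_def aU_def by (simp add: norm_divide norm_mult abs_mult)
    qed
  qed measurable
  have aG: "sq_integrable aG"
    by (rule sq_integrable_bound[OF F1, of _ 1]) (use norm_mult_le_sobw_1 in \<open>auto simp: aG_def norm_mult\<close>)
  \<comment> \<open>A majorant for every bounded weight: |\<eta>|^(\<alpha>-1)|F| is in L^1, and
    |\<zeta>||F| and F are in L^2. It justifies all exchanges of integration below.\<close>
  have K0: "integrable (lborel \<Otimes>\<^sub>M lborel) (\<lambda>(\<xi>, \<eta>). complex_of_real B * (aU \<eta> * aG (\<xi> - \<eta>) * F \<xi>))"
    using integrable_mult_right[OF conv_pair_integrable[OF aU aG Fs], of "complex_of_real B"] by (simp add: case_prod_beta')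
  define k where "k v \<xi> \<eta> = complex_of_real (v \<xi> \<eta> * ker \<alpha> \<eta> (\<xi> - \<eta>)) * (F \<eta> * F (\<xi> - \<eta>) * cnj (F \<xi>))" for v \<xi> \<eta>
  have B0: "0 \<le> B" using w(1)[of 0] by linarith
  have ki: "integrable (lborel \<Otimes>\<^sub>M lborel) (\<lambda>(\<xi>, \<eta>). k v \<xi> \<eta>)"
    if [measurable]: "(\<lambda>(\<xi>, \<eta>). v \<xi> \<eta>) \<in> borel_measurable (borel \<Otimes>\<^sub>M borel)" and v: "\<And>\<xi> \<eta>. \<bar>v \<xi> \<eta>\<bar> \<le> B" for v
  proof (rule Bochner_Integration.integrable_bound[OF K0])
    show "(\<lambda>(\<xi>, \<eta>). k v \<xi> \<eta>) \<in> borel_measurable (lborel \<Otimes>\<^sub>M lborel)" unfolding k_def by measurable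
    have "cmod (k v \<xi> \<eta>) \<le> cmod (of_real B * (aU \<eta> * aG (\<xi> - \<eta>) * F \<xi>))" for \<xi> \<eta>
    proof -
      have "cmod (k v \<xi> \<eta>) = \<bar>v \<xi> \<eta>\<bar> * \<bar>ker \<alpha> \<eta> (\<xi> - \<eta>)\<bar> * (cmod (F \<eta>) * cmod (F (\<xi> - \<eta>)) * cmod (F \<xi>))"
        by (simp add: k_def norm_mult abs_mult)
      also have "\<dots> \<le> B * (norm \<eta> powr (\<alpha> - 1) * norm (\<xi> - \<eta>)) * (cmod (F \<eta>) * cmod (F (\<xi> - \<eta>)) * cmod (F \<xi>))"
        using B0 by (intro mult_right_mono mult_mono v ker_le) auto
      also have "\<dots> = cmod (of_real B * (aU \<eta> * aG (\<xi> - \<eta>) * F \<xi>))"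
        using B0 by (simp add: aU_def aG_def norm_mult abs_mult)
      finally show ?thesis .
    qed
    then show "AE x in lborel \<Otimes>\<^sub>M lborel. cmod (case x of (\<xi>, \<eta>) \<Rightarrow> k v \<xi> \<eta>) \<le> cmod (case x of (\<xi>, \<eta>) \<Rightarrow> of_real B * (aU \<eta> * aG (\<xi> - \<eta>) * F \<xi>))"
      by (intro AE_I2) (simp add: case_prod_beta')
  qed
  let ?P = "\<lambda>v. \<integral>z. (case z of (\<xi>, \<eta>) \<Rightarrow> k v \<xi> \<eta>) \<partial>(lborel \<Otimes>\<^sub>M lborel)"
  define w1 where "w1 \<xi> (\<eta> :: real^2) = w \<xi>" for \<xi> \<eta>
  define w2 where "w2 \<xi> \<eta> = w (\<xi> - \<eta>)" for \<xi> \<eta>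
  have w1: "(\<lambda>(\<xi>, \<eta>). w1 \<xi> \<eta>) \<in> borel_measurable (borel \<Otimes>\<^sub>M borel)" "\<And>\<xi> \<eta>. \<bar>w1 \<xi> \<eta>\<bar> \<le> B"
    unfolding w1_def using w(1) by auto
  have w2: "(\<lambda>(\<xi>, \<eta>). w2 \<xi> \<eta>) \<in> borel_measurable (borel \<Otimes>\<^sub>M borel)" "\<And>\<xi> \<eta>. \<bar>w2 \<xi> \<eta>\<bar> \<le> B"
    unfolding w2_def using w(1) by auto
  note k1 = ki[of w1, OF w1] and k2 = ki[of w2, OF w2]
  have TFk: "TF \<xi> * (of_real (w \<xi>) * cnj (F \<xi>)) = (LBINT \<eta>. k w1 \<xi> \<eta>)" for \<xi>
    unfolding TF_def k_def w1_def by (subst integral_mult_left_zero[symmetric]) (simp add: mult_ac)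
  show "integrable lborel (\<lambda>\<xi>. TF \<xi> * (complex_of_real (w \<xi>) * cnj (F \<xi>)))"
    unfolding TFk by (rule lborel_pair.integrable_fst[OF k1])
  define I where "I = (LBINT \<xi>. TF \<xi> * (complex_of_real (w \<xi>) * cnj (F \<xi>)))"
  have I1: "I = (LBINT \<eta>. (LBINT \<xi>. k w1 \<xi> \<eta>))"
    unfolding I_def TFk by (rule lborel_pair.Fubini_integral[OF k1, symmetric])
  \<comment> \<open>Hermitian symmetry turns conjugation of F into reflection, the kernel is odd in
    \<eta>, and it does not see the shift of its second argument by \<eta>.\<close>
  have kc: "cnj (k w1 (\<xi> - \<eta>) (- \<eta>)) = - k w2 \<xi> \<eta>" for \<xi> \<eta>
    using herm[of \<eta>] by (simp add: k_def w1_def w2_def ker_uminus ker_diff)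
  have "cnj I = (LBINT \<eta>. (LBINT \<xi>. cnj (k w1 \<xi> \<eta>)))"
    unfolding I1 by (simp del: Bochner_Integration.integral_cnj add: Bochner_Integration.integral_cnj[symmetric])
  also have "\<dots> = (LBINT \<eta>. (LBINT \<xi>. cnj (k w1 \<xi> (0 - \<eta>))))"
    by (rule integral_flip[symmetric]) (unfold k_def w1_def, measurable)
  also have "\<dots> = (LBINT \<eta>. (LBINT \<xi>. cnj (k w1 (- \<eta> + \<xi>) (0 - \<eta>))))"
  proof (rule Bochner_Integration.integral_cong[OF refl])
    fix \<eta> :: "real^2"
    show "(LBINT \<xi>. cnj (k w1 \<xi> (0 - \<eta>))) = (LBINT \<xi>. cnj (k w1 (- \<eta> + \<xi>) (0 - \<eta>)))"
      by (rule integral_shift[symmetric]) (unfold k_def w1_def, measurable)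
  qed
  also have "\<dots> = (LBINT \<eta>. (LBINT \<xi>. - k w2 \<xi> \<eta>))"
    using kc by simp
  also have "\<dots> = - (LBINT \<eta>. (LBINT \<xi>. k w2 \<xi> \<eta>))" by simp
  finally have cI: "cnj I = - ?P w2"
    using lborel_pair.integral_snd[OF k2] by simp
  have I2: "I = ?P w1"
    unfolding I1 by (rule lborel_pair.integral_snd[OF k1])
  have "of_real (2 * Re I) = I + cnj I" by (simp add: complex_add_cnj)
  also have "\<dots> = ?P w1 - ?P w2"
    unfolding cI by (simp only: I2 diff_conv_add_uminus)
  also have "\<dots> = (\<integral>z. (case z of (\<xi>, \<eta>) \<Rightarrow> k w1 \<xi> \<eta>) - (case z of (\<xi>, \<eta>) \<Rightarrow> k w2 \<xi> \<eta>) \<partial>(lborel \<Otimes>\<^sub>M lborel))"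
    by (rule Bochner_Integration.integral_diff[OF k1 k2, symmetric])
  finally have R: "complex_of_real (2 * Re I) = (\<integral>z. (case z of (\<xi>, \<eta>) \<Rightarrow> k w1 \<xi> \<eta>) - (case z of (\<xi>, \<eta>) \<Rightarrow> k w2 \<xi> \<eta>) \<partial>(lborel \<Otimes>\<^sub>M lborel))" .
  let ?n = "\<lambda>(\<xi>, \<eta>). ennreal (\<bar>w \<xi> - w (\<xi> - \<eta>)\<bar> * \<bar>ker \<alpha> \<eta> (\<xi> - \<eta>)\<bar> * (cmod (F \<eta>) * cmod (F (\<xi> - \<eta>)) * cmod (F \<xi>)))"
  have "ennreal (cmod (of_real (2 * Re I))) \<le> (\<integral>\<^sup>+z. ?n z \<partial>(lborel \<Otimes>\<^sub>M lborel))"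
  proof -
    have "ennreal (cmod (of_real (2 * Re I))) \<le> (\<integral>\<^sup>+z. cmod ((case z of (\<xi>, \<eta>) \<Rightarrow> k w1 \<xi> \<eta>) - (case z of (\<xi>, \<eta>) \<Rightarrow> k w2 \<xi> \<eta>)) \<partial>(lborel \<Otimes>\<^sub>M lborel))"
      unfolding R by (rule integral_norm_bound_ennreal[OF Bochner_Integration.integrable_diff[OF k1 k2]])
    also have "\<dots> = (\<integral>\<^sup>+z. ?n z \<partial>(lborel \<Otimes>\<^sub>M lborel))"
    proof (rule nn_integral_cong)
      fix z :: "(real^2) \<times> (real^2)"
      obtain \<xi> \<eta> where z: "z = (\<xi>, \<eta>)" by force
      have "k w1 \<xi> \<eta> - k w2 \<xi> \<eta> = of_real ((w \<xi> - w (\<xi> - \<eta>)) * ker \<alpha> \<eta> (\<xi> - \<eta>)) * (F \<eta> * F (\<xi> - \<eta>) * cnj (F \<xi>))"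
        by (simp add: k_def w1_def w2_def algebra_simps)
      then show "ennreal (cmod ((case z of (\<xi>, \<eta>) \<Rightarrow> k w1 \<xi> \<eta>) - (case z of (\<xi>, \<eta>) \<Rightarrow> k w2 \<xi> \<eta>))) = ?n z"
        by (simp only: z prod.case norm_mult norm_of_real abs_mult complex_mod_cnj mult.assoc)
    qed
    finally show ?thesis .
  qed
  also have "(\<integral>\<^sup>+z. ?n z \<partial>(lborel \<Otimes>\<^sub>M lborel)) = nn_integral2 (\<lambda>\<xi> \<eta>. ?n (\<xi>, \<eta>))"
    by (rule lborel.nn_integral_fst[symmetric]) measurable
  finally show "ennreal \<bar>2 * Re (LBINT \<xi>. TF \<xi> * (of_real (w \<xi>) * cnj (F \<xi>)))\<bar>
      \<le> nn_integral2 (\<lambda>\<xi> \<eta>. ennreal (\<bar>w \<xi> - w (\<xi> - \<eta>)\<bar> * \<bar>ker \<alpha> \<eta> (\<xi> - \<eta>)\<bar> * (cmod (F \<eta>) * cmod (F (\<xi> - \<eta>)) * cmod (F \<xi>))))"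
    unfolding I_def norm_of_real prod.case .
  note vi = vel_integrable(1)[OF \<alpha> F1] and gi = grad_sq_integrable(1)[OF F1]
  have "AE \<xi> in lborel. integrable lborel (\<lambda>\<eta>. vel \<alpha> 1 F \<eta> * grad 1 F (\<xi> - \<eta>)) \<and> integrable lborel (\<lambda>\<eta>. vel \<alpha> 2 F \<eta> * grad 2 F (\<xi> - \<eta>))"
    by (intro AE_conjI Young_convolution(2) vi gi) measurable
  then show "AE \<xi> in lborel. NF \<alpha> F \<xi> = of_real (norm \<xi> powr \<alpha>) * F \<xi> - TF \<xi> / of_real ((2 * pi)\<^sup>2)"
  proof eventually_elim
    case (elim \<xi>)
    have "(\<Sum>j\<in>UNIV. (LBINT \<eta>. vel \<alpha> j F \<eta> * grad j F (\<xi> - \<eta>)))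
       = (LBINT \<eta>. vel \<alpha> 1 F \<eta> * grad 1 F (\<xi> - \<eta>) + vel \<alpha> 2 F \<eta> * grad 2 F (\<xi> - \<eta>))"
      using elim by (simp add: UNIV_2 Bochner_Integration.integral_add)
    also have "\<dots> = - TF \<xi>" unfolding vel_grad_sum TF_def by simp
    finally show ?case by (simp add: NF_def)
  qed
qed

text \<open>The 3 counts the permuted model integrals, (2 pi)^2 is the normalisation of the
  convolution, and the bracket is the coefficient of \<epsilon> D in
  \<open>J3_integral_le\<close>.\<close>

definition Ctri :: "real \<Rightarrow> real \<Rightarrow> real" where
  "Ctri \<alpha> s = 3 * C0 s / (2 * pi)\<^sup>2 * (1 / 2 + 2 * 2 powr \<alpha> / \<alpha>\<^sup>2)"

text \<open>Paired with w times conj F, the equation contributes exactly -D from the linear part, so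
  the left side is the trilinear integral divided by (2 pi)^2. The weight is at most N^(2s), so E
  and D are finite for F in H^1, while the constants do not involve N.\<close>

lemma energy_estimate:
  assumes \<alpha>: "0 < \<alpha>" "\<alpha> < 1" and F1: "sq_integrable (sobw 1 F)" and [measurable]: "F \<in> borel_measurable borel"
    and herm: "\<And>\<xi>. F (- \<xi>) = cnj (F \<xi>)" and s: "1 \<le> s" and N: "0 < N"
    and Y: "AE \<xi> in lborel. Y \<xi> = - NF \<alpha> F \<xi>" and [measurable]: "Y \<in> borel_measurable borel"
    and \<epsilon>: "0 < \<epsilon>" and M: "0 \<le> M" and L: "0 \<le> L"
    and low: "(\<integral>\<^sup>+p. ennreal (if norm p \<le> M then cmod (F p) else 0) \<partial>lborel) \<le> ennreal L"
    and tail: "(\<integral>\<^sup>+p. ennreal (if M < norm p then (norm p * cmod (F p))\<^sup>2 else 0) \<partial>lborel) \<le> ennreal (\<epsilon>\<^sup>2)"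
  defines "w \<equiv> \<lambda>\<xi>. trunc (2 * s) N (norm \<xi>)"
  defines "E \<equiv> (LBINT \<xi>. w \<xi> * (cmod (F \<xi>))\<^sup>2)"
  defines "D \<equiv> (LBINT \<xi>. norm \<xi> powr \<alpha> * (w \<xi> * (cmod (F \<xi>))\<^sup>2))"
  shows "\<bar>2 * Re (LBINT \<xi>. Y \<xi> * (of_real (w \<xi>) * cnj (F \<xi>))) + 2 * D\<bar>
    \<le> 3 * C0 s / (2 * pi)\<^sup>2 * M powr \<alpha> * L * E + Ctri \<alpha> s * \<epsilon> * D"
proof -
  have [measurable]: "w \<in> borel_measurable borel" unfolding w_def by measurable
  have w0: "0 \<le> w \<xi>" for \<xi> by (simp add: w_def)
  have wB: "\<bar>w \<xi>\<bar> \<le> N powr (2 * s)" for \<xi>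
    using trunc_le[of "2 * s" "norm \<xi>" N] s N by (simp add: w_def)
  have we: "w (- \<xi>) = w \<xi>" for \<xi> by (simp add: w_def)
  have Fs: "sq_integrable F" by (rule sobw_sq_integrable_mono(1)[OF F1]) auto
  define TF where "TF \<xi> = (LBINT \<eta>. complex_of_real (ker \<alpha> \<eta> (\<xi> - \<eta>)) * (F \<eta> * F (\<xi> - \<eta>)))" for \<xi>
  have [measurable]: "TF \<in> borel_measurable borel" unfolding TF_def[abs_def] by measurable
  note T = trilinear_commutator[where F=F and w=w, OF \<alpha> F1 _ herm _ wB we, folded TF_def]
  have T1: "AE \<xi> in lborel. NF \<alpha> F \<xi> = of_real (norm \<xi> powr \<alpha>) * F \<xi> - TF \<xi> / of_real ((2 * pi)\<^sup>2)"
    by (rule T(1)) measurable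
  have T2: "integrable lborel (\<lambda>\<xi>. TF \<xi> * (complex_of_real (w \<xi>) * cnj (F \<xi>)))"
    by (rule T(2)) measurable
  let ?G = "\<lambda>\<xi> \<eta>. \<bar>w \<xi> - w (\<xi> - \<eta>)\<bar> * \<bar>ker \<alpha> \<eta> (\<xi> - \<eta>)\<bar> * (cmod (F \<eta>) * cmod (F (\<xi> - \<eta>)) * cmod (F \<xi>))"
  let ?I = "(LBINT \<xi>. TF \<xi> * (of_real (w \<xi>) * cnj (F \<xi>)))"
  have T3: "ennreal \<bar>2 * Re ?I\<bar>
      \<le> nn_integral2 (\<lambda>\<xi> \<eta>. ennreal (?G \<xi> \<eta>))"
    by (rule T(3)) measurable
  have Ei: "integrable lborel (\<lambda>\<xi>. w \<xi> * (cmod (F \<xi>))\<^sup>2)"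
  proof (rule Bochner_Integration.integrable_bound)
    show "integrable lborel (\<lambda>\<xi>. N powr (2 * s) * (cmod (F \<xi>))\<^sup>2)" using Fs by (simp add: sq_integrable_def)
    show "AE \<xi> in lborel. norm (w \<xi> * (cmod (F \<xi>))\<^sup>2) \<le> norm (N powr (2 * s) * (cmod (F \<xi>))\<^sup>2)"
      using wB by (intro AE_I2) (simp add: abs_mult mult_right_mono)
  qed measurable
  have Di: "integrable lborel (\<lambda>\<xi>. norm \<xi> powr \<alpha> * (w \<xi> * (cmod (F \<xi>))\<^sup>2))"
  proof (rule Bochner_Integration.integrable_bound)
    show "integrable lborel (\<lambda>\<xi>. N powr (2 * s) * (cmod (sobw 1 F \<xi>))\<^sup>2)" using F1 by (simp add: sq_integrable_def)
    show "AE \<xi> in lborel. norm (norm \<xi> powr \<alpha> * (w \<xi> * (cmod (F \<xi>))\<^sup>2)) \<le> norm (N powr (2 * s) * (cmod (sobw 1 F \<xi>))\<^sup>2)"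
    proof (rule AE_I2)
      fix \<xi> :: "real^2"
      have "norm \<xi> powr \<alpha> \<le> (1 + (norm \<xi>)\<^sup>2) powr (2 / 2)" using \<alpha> by (intro norm_powr_le) auto
      then have "norm \<xi> powr \<alpha> \<le> (1 + (norm \<xi>)\<^sup>2) powr 1" by simp
      then have "w \<xi> * (norm \<xi> powr \<alpha> * (cmod (F \<xi>))\<^sup>2) \<le> N powr (2 * s) * ((1 + (norm \<xi>)\<^sup>2) powr 1 * (cmod (F \<xi>))\<^sup>2)"
        using wB[of \<xi>] w0[of \<xi>] by (intro mult_mono) auto
      then show "norm (norm \<xi> powr \<alpha> * (w \<xi> * (cmod (F \<xi>))\<^sup>2)) \<le> norm (N powr (2 * s) * (cmod (sobw 1 F \<xi>))\<^sup>2)"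
        unfolding norm_sobw_sq using w0[of \<xi>] by (simp add: mult_ac)
    qed
  qed measurable
  have E0: "0 \<le> E" and D0: "0 \<le> D" unfolding E_def D_def using w0 by auto
  have g: "(trunc s N (norm q) * cmod (F q))\<^sup>2 = w q * (cmod (F q))\<^sup>2" for q
    unfolding w_def trunc_sq by (simp add: power2_eq_square mult_ac)
  have En: "(\<integral>\<^sup>+q. ennreal ((trunc s N (norm q) * cmod (F q))\<^sup>2) \<partial>lborel) \<le> ennreal E"
    unfolding g E_def using Ei w0 by (subst nn_integral_eq_integral) auto
  have Dn: "(\<integral>\<^sup>+q. ennreal (norm q powr \<alpha> * (trunc s N (norm q) * cmod (F q))\<^sup>2) \<partial>lborel) \<le> ennreal D"
    unfolding g D_def using Di w0 by (subst nn_integral_eq_integral) auto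
  let ?f = "\<lambda>x. cmod (F x)"
  let ?J = "\<integral>\<^sup>+\<xi>. (\<integral>\<^sup>+\<eta>. ennreal (J3 \<alpha> s N ?f \<eta> \<xi> (\<xi> - \<eta>)) \<partial>lborel) \<partial>lborel"
  let ?b = "M powr \<alpha> * L * E + \<epsilon> * (1 / 2 + 2 * 2 powr \<alpha> / \<alpha>\<^sup>2) * D"
  have J: "?J \<le> ennreal ?b"
    by (rule J3_integral_le[OF _ \<alpha> _ _ \<epsilon> M L E0 D0 low tail En Dn]) (use s in auto)
  have b0: "0 \<le> ?b" using L E0 D0 \<epsilon> by (intro add_nonneg_nonneg mult_nonneg_nonneg) auto
  have e3: "ennreal c * (ennreal x + (ennreal x + ennreal x)) = ennreal (c * (3 * x))" if "0 \<le> c" "0 \<le> x" for c x :: real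
    using that by (simp add: ennreal_mult[symmetric] ennreal_plus[symmetric] del: ennreal_plus)
  have even: "?f (- x) = ?f x" for x by (simp add: herm)
  have "nn_integral2 (\<lambda>\<xi> \<eta>. ennreal (?G \<xi> \<eta>))
     \<le> nn_integral2 (\<lambda>\<xi> \<eta>. ennreal (C0 s) * (ennreal (J3 \<alpha> s N ?f \<eta> \<xi> (\<xi> - \<eta>)) + (ennreal (J3 \<alpha> s N ?f \<xi> \<eta> (\<xi> - \<eta>)) + ennreal (J3 \<alpha> s N ?f (\<xi> - \<eta>) \<eta> \<xi>))))"
  proof (intro nn_integral_mono)
    fix \<xi> \<eta> :: "real^2"
    have "?G \<xi> \<eta>
      \<le> C0 s * (J3 \<alpha> s N ?f \<eta> \<xi> (\<xi> - \<eta>) + J3 \<alpha> s N ?f \<xi> \<eta> (\<xi> - \<eta>) + J3 \<alpha> s N ?f (\<xi> - \<eta>) \<eta> \<xi>)"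
      unfolding w_def by (rule commutator_pointwise[OF s N \<alpha>]) simp
    then show "ennreal (?G \<xi> \<eta>)
      \<le> ennreal (C0 s) * (ennreal (J3 \<alpha> s N ?f \<eta> \<xi> (\<xi> - \<eta>)) + (ennreal (J3 \<alpha> s N ?f \<xi> \<eta> (\<xi> - \<eta>)) + ennreal (J3 \<alpha> s N ?f (\<xi> - \<eta>) \<eta> \<xi>)))"
      using C0_nonneg[of s] J3_nonneg[of ?f]
      by (simp add: ennreal_mult[symmetric] ennreal_plus[symmetric] ennreal_leI add.assoc del: ennreal_plus)
  qed
  also have "\<dots> = ennreal (C0 s) * (?J + (nn_integral2 (\<lambda>\<xi> \<eta>. ennreal (J3 \<alpha> s N ?f \<xi> \<eta> (\<xi> - \<eta>)))
      + nn_integral2 (\<lambda>\<xi> \<eta>. ennreal (J3 \<alpha> s N ?f (\<xi> - \<eta>) \<eta> \<xi>))))"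
    by (simp add: nn_integral_add nn_integral_cmult)
  also have "\<dots> = ennreal (C0 s) * (?J + (?J + ?J))"
    using J3_permute[of ?f, OF _ even] by simp
  also have "\<dots> \<le> ennreal (C0 s) * (ennreal ?b + (ennreal ?b + ennreal ?b))"
    by (intro mult_left_mono add_mono J) auto
  also have "\<dots> = ennreal (C0 s * (3 * ?b))"
    by (rule e3[OF C0_nonneg b0])
  finally have "ennreal \<bar>2 * Re ?I\<bar> \<le> ennreal (C0 s * (3 * ?b))" using T3 by (rule order_trans[rotated])
  then have Ib: "\<bar>2 * Re ?I\<bar> \<le> C0 s * (3 * ?b)"
    using C0_nonneg[of s] b0 by (subst (asm) ennreal_le_iff) auto
  have "(LBINT \<xi>. Y \<xi> * (of_real (w \<xi>) * cnj (F \<xi>)))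
      = (LBINT \<xi>. 1 / of_real ((2 * pi)\<^sup>2) * (TF \<xi> * (of_real (w \<xi>) * cnj (F \<xi>))) - of_real (norm \<xi> powr \<alpha> * (w \<xi> * (cmod (F \<xi>))\<^sup>2)))"
  proof (rule integral_cong_AE)
    show "AE \<xi> in lborel. Y \<xi> * (of_real (w \<xi>) * cnj (F \<xi>))
       = 1 / of_real ((2 * pi)\<^sup>2) * (TF \<xi> * (of_real (w \<xi>) * cnj (F \<xi>))) - of_real (norm \<xi> powr \<alpha> * (w \<xi> * (cmod (F \<xi>))\<^sup>2))"
      using Y T1
    proof eventually_elim
      case (elim \<xi>)
      have c: "of_real ((cmod (F \<xi>))\<^sup>2) = F \<xi> * cnj (F \<xi>)" by (rule complex_norm_square)
      show ?case unfolding elim of_real_mult c by (simp add: algebra_simps)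
    qed
    have [measurable]: "(\<lambda>x. cnj (F x)) \<in> borel_measurable borel"
      by (intro measurable_compose[OF _ borel_measurable_cnj]) measurable
    show "(\<lambda>\<xi>. Y \<xi> * (of_real (w \<xi>) * cnj (F \<xi>))) \<in> borel_measurable lborel"
      "(\<lambda>\<xi>. 1 / of_real ((2 * pi)\<^sup>2) * (TF \<xi> * (of_real (w \<xi>) * cnj (F \<xi>))) - of_real (norm \<xi> powr \<alpha> * (w \<xi> * (cmod (F \<xi>))\<^sup>2))) \<in> borel_measurable lborel"
      by measurable
  qed
  also have "\<dots> = (LBINT \<xi>. 1 / of_real ((2 * pi)\<^sup>2) * (TF \<xi> * (of_real (w \<xi>) * cnj (F \<xi>))))
      - (LBINT \<xi>. of_real (norm \<xi> powr \<alpha> * (w \<xi> * (cmod (F \<xi>))\<^sup>2)))"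
    by (intro Bochner_Integration.integral_diff integrable_mult_right T2 Bochner_Integration.integrable_of_real Di)
  also have "\<dots> = complex_of_real (1 / (2 * pi)\<^sup>2) * ?I - complex_of_real D"
    unfolding integral_mult_right_zero integral_complex_of_real D_def by simp
  finally have "2 * Re (LBINT \<xi>. Y \<xi> * (of_real (w \<xi>) * cnj (F \<xi>))) + 2 * D = 1 / (2 * pi)\<^sup>2 * (2 * Re ?I)"
    by (simp only: minus_complex.simps Re_complex_of_real scaleR_conv_of_real[symmetric] scaleR_complex.sel) simp
  then have "\<bar>2 * Re (LBINT \<xi>. Y \<xi> * (of_real (w \<xi>) * cnj (F \<xi>))) + 2 * D\<bar> = 1 / (2 * pi)\<^sup>2 * \<bar>2 * Re ?I\<bar>"
    by (simp only: abs_mult) simp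
  also have "\<dots> \<le> 1 / (2 * pi)\<^sup>2 * (C0 s * (3 * ?b))"
    using Ib by (rule mult_left_mono) simp
  also have "\<dots> = 3 * C0 s / (2 * pi)\<^sup>2 * M powr \<alpha> * L * E + Ctri \<alpha> s * \<epsilon> * D"
    unfolding Ctri_def by (simp only: divide_inverse) (simp add: algebra_simps)
  finally show ?thesis .
qed

section \<open>Propagation of regularity\<close>

lemma Dini_zero:
  fixes q :: "nat \<Rightarrow> real \<Rightarrow> real"
  assumes S: "compact S" and cont: "\<And>n. continuous_on S (q n)"
    and anti: "\<And>m n t. m \<le> n \<Longrightarrow> t \<in> S \<Longrightarrow> q n t \<le> q m t"
    and lim: "\<And>t. t \<in> S \<Longrightarrow> (\<lambda>n. q n t) \<longlonglongrightarrow> 0" and \<epsilon>: "0 < \<epsilon>"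
  shows "\<exists>n. \<forall>t\<in>S. q n t < \<epsilon>"
proof (rule ccontr)
  assume "\<not> ?thesis"
  then have "\<forall>n. \<exists>t\<in>S. \<epsilon> \<le> q n t" by (auto simp: not_less)
  then obtain u where u: "\<And>n. u n \<in> S" "\<And>n. \<epsilon> \<le> q n (u n)" by metis
  from S u(1) obtain l r where l: "l \<in> S" "strict_mono r" "(u \<circ> r) \<longlonglongrightarrow> l"
    unfolding compact_def by blast
  have "\<epsilon> \<le> q m l" for m
  proof (rule tendsto_lowerbound)
    show "(\<lambda>n. q m (u (r n))) \<longlonglongrightarrow> q m l"
      using continuous_on_tendsto_compose[OF cont[of m] l(3) l(1)] u(1) by (simp add: o_def)
    show "\<forall>\<^sub>F n in sequentially. \<epsilon> \<le> q m (u (r n))"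
      using eventually_ge_at_top[of m]
    proof eventually_elim
      case (elim n)
      then have "m \<le> r n" using seq_suble[OF l(2), of n] by linarith
      then have "q (r n) (u (r n)) \<le> q m (u (r n))" by (rule anti[OF _ u(1)])
      then show ?case using u(2)[of "r n"] by linarith
    qed
  qed simp
  then have "\<epsilon> \<le> 0" using LIMSEQ_le_const[OF lim[OF l(1)], of \<epsilon>] by auto
  with \<epsilon> show False by simp
qed

text \<open>The hypothesis is two-sided. Its upper half, e' <= K e - d, gives the first two bounds
  through the integrating factor g. Both halves together give |e'| <= 3 d + K e, hence the modulus
  of continuity in the third; one-sided differential inequalities would not bound the decrease of
  e.\<close>

lemma dissipative_bound:
  fixes e d e' :: "real \<Rightarrow> real"
  assumes ab: "a \<le> b" and e: "continuous_on {a..b} e" and d: "continuous_on {a..b} d"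
    and e0: "\<And>t. t \<in> {a..b} \<Longrightarrow> 0 \<le> e t" and d0: "\<And>t. t \<in> {a..b} \<Longrightarrow> 0 \<le> d t" and K: "0 \<le> K"
    and der: "\<And>t. a < t \<Longrightarrow> t < b \<Longrightarrow> (e has_real_derivative e' t) (at t)"
    and le: "\<And>t. a < t \<Longrightarrow> t < b \<Longrightarrow> \<bar>e' t + 2 * d t\<bar> \<le> K * e t + d t"
  shows "t \<in> {a..b} \<Longrightarrow> e t \<le> exp (K * (b - a)) * e a"
    and "integral {a..b} d \<le> exp (K * (b - a)) * e a"
    and "a \<le> s \<Longrightarrow> s \<le> t \<Longrightarrow> t \<le> b \<Longrightarrow> \<bar>e t - e s\<bar> \<le> integral {s..t} (\<lambda>u. 3 * d u + K * e u)"
proof -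
  define g where "g u = exp (- (K * (u - a)))" for u
  have gd: "(g has_real_derivative - K * g u) (at u)" for u
    unfolding g_def by (auto intro!: derivative_eq_intros)
  have gc: "continuous_on A g" for A unfolding g_def by (intro continuous_intros)
  define I where "I t = integral {a..t} (\<lambda>u. g u * d u)" for t
  have gdc: "continuous_on {a..b} (\<lambda>u. g u * d u)" by (intro continuous_intros gc d)
  have antider: "((\<lambda>x. integral {a..x} f) has_real_derivative f t) (at t)"
    if "continuous_on {a..b} f" "a < t" "t < b" for f :: "real \<Rightarrow> real" and t
    using integral_has_real_derivative[OF that(1), of t] that(2,3) by (simp add: at_within_Icc_at)
  have Ic: "continuous_on {a..b} (\<lambda>x. integral {a..x} f)" if "continuous_on {a..b} f" for f :: "real \<Rightarrow> real"
    by (rule indefinite_integral_continuous_1[OF integrable_continuous_interval[OF that]])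
  have F: "g t * e t + I t \<le> e a" if t: "t \<in> {a..b}" for t
  proof -
    have "g t * e t + I t \<le> g a * e a + I a"
    proof (rule DERIV_nonpos_imp_decreasing_open[of a t "\<lambda>t. g t * e t + I t"])
      show "a \<le> t" using t by simp
      fix x assume x: "a < x" "x < t"
      then have xb: "x < b" using t by simp
      have D: "((\<lambda>t. g t * e t + I t) has_real_derivative (- K * g x) * e x + e' x * g x + g x * d x) (at x)"
        unfolding I_def by (intro DERIV_add DERIV_mult gd der antider gdc x xb)
      have "g x * (e' x - K * e x + d x) \<le> 0"
        using le[OF x(1) xb] by (intro mult_nonneg_nonpos) (auto simp: g_def)
      then show "\<exists>y. ((\<lambda>t. g t * e t + I t) has_real_derivative y) (at x) \<and> y \<le> 0"
        by (intro exI[of _ "(- K * g x) * e x + e' x * g x + g x * d x"] conjI D) (simp add: algebra_simps)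
    next
      have "{a..t} \<subseteq> {a..b}" using t by auto
      then show "continuous_on {a..t} (\<lambda>t. g t * e t + I t)"
        unfolding I_def by (intro continuous_intros gc continuous_on_subset[OF e] continuous_on_subset[OF Ic[OF gdc]])
    qed
    then show ?thesis by (simp add: g_def I_def)
  qed
  have I0: "0 \<le> I t" if "t \<in> {a..b}" for t
    unfolding I_def
  proof (rule integral_nonneg)
    show "(\<lambda>u. g u * d u) integrable_on {a..t}"
      using that by (intro integrable_continuous_interval continuous_on_subset[OF gdc]) auto
  qed (use that d0 in \<open>auto simp: g_def\<close>)
  have ea: "0 \<le> e a" using e0 ab by simp
  show "e t \<le> exp (K * (b - a)) * e a" if t: "t \<in> {a..b}"
  proof -
    have "g t * e t \<le> e a" using F[OF t] I0[OF t] by linarith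
    then have "exp (K * (t - a)) * (g t * e t) \<le> exp (K * (t - a)) * e a" by (rule mult_left_mono) simp
    also have "exp (K * (t - a)) * (g t * e t) = e t" by (simp add: g_def exp_minus)
    also have "exp (K * (t - a)) * e a \<le> exp (K * (b - a)) * e a"
      using K t ea by (intro mult_right_mono) (auto intro: mult_left_mono)
    finally show ?thesis .
  qed
  show "integral {a..b} d \<le> exp (K * (b - a)) * e a"
  proof -
    have "integral {a..b} d \<le> integral {a..b} (\<lambda>u. exp (K * (b - a)) * (g u * d u))"
    proof (rule integral_le)
      fix u assume u: "u \<in> {a..b}"
      have "1 * d u \<le> (exp (K * (b - a)) * g u) * d u"
        using K u by (intro mult_right_mono d0) (auto simp: g_def simp flip: exp_add intro: mult_left_mono)
      then show "d u \<le> exp (K * (b - a)) * (g u * d u)" by (simp add: mult_ac)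
    qed (intro integrable_continuous_interval continuous_intros d gdc)+
    also have "\<dots> = exp (K * (b - a)) * I b" by (simp add: I_def)
    also have "\<dots> \<le> exp (K * (b - a)) * e a"
      using F[of b] e0[of b] ab by (intro mult_left_mono) (auto simp: g_def intro: order_trans[rotated])
    finally show ?thesis .
  qed
  assume st: "a \<le> s" "s \<le> t" "t \<le> b"
  define f where "f u = 3 * d u + K * e u" for u
  have fc: "continuous_on {a..b} f" unfolding f_def by (intro continuous_intros d e)
  define H where "H x = integral {a..x} f" for x
  have sub: "{s..t} \<subseteq> {a..b}" using st by auto
  have Hc: "continuous_on {s..t} H" unfolding H_def by (rule continuous_on_subset[OF Ic[OF fc] sub])
  have ec: "continuous_on {s..t} e" by (rule continuous_on_subset[OF e sub])
  have Hst: "H t - H s = integral {s..t} f"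
  proof -
    have "f integrable_on {a..t}" using st by (intro integrable_continuous_interval continuous_on_subset[OF fc]) auto
    from Henstock_Kurzweil_Integration.integral_combine[OF st(1,2) this] show ?thesis by (simp add: H_def)
  qed
  have "e t - H t \<le> e s - H s"
  proof (rule DERIV_nonpos_imp_decreasing_open[OF st(2), of "\<lambda>x. e x - H x"])
    fix x assume "s < x" "x < t"
    then have x: "a < x" "x < b" using st by auto
    show "\<exists>y. ((\<lambda>x. e x - H x) has_real_derivative y) (at x) \<and> y \<le> 0"
      unfolding H_def using le[OF x] d0[of x] x
      by (intro exI[of _ "e' x - f x"] conjI DERIV_diff der antider fc x) (auto simp: f_def)
  qed (intro continuous_intros ec Hc)
  moreover have "- (e t + H t) \<le> - (e s + H s)"
  proof (rule DERIV_nonpos_imp_decreasing_open[OF st(2), of "\<lambda>x. - (e x + H x)"])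
    fix x assume "s < x" "x < t"
    then have x: "a < x" "x < b" using st by auto
    show "\<exists>y. ((\<lambda>x. - (e x + H x)) has_real_derivative y) (at x) \<and> y \<le> 0"
      unfolding H_def using le[OF x] d0[of x] x
      by (intro exI[of _ "- (e' x + f x)"] conjI DERIV_minus DERIV_add der antider fc x) (auto simp: f_def)
  qed (intro continuous_intros ec Hc)
  ultimately show "\<bar>e t - e s\<bar> \<le> integral {s..t} (\<lambda>u. 3 * d u + K * e u)"
    using Hst unfolding f_def by linarith
qed

lemma SUP_trunc:
  assumes "0 \<le> r" "0 \<le> p" "0 \<le> c" "0 \<le> y"
  shows "(SUP n. ennreal (c * (trunc p (real (Suc n)) r * y))) = ennreal (c * (r powr p * y))"
proof (rule antisym)
  show "(SUP n. ennreal (c * (trunc p (real (Suc n)) r * y))) \<le> ennreal (c * (r powr p * y))"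
    using assms by (intro SUP_least ennreal_leI mult_left_mono mult_right_mono) (auto simp: trunc_def intro!: powr_mono2)
  define n where "n = nat \<lceil>r\<rceil>"
  have "r \<le> real (Suc n)" unfolding n_def by linarith
  then have "trunc p (real (Suc n)) r = r powr p" by (simp add: trunc_def)
  then show "ennreal (c * (r powr p * y)) \<le> (SUP n. ennreal (c * (trunc p (real (Suc n)) r * y)))"
    by (intro SUP_upper2[of n]) auto
qed

lemma trunc_mono: "0 \<le> r \<Longrightarrow> 0 \<le> p \<Longrightarrow> 0 \<le> M \<Longrightarrow> M \<le> N \<Longrightarrow> trunc p M r \<le> trunc p N r"
  unfolding trunc_def by (intro powr_mono2) auto

lemma one_plus_sq_powr_le:
  assumes "0 \<le> s" "0 \<le> (x::real)"
  shows "(1 + x\<^sup>2) powr s \<le> 2 powr s * (1 + x powr (2 * s))"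
    and "1 \<le> x \<Longrightarrow> (1 + x\<^sup>2) powr s \<le> 2 powr s * x powr (2 * s)"
proof -
  show *: "(1 + x\<^sup>2) powr s \<le> 2 powr s * x powr (2 * s)" if "1 \<le> x"
  proof -
    have "(1 + x\<^sup>2) powr s \<le> (2 * x\<^sup>2) powr s" using that assms by (intro powr_mono2) auto
    also have "\<dots> = 2 powr s * (x powr 2) powr s" using that by (simp add: powr_mult)
    finally show ?thesis by (simp add: powr_powr)
  qed
  show "(1 + x\<^sup>2) powr s \<le> 2 powr s * (1 + x powr (2 * s))"
  proof (cases "1 \<le> x")
    case True
    have "2 powr s * x powr (2 * s) \<le> 2 powr s * (1 + x powr (2 * s))" by (intro mult_left_mono) auto
    with *[OF True] show ?thesis by linarith
  next
    case False
    then have "1 + x\<^sup>2 \<le> 2" using assms by (simp add: power_le_one)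
    then have "(1 + x\<^sup>2) powr s \<le> 2 powr s * 1" using assms by (simp add: powr_mono2)
    also have "\<dots> \<le> 2 powr s * (1 + x powr (2 * s))" by (intro mult_left_mono) auto
    finally show ?thesis .
  qed
qed

lemma powr_le_one_plus_sq: "0 \<le> s \<Longrightarrow> 0 \<le> x \<Longrightarrow> x powr (2 * s) \<le> (1 + x\<^sup>2) powr s" for x :: real
proof -
  assume "0 \<le> s" "0 \<le> x"
  have "(x powr 2) powr s \<le> (1 + x\<^sup>2) powr s" using \<open>0 \<le> s\<close> \<open>0 \<le> x\<close> by (intro powr_mono2) auto
  then show ?thesis by (simp add: powr_powr)
qed

section \<open>Estimates uniform in time for the flow\<close>

context mqg_flow
begin

lemma Q_integrable:
  assumes [measurable]: "w \<in> borel_measurable borel" and w: "\<And>\<xi>. \<bar>w \<xi>\<bar> \<le> B * (1 + (norm \<xi>)\<^sup>2)" and t: "t \<in> {0..T}"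
  shows "integrable lborel (\<lambda>\<xi>. w \<xi> * (cmod (X t \<xi>))\<^sup>2)"
proof (rule Bochner_Integration.integrable_bound)
  note [measurable] = X_measurable[OF t]
  show "integrable lborel (\<lambda>\<xi>. B * (cmod (sobw 1 (X t) \<xi>))\<^sup>2)"
    using X_H1[OF t] by (simp add: sq_integrable_def)
  have "\<bar>w \<xi>\<bar> * (cmod (X t \<xi>))\<^sup>2 \<le> \<bar>B * (cmod (sobw 1 (X t) \<xi>))\<^sup>2\<bar>" for \<xi>
  proof -
    have "\<bar>w \<xi>\<bar> * (cmod (X t \<xi>))\<^sup>2 \<le> B * (1 + (norm \<xi>)\<^sup>2) * (cmod (X t \<xi>))\<^sup>2"
      by (rule mult_right_mono[OF w]) simp
    also have "\<dots> = B * (cmod (sobw 1 (X t) \<xi>))\<^sup>2"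
      unfolding norm_sobw_sq by (simp add: add_nonneg_eq_0_iff)
    finally show ?thesis by linarith
  qed
  then show "AE \<xi> in lborel. norm (w \<xi> * (cmod (X t \<xi>))\<^sup>2) \<le> norm (B * (cmod (sobw 1 (X t) \<xi>))\<^sup>2)"
    by (intro AE_I2) (simp add: abs_mult)
  show "(\<lambda>\<xi>. w \<xi> * (cmod (X t \<xi>))\<^sup>2) \<in> borel_measurable lborel" by measurable
qed

text \<open>Dividing w by 1 + |\<xi>|^2 leaves a bounded multiplier between two H^1-weighted copies
  of X, and these depend continuously on time in L^2.\<close>

lemma Q_continuous:
  assumes [measurable]: "w \<in> borel_measurable borel" and w: "\<And>\<xi>. \<bar>w \<xi>\<bar> \<le> B * (1 + (norm \<xi>)\<^sup>2)"
  shows "continuous_on {0..T} (\<lambda>t. (LBINT \<xi>. w \<xi> * (cmod (X t \<xi>))\<^sup>2))"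
  unfolding continuous_on_def
proof
  fix t assume t: "t \<in> {0..T}"
  define v where "v \<xi> = w \<xi> / (1 + (norm \<xi>)\<^sup>2)" for \<xi>
  have pos: "0 < 1 + (norm \<xi>)\<^sup>2" for \<xi> :: "real^2" by (simp add: add_pos_nonneg)
  have [measurable]: "v \<in> borel_measurable borel" unfolding v_def by measurable
  have vB: "\<bar>v \<xi>\<bar> \<le> B" for \<xi>
    using w[of \<xi>] pos[of \<xi>] by (simp add: v_def pos_divide_le_eq)
  let ?a = "\<lambda>r. sobw 1 (X r)" and ?b = "\<lambda>r \<xi>. of_real (v \<xi>) * cnj (sobw 1 (X r) \<xi>)"
  have eq: "?a r \<xi> * ?b r \<xi> = of_real (w \<xi> * (cmod (X r \<xi>))\<^sup>2)" for r \<xi>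
  proof -
    have "?a r \<xi> * ?b r \<xi> = of_real (v \<xi>) * of_real ((cmod (sobw 1 (X r) \<xi>))\<^sup>2)"
      unfolding complex_norm_square by (simp only: mult_ac)
    also have "\<dots> = of_real (v \<xi> * (1 + (norm \<xi>)\<^sup>2) * (cmod (X r \<xi>))\<^sup>2)"
      unfolding norm_sobw_sq of_real_mult[symmetric] using pos[of \<xi>] by (simp add: mult.assoc)
    also have "v \<xi> * (1 + (norm \<xi>)\<^sup>2) = w \<xi>" using pos[of \<xi>] by (simp add: v_def)
    finally show ?thesis .
  qed
  have "((\<lambda>r. (LBINT \<xi>. ?a r \<xi> * ?b r \<xi>)) \<longlongrightarrow> (LBINT \<xi>. ?a t \<xi> * ?b t \<xi>)) (at t within {0..T})"
  proof (rule inner_tendsto_within)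
    show "\<forall>\<^sub>F r in at t within {0..T}. sq_integrable (?a r) \<and> sq_integrable (?b r)"
      using eventually_within_mem[of "{0..T}" t]
      by eventually_elim (intro conjI X_H1 weighted_cnj(1)[OF _ vB], measurable)
    show "sq_integrable (?a t)" by (rule X_H1[OF t])
    show "sq_integrable (?b t)" by (intro weighted_cnj(1)[OF _ vB] X_H1[OF t]) measurable
    show "((\<lambda>r. l2n (\<lambda>\<xi>. ?a r \<xi> - ?a t \<xi>)) \<longlongrightarrow> 0) (at t within {0..T})"
      using X_cont_H1[OF t] by (simp add: sobw_diff[abs_def])
    show "((\<lambda>r. l2n (\<lambda>\<xi>. ?b r \<xi> - ?b t \<xi>)) \<longlongrightarrow> 0) (at t within {0..T})"
    proof (rule tendsto_0_le[OF X_cont_H1[OF t], of _ B])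
      show "\<forall>\<^sub>F r in at t within {0..T}. norm (l2n (\<lambda>\<xi>. ?b r \<xi> - ?b t \<xi>)) \<le> norm (l2n (sobw 1 (\<lambda>\<xi>. X r \<xi> - X t \<xi>))) * B"
        using eventually_within_mem[of "{0..T}" t]
      proof eventually_elim
        case (elim r)
        have "(\<lambda>\<xi>. ?b r \<xi> - ?b t \<xi>) = (\<lambda>\<xi>. of_real (v \<xi>) * cnj (sobw 1 (\<lambda>\<xi>. X r \<xi> - X t \<xi>) \<xi>))"
          by (rule ext) (simp add: sobw_diff right_diff_distrib)
        moreover have "sq_integrable (sobw 1 (\<lambda>\<xi>. X r \<xi> - X t \<xi>))"
          by (intro sobw_sq_integrable_diff X_H1 elim t)
        ultimately show ?case
          using weighted_cnj(2)[of v B "sobw 1 (\<lambda>\<xi>. X r \<xi> - X t \<xi>)", OF _ vB] by (simp add: mult.commute)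
      qed
    qed
  qed
  from tendsto_Re[OF this] show "((\<lambda>t. (LBINT \<xi>. w \<xi> * (cmod (X t \<xi>))\<^sup>2)) \<longlongrightarrow> (LBINT \<xi>. w \<xi> * (cmod (X t \<xi>))\<^sup>2)) (at t within {0..T})"
    unfolding eq integral_complex_of_real by simp
qed

text \<open>The tail is the full integral, continuous by hypothesis, minus its low-frequency part,
  continuous for any curve in H^1. It decreases to 0 pointwise in time, so Dini applies. It serves
  once with p = 2 on the whole interval, to make the commutator absorbable, and once with p = 2
  \<sigma>, for continuity in the Sobolev space.\<close>

lemma tail_uniform:
  assumes S: "compact S" "S \<subseteq> {0..T}" and p: "0 \<le> p"
    and i: "\<And>t. t \<in> S \<Longrightarrow> integrable lborel (\<lambda>\<xi>. norm \<xi> powr p * (cmod (X t \<xi>))\<^sup>2)"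
    and c: "continuous_on S (\<lambda>t. (LBINT \<xi>. norm \<xi> powr p * (cmod (X t \<xi>))\<^sup>2))" and \<epsilon>: "0 < \<epsilon>"
  shows "\<exists>n\<ge>1. \<forall>t\<in>S. (LBINT \<xi>. (if real n < norm \<xi> then norm \<xi> powr p * (cmod (X t \<xi>))\<^sup>2 else 0)) < \<epsilon>"
proof -
  \<comment> \<open>Cutting at Suc n keeps the level at least 1; above it 1 + |\<xi>|^2 is
    comparable with |\<xi>|^2.\<close>
  define low where "low n t = (LBINT \<xi>. (if norm \<xi> \<le> real (Suc n) then norm \<xi> powr p else 0) * (cmod (X t \<xi>))\<^sup>2)" for n t
  define q where "q n t = (LBINT \<xi>. (if real (Suc n) < norm \<xi> then norm \<xi> powr p * (cmod (X t \<xi>))\<^sup>2 else 0))" for n t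
  have w: "\<bar>if norm \<xi> \<le> real (Suc n) then norm \<xi> powr p else 0\<bar> \<le> real (Suc n) powr p * (1 + (norm \<xi>)\<^sup>2)" for n and \<xi> :: "real^2"
  proof -
    have "norm \<xi> powr p \<le> real (Suc n) powr p" if "norm \<xi> \<le> real (Suc n)"
      using that p by (intro powr_mono2) auto
    moreover have "real (Suc n) powr p \<le> real (Suc n) powr p * (1 + (norm \<xi>)\<^sup>2)"
      using mult_left_mono[of 1 "1 + (norm \<xi>)\<^sup>2" "real (Suc n) powr p"] by simp
    ultimately show ?thesis by (auto simp del: of_nat_Suc intro: order_trans)
  qed
  have lowi: "integrable lborel (\<lambda>\<xi>. (if norm \<xi> \<le> real (Suc n) then norm \<xi> powr p else 0) * (cmod (X t \<xi>))\<^sup>2)" if "t \<in> {0..T}" for n t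
    by (rule Q_integrable[OF _ w that]) measurable
  have qi: "integrable lborel (\<lambda>\<xi>. if real (Suc n) < norm \<xi> then norm \<xi> powr p * (cmod (X t \<xi>))\<^sup>2 else 0)" if t: "t \<in> S" for n t
  proof (rule Bochner_Integration.integrable_bound[OF i[OF t]])
    have "t \<in> {0..T}" using t S(2) by auto
    note [measurable] = X_measurable[OF this]
    show "(\<lambda>\<xi>. if real (Suc n) < norm \<xi> then norm \<xi> powr p * (cmod (X t \<xi>))\<^sup>2 else 0) \<in> borel_measurable lborel"
      by measurable
  qed auto
  have q: "q n t = (LBINT \<xi>. norm \<xi> powr p * (cmod (X t \<xi>))\<^sup>2) - low n t" if t: "t \<in> S" for n t
  proof -
    have "(LBINT \<xi>. norm \<xi> powr p * (cmod (X t \<xi>))\<^sup>2) - low n t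
      = (LBINT \<xi>. norm \<xi> powr p * (cmod (X t \<xi>))\<^sup>2 - (if norm \<xi> \<le> real (Suc n) then norm \<xi> powr p else 0) * (cmod (X t \<xi>))\<^sup>2)"
      unfolding low_def using t S(2) by (intro Bochner_Integration.integral_diff[symmetric] i lowi) auto
    also have "\<dots> = q n t"
      unfolding q_def by (intro arg_cong[where f="integral\<^sup>L lborel"] ext) auto
    finally show ?thesis by simp
  qed
  have "\<exists>n. \<forall>t\<in>S. q n t < \<epsilon>"
  proof (rule Dini_zero[OF S(1) _ _ _ \<epsilon>])
    show "continuous_on S (q n)" for n
    proof -
      have "continuous_on {0..T} (low n)" unfolding low_def by (rule Q_continuous[OF _ w]) measurable
      then have "continuous_on S (\<lambda>t. (LBINT \<xi>. norm \<xi> powr p * (cmod (X t \<xi>))\<^sup>2) - low n t)"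
        using S(2) by (intro continuous_on_diff c) (rule continuous_on_subset)
      then show ?thesis by (rule continuous_on_eq) (simp add: q)
    qed
    show "q n t \<le> q m t" if "m \<le> n" "t \<in> S" for m n t
      unfolding q_def using that by (intro integral_mono qi) auto
    fix t assume t: "t \<in> S"
    have [measurable]: "X t \<in> borel_measurable borel" using t S(2) X_measurable[of t] by auto
    have "(\<lambda>n. q n t) \<longlonglongrightarrow> (LBINT (\<xi>::real^2). 0)"
      unfolding q_def
    proof (rule integral_dominated_convergence[OF _ _ i[OF t]])
      show "(\<lambda>\<xi>. if real (Suc n) < norm \<xi> then norm \<xi> powr p * (cmod (X t \<xi>))\<^sup>2 else 0) \<in> borel_measurable lborel" for n
        by measurable
      show "AE \<xi> in lborel. norm (if real (Suc n) < norm \<xi> then norm \<xi> powr p * (cmod (X t \<xi>))\<^sup>2 else 0) \<le> norm \<xi> powr p * (cmod (X t \<xi>))\<^sup>2" for n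
        by (intro AE_I2) simp
      show "AE \<xi> in lborel. (\<lambda>n. if real (Suc n) < norm \<xi> then norm \<xi> powr p * (cmod (X t \<xi>))\<^sup>2 else 0) \<longlonglongrightarrow> 0"
      proof (rule AE_I2)
        fix \<xi> :: "real^2"
        have "\<forall>\<^sub>F n in sequentially. (if real (Suc n) < norm \<xi> then norm \<xi> powr p * (cmod (X t \<xi>))\<^sup>2 else 0) = 0"
          using eventually_ge_at_top[of "nat \<lceil>norm \<xi>\<rceil>"]
        proof eventually_elim
          case (elim n)
          then have "norm \<xi> \<le> real (Suc n)" by linarith
          then show ?case by simp
        qed
        then show "(\<lambda>n. if real (Suc n) < norm \<xi> then norm \<xi> powr p * (cmod (X t \<xi>))\<^sup>2 else 0) \<longlonglongrightarrow> 0"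
          by (rule tendsto_eventually)
      qed
    qed simp
    then show "(\<lambda>n. q n t) \<longlonglongrightarrow> 0" by simp
  qed
  then obtain n where "\<forall>t\<in>S. q n t < \<epsilon>" by blast
  then show ?thesis unfolding q_def by (intro exI[of _ "Suc n"]) auto
qed

lemma X_energy_bounded: "\<exists>B\<ge>0. \<forall>t\<in>{0..T}. (LBINT \<xi>. (cmod (X t \<xi>))\<^sup>2) \<le> B"
proof -
  have w1: "\<bar>1\<bar> \<le> 1 * (1 + (norm \<xi>)\<^sup>2)" for \<xi> :: "real^2" by simp
  have "continuous_on {0..T} (\<lambda>t. (LBINT \<xi>. 1 * (cmod (X t \<xi>))\<^sup>2))"
    by (rule Q_continuous[OF _ w1]) measurable
  then have "bounded ((\<lambda>t. (LBINT \<xi>. 1 * (cmod (X t \<xi>))\<^sup>2)) ` {0..T})"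
    by (intro compact_imp_bounded compact_continuous_image) auto
  then obtain B where "\<forall>x\<in>(\<lambda>t. (LBINT \<xi>. 1 * (cmod (X t \<xi>))\<^sup>2)) ` {0..T}. norm x \<le> B"
    unfolding bounded_iff by blast
  then have B: "(LBINT \<xi>. (cmod (X t \<xi>))\<^sup>2) \<le> B" if "t \<in> {0..T}" for t using that by auto
  have "0 \<le> B" using B[of 0] T by (auto intro: order_trans[rotated])
  with B show ?thesis by blast
qed

text \<open>The constants are fixed in the order \<epsilon>, M, L, K, where M is the level above
  which the squared homogeneous H^1 tail stays below \<epsilon>^2 at all times. None of them depends
  on N or t. The remaining D on the right is weaker than the 2 D on the left, so dissipation
  survives.\<close>

lemma energy_inequality:
  assumes s: "1 \<le> s"
  shows "\<exists>K\<ge>0. \<forall>N>0. \<forall>t. 0 < t \<and> t < T \<longrightarrow>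
    \<bar>2 * Re (LBINT \<xi>. Y t \<xi> * (of_real (trunc (2 * s) N (norm \<xi>)) * cnj (X t \<xi>)))
      + 2 * (LBINT \<xi>. norm \<xi> powr \<alpha> * (trunc (2 * s) N (norm \<xi>) * (cmod (X t \<xi>))\<^sup>2))\<bar>
    \<le> K * (LBINT \<xi>. trunc (2 * s) N (norm \<xi>) * (cmod (X t \<xi>))\<^sup>2)
      + (LBINT \<xi>. norm \<xi> powr \<alpha> * (trunc (2 * s) N (norm \<xi>) * (cmod (X t \<xi>))\<^sup>2))"
proof -
  have C: "0 \<le> Ctri \<alpha> s" unfolding Ctri_def using C0_nonneg[of s] by auto
  \<comment> \<open>Makes the coefficient \<open>Ctri \<alpha> s * \<epsilon>\<close> of D at most
    1; the added 1 keeps the quotient defined when the constant is 0.\<close>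
  define \<epsilon> where "\<epsilon> = 1 / (Ctri \<alpha> s + 1)"
  have \<epsilon>: "0 < \<epsilon>" "Ctri \<alpha> s * \<epsilon> \<le> 1" using C by (auto simp: \<epsilon>_def)
  have p2: "norm \<xi> powr 2 = (norm \<xi>)\<^sup>2" for \<xi> :: "real^2" by simp
  have w2: "\<bar>norm \<xi> powr 2\<bar> \<le> 1 * (1 + (norm \<xi>)\<^sup>2)" for \<xi> :: "real^2" unfolding p2 by simp
  have "\<exists>n\<ge>1. \<forall>t\<in>{0..T}. (LBINT \<xi>. (if real n < norm \<xi> then norm \<xi> powr 2 * (cmod (X t \<xi>))\<^sup>2 else 0)) < \<epsilon>\<^sup>2"
  proof (rule tail_uniform)
    show "integrable lborel (\<lambda>\<xi>. norm \<xi> powr 2 * (cmod (X t \<xi>))\<^sup>2)" if "t \<in> {0..T}" for t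
      by (rule Q_integrable[OF _ w2 that]) measurable
    show "continuous_on {0..T} (\<lambda>t. (LBINT \<xi>. norm \<xi> powr 2 * (cmod (X t \<xi>))\<^sup>2))"
      by (rule Q_continuous[OF _ w2]) measurable
  qed (use \<epsilon> in auto)
  then obtain n where n: "\<And>t. t \<in> {0..T} \<Longrightarrow> (LBINT \<xi>. (if real n < norm \<xi> then norm \<xi> powr 2 * (cmod (X t \<xi>))\<^sup>2 else 0)) < \<epsilon>\<^sup>2"
    by blast
  define M where "M = real n"
  obtain B where B0: "0 \<le> B" and B: "\<And>t. t \<in> {0..T} \<Longrightarrow> (LBINT \<xi>. (cmod (X t \<xi>))\<^sup>2) \<le> B"
    using X_energy_bounded by blast
  \<comment> \<open>From |X| <= 1 + |X|^2: the volume of the ball bounds the first term, the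
    time-uniform L^2 energy the second.\<close>
  define L where "L = measure lborel (cball (0::real^2) M) + B"
  have L0: "0 \<le> L" unfolding L_def using B0 by simp
  define K where "K = 3 * C0 s / (2 * pi)\<^sup>2 * M powr \<alpha> * L"
  have K0: "0 \<le> K" unfolding K_def using L0 C0_nonneg[of s] by simp
  show ?thesis
  proof (intro exI[of _ K] conjI K0 allI impI)
    fix N t :: real assume N: "0 < N" and t: "0 < t \<and> t < T"
    then have t': "t \<in> {0..T}" by simp
    note [measurable] = X_measurable[OF t'] L2FT_measurable(2)[OF Y_L2FT[OF t']]
    let ?w = "\<lambda>\<xi>. trunc (2 * s) N (norm \<xi>)"
    let ?E = "(LBINT \<xi>. ?w \<xi> * (cmod (X t \<xi>))\<^sup>2)" and ?D = "(LBINT \<xi>. norm \<xi> powr \<alpha> * (?w \<xi> * (cmod (X t \<xi>))\<^sup>2))"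
    have X2: "integrable lborel (\<lambda>\<xi>. (cmod (X t \<xi>))\<^sup>2)" using X_sq[OF t'] by (simp add: sq_integrable_def)
    have "\<bar>2 * Re (LBINT \<xi>. Y t \<xi> * (of_real (?w \<xi>) * cnj (X t \<xi>))) + 2 * ?D\<bar>
      \<le> 3 * C0 s / (2 * pi)\<^sup>2 * M powr \<alpha> * L * ?E + Ctri \<alpha> s * \<epsilon> * ?D"
    proof (rule energy_estimate[OF \<alpha> X_H1[OF t'] _ X_herm s N equation_fourier _ \<epsilon>(1) _ L0])
      show "(\<integral>\<^sup>+p. ennreal (if norm p \<le> M then cmod (X t p) else 0) \<partial>lborel) \<le> ennreal L"
      proof -
        have "(\<integral>\<^sup>+p. ennreal (if norm p \<le> M then cmod (X t p) else 0) \<partial>lborel)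
          \<le> (\<integral>\<^sup>+p. indicator (cball 0 M) p + ennreal ((cmod (X t p))\<^sup>2) \<partial>lborel)"
        proof (rule nn_integral_mono)
          fix p :: "real^2"
          have "cmod (X t p) \<le> 1 + (cmod (X t p))\<^sup>2"
            using sum_squares_bound[of "cmod (X t p)" 1] norm_ge_zero[of "X t p"]
            unfolding one_power2 mult_1_right by linarith
          then have "ennreal (cmod (X t p)) \<le> 1 + ennreal ((cmod (X t p))\<^sup>2)"
            by (simp add: ennreal_1[symmetric] ennreal_plus[symmetric] ennreal_leI del: ennreal_1 ennreal_plus)
          then show "ennreal (if norm p \<le> M then cmod (X t p) else 0) \<le> indicator (cball 0 M) p + ennreal ((cmod (X t p))\<^sup>2)"
            by auto
        qed
        also have "\<dots> = emeasure lborel (cball (0::real^2) M) + (\<integral>\<^sup>+p. ennreal ((cmod (X t p))\<^sup>2) \<partial>lborel)"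
          by (subst nn_integral_add) (auto intro!: borel_measurable_indicator)
        also have "(\<integral>\<^sup>+p. ennreal ((cmod (X t p))\<^sup>2) \<partial>lborel) = ennreal (LBINT \<xi>. (cmod (X t \<xi>))\<^sup>2)"
          by (rule nn_integral_eq_integral[OF X2]) simp
        also have "emeasure lborel (cball (0::real^2) M) = ennreal (measure lborel (cball (0::real^2) M))"
          using emeasure_lborel_cball_finite[of "0::real^2" M] by (intro emeasure_eq_ennreal_measure) auto
        also have "ennreal (measure lborel (cball (0::real^2) M)) + ennreal (LBINT \<xi>. (cmod (X t \<xi>))\<^sup>2)
           = ennreal (measure lborel (cball (0::real^2) M) + (LBINT \<xi>. (cmod (X t \<xi>))\<^sup>2))"
          by (rule ennreal_plus[symmetric]) auto
        also have "\<dots> \<le> ennreal L" unfolding L_def using B[OF t'] by (intro ennreal_leI) simp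
        finally show ?thesis .
      qed
      show "(\<integral>\<^sup>+p. ennreal (if M < norm p then (norm p * cmod (X t p))\<^sup>2 else 0) \<partial>lborel) \<le> ennreal (\<epsilon>\<^sup>2)"
      proof -
        have e: "(if M < norm p then (norm p * cmod (X t p))\<^sup>2 else 0) = (if real n < norm p then norm p powr 2 * (cmod (X t p))\<^sup>2 else 0)" for p
          by (simp add: M_def power_mult_distrib)
        have "integrable lborel (\<lambda>\<xi>. (if M < norm \<xi> then norm \<xi> powr 2 else 0) * (cmod (X t \<xi>))\<^sup>2)"
          using w2 by (intro Q_integrable[of "\<lambda>\<xi>. if M < norm \<xi> then norm \<xi> powr 2 else 0" 1, OF _ _ t']) auto
        then have "integrable lborel (\<lambda>p. if real n < norm p then norm p powr 2 * (cmod (X t p))\<^sup>2 else 0)"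
          by (rule Bochner_Integration.integrable_cong[THEN iffD1, OF refl, rotated]) (simp add: M_def)
        then show ?thesis
          unfolding e using n[OF t'] by (subst nn_integral_eq_integral) (auto intro!: ennreal_leI)
      qed
    qed (use t in \<open>auto simp: M_def\<close>)
    also have "Ctri \<alpha> s * \<epsilon> * ?D \<le> 1 * ?D" using \<epsilon>(2) by (intro mult_right_mono) auto
    finally show "\<bar>2 * Re (LBINT \<xi>. Y t \<xi> * (of_real (?w \<xi>) * cnj (X t \<xi>))) + 2 * ?D\<bar> \<le> K * ?E + ?D"
      unfolding K_def by simp
  qed
qed

end

lemma norm_sobw_cutoff:
  assumes "0 \<le> s" "\<And>\<xi>. real n < norm \<xi> \<Longrightarrow> F \<xi> = 0"
  shows "cmod (sobw s F \<xi>) \<le> (1 + (real n)\<^sup>2) powr (s / 2) * cmod (F \<xi>)"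
proof (cases "real n < norm \<xi>")
  case False
  then have "(norm \<xi>)\<^sup>2 \<le> (real n)\<^sup>2" by (intro power_mono) auto
  then have "(1 + (norm \<xi>)\<^sup>2) powr (s / 2) \<le> (1 + (real n)\<^sup>2) powr (s / 2)" using assms(1) by (intro powr_mono2) auto
  from mult_right_mono[OF this, of "cmod (F \<xi>)"] show ?thesis by (simp add: sobw_def norm_mult)
qed (simp add: assms(2) sobw_def)

text \<open>Bernstein's inequality: on frequencies at most n the Sobolev weight is bounded, so L^2
  controls every Sobolev norm. It is the cost of a frequency cutoff in the construction of simple
  functions.\<close>

lemma l2n_sobw_cutoff:
  assumes "0 \<le> s" "\<And>\<xi>. real n < norm \<xi> \<Longrightarrow> F \<xi> = 0" and F: "sq_integrable F"
  shows "sq_integrable (sobw s F)" "l2n (sobw s F) \<le> (1 + (real n)\<^sup>2) powr (s / 2) * l2n F"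
proof -
  note [measurable] = sq_integrable_measurable[OF F]
  note le = norm_sobw_cutoff[of s n F, OF assms(1,2)]
  show "sq_integrable (sobw s F)" by (rule sq_integrable_bound[OF F _ le]) measurable
  have "l2n (sobw s F) \<le> l2n (\<lambda>\<xi>. of_real ((1 + (real n)\<^sup>2) powr (s / 2)) * F \<xi>)"
    by (rule l2n_mono[OF sq_integrable_cmult[OF F]]) (measurable, simp add: norm_mult le)
  then show "l2n (sobw s F) \<le> (1 + (real n)\<^sup>2) powr (s / 2) * l2n F"
    unfolding l2n_cmult by simp
qed

lemma floor_grid:
  fixes h t :: real assumes "0 < h"
  shows "h * \<lfloor>t / h\<rfloor> \<le> t" "t - h * \<lfloor>t / h\<rfloor> < h"
proof -
  have "of_int \<lfloor>t / h\<rfloor> \<le> t / h" by simp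
  then have "real_of_int \<lfloor>t / h\<rfloor> * h \<le> t" unfolding pos_le_divide_eq[OF assms] .
  then show "h * \<lfloor>t / h\<rfloor> \<le> t" by (simp only: mult.commute)
  have "t / h < of_int \<lfloor>t / h\<rfloor> + 1" by linarith
  then have "t < (of_int \<lfloor>t / h\<rfloor> + 1) * h" unfolding pos_divide_less_eq[OF assms] .
  then show "t - h * \<lfloor>t / h\<rfloor> < h" by (simp add: algebra_simps)
qed

context mqg_flow
begin

text \<open>Heine-Cantor for the L^2 distance: violating time pairs have a common limit point by
  compactness, where continuity and the triangle inequality contradict the gap.\<close>

lemma X_uniformly_continuous:
  assumes \<epsilon>: "0 < \<epsilon>"
  shows "\<exists>\<delta>>0. \<forall>s\<in>{0..T}. \<forall>t\<in>{0..T}. \<bar>s - t\<bar> < \<delta> \<longrightarrow> l2n (\<lambda>\<xi>. X s \<xi> - X t \<xi>) < \<epsilon>"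
proof (rule ccontr)
  assume "\<not> ?thesis"
  then have "\<forall>\<delta>>0. \<exists>s t. s \<in> {0..T} \<and> t \<in> {0..T} \<and> \<bar>s - t\<bar> < \<delta> \<and> \<epsilon> \<le> l2n (\<lambda>\<xi>. X s \<xi> - X t \<xi>)"
    unfolding not_ex not_all Bex_def Ball_def by (metis not_less)
  then have "\<forall>n. \<exists>s t. s \<in> {0..T} \<and> t \<in> {0..T} \<and> \<bar>s - t\<bar> < inverse (real (Suc n)) \<and> \<epsilon> \<le> l2n (\<lambda>\<xi>. X s \<xi> - X t \<xi>)"
    by simp
  then obtain s t where st: "\<And>n. s n \<in> {0..T}" "\<And>n. t n \<in> {0..T}" "\<And>n. \<bar>s n - t n\<bar> < inverse (real (Suc n))"
    "\<And>n. \<epsilon> \<le> l2n (\<lambda>\<xi>. X (s n) \<xi> - X (t n) \<xi>)" by metis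
  obtain l r where l: "l \<in> {0..T}" "strict_mono r" "(s \<circ> r) \<longlonglongrightarrow> l"
    using st(1) compact_Icc[of 0 T] unfolding compact_def by blast
  have "(\<lambda>n. s n - t n) \<longlonglongrightarrow> 0"
    by (rule tendsto_0_le[OF LIMSEQ_inverse_real_of_nat, of _ 1]) (use st(3) in \<open>auto intro!: always_eventually less_imp_le simp del: of_nat_Suc\<close>)
  from LIMSEQ_subseq_LIMSEQ[OF this l(2)] have "(\<lambda>n. s (r n) - t (r n)) \<longlonglongrightarrow> 0" by (simp add: o_def)
  from tendsto_diff[OF l(3) this] have tl: "(\<lambda>n. t (r n)) \<longlonglongrightarrow> l" by (simp add: o_def)
  have sl: "(\<lambda>n. s (r n)) \<longlonglongrightarrow> l" using l(3) by (simp add: o_def)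
  let ?f = "\<lambda>u. l2n (\<lambda>\<xi>. X u \<xi> - X l \<xi>)"
  have f0: "?f l = 0" by (simp add: l2n_def)
  have "continuous (at l within {0..T}) ?f"
    unfolding continuous_within f0 by (rule X_cont_L2[OF l(1)])
  then have f: "(\<lambda>n. ?f (u n)) \<longlonglongrightarrow> 0" if "u \<longlonglongrightarrow> l" "\<And>n. u n \<in> {0..T}" for u
    using continuous_within_tendsto_compose[of l "{0..T}" ?f u sequentially] that f0 by auto
  have "(\<lambda>n. ?f (s (r n)) + ?f (t (r n))) \<longlonglongrightarrow> 0 + 0"
    by (intro tendsto_add f sl tl st)
  moreover have "\<epsilon> \<le> ?f (s (r n)) + ?f (t (r n))" for n
    using st(4)[of "r n"] l2n_triangle_diff[OF X_sq[OF st(1)[of "r n"]] X_sq[OF l(1)] X_sq[OF st(2)[of "r n"]]]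
    by (simp add: l2n_minus_commute[of "X l"])
  ultimately have "\<epsilon> \<le> 0" using LIMSEQ_le_const[of _ "0 + 0" \<epsilon>] by fastforce
  with \<epsilon> show False by simp
qed

lemma SUP_weight:
  fixes c :: "real^2 \<Rightarrow> real"
  assumes [measurable]: "c \<in> borel_measurable borel" and c: "\<And>\<xi>. 0 \<le> c \<xi>" and p: "0 \<le> p" and t: "t \<in> {0..T}"
    and i: "\<And>n. integrable lborel (\<lambda>\<xi>. c \<xi> * (trunc p (real (Suc n)) (norm \<xi>) * (cmod (X t \<xi>))\<^sup>2))"
  shows "(SUP n. ennreal (LBINT \<xi>. c \<xi> * (trunc p (real (Suc n)) (norm \<xi>) * (cmod (X t \<xi>))\<^sup>2)))
    = (\<integral>\<^sup>+\<xi>. ennreal (c \<xi> * (norm \<xi> powr p * (cmod (X t \<xi>))\<^sup>2)) \<partial>lborel)"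
proof -
  note [measurable] = X_measurable[OF t]
  let ?f = "\<lambda>n \<xi>. ennreal (c \<xi> * (trunc p (real (Suc n)) (norm \<xi>) * (cmod (X t \<xi>))\<^sup>2))"
  have "(SUP n. ennreal (LBINT \<xi>. c \<xi> * (trunc p (real (Suc n)) (norm \<xi>) * (cmod (X t \<xi>))\<^sup>2))) = (SUP n. integral\<^sup>N lborel (?f n))"
    using c by (intro SUP_cong refl nn_integral_eq_integral[symmetric] i) auto
  also have "\<dots> = (\<integral>\<^sup>+\<xi>. (SUP n. ?f n \<xi>) \<partial>lborel)"
  proof (rule nn_integral_monotone_convergence_SUP[symmetric])
    show "incseq ?f"
      using c p by (intro incseq_SucI le_funI ennreal_leI mult_left_mono mult_right_mono trunc_mono) auto
  qed measurable
  also have "\<dots> = (\<integral>\<^sup>+\<xi>. ennreal (c \<xi> * (norm \<xi> powr p * (cmod (X t \<xi>))\<^sup>2)) \<partial>lborel)"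
    using c p by (intro nn_integral_cong SUP_trunc) auto
  finally show ?thesis .
qed

end

section \<open>Bounds uniform in the truncation and continuity in the Sobolev space\<close>

locale mqg_regular = mqg_flow +
  fixes \<sigma> t0 :: real
  assumes \<sigma>: "1 \<le> \<sigma>" and t0: "0 \<le> t0" "t0 < T" and reg: "\<theta> t0 \<in> Sobolev \<sigma>"
begin

text \<open>The truncation level is Suc n, so it is positive and the suprema run over a sequence, as
  monotone convergence requires.\<close>

definition En :: "nat \<Rightarrow> real \<Rightarrow> real" where
  "En n t = (LBINT \<xi>. trunc (2 * \<sigma>) (real (Suc n)) (norm \<xi>) * (cmod (X t \<xi>))\<^sup>2)"

definition Dn :: "nat \<Rightarrow> real \<Rightarrow> real" where
  "Dn n t = (LBINT \<xi>. norm \<xi> powr \<alpha> * (trunc (2 * \<sigma>) (real (Suc n)) (norm \<xi>) * (cmod (X t \<xi>))\<^sup>2))"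

definition E :: "real \<Rightarrow> real" where
  "E t = (LBINT \<xi>. norm \<xi> powr (2 * \<sigma>) * (cmod (X t \<xi>))\<^sup>2)"

text \<open>Extended-valued, unlike E: the energy is finite at every time after t0, while the
  dissipation is known to be finite only at almost every time.\<close>

definition D :: "real \<Rightarrow> ennreal" where
  "D t = (\<integral>\<^sup>+\<xi>. ennreal (norm \<xi> powr \<alpha> * (norm \<xi> powr (2 * \<sigma>) * (cmod (X t \<xi>))\<^sup>2)) \<partial>lborel)"

lemma t0T: "{t0..T} \<subseteq> {0..T}" "t \<in> {t0..T} \<Longrightarrow> t \<in> {0..T}"
  using t0 by auto

lemma weight_bounds:
  "\<bar>trunc (2 * \<sigma>) (real (Suc n)) (norm \<xi>)\<bar> \<le> real (Suc n) powr (2 * \<sigma>) * (1 + (norm \<xi>)\<^sup>2)"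
  "\<bar>norm \<xi> powr \<alpha> * trunc (2 * \<sigma>) (real (Suc n)) (norm \<xi>)\<bar> \<le> real (Suc n) powr (2 * \<sigma>) * (1 + (norm \<xi>)\<^sup>2)"
  for \<xi> :: "real^2"
proof -
  have a: "trunc (2 * \<sigma>) (real (Suc n)) (norm \<xi>) \<le> real (Suc n) powr (2 * \<sigma>)"
    using \<sigma> by (intro trunc_le) auto
  have "norm \<xi> powr \<alpha> \<le> (1 + (norm \<xi>)\<^sup>2) powr (2 / 2)" using \<alpha> by (intro norm_powr_le) auto
  then have b: "norm \<xi> powr \<alpha> \<le> 1 + (norm \<xi>)\<^sup>2" by (simp add: add_nonneg_eq_0_iff)
  show "\<bar>trunc (2 * \<sigma>) (real (Suc n)) (norm \<xi>)\<bar> \<le> real (Suc n) powr (2 * \<sigma>) * (1 + (norm \<xi>)\<^sup>2)"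
    using mult_mono[OF a, of 1 "1 + (norm \<xi>)\<^sup>2"] by simp
  show "\<bar>norm \<xi> powr \<alpha> * trunc (2 * \<sigma>) (real (Suc n)) (norm \<xi>)\<bar> \<le> real (Suc n) powr (2 * \<sigma>) * (1 + (norm \<xi>)\<^sup>2)"
    using mult_mono[OF a b] by (simp add: abs_mult mult.commute)
qed

lemma En_integrable: "t \<in> {0..T} \<Longrightarrow> integrable lborel (\<lambda>\<xi>. trunc (2 * \<sigma>) (real (Suc n)) (norm \<xi>) * (cmod (X t \<xi>))\<^sup>2)"
  by (rule Q_integrable[OF _ weight_bounds(1)]) measurable

lemma Dn_integrable: "t \<in> {0..T} \<Longrightarrow> integrable lborel (\<lambda>\<xi>. norm \<xi> powr \<alpha> * (trunc (2 * \<sigma>) (real (Suc n)) (norm \<xi>) * (cmod (X t \<xi>))\<^sup>2))"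
  unfolding mult.assoc[symmetric] by (rule Q_integrable[OF _ weight_bounds(2)]) measurable

lemma En_continuous: "continuous_on {0..T} (En n)"
  unfolding En_def by (rule Q_continuous[OF _ weight_bounds(1)]) measurable

lemma Dn_continuous: "continuous_on {0..T} (Dn n)"
  unfolding Dn_def mult.assoc[symmetric] by (rule Q_continuous[OF _ weight_bounds(2)]) measurable

lemma En_nonneg: "0 \<le> En n t" and Dn_nonneg: "0 \<le> Dn n t"
  unfolding En_def Dn_def by (intro integral_nonneg_AE AE_I2; simp)+

lemma Dn_mono: "m \<le> n \<Longrightarrow> t \<in> {0..T} \<Longrightarrow> Dn m t \<le> Dn n t"
  unfolding Dn_def using \<sigma> by (intro integral_mono Dn_integrable mult_left_mono mult_right_mono trunc_mono) auto

text \<open>The truncated energy at t0 is at most the squared Sobolev norm of \<theta> t0, for every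
  n, and the Gronwall constant K is independent of n. This is the only place where regularity at t0
  enters the estimates.\<close>

lemma truncated_bounds:
  "\<exists>A K. 0 \<le> A \<and> 0 \<le> K \<and> (\<forall>n. \<forall>t\<in>{t0..T}. En n t \<le> A) \<and> (\<forall>n. integral {t0..T} (Dn n) \<le> A) \<and>
    (\<forall>n s t. t0 \<le> s \<longrightarrow> s \<le> t \<longrightarrow> t \<le> T \<longrightarrow> \<bar>En n t - En n s\<bar> \<le> integral {s..t} (\<lambda>u. 3 * Dn n u + K * En n u))"
proof -
  obtain K where K: "0 \<le> K" and Kle: "\<And>N t. 0 < N \<Longrightarrow> 0 < t \<Longrightarrow> t < T \<Longrightarrow>
    \<bar>2 * Re (LBINT \<xi>. Y t \<xi> * (of_real (trunc (2 * \<sigma>) N (norm \<xi>)) * cnj (X t \<xi>)))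
      + 2 * (LBINT \<xi>. norm \<xi> powr \<alpha> * (trunc (2 * \<sigma>) N (norm \<xi>) * (cmod (X t \<xi>))\<^sup>2))\<bar>
    \<le> K * (LBINT \<xi>. trunc (2 * \<sigma>) N (norm \<xi>) * (cmod (X t \<xi>))\<^sup>2)
      + (LBINT \<xi>. norm \<xi> powr \<alpha> * (trunc (2 * \<sigma>) N (norm \<xi>) * (cmod (X t \<xi>))\<^sup>2))"
    using energy_inequality[OF \<sigma>] by blast
  define e' where "e' n t = 2 * Re (LBINT \<xi>. Y t \<xi> * (complex_of_real (trunc (2 * \<sigma>) (real (Suc n)) (norm \<xi>)) * cnj (X t \<xi>)))" for n t
  have t0': "t0 \<in> {0..T}" using t0 by simp
  have e: "continuous_on {t0..T} (En n)" and d: "continuous_on {t0..T} (Dn n)" for n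
    by (rule continuous_on_subset[OF En_continuous t0T(1)], rule continuous_on_subset[OF Dn_continuous t0T(1)])
  have der: "(En n has_real_derivative e' n t) (at t)" if "t0 < t" "t < T" for n t
  proof -
    have "\<bar>trunc (2 * \<sigma>) (real (Suc n)) (norm \<xi>)\<bar> \<le> real (Suc n) powr (2 * \<sigma>)" for \<xi> :: "real^2"
      using trunc_le[of "2 * \<sigma>" "norm \<xi>" "real (Suc n)"] \<sigma> by simp
    then have "(En n has_real_derivative e' n t) (at t within {0..T})"
      unfolding En_def e'_def using that t0 by (intro energy_deriv) auto
    then show ?thesis using that t0 by (simp add: at_within_Icc_at)
  qed
  have le: "\<bar>e' n t + 2 * Dn n t\<bar> \<le> K * En n t + Dn n t" if "t0 < t" "t < T" for n t
    unfolding e'_def En_def Dn_def by (rule Kle) (use that t0 in auto)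
  have diss: "t \<in> {t0..T} \<Longrightarrow> En n t \<le> exp (K * (T - t0)) * En n t0"
      "integral {t0..T} (Dn n) \<le> exp (K * (T - t0)) * En n t0"
      "t0 \<le> s \<Longrightarrow> s \<le> t \<Longrightarrow> t \<le> T \<Longrightarrow> \<bar>En n t - En n s\<bar> \<le> integral {s..t} (\<lambda>u. 3 * Dn n u + K * En n u)" for n s t
    using dissipative_bound[of t0 T "En n" "Dn n" K "e' n"] less_imp_le[OF t0(2)] e d En_nonneg Dn_nonneg K der le
    by blast+
  define A0 where "A0 = (l2n (sobw \<sigma> (X t0)))\<^sup>2"
  have sq: "sq_integrable (sobw \<sigma> (X t0))" using reg Sobolev_L2FT[OF X_L2FT[OF t0']] by simp
  have EA: "En n t0 \<le> A0" for n
    unfolding En_def A0_def l2n_sq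
  proof (rule integral_mono[OF En_integrable[OF t0']])
    show "integrable lborel (\<lambda>\<xi>. (cmod (sobw \<sigma> (X t0) \<xi>))\<^sup>2)" using sq by (simp add: sq_integrable_def)
    fix \<xi> :: "real^2"
    have "trunc (2 * \<sigma>) (real (Suc n)) (norm \<xi>) \<le> norm \<xi> powr (2 * \<sigma>)"
      using \<sigma> unfolding trunc_def by (intro powr_mono2) auto
    also have "\<dots> \<le> (1 + (norm \<xi>)\<^sup>2) powr \<sigma>" using \<sigma> by (intro powr_le_one_plus_sq) auto
    finally show "trunc (2 * \<sigma>) (real (Suc n)) (norm \<xi>) * (cmod (X t0 \<xi>))\<^sup>2 \<le> (cmod (sobw \<sigma> (X t0) \<xi>))\<^sup>2"
      unfolding norm_sobw_sq by (rule mult_right_mono) simp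
  qed
  define A where "A = exp (K * (T - t0)) * A0"
  have A: "exp (K * (T - t0)) * En n t0 \<le> A" for n unfolding A_def by (rule mult_left_mono[OF EA]) simp
  have "0 \<le> A" by (simp add: A_def A0_def)
  moreover have "En n t \<le> A" if "t \<in> {t0..T}" for n t using diss(1)[OF that, of n] A[of n] by linarith
  moreover have "integral {t0..T} (Dn n) \<le> A" for n using diss(2)[of n] A[of n] by linarith
  ultimately show ?thesis using K diss(3) by blast
qed

lemma energy_integrable:
  assumes t: "t \<in> {t0..T}" shows "integrable lborel (\<lambda>\<xi>. norm \<xi> powr (2 * \<sigma>) * (cmod (X t \<xi>))\<^sup>2)"
proof -
  obtain A where A: "\<And>n. En n t \<le> A" using truncated_bounds t by blast
  note [measurable] = X_measurable[OF t0T(2)[OF t]]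
  have "(\<integral>\<^sup>+\<xi>. ennreal (1 * (norm \<xi> powr (2 * \<sigma>) * (cmod (X t \<xi>))\<^sup>2)) \<partial>lborel) = (SUP n. ennreal (En n t))"
    using SUP_weight[of "\<lambda>_. 1" "2 * \<sigma>" t] En_integrable[OF t0T(2)[OF t]] \<sigma> t0T(2)[OF t] by (simp add: En_def)
  also have "\<dots> \<le> ennreal A" by (intro SUP_least ennreal_leI A)
  finally have "(\<integral>\<^sup>+\<xi>. ennreal (norm \<xi> powr (2 * \<sigma>) * (cmod (X t \<xi>))\<^sup>2) \<partial>lborel) < \<infinity>"
    unfolding mult_1_left infinity_ennreal_def by (rule le_less_trans) (rule ennreal_less_top)
  then show ?thesis by (intro integrableI_nonneg) auto
qed

lemma En_tendsto:
  assumes t: "t \<in> {t0..T}" shows "(\<lambda>n. En n t) \<longlonglongrightarrow> E t"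
  unfolding En_def E_def
proof (rule integral_dominated_convergence[OF _ _ energy_integrable[OF t]])
  note [measurable] = X_measurable[OF t0T(2)[OF t]]
  show "(\<lambda>\<xi>. norm \<xi> powr (2 * \<sigma>) * (cmod (X t \<xi>))\<^sup>2) \<in> borel_measurable lborel"
    "(\<lambda>\<xi>. trunc (2 * \<sigma>) (real (Suc n)) (norm \<xi>) * (cmod (X t \<xi>))\<^sup>2) \<in> borel_measurable lborel" for n by measurable
  show "AE \<xi> in lborel. (\<lambda>n. trunc (2 * \<sigma>) (real (Suc n)) (norm \<xi>) * (cmod (X t \<xi>))\<^sup>2) \<longlonglongrightarrow> norm \<xi> powr (2 * \<sigma>) * (cmod (X t \<xi>))\<^sup>2"
  proof (rule AE_I2)
    fix \<xi> :: "real^2"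
    have "\<forall>\<^sub>F n in sequentially. trunc (2 * \<sigma>) (real (Suc n)) (norm \<xi>) * (cmod (X t \<xi>))\<^sup>2 = norm \<xi> powr (2 * \<sigma>) * (cmod (X t \<xi>))\<^sup>2"
      using eventually_ge_at_top[of "nat \<lceil>norm \<xi>\<rceil>"]
    proof eventually_elim
      case (elim n)
      then have "norm \<xi> \<le> real (Suc n)" by linarith
      then show ?case by (simp add: trunc_def)
    qed
    then show "(\<lambda>n. trunc (2 * \<sigma>) (real (Suc n)) (norm \<xi>) * (cmod (X t \<xi>))\<^sup>2) \<longlonglongrightarrow> norm \<xi> powr (2 * \<sigma>) * (cmod (X t \<xi>))\<^sup>2"
      by (rule tendsto_eventually)
  qed
  show "AE \<xi> in lborel. norm (trunc (2 * \<sigma>) (real (Suc n)) (norm \<xi>) * (cmod (X t \<xi>))\<^sup>2) \<le> norm \<xi> powr (2 * \<sigma>) * (cmod (X t \<xi>))\<^sup>2" for n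
    using \<sigma> by (intro AE_I2) (auto simp: abs_mult trunc_def intro!: mult_right_mono powr_mono2)
qed

text \<open>The \<open>En n\<close> are equicontinuous: as \<open>\<integral> Dn n\<close> increases to a finite limit, \<open>Dn n\<close> differs in \<open>L\<^sup>1\<close>
  from a fixed bounded \<open>Dn m\<close> by as little as desired.\<close>

lemma E_continuous: "continuous_on {t0..T} E"
proof -
  obtain A K where A: "0 \<le> A" and K: "0 \<le> K" and EA: "\<And>n t. t \<in> {t0..T} \<Longrightarrow> En n t \<le> A"
    and DA: "\<And>n. integral {t0..T} (Dn n) \<le> A"
    and inc: "\<And>n s t. t0 \<le> s \<Longrightarrow> s \<le> t \<Longrightarrow> t \<le> T \<Longrightarrow> \<bar>En n t - En n s\<bar> \<le> integral {s..t} (\<lambda>u. 3 * Dn n u + K * En n u)"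
    using truncated_bounds by blast
  have e: "continuous_on {t0..T} (En n)" and d: "continuous_on {t0..T} (Dn n)" for n
    by (rule continuous_on_subset[OF En_continuous t0T(1)], rule continuous_on_subset[OF Dn_continuous t0T(1)])
  note di = integrable_continuous_interval[OF d]
  let ?a = "\<lambda>n. integral {t0..T} (Dn n)"
  have mono: "?a m \<le> ?a n" if "m \<le> n" for m n
    using that t0T(2) by (intro integral_le di Dn_mono) auto
  have pos: "0 \<le> ?a n" for n by (intro integral_nonneg di Dn_nonneg)
  from mono have "convergent ?a"
    using DA by (intro Bseq_monoseq_convergent BseqI'[of _ A] monoI1) (auto simp: pos)
  then have Cauchy: "Cauchy ?a" by (rule convergent_Cauchy)
  show ?thesis
    unfolding continuous_on_iff
  proof (intro ballI allI impI)
    fix x \<epsilon> :: real assume x: "x \<in> {t0..T}" and \<epsilon>: "0 < \<epsilon>"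
    \<comment> \<open>The increment bound carries a factor 3 in front of the dissipation, so
      \<epsilon>/6 leaves \<epsilon>/2.\<close>
    obtain m where m: "\<And>n. m \<le> n \<Longrightarrow> \<bar>?a n - ?a m\<bar> < \<epsilon> / 6"
      using CauchyD[OF Cauchy, of "\<epsilon> / 6"] \<epsilon> by fastforce
    have "bounded (Dn m ` {t0..T})" by (intro compact_imp_bounded compact_continuous_image d) auto
    then obtain C where "\<forall>x\<in>Dn m ` {t0..T}. norm x \<le> C" unfolding bounded_iff by blast
    then have "norm (Dn m t) \<le> C" if "t \<in> {t0..T}" for t using that by blast
    then have C: "Dn m t \<le> C" if "t \<in> {t0..T}" for t using that by (simp add: Dn_nonneg)
    have C0: "0 \<le> C" using C[of t0] Dn_nonneg[of m t0] t0 by auto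
    \<comment> \<open>A Lipschitz slope independent of n: C bounds the fixed \<open>Dn m\<close> and
      A bounds all energies.\<close>
    define R where "R = 3 * C + K * A"
    have R0: "0 \<le> R" unfolding R_def using C0 K A by simp
    have key: "\<bar>E t - E s\<bar> \<le> \<epsilon> / 2 + R * (t - s)" if st: "t0 \<le> s" "s \<le> t" "t \<le> T" for s t
    proof (rule LIMSEQ_le_const2)
      show "(\<lambda>n. \<bar>En n t - En n s\<bar>) \<longlonglongrightarrow> \<bar>E t - E s\<bar>"
        using st by (intro tendsto_rabs tendsto_diff En_tendsto) auto
      show "\<exists>N. \<forall>n\<ge>N. \<bar>En n t - En n s\<bar> \<le> \<epsilon> / 2 + R * (t - s)"
      proof (intro exI[of _ m] allI impI)
        fix n assume n: "m \<le> n"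
        have sub: "{s..t} \<subseteq> {t0..T}" using st by auto
        have ci: "f integrable_on {s..t}" if "continuous_on {t0..T} f" for f :: "real \<Rightarrow> real"
          using continuous_on_subset[OF that sub] by (rule integrable_continuous_interval)
        have "\<bar>En n t - En n s\<bar> \<le> integral {s..t} (\<lambda>u. 3 * Dn n u + K * En n u)" by (rule inc[OF st])
        also have "\<dots> \<le> integral {s..t} (\<lambda>u. 3 * (Dn n u - Dn m u) + R)"
        proof (rule integral_le)
          fix u assume "u \<in> {s..t}"
          then have u: "u \<in> {t0..T}" using sub by auto
          have "K * En n u \<le> K * A" using EA[OF u] K by (rule mult_left_mono)
          then show "3 * Dn n u + K * En n u \<le> 3 * (Dn n u - Dn m u) + R"
            using C[OF u] unfolding R_def right_diff_distrib by linarith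
        qed (intro ci continuous_intros d e)+
        also have "\<dots> = integral {s..t} (\<lambda>u. 3 * (Dn n u - Dn m u)) + R * (t - s)"
          using st by (subst Henstock_Kurzweil_Integration.integral_add) (auto intro!: ci continuous_intros d)
        \<comment> \<open>The interval may be enlarged because \<open>Dn\<close> increases with the
          truncation level; over the whole interval the Cauchy property applies.\<close>
        also have "integral {s..t} (\<lambda>u. 3 * (Dn n u - Dn m u)) \<le> integral {t0..T} (\<lambda>u. 3 * (Dn n u - Dn m u))"
        proof (rule integral_subset_le[OF sub])
          show "(\<lambda>u. 3 * (Dn n u - Dn m u)) integrable_on {t0..T}"
            by (intro integrable_continuous_interval continuous_intros d)
          show "\<forall>u\<in>{t0..T}. 0 \<le> 3 * (Dn n u - Dn m u)"
            using Dn_mono[OF n t0T(2)] by auto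
        qed (intro ci continuous_intros d)
        also have "integral {t0..T} (\<lambda>u. 3 * (Dn n u - Dn m u)) = 3 * (?a n - ?a m)"
          unfolding Henstock_Kurzweil_Integration.integral_mult_right Henstock_Kurzweil_Integration.integral_diff[OF di di] ..
        also have "\<dots> \<le> \<epsilon> / 2" using abs_ge_self[of "?a n - ?a m"] m[OF n] unfolding right_diff_distrib by linarith
        finally show "\<bar>En n t - En n s\<bar> \<le> \<epsilon> / 2 + R * (t - s)" by simp
      qed
    qed
    define \<delta> where "\<delta> = \<epsilon> / (2 * (R + 1))"
    have \<delta>: "0 < \<delta>" "R * \<delta> < \<epsilon> / 2" using \<epsilon> R0 by (auto simp: \<delta>_def field_simps)
    show "\<exists>\<delta>>0. \<forall>y\<in>{t0..T}. dist y x < \<delta> \<longrightarrow> dist (E y) (E x) < \<epsilon>"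
    proof (intro exI[of _ \<delta>] conjI ballI impI)
      fix y assume y: "y \<in> {t0..T}" "dist y x < \<delta>"
      have "\<bar>E y - E x\<bar> \<le> \<epsilon> / 2 + R * \<bar>y - x\<bar>"
        using key[of x y] key[of y x] x y by (cases "x \<le> y") (auto simp: abs_minus_commute)
      also have "R * \<bar>y - x\<bar> \<le> R * \<delta>" using y R0 by (intro mult_left_mono) (auto simp: dist_real_def)
      finally show "dist (E y) (E x) < \<epsilon>" using \<delta>(2) by (simp add: dist_real_def)
    qed (rule \<delta>(1))
  qed
qed

lemma X_Sobolev: assumes t: "t \<in> {t0..T}" shows "sq_integrable (sobw \<sigma> (X t))"
proof -
  note [measurable] = X_measurable[OF t0T(2)[OF t]]
  have "integrable lborel (\<lambda>\<xi>. (cmod (sobw \<sigma> (X t) \<xi>))\<^sup>2)"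
  proof (rule Bochner_Integration.integrable_bound)
    show "integrable lborel (\<lambda>\<xi>. 2 powr \<sigma> * ((cmod (X t \<xi>))\<^sup>2 + norm \<xi> powr (2 * \<sigma>) * (cmod (X t \<xi>))\<^sup>2))"
      using X_sq[OF t0T(2)[OF t]] energy_integrable[OF t] by (simp add: sq_integrable_def)
    show "AE \<xi> in lborel. norm ((cmod (sobw \<sigma> (X t) \<xi>))\<^sup>2) \<le> norm (2 powr \<sigma> * ((cmod (X t \<xi>))\<^sup>2 + norm \<xi> powr (2 * \<sigma>) * (cmod (X t \<xi>))\<^sup>2))"
    proof (rule AE_I2)
      fix \<xi> :: "real^2"
      have "(1 + (norm \<xi>)\<^sup>2) powr \<sigma> * (cmod (X t \<xi>))\<^sup>2 \<le> 2 powr \<sigma> * (1 + norm \<xi> powr (2 * \<sigma>)) * (cmod (X t \<xi>))\<^sup>2"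
        using one_plus_sq_powr_le(1)[of \<sigma> "norm \<xi>"] \<sigma> by (intro mult_right_mono) auto
      then show "norm ((cmod (sobw \<sigma> (X t) \<xi>))\<^sup>2) \<le> norm (2 powr \<sigma> * ((cmod (X t \<xi>))\<^sup>2 + norm \<xi> powr (2 * \<sigma>) * (cmod (X t \<xi>))\<^sup>2))"
        unfolding norm_sobw_sq by (simp add: algebra_simps)
    qed
  qed measurable
  then show ?thesis by (simp add: sq_integrable_def)
qed


text \<open>Below a fixed frequency n the Sobolev weight is bounded and continuity in L^2 suffices;
  above it both X r and X t have small tails, uniformly in time.\<close>

lemma in_C_Sobolev: "\<theta> \<in> C_Sobolev t0 T \<sigma>"
proof -
  have "\<theta> t \<in> Sobolev \<sigma>" if "t \<in> {t0..T}" for t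
    unfolding Sobolev_L2FT[OF X_L2FT[OF t0T(2)[OF that]]] by (rule X_Sobolev[OF that])
  moreover have "((\<lambda>r. Sobolev_norm \<sigma> (\<lambda>x. \<theta> r x - \<theta> t x)) \<longlongrightarrow> 0) (at t within {t0..T})" if t: "t \<in> {t0..T}" for t
  proof (rule tendstoI)
    fix \<epsilon> :: real assume \<epsilon>: "0 < \<epsilon>"
    let ?tail = "\<lambda>n t \<xi>. if real n < norm \<xi> then norm \<xi> powr (2 * \<sigma>) * (cmod (X t \<xi>))\<^sup>2 else 0"
    \<comment> \<open>The difference costs 2 for each of two tails and the weights cost 2^\<sigma>,
      so the high frequencies contribute at most \<epsilon>^2/2.\<close>
    define \<eta> where "\<eta> = \<epsilon>\<^sup>2 / (8 * 2 powr \<sigma>)"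
    have \<eta>: "0 < \<eta>" "2 powr \<sigma> * (4 * \<eta>) = \<epsilon>\<^sup>2 / 2" using \<epsilon> by (simp_all add: \<eta>_def)
    have "\<exists>n\<ge>1. \<forall>t\<in>{t0..T}. (LBINT \<xi>. ?tail n t \<xi>) < \<eta>"
      using \<sigma> E_continuous unfolding E_def[abs_def]
      by (intro tail_uniform[OF _ t0T(1)] energy_integrable \<eta>(1)) auto
    then obtain n where n: "1 \<le> n" "\<And>t. t \<in> {t0..T} \<Longrightarrow> (LBINT \<xi>. ?tail n t \<xi>) < \<eta>" by blast
    let ?c = "(1 + (real n)\<^sup>2) powr \<sigma>"
    have key: "(l2n (sobw \<sigma> (\<lambda>\<xi>. X r \<xi> - X t \<xi>)))\<^sup>2 < ?c * (l2n (\<lambda>\<xi>. X r \<xi> - X t \<xi>))\<^sup>2 + \<epsilon>\<^sup>2 / 2"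
      if r: "r \<in> {t0..T}" for r
    proof -
      note [measurable] = X_measurable[OF t0T(2)[OF r]] X_measurable[OF t0T(2)[OF t]]
      define H where "H \<xi> = X r \<xi> - X t \<xi>" for \<xi>
      have H: "sq_integrable (sobw \<sigma> H)" "sq_integrable H"
        unfolding H_def[abs_def] by (intro sobw_sq_integrable_diff sq_integrable_diff X_Sobolev X_sq t0T(2) r t)+
      have ti: "integrable lborel (?tail n t)" if "t \<in> {t0..T}" for t
      proof (rule Bochner_Integration.integrable_bound[OF energy_integrable[OF that]])
        note [measurable] = X_measurable[OF t0T(2)[OF that]]
        show "?tail n t \<in> borel_measurable lborel" by measurable
        show "AE \<xi> in lborel. norm (?tail n t \<xi>) \<le> norm (norm \<xi> powr (2 * \<sigma>) * (cmod (X t \<xi>))\<^sup>2)"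
          by (intro AE_I2) simp
      qed
      have "(l2n (sobw \<sigma> H))\<^sup>2 \<le> (LBINT \<xi>. ?c * (cmod (H \<xi>))\<^sup>2 + 2 powr \<sigma> * (2 * ?tail n r \<xi> + 2 * ?tail n t \<xi>))"
        unfolding l2n_sq
      proof (rule integral_mono)
        show "integrable lborel (\<lambda>\<xi>. (cmod (sobw \<sigma> H \<xi>))\<^sup>2)" using H(1) by (simp add: sq_integrable_def)
        show "integrable lborel (\<lambda>\<xi>. ?c * (cmod (H \<xi>))\<^sup>2 + 2 powr \<sigma> * (2 * ?tail n r \<xi> + 2 * ?tail n t \<xi>))"
          using H(2) by (intro Bochner_Integration.integrable_add integrable_mult_right ti r t) (simp add: sq_integrable_def)
        fix \<xi> :: "real^2"
        show "(cmod (sobw \<sigma> H \<xi>))\<^sup>2 \<le> ?c * (cmod (H \<xi>))\<^sup>2 + 2 powr \<sigma> * (2 * ?tail n r \<xi> + 2 * ?tail n t \<xi>)"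
        proof (cases "real n < norm \<xi>")
          case True
          have "1 \<le> norm \<xi>" using True n(1) by linarith
          then have "(1 + (norm \<xi>)\<^sup>2) powr \<sigma> \<le> 2 powr \<sigma> * norm \<xi> powr (2 * \<sigma>)"
            using \<sigma> by (intro one_plus_sq_powr_le(2)) auto
          moreover have "(cmod (H \<xi>))\<^sup>2 \<le> 2 * (cmod (X r \<xi>))\<^sup>2 + 2 * (cmod (X t \<xi>))\<^sup>2"
            unfolding H_def by (rule norm_diff_sq_le)
          ultimately have "(1 + (norm \<xi>)\<^sup>2) powr \<sigma> * (cmod (H \<xi>))\<^sup>2
              \<le> (2 powr \<sigma> * norm \<xi> powr (2 * \<sigma>)) * (2 * (cmod (X r \<xi>))\<^sup>2 + 2 * (cmod (X t \<xi>))\<^sup>2)"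
            by (intro mult_mono) auto
          also have "\<dots> = 2 powr \<sigma> * (2 * ?tail n r \<xi> + 2 * ?tail n t \<xi>)" using True by (simp add: algebra_simps)
          also have "\<dots> \<le> ?c * (cmod (H \<xi>))\<^sup>2 + \<dots>" by simp
          finally show ?thesis unfolding norm_sobw_sq .
        next
          case False
          then have "(norm \<xi>)\<^sup>2 \<le> (real n)\<^sup>2" by (intro power_mono) auto
          then have "(1 + (norm \<xi>)\<^sup>2) powr \<sigma> \<le> ?c" using \<sigma> by (intro powr_mono2) auto
          from mult_right_mono[OF this, of "(cmod (H \<xi>))\<^sup>2"] show ?thesis unfolding norm_sobw_sq using False by simp
        qed
      qed
      also have "\<dots> = ?c * (l2n H)\<^sup>2 + 2 powr \<sigma> * (2 * (LBINT \<xi>. ?tail n r \<xi>) + 2 * (LBINT \<xi>. ?tail n t \<xi>))"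
        unfolding l2n_sq using H(2) ti[OF r] ti[OF t]
        by (subst Bochner_Integration.integral_add) (auto simp: sq_integrable_def)
      also have "2 powr \<sigma> * (2 * (LBINT \<xi>. ?tail n r \<xi>) + 2 * (LBINT \<xi>. ?tail n t \<xi>)) < 2 powr \<sigma> * (4 * \<eta>)"
        using n(2)[OF r] n(2)[OF t] by (intro mult_strict_left_mono) auto
      finally show ?thesis unfolding \<eta>(2) H_def[abs_def] by simp
    qed
    have "((\<lambda>r. ?c * (l2n (\<lambda>\<xi>. X r \<xi> - X t \<xi>))\<^sup>2) \<longlongrightarrow> ?c * 0\<^sup>2) (at t within {t0..T})"
      by (intro tendsto_intros tendsto_within_subset[OF X_cont_L2[OF t0T(2)[OF t]] t0T(1)])
    then have "\<forall>\<^sub>F r in at t within {t0..T}. ?c * (l2n (\<lambda>\<xi>. X r \<xi> - X t \<xi>))\<^sup>2 < \<epsilon>\<^sup>2 / 2"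
      using \<epsilon> by (intro order_tendstoD(2)[of _ 0]) auto
    then show "\<forall>\<^sub>F r in at t within {t0..T}. dist (Sobolev_norm \<sigma> (\<lambda>x. \<theta> r x - \<theta> t x)) 0 < \<epsilon>"
      using eventually_within_mem[of "{t0..T}" t]
    proof eventually_elim
      case (elim r)
      have eq: "Sobolev_norm \<sigma> (\<lambda>x. \<theta> r x - \<theta> t x) = l2n (sobw \<sigma> (\<lambda>\<xi>. X r \<xi> - X t \<xi>))"
        unfolding X_def by (intro Sobolev_norm_diff inL2 t0T(2) elim t)
      have "(l2n (sobw \<sigma> (\<lambda>\<xi>. X r \<xi> - X t \<xi>)))\<^sup>2 < \<epsilon>\<^sup>2"
        using key[OF elim(2)] elim(1) by linarith
      then have "l2n (sobw \<sigma> (\<lambda>\<xi>. X r \<xi> - X t \<xi>)) < \<epsilon>"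
        using \<epsilon> by (intro power2_less_imp_less[of _ \<epsilon>]) auto
      then show ?case unfolding eq by simp
    qed
  qed
  ultimately show ?thesis by (simp add: C_Sobolev_def)
qed

section \<open>Square integrability in time of the higher norm\<close>

lemma D_SUP: assumes t: "t \<in> {0..T}" shows "D t = (SUP n. ennreal (Dn n t))"
  unfolding D_def Dn_def using \<sigma> by (intro SUP_weight[symmetric] Dn_integrable t) auto

lemma D_time:
  shows "D \<in> borel_measurable (lebesgue_on {t0..T})"
    and "(\<integral>\<^sup>+t. D t \<partial>lebesgue_on {t0..T}) < \<infinity>"
proof -
  let ?M = "lebesgue_on {t0..T}"
  obtain A where A: "\<And>n. integral {t0..T} (Dn n) \<le> A" using truncated_bounds by blast
  have d: "continuous_on {t0..T} (Dn n)" for n by (rule continuous_on_subset[OF Dn_continuous t0T(1)])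
  have [measurable]: "Dn n \<in> borel_measurable ?M" for n
    by (rule continuous_imp_measurable_on_sets_lebesgue[OF d]) simp
  have eq: "D t = (SUP n. ennreal (Dn n t))" if "t \<in> space ?M" for t
    using that t0T(2) by (intro D_SUP) (simp add: space_restrict_space)
  show "D \<in> borel_measurable ?M"
    by (subst measurable_cong[OF eq]) measurable
  have "(\<integral>\<^sup>+t. D t \<partial>?M) = (\<integral>\<^sup>+t. (SUP n. ennreal (Dn n t)) \<partial>?M)"
    by (rule nn_integral_cong[OF eq])
  also have "\<dots> = (SUP n. \<integral>\<^sup>+t. ennreal (Dn n t) \<partial>?M)"
  proof (rule nn_integral_monotone_convergence_SUP_AE)
    show "AE t in ?M. ennreal (Dn n t) \<le> ennreal (Dn (Suc n) t)" for n
      using t0 by (intro AE_I2 ennreal_leI Dn_mono) (auto simp: space_restrict_space)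
  qed measurable
  also have "\<dots> \<le> ennreal A"
  proof (rule SUP_least)
    fix n
    note i = continuous_imp_integrable_real[OF d[of n]]
    have "(\<integral>\<^sup>+t. ennreal (Dn n t) \<partial>?M) = ennreal (integral\<^sup>L ?M (Dn n))"
      by (rule nn_integral_eq_integral[OF i]) (simp add: Dn_nonneg)
    also have "integral\<^sup>L ?M (Dn n) = integral {t0..T} (Dn n)"
      by (rule lebesgue_integral_eq_integral[OF i]) simp
    finally show "(\<integral>\<^sup>+t. ennreal (Dn n t) \<partial>?M) \<le> ennreal A" using A[of n] by (simp add: ennreal_leI)
  qed
  also have "\<dots> < \<infinity>" unfolding infinity_ennreal_def by (rule ennreal_less_top)
  finally show "(\<integral>\<^sup>+t. D t \<partial>?M) < \<infinity>" .
qed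

abbreviation \<sigma>' :: real where "\<sigma>' \<equiv> \<sigma> + \<alpha> / 2"

text \<open>The squared Sobolev norm of order \<sigma> + \<alpha>/2, extended-valued so that it can
  be integrated over time before it is known to be finite.\<close>

definition h :: "real \<Rightarrow> ennreal" where
  "h t = (\<integral>\<^sup>+\<xi>. ennreal ((cmod (sobw \<sigma>' (X t) \<xi>))\<^sup>2) \<partial>lborel)"

lemma h_le: "\<exists>B\<ge>0. \<forall>t\<in>{0..T}. h t \<le> ennreal (2 powr \<sigma>') * (ennreal B + D t)"
proof -
  obtain B where B: "0 \<le> B" "\<And>t. t \<in> {0..T} \<Longrightarrow> (LBINT \<xi>. (cmod (X t \<xi>))\<^sup>2) \<le> B"
    using X_energy_bounded by blast
  have "h t \<le> ennreal (2 powr \<sigma>') * (ennreal B + D t)" if t: "t \<in> {0..T}" for t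
  proof -
    note [measurable] = X_measurable[OF t]
    let ?d = "\<lambda>\<xi>. norm \<xi> powr \<alpha> * (norm \<xi> powr (2 * \<sigma>) * (cmod (X t \<xi>))\<^sup>2)"
    have "h t \<le> (\<integral>\<^sup>+\<xi>. ennreal (2 powr \<sigma>') * (ennreal ((cmod (X t \<xi>))\<^sup>2) + ennreal (?d \<xi>)) \<partial>lborel)"
      unfolding h_def
    proof (rule nn_integral_mono)
      fix \<xi> :: "real^2"
      have "norm \<xi> powr (2 * \<sigma>') = norm \<xi> powr \<alpha> * norm \<xi> powr (2 * \<sigma>)"
        by (simp add: powr_add[symmetric] algebra_simps)
      with one_plus_sq_powr_le(1)[of \<sigma>' "norm \<xi>"] \<sigma> \<alpha>
      have "(1 + (norm \<xi>)\<^sup>2) powr \<sigma>' \<le> 2 powr \<sigma>' * (1 + norm \<xi> powr \<alpha> * norm \<xi> powr (2 * \<sigma>))" by simp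
      from mult_right_mono[OF this, of "(cmod (X t \<xi>))\<^sup>2"]
      have "(cmod (sobw \<sigma>' (X t) \<xi>))\<^sup>2 \<le> 2 powr \<sigma>' * ((cmod (X t \<xi>))\<^sup>2 + ?d \<xi>)"
        unfolding norm_sobw_sq by (simp add: algebra_simps)
      then show "ennreal ((cmod (sobw \<sigma>' (X t) \<xi>))\<^sup>2) \<le> ennreal (2 powr \<sigma>') * (ennreal ((cmod (X t \<xi>))\<^sup>2) + ennreal (?d \<xi>))"
        by (subst ennreal_plus[symmetric], simp, simp, subst ennreal_mult[symmetric]) (auto intro: ennreal_leI)
    qed
    also have "\<dots> = ennreal (2 powr \<sigma>') * ((\<integral>\<^sup>+\<xi>. ennreal ((cmod (X t \<xi>))\<^sup>2) \<partial>lborel) + D t)"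
      unfolding D_def by (subst nn_integral_cmult, measurable, subst nn_integral_add) auto
    also have "(\<integral>\<^sup>+\<xi>. ennreal ((cmod (X t \<xi>))\<^sup>2) \<partial>lborel) = ennreal (LBINT \<xi>. (cmod (X t \<xi>))\<^sup>2)"
      using X_sq[OF t] by (intro nn_integral_eq_integral) (auto simp: sq_integrable_def)
    also have "\<dots> \<le> ennreal B" by (intro ennreal_leI B(2) t)
    finally show ?thesis by (simp add: add_right_mono mult_left_mono)
  qed
  with B(1) show ?thesis by blast
qed

text \<open>Restricting the weight to |\<xi>| <= n makes it bounded, so the restricted norms are
  continuous in time, and h is their supremum.\<close>

lemma h_measurable: "h \<in> borel_measurable (lebesgue_on {t0..T})"
proof -
  let ?M = "lebesgue_on {t0..T}"
  let ?w = "\<lambda>n \<xi>. if norm \<xi> \<le> real n then (1 + (norm \<xi>)\<^sup>2) powr \<sigma>' else 0"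
  define q where "q n t = (LBINT \<xi>. ?w n \<xi> * (cmod (X t \<xi>))\<^sup>2)" for n t
  have w: "\<bar>?w n \<xi>\<bar> \<le> (1 + (real n)\<^sup>2) powr \<sigma>' * (1 + (norm \<xi>)\<^sup>2)" for n and \<xi> :: "real^2"
  proof -
    have "(1 + (norm \<xi>)\<^sup>2) powr \<sigma>' \<le> (1 + (real n)\<^sup>2) powr \<sigma>'" if "norm \<xi> \<le> real n"
      using that \<sigma> \<alpha> by (intro powr_mono2) auto
    moreover have "(1 + (real n)\<^sup>2) powr \<sigma>' \<le> (1 + (real n)\<^sup>2) powr \<sigma>' * (1 + (norm \<xi>)\<^sup>2)"
      using mult_left_mono[of 1 "1 + (norm \<xi>)\<^sup>2" "(1 + (real n)\<^sup>2) powr \<sigma>'"] by simp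
    ultimately show ?thesis by (auto intro: order_trans)
  qed
  have "continuous_on {0..T} (q n)" for n unfolding q_def by (rule Q_continuous[OF _ w]) measurable
  then have "continuous_on {t0..T} (q n)" for n using t0T(1) by (rule continuous_on_subset)
  then have [measurable]: "q n \<in> borel_measurable ?M" for n
    by (rule continuous_imp_measurable_on_sets_lebesgue) simp
  have eq: "h t = (SUP n. ennreal (q n t))" if "t \<in> space ?M" for t
  proof -
    have t: "t \<in> {0..T}" using that t0T(2) by (simp add: space_restrict_space)
    note [measurable] = X_measurable[OF t]
    have "(SUP n. ennreal (q n t)) = (SUP n. \<integral>\<^sup>+\<xi>. ennreal (?w n \<xi> * (cmod (X t \<xi>))\<^sup>2) \<partial>lborel)"
      unfolding q_def by (intro SUP_cong refl nn_integral_eq_integral[symmetric] Q_integrable[OF _ w t]) auto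
    also have "\<dots> = (\<integral>\<^sup>+\<xi>. (SUP n. ennreal (?w n \<xi> * (cmod (X t \<xi>))\<^sup>2)) \<partial>lborel)"
    proof (rule nn_integral_monotone_convergence_SUP[symmetric])
      show "incseq (\<lambda>n \<xi>. ennreal (?w n \<xi> * (cmod (X t \<xi>))\<^sup>2))"
        by (intro incseq_SucI le_funI ennreal_leI mult_right_mono) auto
    qed measurable
    also have "\<dots> = h t" unfolding h_def
    proof (rule nn_integral_cong)
      fix \<xi> :: "real^2"
      show "(SUP n. ennreal (?w n \<xi> * (cmod (X t \<xi>))\<^sup>2)) = ennreal ((cmod (sobw \<sigma>' (X t) \<xi>))\<^sup>2)"
      proof (rule antisym)
        show "(SUP n. ennreal (?w n \<xi> * (cmod (X t \<xi>))\<^sup>2)) \<le> ennreal ((cmod (sobw \<sigma>' (X t) \<xi>))\<^sup>2)"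
          unfolding norm_sobw_sq by (intro SUP_least ennreal_leI mult_right_mono) auto
        define n where "n = nat \<lceil>norm \<xi>\<rceil>"
        have "norm \<xi> \<le> real n" unfolding n_def by linarith
        then show "ennreal ((cmod (sobw \<sigma>' (X t) \<xi>))\<^sup>2) \<le> (SUP n. ennreal (?w n \<xi> * (cmod (X t \<xi>))\<^sup>2))"
          unfolding norm_sobw_sq by (intro SUP_upper2[of n]) auto
      qed
    qed
    finally show ?thesis by simp
  qed
  show ?thesis by (subst measurable_cong[OF eq]) measurable
qed

lemma Sobolev_norm_h: assumes t: "t \<in> {0..T}" shows "(Sobolev_norm \<sigma>' (\<theta> t))\<^sup>2 = enn2real (h t)"
proof -
  note [measurable] = X_measurable[OF t]
  show ?thesis
    unfolding Sobolev_norm_cong[OF X_L2FT[OF t]] l2n_sq h_def by (rule integral_eq_nn_integral) auto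
qed

lemma h_integral_finite: "(\<integral>\<^sup>+t. h t \<partial>lebesgue_on {t0..T}) < \<infinity>"
proof -
  let ?M = "lebesgue_on {t0..T}"
  obtain B where B: "0 \<le> B" "\<And>t. t \<in> {0..T} \<Longrightarrow> h t \<le> ennreal (2 powr \<sigma>') * (ennreal B + D t)" using h_le by blast
  note [measurable] = D_time(1)
  have "(\<integral>\<^sup>+t. h t \<partial>?M) \<le> (\<integral>\<^sup>+t. ennreal (2 powr \<sigma>') * (ennreal B + D t) \<partial>?M)"
    using t0T(2) by (intro nn_integral_mono B(2)) (simp add: space_restrict_space)
  also have "\<dots> = ennreal (2 powr \<sigma>') * (ennreal B * emeasure ?M (space ?M) + (\<integral>\<^sup>+t. D t \<partial>?M))"
    by (subst nn_integral_cmult, measurable, subst nn_integral_add) auto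
  also have "\<dots> < \<infinity>"
  proof -
    have "emeasure ?M (space ?M) < \<infinity>"
      using t0 by (simp add: space_restrict_space emeasure_restrict_space)
    then show ?thesis using D_time(2)
      by (simp add: ennreal_mult_less_top ennreal_add_less_top)
  qed
  finally show ?thesis .
qed

lemma AE_Sobolev: "AE t in lebesgue_on {t0..T}. t \<in> {t0..T} \<and> sq_integrable (sobw \<sigma>' (X t))"
proof -
  have "AE t in lebesgue_on {t0..T}. h t \<noteq> \<infinity>"
    using h_integral_finite by (intro nn_integral_PInf_AE h_measurable) auto
  moreover have "AE t in lebesgue_on {t0..T}. t \<in> {t0..T}"
    by (intro AE_I2) (simp add: space_restrict_space)
  ultimately show ?thesis
  proof eventually_elim
    case (elim t)
    note [measurable] = X_measurable[OF t0T(2)[OF elim(2)]]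
    have "integrable lborel (\<lambda>\<xi>. (cmod (sobw \<sigma>' (X t) \<xi>))\<^sup>2)"
      using elim(1) unfolding h_def by (intro integrableI_nonneg) (auto simp: less_top)
    then show ?case using elim(2) by (simp add: sq_integrable_def)
  qed
qed

text \<open>The cutoff region is symmetric under \<xi> -> -\<xi>, so Hermitian symmetry survives and
  the inverse transform is real.\<close>

lemma cutoff_exists:
  assumes t: "t \<in> {0..T}"
  shows "\<exists>g. L2FT (cr g) (\<lambda>\<xi>. if norm \<xi> \<le> real n then X t \<xi> else 0)"
proof -
  note [measurable] = X_measurable[OF t]
  have "sq_integrable (\<lambda>\<xi>. if norm \<xi> \<le> real n then X t \<xi> else 0)"
    by (rule sq_integrable_bound[OF X_sq[OF t], of _ 1]) auto
  then obtain g where "L2FT (cr g) (\<lambda>\<xi>. if norm \<xi> \<le> real n then X t \<xi> else 0)"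
    by (rule L2FT_inverse_real) (auto simp: X_herm)
  then show ?thesis by blast
qed

text \<open>The approximating simple functions are frequency cutoffs of \<open>\<theta>\<close> at the points of a time grid
  that is fine enough to compensate the norm of the cutoff from \<open>L\<^sup>2\<close> to \<open>H\<^bsup>\<sigma>+\<alpha>/2\<^esup>\<close>.\<close>

lemma strongly_measurable:
  "\<exists>S :: nat \<Rightarrow> real \<Rightarrow> real^2 \<Rightarrow> real.
    (\<forall>n. simple_function (lebesgue_on {t0..T}) (S n) \<and> (\<forall>t\<in>{t0..T}. S n t \<in> Sobolev \<sigma>')) \<and>
    (AE t in lebesgue_on {t0..T}. (\<lambda>n. Sobolev_norm \<sigma>' (\<lambda>x. S n t x - \<theta> t x)) \<longlonglongrightarrow> 0)"
proof -
  let ?M = "lebesgue_on {t0..T}"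
  let ?c = "\<lambda>n. (1 + (real n)\<^sup>2) powr (\<sigma>' / 2)"
  let ?cut = "\<lambda>n t \<xi>. if norm \<xi> \<le> real n then X t \<xi> else 0"
  have \<sigma>': "0 \<le> \<sigma>'" using \<sigma> \<alpha> by simp
  have cp: "0 < ?c n" for n by (simp add: add_nonneg_eq_0_iff)
  have "\<forall>n. \<exists>\<delta>>0. \<forall>s\<in>{0..T}. \<forall>t\<in>{0..T}. \<bar>s - t\<bar> < \<delta> \<longrightarrow> l2n (\<lambda>\<xi>. X s \<xi> - X t \<xi>) < inverse (real (Suc n)) / ?c n"
    using cp by (intro allI X_uniformly_continuous divide_pos_pos) auto
  then obtain \<delta> where \<delta>: "\<And>n. 0 < \<delta> n"
    "\<And>n s t. s \<in> {0..T} \<Longrightarrow> t \<in> {0..T} \<Longrightarrow> \<bar>s - t\<bar> < \<delta> n \<Longrightarrow> l2n (\<lambda>\<xi>. X s \<xi> - X t \<xi>) < inverse (real (Suc n)) / ?c n"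
    by metis
  \<comment> \<open>The largest grid point below t may precede t0, where no regularity is claimed;
    the maximum with t0 prevents this and only moves the value closer to t.\<close>
  define grid where "grid n t = max t0 (\<delta> n * \<lfloor>t / \<delta> n\<rfloor>)" for n t
  have grid: "grid n t \<in> {t0..T}" "\<bar>grid n t - t\<bar> < \<delta> n" if "t \<in> {t0..T}" for n t
    using floor_grid[OF \<delta>(1)[of n], of t] that by (auto simp: grid_def)
  have grid_simple: "simple_function ?M (grid n)" for n
  proof (rule simple_function_borel_measurable)
    have "grid n \<in> borel_measurable borel" unfolding grid_def[abs_def] by measurable
    then show "grid n \<in> borel_measurable ?M"
      by (intro measurable_restrict_space1 measurable_completion) simp
    have "grid n ` space ?M \<subseteq> (\<lambda>k. max t0 (\<delta> n * real_of_int k)) ` {\<lfloor>t0 / \<delta> n\<rfloor>..\<lfloor>T / \<delta> n\<rfloor>}"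
      using \<delta>(1)[of n] unfolding grid_def space_restrict_space
      by (auto intro!: imageI floor_mono divide_right_mono)
    then show "finite (grid n ` space ?M)" by (rule finite_subset) simp
  qed
  \<comment> \<open>A single representative is fixed for each level and time. So S n depends on t
    only through the grid point and has finitely many values as functions, not merely up to null
    sets.\<close>
  define cut where "cut n t = (SOME g. L2FT (cr g) (?cut n t))" for n t
  have cut: "L2FT (cr (cut n t)) (?cut n t)" if "t \<in> {0..T}" for n t
    unfolding cut_def by (rule someI_ex[OF cutoff_exists[OF that]])
  define S where "S n t = cut n (grid n t)" for n t
  have "simple_function ?M (S n)" for n
    unfolding S_def[abs_def] by (rule simple_function_compose1[OF grid_simple])
  moreover have "S n t \<in> Sobolev \<sigma>'" if "t \<in> {t0..T}" for n t
  proof -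
    note L = cut[OF t0T(2)[OF grid(1)[OF that]], of n n]
    show ?thesis unfolding S_def Sobolev_L2FT[OF L]
      by (rule l2n_sobw_cutoff(1)[OF \<sigma>' _ L2FT_sq(2)[OF L], of n]) simp
  qed
  moreover have "AE t in ?M. (\<lambda>n. Sobolev_norm \<sigma>' (\<lambda>x. S n t x - \<theta> t x)) \<longlonglongrightarrow> 0"
    using AE_Sobolev
  proof eventually_elim
    case (elim t)
    then have t1: "t \<in> {t0..T}" and t: "t \<in> {0..T}" and sq: "sq_integrable (sobw \<sigma>' (X t))"
      using t0T(2) by auto
    note [measurable] = X_measurable[OF t]
    \<comment> \<open>The error splits into the time discretisation at low frequencies, controlled
      by the fine grid, and the discarded high frequencies of X t, which vanish in the limit at
      times of finite norm.\<close>
    let ?hi = "\<lambda>n \<xi>. if norm \<xi> \<le> real n then 0 else sobw \<sigma>' (X t) \<xi>"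
    have hi: "sq_integrable (?hi n)" for n
      by (rule sq_integrable_bound[OF sq, of _ 1]) auto
    have hi0: "(\<lambda>n. l2n (?hi n)) \<longlonglongrightarrow> 0"
    proof -
      have "(\<lambda>n. (LBINT \<xi>. (cmod (?hi n \<xi>))\<^sup>2)) \<longlonglongrightarrow> (LBINT (\<xi>::real^2). 0)"
      proof (rule integral_dominated_convergence)
        show "integrable lborel (\<lambda>\<xi>. (cmod (sobw \<sigma>' (X t) \<xi>))\<^sup>2)" using sq by (simp add: sq_integrable_def)
        show "(\<lambda>\<xi>. (cmod (?hi n \<xi>))\<^sup>2) \<in> borel_measurable lborel" for n by measurable
        show "AE \<xi> in lborel. norm ((cmod (?hi n \<xi>))\<^sup>2) \<le> (cmod (sobw \<sigma>' (X t) \<xi>))\<^sup>2" for n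
          by (intro AE_I2) simp
        show "AE \<xi> in lborel. (\<lambda>n. (cmod (?hi n \<xi>))\<^sup>2) \<longlonglongrightarrow> 0"
        proof (rule AE_I2)
          fix \<xi> :: "real^2"
          have "\<forall>\<^sub>F n in sequentially. (cmod (?hi n \<xi>))\<^sup>2 = 0"
            using eventually_ge_at_top[of "nat \<lceil>norm \<xi>\<rceil>"]
          proof eventually_elim
            case (elim n)
            then have "norm \<xi> \<le> real n" by linarith
            then show ?case by simp
          qed
          then show "(\<lambda>n. (cmod (?hi n \<xi>))\<^sup>2) \<longlonglongrightarrow> 0" by (rule tendsto_eventually)
        qed
      qed simp
      from tendsto_real_sqrt[OF this] show ?thesis by (simp add: l2n_def)
    qed
    have le: "Sobolev_norm \<sigma>' (\<lambda>x. S n t x - \<theta> t x) \<le> inverse (real (Suc n)) + l2n (?hi n)" for n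
    proof -
      let ?g = "grid n t"
      have g: "?g \<in> {0..T}" and gt: "\<bar>?g - t\<bar> < \<delta> n" using grid[OF t1] t0T(2) by auto
      let ?lo = "\<lambda>\<xi>. if norm \<xi> \<le> real n then X ?g \<xi> - X t \<xi> else 0"
      note [measurable] = X_measurable[OF g]
      have dsq: "sq_integrable (\<lambda>\<xi>. X ?g \<xi> - X t \<xi>)" by (intro sq_integrable_diff X_sq g t)
      have lo: "sq_integrable ?lo" by (rule sq_integrable_bound[OF dsq, of _ 1]) auto
      have slo: "sq_integrable (sobw \<sigma>' ?lo)" "l2n (sobw \<sigma>' ?lo) \<le> ?c n * l2n ?lo"
        by (rule l2n_sobw_cutoff[where n=n, OF \<sigma>' _ lo]; simp)+
      have "L2FT (cr (\<lambda>x. S n t x - \<theta> t x)) (\<lambda>\<xi>. ?cut n ?g \<xi> - X t \<xi>)"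
        using L2FT_diff[OF cut[OF g, of n] X_L2FT[OF t]] by (simp add: S_def)
      then have "Sobolev_norm \<sigma>' (\<lambda>x. S n t x - \<theta> t x) = l2n (sobw \<sigma>' (\<lambda>\<xi>. ?cut n ?g \<xi> - X t \<xi>))"
        by (rule Sobolev_norm_cong)
      also have "sobw \<sigma>' (\<lambda>\<xi>. ?cut n ?g \<xi> - X t \<xi>) = (\<lambda>\<xi>. sobw \<sigma>' ?lo \<xi> + - ?hi n \<xi>)"
        by (rule ext) (simp add: sobw_def)
      also have "l2n \<dots> \<le> l2n (sobw \<sigma>' ?lo) + l2n (\<lambda>\<xi>. - ?hi n \<xi>)"
        by (intro l2n_triangle slo sq_integrable_uminus hi)
      also have "l2n (\<lambda>\<xi>. - ?hi n \<xi>) = l2n (?hi n)" by (rule l2n_uminus)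
      also have "l2n (sobw \<sigma>' ?lo) \<le> ?c n * l2n (\<lambda>\<xi>. X ?g \<xi> - X t \<xi>)"
        using cp[of n] by (intro order_trans[OF slo(2)] mult_left_mono l2n_mono[OF dsq]) auto
      also have "\<dots> \<le> ?c n * (inverse (real (Suc n)) / ?c n)"
        using \<delta>(2)[OF g t gt] cp[of n] by (intro mult_left_mono) auto
      also have "\<dots> = inverse (real (Suc n))" using cp[of n] by simp
      finally show ?thesis by simp
    qed
    show ?case
    proof (rule tendsto_sandwich[OF _ _ tendsto_const])
      show "(\<lambda>n. inverse (real (Suc n)) + l2n (?hi n)) \<longlonglongrightarrow> 0"
        using tendsto_add[OF LIMSEQ_inverse_real_of_nat hi0] by simp
      show "\<forall>\<^sub>F n in sequentially. 0 \<le> Sobolev_norm \<sigma>' (\<lambda>x. S n t x - \<theta> t x)"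
        by (simp add: Sobolev_norm_eq)
      show "\<forall>\<^sub>F n in sequentially. Sobolev_norm \<sigma>' (\<lambda>x. S n t x - \<theta> t x) \<le> inverse (real (Suc n)) + l2n (?hi n)"
        by (intro always_eventually allI le)
    qed
  qed
  ultimately show ?thesis by blast
qed

lemma in_L2_Sobolev: "\<theta> \<in> L2_Sobolev t0 T \<sigma>'"
proof -
  let ?M = "lebesgue_on {t0..T}"
  have "AE t in ?M. \<theta> t \<in> Sobolev \<sigma>'"
    using AE_Sobolev by eventually_elim (use t0T(2) in \<open>auto simp: Sobolev_L2FT[OF X_L2FT]\<close>)
  moreover have "integrable ?M (\<lambda>t. (Sobolev_norm \<sigma>' (\<theta> t))\<^sup>2)"
  proof -
    have "integrable ?M (\<lambda>t. enn2real (h t))"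
    proof (rule integrableI_bounded)
      show "(\<lambda>t. enn2real (h t)) \<in> borel_measurable ?M" using h_measurable by measurable
      have "(\<integral>\<^sup>+t. ennreal (norm (enn2real (h t))) \<partial>?M) \<le> (\<integral>\<^sup>+t. h t \<partial>?M)"
        by (intro nn_integral_mono) (simp add: ennreal_enn2real_if)
      also have "\<dots> < \<infinity>" by (rule h_integral_finite)
      finally show "(\<integral>\<^sup>+t. ennreal (norm (enn2real (h t))) \<partial>?M) < \<infinity>" .
    qed
    then show ?thesis
      by (rule Bochner_Integration.integrable_cong[THEN iffD1, OF refl, rotated])
        (use t0T(2) in \<open>auto simp: Sobolev_norm_h space_restrict_space\<close>)
  qed
  ultimately show ?thesis
    using strongly_measurable unfolding L2_Sobolev_def by blast
qed

end

theorem proposition1p2: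
  fixes \<alpha> T t\<^sub>0 \<sigma> :: real
    and \<theta>\<^sub>s :: "real^2 \<Rightarrow> real"
    and \<theta> :: "real \<Rightarrow> real^2 \<Rightarrow> real"
  assumes "0 < \<alpha>" and "\<alpha> < 1" and "0 < T"
    and "\<theta>\<^sub>s \<in> Sobolev 1"
    and "mqg_solution \<alpha> T \<theta>\<^sub>s \<theta>"
    and "\<theta> \<in> C1_L2 0 T \<inter> C_Sobolev 0 T 1 \<inter> L2_Sobolev 0 T (1 + \<alpha> / 2)"
    and "t\<^sub>0 \<in> {0..<T}" and "1 \<le> \<sigma>"
    and "\<theta> t\<^sub>0 \<in> Sobolev \<sigma>"
  shows "\<theta> \<in> C_Sobolev t\<^sub>0 T \<sigma> \<inter> L2_Sobolev t\<^sub>0 T (\<sigma> + \<alpha> / 2)"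
proof -
  obtain \<theta>' where "\<theta>' \<in> C_L2 0 T" "\<And>t. t \<in> {0..T} \<Longrightarrow>
      ((\<lambda>r. L2_norm (\<lambda>x. (\<theta> r x - \<theta> t x) / (r - t) - \<theta>' t x)) \<longlongrightarrow> 0) (at t within {0..T})"
    using assms(6) unfolding C1_L2_def by blast
  then interpret mqg_regular \<alpha> T \<theta>\<^sub>s \<theta> \<theta>' \<sigma> t\<^sub>0
    using assms by unfold_locales auto
  show ?thesis using in_C_Sobolev in_L2_Sobolev by blast
qed

end
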